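(* Let $\mu\in\mathbb{R}$, $\sigma>0$ and $t>0$, let $W=(W_s)_{s\ge 0}$ be a standard Brownian motion, and let $X_t=\int_0^t|\mu s+\sigma W_s|\,\mathrm{d}s$. Then the probability density function $f_{X_t}(x)=\mathbb{P}\{X_t\in\mathrm{d}x\}/\mathrm{d}x$ and the cumulative distribution function $F_{X_t}(x)=\mathbb{P}\{X_t\le x\}$ of $X_t$ satisfy, as $x\to\infty$, $$f_{X_t}(x)=\sqrt{\frac{6}{\pi\sigma^2t^3}}\,\exp\bigg(-\frac{3\mu^2t}{8\sigma^2}-\frac{3x^2}{2\sigma^2t^3}\bigg)\cosh\bigg(\frac{3\mu x}{2\sigma^2t}\bigg)\,(1+O(x^{-1}))$$ and $$F_{X_t}(x)=1-\sqrt{\frac{2\sigma^2t^3}{3\pi}}\,\frac1x\,\exp\bigg(-\frac{3\mu^2t}{8\sigma^2}-\frac{3x^2}{2\sigma^2t^3}\bigg)\cosh\bigg(\frac{3\mu x}{2\sigma^2t}\bigg)\,(1+O(x^{-1})).$$ *)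

theory Defs
  imports "HOL-Probability.Probability" "HOL-Library.Landau_Symbols"
begin

text \<open>
  Standard one-dimensional Brownian motion on the time axis \<open>[0, \<infinity>)\<close>; the values of
  \<open>W\<close> at negative times are unconstrained. Every path is required to be continuous, not just
  almost every one: the underlying space need not be complete, so this is what makes path
  functionals such as the integral below random variables.
\<close>

locale standard_brownian_motion = prob_space M
  for M :: "'a measure" and W :: "real \<Rightarrow> 'a \<Rightarrow> real" +
  assumes random_variable: "\<And>s. 0 \<le> s \<Longrightarrow> W s \<in> borel_measurable M"
    and start_zero: "AE \<omega> in M. W 0 \<omega> = 0"
    and independent_increments:
      "\<And>n (\<tau> :: nat \<Rightarrow> real). 0 \<le> \<tau> 0 \<Longrightarrow> (\<And>i. i < n \<Longrightarrow> \<tau> i < \<tau> (Suc i)) \<Longrightarrow>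
         indep_vars (\<lambda>_. borel) (\<lambda>i \<omega>. W (\<tau> (Suc i)) \<omega> - W (\<tau> i) \<omega>) {..<n}"
    and gaussian_increments:
      "\<And>s u. 0 \<le> s \<Longrightarrow> s < u \<Longrightarrow>
         distributed M lborel (\<lambda>\<omega>. W u \<omega> - W s \<omega>) (\<lambda>x. ennreal (normal_density 0 (sqrt (u - s)) x))"
    and continuous_paths: "\<And>\<omega>. \<omega> \<in> space M \<Longrightarrow> continuous_on {0..} (\<lambda>s. W s \<omega>)"

definition abs_integral :: "real \<Rightarrow> real \<Rightarrow> (real \<Rightarrow> 'a \<Rightarrow> real) \<Rightarrow> real \<Rightarrow> 'a \<Rightarrow> real" where
  "abs_integral \<mu> \<sigma> W t \<omega> = (LINT s:{0..t}|lborel. \<bar>\<mu> * s + \<sigma> * W s \<omega>\<bar>)"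

end

theory Submission
  imports Defs "HOL-Real_Asymp.Real_Asymp"
begin

text \<open>
  By scaling, \<open>\<sigma> = t = 1\<close>. Write \<open>V\<close> for the drifting path, sampled at the multiples of \<open>1/n\<close>,
  \<open>Y\<close> for its average and \<open>Q\<close> for the average of \<open>\<bar>V\<bar>\<close>; all estimates are uniform in \<open>n = 2^N\<close>. Where
  \<open>V\<close> has constant sign, \<open>Q = \<bar>Y\<bar>\<close>, and \<open>Y\<close> is Gaussian with mean \<open>\<nu>/2\<close> and variance about \<open>1/3\<close>: the
  sum of the two Gaussian densities produced by the two signs is the main term.

  The component of \<open>V\<close> along \<open>Y\<close> is Gaussian and independent of the rest of the path, so that for
  a fixed residual \<open>Q\<close> becomes a function of \<open>Y\<close> whose slope is close to 1 on those paths that are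
  negative only little; the correction is a conditional expectation of relative size \<open>O(1/x)\<close>.
  A path with \<open>Q \<ge> x\<close> that is far from having constant sign either has energy noticeably larger than
  the minimal energy \<open>3x\<^sup>2\<close>, since near-minimisers are close to the parabolic minimiser, or
  oscillates a lot between coarse grid points; both events have exponentially smaller probability.
  Smoothing along ramps turns this into a bound for the density. Interval bounds pass to the limit
  \<open>n \<rightarrow> \<infinity>\<close> and yield a density with the claimed asymptotics, and integrating the density gives the
  distribution function.
\<close>

section \<open>Finite-dimensional Gaussian vectors\<close>

text \<open>Tail bounds alone are too weak: a relative error for the density requires bounds
  proportional to the length of the interval, up to a remainder that vanishes as n grows.
  Exceptional paths receive the factor \<open>b - a\<close> by smoothing. A path too irregular to be
  smoothed on one grid is smoothed on the next finer one, and so on through all dyadic grids: the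
  cost grows like \<open>8 ^ m\<close>, while the probability of failing at level m falls like exp(-
  2^m x^2 / 32). The correction on mostly positive paths is small because a path conditioned on a
  large average rises from 0 with slope of order x, so that it is negative only for a time of order
  1 / x^2. Typical and exceptional paths are told apart on a coarse grid with a fixed number 2^60 of
  blocks. Its constants are enormous but do not depend on x; the energy gap 10^-8 x^2 leaves a
  margin 10^-9 x^2 in the exponent, which beats constants, polynomials and factors exp(K x).\<close>

lemma nn_integral_PiM_transform:
  fixes N :: "real measure" and T :: "nat \<Rightarrow> real \<Rightarrow> real" and w :: "nat \<Rightarrow> real \<Rightarrow> ennreal"
  assumes N: "prob_space N" and sN [measurable_cong]: "sets N = sets borel"
    and T [measurable]: "\<And>i. T i \<in> borel_measurable borel"
    and w [measurable]: "\<And>i. w i \<in> borel_measurable borel"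
    and tr: "\<And>i f. f \<in> borel_measurable borel \<Longrightarrow>
        (\<integral>\<^sup>+y. f (T i y) * w i y \<partial>N) = (\<integral>\<^sup>+y. f y \<partial>N)"
    and "finite I"
    and F: "F \<in> borel_measurable (Pi\<^sub>M I (\<lambda>_. N))"
  shows "(\<integral>\<^sup>+\<xi>. F (\<lambda>i\<in>I. T i (\<xi> i)) * (\<Prod>i\<in>I. w i (\<xi> i)) \<partial>Pi\<^sub>M I (\<lambda>_. N))
          = (\<integral>\<^sup>+\<xi>. F \<xi> \<partial>Pi\<^sub>M I (\<lambda>_. N))"
proof -
  interpret N: prob_space N by fact
  interpret P: product_prob_space "\<lambda>_::nat. N" by standard
  show ?thesis using \<open>finite I\<close> F
  proof (induction I arbitrary: F rule: finite_induct)
    case empty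
    then show ?case by (simp add: PiM_empty nn_integral_count_space_finite)
  next
    case (insert i I)
    note [measurable] = insert.prems
    have eq: "(\<lambda>j\<in>insert i I. T j ((\<xi>(i := y)) j)) = (\<lambda>j\<in>I. T j (\<xi> j))(i := T i y)" for \<xi> y
      using \<open>i \<notin> I\<close> by (auto simp: fun_eq_iff)
    have pr: "(\<Prod>j\<in>insert i I. w j ((\<xi>(i := y)) j)) = w i y * (\<Prod>j\<in>I. w j (\<xi> j))" for \<xi> y
    proof -
      have "(\<Prod>j\<in>I. w j ((\<xi>(i := y)) j)) = (\<Prod>j\<in>I. w j (\<xi> j))"
        using \<open>i \<notin> I\<close> by (intro prod.cong) auto
      then show ?thesis using insert.hyps by simp
    qed
    have inner: "(\<integral>\<^sup>+y. F ((\<lambda>j\<in>I. T j (\<xi> j))(i := T i y)) * (w i y * (\<Prod>j\<in>I. w j (\<xi> j))) \<partial>N)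
        = (\<integral>\<^sup>+y. F ((\<lambda>j\<in>I. T j (\<xi> j))(i := y)) \<partial>N) * (\<Prod>j\<in>I. w j (\<xi> j))"
      if \<xi>: "\<xi> \<in> space (Pi\<^sub>M I (\<lambda>_. N))" for \<xi>
    proof -
      have sp: "(\<lambda>j\<in>I. T j (\<xi> j)) \<in> space (Pi\<^sub>M I (\<lambda>_. N))"
        using sN by (auto simp: space_PiM sets_eq_imp_space_eq)
      have m: "(\<lambda>y. F ((\<lambda>j\<in>I. T j (\<xi> j))(i := y))) \<in> borel_measurable borel"
      proof -
        have "(\<lambda>y. (\<lambda>j\<in>I. T j (\<xi> j))(i := y)) \<in> measurable N (Pi\<^sub>M (insert i I) (\<lambda>_. N))"
          by (rule measurable_fun_upd[where J=I]) (use sp in auto)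
        then have "(\<lambda>y. F ((\<lambda>j\<in>I. T j (\<xi> j))(i := y))) \<in> borel_measurable N"
          by measurable
        then show ?thesis using measurable_cong_sets[OF sN refl] by blast
      qed
      note [measurable] = m
      have "(\<integral>\<^sup>+y. F ((\<lambda>j\<in>I. T j (\<xi> j))(i := T i y)) * (w i y * (\<Prod>j\<in>I. w j (\<xi> j))) \<partial>N)
          = (\<integral>\<^sup>+y. (F ((\<lambda>j\<in>I. T j (\<xi> j))(i := T i y)) * w i y) * (\<Prod>j\<in>I. w j (\<xi> j)) \<partial>N)"
        by (simp add: mult.assoc)
      also have "\<dots> = (\<integral>\<^sup>+y. F ((\<lambda>j\<in>I. T j (\<xi> j))(i := T i y)) * w i y \<partial>N) * (\<Prod>j\<in>I. w j (\<xi> j))"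
      proof (rule nn_integral_multc)
        have "(\<lambda>y. F ((\<lambda>j\<in>I. T j (\<xi> j))(i := T i y)) * w i y) \<in> borel_measurable borel"
          using measurable_compose[OF T m] by measurable
        then show "(\<lambda>y. F ((\<lambda>j\<in>I. T j (\<xi> j))(i := T i y)) * w i y) \<in> borel_measurable N"
          using measurable_cong_sets[OF sN refl] by blast
      qed
      finally show ?thesis by (simp only: tr[OF m])
    qed
    have "(\<integral>\<^sup>+\<xi>. F (\<lambda>j\<in>insert i I. T j (\<xi> j)) * (\<Prod>j\<in>insert i I. w j (\<xi> j)) \<partial>Pi\<^sub>M (insert i I) (\<lambda>_. N))
      = (\<integral>\<^sup>+\<xi>. \<integral>\<^sup>+y. F (\<lambda>j\<in>insert i I. T j ((\<xi>(i := y)) j)) * (\<Prod>j\<in>insert i I. w j ((\<xi>(i := y)) j)) \<partial>N \<partial>Pi\<^sub>M I (\<lambda>_. N))"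
      using insert.hyps by (intro P.product_nn_integral_insert) auto
    also have "\<dots> = (\<integral>\<^sup>+\<xi>. (\<integral>\<^sup>+y. F ((\<lambda>j\<in>I. T j (\<xi> j))(i := y)) \<partial>N) * (\<Prod>j\<in>I. w j (\<xi> j)) \<partial>Pi\<^sub>M I (\<lambda>_. N))"
      unfolding eq pr by (intro nn_integral_cong inner)
    also have "\<dots> = (\<integral>\<^sup>+\<xi>. \<integral>\<^sup>+y. F (\<xi>(i := y)) \<partial>N \<partial>Pi\<^sub>M I (\<lambda>_. N))"
      by (rule insert.IH) measurable
    also have "\<dots> = (\<integral>\<^sup>+\<xi>. F \<xi> \<partial>Pi\<^sub>M (insert i I) (\<lambda>_. N))"
      using insert.hyps by (intro P.product_nn_integral_insert[symmetric]) auto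
    finally show ?case .
  qed
qed

definition gauss :: "nat \<Rightarrow> (nat \<Rightarrow> real) measure" where
  "gauss n = Pi\<^sub>M {..<n} (\<lambda>_. std_normal_distribution)"

definition lin :: "nat \<Rightarrow> (nat \<Rightarrow> real) \<Rightarrow> (nat \<Rightarrow> real) \<Rightarrow> real" where
  "lin n c \<xi> = (\<Sum>i<n. c i * \<xi> i)"

definition shift :: "nat \<Rightarrow> (nat \<Rightarrow> real) \<Rightarrow> (nat \<Rightarrow> real) \<Rightarrow> nat \<Rightarrow> real" where
  "shift n b \<xi> = (\<lambda>i\<in>{..<n}. \<xi> i + b i)"

lemma sets_gauss [measurable_cong]: "sets (gauss n) = sets (Pi\<^sub>M {..<n} (\<lambda>_. borel))"
  unfolding gauss_def by (intro sets_PiM_cong) auto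

lemma space_gauss: "space (gauss n) = extensional {..<n}"
  unfolding gauss_def space_PiM by (auto simp: PiE_def)

lemma prob_space_gauss: "prob_space (gauss n)"
  unfolding gauss_def using real_dist_normal_dist by (intro prob_space_PiM) (simp add: real_distribution_def)

lemma measurable_lin [measurable]: "lin n c \<in> borel_measurable (gauss n)"
  unfolding lin_def[abs_def] by measurable

lemma lin_shift: "lin n c (shift n b \<xi>) = lin n c \<xi> + (\<Sum>i<n. c i * b i)"
  unfolding lin_def shift_def by (simp add: algebra_simps sum.distrib)

text \<open>Cameron-Martin formula. Completing the square in each coordinate gives the weight exp(-
  b y - b^2 / 2), and the product over the coordinates adds up the exponents.\<close>

lemma gauss_shift:
  assumes F: "F \<in> borel_measurable (gauss n)"
  shows "(\<integral>\<^sup>+\<xi>. F \<xi> \<partial>gauss n)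
    = (\<integral>\<^sup>+\<xi>. F (shift n b \<xi>) * ennreal (exp (- lin n b \<xi> - (\<Sum>i<n. (b i)\<^sup>2) / 2)) \<partial>gauss n)"
proof -
  have one: "(\<integral>\<^sup>+y. f (y + b i) * ennreal (exp (- (b i * y) - (b i)\<^sup>2 / 2)) \<partial>std_normal_distribution)
      = (\<integral>\<^sup>+y. f y \<partial>std_normal_distribution)"
    if f[measurable]: "f \<in> borel_measurable borel" for f :: "real \<Rightarrow> ennreal" and i
  proof -
    have d: "std_normal_density y * exp (- (c * y) - c\<^sup>2 / 2) = std_normal_density (c + y)" for c y
      by (simp add: std_normal_density_def exp_add[symmetric] power2_eq_square field_simps)
    have "(\<integral>\<^sup>+y. f y \<partial>std_normal_distribution) = (\<integral>\<^sup>+y. std_normal_density y * f y \<partial>lborel)"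
      by (subst nn_integral_density) auto
    also have "\<dots> = (\<integral>\<^sup>+y. std_normal_density (b i + y) * f (b i + y) \<partial>lborel)"
      by (subst nn_integral_real_affine[where c=1 and t="b i"]) auto
    also have "\<dots> = (\<integral>\<^sup>+y. std_normal_density y * (f (y + b i) * ennreal (exp (- (b i * y) - (b i)\<^sup>2 / 2))) \<partial>lborel)"
      unfolding d[symmetric] by (intro nn_integral_cong) (simp add: ennreal_mult ac_simps)
    also have "\<dots> = (\<integral>\<^sup>+y. f (y + b i) * ennreal (exp (- (b i * y) - (b i)\<^sup>2 / 2)) \<partial>std_normal_distribution)"
      by (subst nn_integral_density) auto
    finally show ?thesis by simp
  qed
  have "(\<integral>\<^sup>+\<xi>. F (\<lambda>i\<in>{..<n}. \<xi> i + b i) * (\<Prod>i\<in>{..<n}. ennreal (exp (- (b i * \<xi> i) - (b i)\<^sup>2 / 2))) \<partial>gauss n)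
     = (\<integral>\<^sup>+\<xi>. F \<xi> \<partial>gauss n)"
    unfolding gauss_def
    by (rule nn_integral_PiM_transform[where T="\<lambda>i y. y + b i"
          and w="\<lambda>i y. ennreal (exp (- (b i * y) - (b i)\<^sup>2 / 2))"])
      (use one F real_dist_normal_dist in \<open>auto simp: real_distribution_def gauss_def\<close>)
  moreover have "(\<Prod>i\<in>{..<n}. ennreal (exp (- (b i * \<xi> i) - (b i)\<^sup>2 / 2)))
      = ennreal (exp (- lin n b \<xi> - (\<Sum>i<n. (b i)\<^sup>2) / 2))" for \<xi>
    by (simp add: prod_ennreal exp_sum[symmetric] lin_def sum_subtractf sum_negf sum_divide_distrib)
  ultimately show ?thesis by (simp add: shift_def)
qed

lemma gauss_reflect:
  assumes F: "F \<in> borel_measurable (gauss n)"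
  shows "(\<integral>\<^sup>+\<xi>. F (\<lambda>i\<in>{..<n}. - \<xi> i) \<partial>gauss n) = (\<integral>\<^sup>+\<xi>. F \<xi> \<partial>gauss n)"
proof -
  have one: "(\<integral>\<^sup>+y. f (- y) \<partial>std_normal_distribution) = (\<integral>\<^sup>+y. f y \<partial>std_normal_distribution)"
    if f[measurable]: "f \<in> borel_measurable borel" for f :: "real \<Rightarrow> ennreal"
  proof -
    have "(\<integral>\<^sup>+y. f y \<partial>std_normal_distribution) = (\<integral>\<^sup>+y. std_normal_density y * f y \<partial>lborel)"
      by (subst nn_integral_density) auto
    also have "\<dots> = (\<integral>\<^sup>+y. std_normal_density (- y) * f (- y) \<partial>lborel)"
      by (subst nn_integral_real_affine[where c="-1" and t=0]) auto
    also have "\<dots> = (\<integral>\<^sup>+y. f (- y) \<partial>std_normal_distribution)"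
      by (subst nn_integral_density) (auto simp: std_normal_density_def)
    finally show ?thesis by simp
  qed
  have "(\<integral>\<^sup>+\<xi>. F (\<lambda>i\<in>{..<n}. - \<xi> i) * (\<Prod>i\<in>{..<n}. 1) \<partial>gauss n) = (\<integral>\<^sup>+\<xi>. F \<xi> \<partial>gauss n)"
    unfolding gauss_def
    by (rule nn_integral_PiM_transform[where T="\<lambda>i y. - y" and w="\<lambda>i y. 1"])
      (use one F real_dist_normal_dist in \<open>auto simp: real_distribution_def gauss_def\<close>)
  then show ?thesis by simp
qed

text \<open>The shift formula for the constant function 1 and the direction - c: its left side is
  the total mass 1, its right side the moment generating function times a constant.\<close>

lemma gauss_mgf: "(\<integral>\<^sup>+\<xi>. ennreal (exp (lin n c \<xi>)) \<partial>gauss n) = ennreal (exp ((\<Sum>i<n. (c i)\<^sup>2) / 2))"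
proof -
  interpret prob_space "gauss n" by (rule prob_space_gauss)
  let ?s = "(\<Sum>i<n. (c i)\<^sup>2) / 2"
  have neg: "lin n (\<lambda>i. - c i) \<xi> = - lin n c \<xi>" for \<xi> by (simp add: lin_def sum_negf)
  have "1 = (\<integral>\<^sup>+\<xi>. 1 \<partial>gauss n)" by (simp add: emeasure_space_1)
  also have "\<dots> = (\<integral>\<^sup>+\<xi>. 1 * ennreal (exp (- lin n (\<lambda>i. - c i) \<xi> - (\<Sum>i<n. (- c i)\<^sup>2) / 2)) \<partial>gauss n)"
    by (rule gauss_shift) auto
  also have "\<dots> = (\<integral>\<^sup>+\<xi>. ennreal (exp (- ?s)) * ennreal (exp (lin n c \<xi>)) \<partial>gauss n)"
    by (intro nn_integral_cong) (simp add: neg ennreal_mult'[symmetric] exp_add[symmetric])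
  also have "\<dots> = ennreal (exp (- ?s)) * (\<integral>\<^sup>+\<xi>. ennreal (exp (lin n c \<xi>)) \<partial>gauss n)"
    by (rule nn_integral_cmult) measurable
  finally have "ennreal (exp ?s) * 1 = ennreal (exp ?s) * (ennreal (exp (- ?s)) * (\<integral>\<^sup>+\<xi>. ennreal (exp (lin n c \<xi>)) \<partial>gauss n))"
    by simp
  also have "\<dots> = (\<integral>\<^sup>+\<xi>. ennreal (exp (lin n c \<xi>)) \<partial>gauss n)"
    by (simp add: mult.assoc[symmetric] ennreal_mult'[symmetric] exp_add[symmetric])
  finally show ?thesis by simp
qed

text \<open>Averaging the shift formula over all multiples \<open>c b\<close> expresses that the component along
  \<open>b\<close> is Gaussian and independent of the rest.\<close>

lemma gauss_disintegrate:
  assumes F: "F \<in> borel_measurable (gauss n)" and \<beta>: "\<beta> = (\<Sum>i<n. (b i)\<^sup>2)" "\<beta> > 0"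
  shows "(\<integral>\<^sup>+\<xi>. F \<xi> \<partial>gauss n) = (\<integral>\<^sup>+\<xi>. (\<integral>\<^sup>+c. F (shift n (\<lambda>i. c * b i) \<xi>) *
      ennreal (\<beta> * normal_density 0 (sqrt \<beta>) (lin n b \<xi> + c * \<beta>)) \<partial>lborel) \<partial>gauss n)"
proof -
  interpret G: prob_space "gauss n" by (rule prob_space_gauss)
  interpret P: pair_sigma_finite "gauss n" lborel ..
  note F[measurable]
  let ?g = "\<lambda>y. ennreal (normal_density 0 (sqrt \<beta>) y)"
  have sb: "(\<lambda>x. shift n (\<lambda>i. snd x * b i) (fst x)) \<in> measurable (gauss n \<Otimes>\<^sub>M lborel) (gauss n)"
    unfolding shift_def by measurable
  have [measurable]: "(\<lambda>x. F (shift n (\<lambda>i. snd x * b i) (fst x))) \<in> borel_measurable (gauss n \<Otimes>\<^sub>M lborel)"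
    by (rule measurable_compose[OF sb F])
  \<comment> \<open>Averaging the density over all c, with the Jacobian \<open>\<beta>\<close>,
    gives 1 whatever the value of y; this 1 is inserted into the integral before the shift formula
    is applied for each c.\<close>
  have a: "(\<integral>\<^sup>+c. ?g (y - c * \<beta>) \<partial>lborel) * \<beta> = 1" for y
  proof -
    have "1 = (\<integral>\<^sup>+x. ?g x \<partial>lborel)"
      using prob_space.emeasure_space_1[OF prob_space_normal_density[of "sqrt \<beta>" 0]] \<beta>
      by (simp add: emeasure_density)
    also have "\<dots> = ennreal \<bar>- \<beta>\<bar> * (\<integral>\<^sup>+c. ?g (y + (-\<beta>) * c) \<partial>lborel)"
      using \<beta>(2) by (intro nn_integral_real_affine) auto
    finally show ?thesis using \<beta>(2) by (simp add: mult.commute)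
  qed
  have lb: "lin n b (shift n (\<lambda>i. c * b i) \<xi>) = lin n b \<xi> + c * \<beta>" for c \<xi>
    unfolding lin_shift \<beta> by (simp add: sum_distrib_left power2_eq_square ac_simps)
  have "(\<integral>\<^sup>+\<xi>. F \<xi> \<partial>gauss n) = (\<integral>\<^sup>+\<xi>. (\<integral>\<^sup>+c. \<beta> * F \<xi> * ?g (lin n b \<xi> - c * \<beta>) \<partial>lborel) \<partial>gauss n)"
  proof (rule nn_integral_cong)
    fix \<xi>
    have "F \<xi> = F \<xi> * ((\<integral>\<^sup>+c. ?g (lin n b \<xi> - c * \<beta>) \<partial>lborel) * \<beta>)" by (simp only: a mult_1_right)
    also have "\<dots> = (\<beta> * F \<xi>) * (\<integral>\<^sup>+c. ?g (lin n b \<xi> - c * \<beta>) \<partial>lborel)" by (simp add: ac_simps)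
    also have "\<dots> = (\<integral>\<^sup>+c. \<beta> * F \<xi> * ?g (lin n b \<xi> - c * \<beta>) \<partial>lborel)"
      by (rule nn_integral_cmult[symmetric]) measurable
    finally show "F \<xi> = (\<integral>\<^sup>+c. \<beta> * F \<xi> * ?g (lin n b \<xi> - c * \<beta>) \<partial>lborel)" .
  qed
  also have "\<dots> = (\<integral>\<^sup>+c. (\<integral>\<^sup>+\<xi>. \<beta> * F \<xi> * ?g (lin n b \<xi> - c * \<beta>) \<partial>gauss n) \<partial>lborel)"
    by (rule P.Fubini'[symmetric]) measurable
  also have "\<dots> = (\<integral>\<^sup>+c. (\<integral>\<^sup>+\<xi>. F (shift n (\<lambda>i. c * b i) \<xi>) *
      ennreal (\<beta> * normal_density 0 (sqrt \<beta>) (lin n b \<xi> + c * \<beta>)) \<partial>gauss n) \<partial>lborel)"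
  proof (rule nn_integral_cong)
    fix c :: real
    \<comment> \<open>The Cameron-Martin weight of the shift by c b is exactly the quotient of the
      Gaussian densities at \<open>x + c * \<beta>\<close> and at x, so both factors merge into one
      density.\<close>
    have e: "normal_density 0 (sqrt \<beta>) x * exp (- (c * x) - c\<^sup>2 * \<beta> / 2) = normal_density 0 (sqrt \<beta>) (x + c * \<beta>)" for x
      using \<beta>(2) unfolding normal_density_def mult.assoc
      by (simp add: exp_add[symmetric] power2_eq_square field_simps)
    have "(\<integral>\<^sup>+\<xi>. \<beta> * F \<xi> * ?g (lin n b \<xi> - c * \<beta>) \<partial>gauss n)
      = (\<integral>\<^sup>+\<xi>. \<beta> * F (shift n (\<lambda>i. c * b i) \<xi>) * ?g (lin n b (shift n (\<lambda>i. c * b i) \<xi>) - c * \<beta>)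
          * ennreal (exp (- lin n (\<lambda>i. c * b i) \<xi> - (\<Sum>i<n. (c * b i)\<^sup>2) / 2)) \<partial>gauss n)"
      by (rule gauss_shift) measurable
    also have "\<dots> = (\<integral>\<^sup>+\<xi>. F (shift n (\<lambda>i. c * b i) \<xi>) *
      ennreal (\<beta> * normal_density 0 (sqrt \<beta>) (lin n b \<xi> + c * \<beta>)) \<partial>gauss n)"
    proof (rule nn_integral_cong)
      fix \<xi>
      have l: "lin n (\<lambda>i. c * b i) \<xi> = c * lin n b \<xi>" by (simp add: lin_def sum_distrib_left ac_simps)
      have s: "(\<Sum>i<n. (c * b i)\<^sup>2) = c\<^sup>2 * \<beta>" by (simp add: \<beta> power_mult_distrib sum_distrib_left)
      have "?g (lin n b \<xi>) * ennreal (exp (- (c * lin n b \<xi>) - c\<^sup>2 * \<beta> / 2)) = ?g (lin n b \<xi> + c * \<beta>)"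
        unfolding e[symmetric] by (simp add: ennreal_mult)
      then show "\<beta> * F (shift n (\<lambda>i. c * b i) \<xi>) * ?g (lin n b (shift n (\<lambda>i. c * b i) \<xi>) - c * \<beta>)
          * ennreal (exp (- lin n (\<lambda>i. c * b i) \<xi> - (\<Sum>i<n. (c * b i)\<^sup>2) / 2))
          = F (shift n (\<lambda>i. c * b i) \<xi>) * ennreal (\<beta> * normal_density 0 (sqrt \<beta>) (lin n b \<xi> + c * \<beta>))"
        using \<beta>(2) unfolding lb l s
        by (simp add: ennreal_mult mult.assoc) (simp add: ac_simps)
    qed
    finally show "(\<integral>\<^sup>+\<xi>. \<beta> * F \<xi> * ?g (lin n b \<xi> - c * \<beta>) \<partial>gauss n) = \<dots>" .
  qed
  also have "\<dots> = (\<integral>\<^sup>+\<xi>. (\<integral>\<^sup>+c. F (shift n (\<lambda>i. c * b i) \<xi>) *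
      ennreal (\<beta> * normal_density 0 (sqrt \<beta>) (lin n b \<xi> + c * \<beta>)) \<partial>lborel) \<partial>gauss n)"
    by (rule P.Fubini') measurable
  finally show ?thesis .
qed

text \<open>Chernoff bound for both signs, with the exponent \<open>r / v\<close> that is optimal
  for variance v.\<close>

lemma gauss_tail:
  assumes v: "(\<Sum>i<n. (c i)\<^sup>2) \<le> v" "0 < v" "0 \<le> r"
  shows "emeasure (gauss n) {\<xi>\<in>space (gauss n). r \<le> \<bar>lin n c \<xi>\<bar>} \<le> ennreal (2 * exp (- r\<^sup>2 / (2 * v)))"
proof -
  have one: "(\<integral>\<^sup>+\<xi>. ennreal (exp (lin n (\<lambda>i. a * c i) \<xi> - r\<^sup>2 / v)) \<partial>gauss n) \<le> ennreal (exp (- r\<^sup>2 / (2 * v)))"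
    if a: "a = r / v \<or> a = - r / v" for a
  proof -
    have "(\<integral>\<^sup>+\<xi>. ennreal (exp (lin n (\<lambda>i. a * c i) \<xi> - r\<^sup>2 / v)) \<partial>gauss n)
      = (\<integral>\<^sup>+\<xi>. ennreal (exp (- r\<^sup>2 / v)) * ennreal (exp (lin n (\<lambda>i. a * c i) \<xi>)) \<partial>gauss n)"
      by (intro nn_integral_cong) (simp add: ennreal_mult'[symmetric] exp_add[symmetric])
    also have "\<dots> = ennreal (exp (- r\<^sup>2 / v)) * ennreal (exp ((\<Sum>i<n. (a * c i)\<^sup>2) / 2))"
      by (subst nn_integral_cmult) (auto simp: gauss_mgf)
    also have "\<dots> = ennreal (exp (- r\<^sup>2 / v + (\<Sum>i<n. (a * c i)\<^sup>2) / 2))"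
      by (simp add: ennreal_mult'[symmetric] exp_add[symmetric])
    also have "(\<Sum>i<n. (a * c i)\<^sup>2) = (r/v)\<^sup>2 * (\<Sum>i<n. (c i)\<^sup>2)"
      using a by (auto simp: power_mult_distrib sum_distrib_left power_divide)
    also have "ennreal (exp (- r\<^sup>2 / v + (r/v)\<^sup>2 * (\<Sum>i<n. (c i)\<^sup>2) / 2)) \<le> ennreal (exp (- r\<^sup>2 / v + (r/v)\<^sup>2 * v / 2))"
      using v by (intro ennreal_leI) (auto intro!: mult_left_mono divide_right_mono)
    also have "- r\<^sup>2 / v + (r/v)\<^sup>2 * v / 2 = - r\<^sup>2 / (2 * v)"
      using v by (simp add: power2_eq_square field_simps)
    finally show ?thesis .
  qed
  have "emeasure (gauss n) {\<xi>\<in>space (gauss n). r \<le> \<bar>lin n c \<xi>\<bar>}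
      = (\<integral>\<^sup>+\<xi>. indicator {\<xi>\<in>space (gauss n). r \<le> \<bar>lin n c \<xi>\<bar>} \<xi> \<partial>gauss n)"
    by simp
  also have "\<dots> \<le> (\<integral>\<^sup>+\<xi>. ennreal (exp (lin n (\<lambda>i. r/v * c i) \<xi> - r\<^sup>2 / v))
      + ennreal (exp (lin n (\<lambda>i. -r/v * c i) \<xi> - r\<^sup>2 / v)) \<partial>gauss n)"
  proof (rule nn_integral_mono)
    fix \<xi>
    have l: "lin n (\<lambda>i. a * c i) \<xi> = a * lin n c \<xi>" for a by (simp add: lin_def sum_distrib_left ac_simps)
    show "indicator {\<xi>\<in>space (gauss n). r \<le> \<bar>lin n c \<xi>\<bar>} \<xi> \<le> ennreal (exp (lin n (\<lambda>i. r/v * c i) \<xi> - r\<^sup>2 / v))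
      + ennreal (exp (lin n (\<lambda>i. -r/v * c i) \<xi> - r\<^sup>2 / v))"
    proof (cases "r \<le> \<bar>lin n c \<xi>\<bar>")
      case True
      have "1 \<le> exp (r/v * \<bar>lin n c \<xi>\<bar> - r\<^sup>2 / v)"
        using True v by (simp add: power2_eq_square field_simps mult_left_mono)
      also have "\<dots> \<le> exp (r/v * lin n c \<xi> - r\<^sup>2 / v) + exp (-r/v * lin n c \<xi> - r\<^sup>2 / v)"
        by (cases "lin n c \<xi> \<ge> 0") auto
      finally have "ennreal 1 \<le> ennreal (exp (r/v * lin n c \<xi> - r\<^sup>2 / v) + exp (-r/v * lin n c \<xi> - r\<^sup>2 / v))"
        by (rule ennreal_leI)
      then show ?thesis unfolding l by (simp add: indicator_def)
    qed (simp add: indicator_def)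
  qed
  also have "\<dots> \<le> ennreal (exp (- r\<^sup>2 / (2 * v))) + ennreal (exp (- r\<^sup>2 / (2 * v)))"
    by (subst nn_integral_add, measurable) (intro add_mono one; simp)
  also have "\<dots> = ennreal (2 * exp (- r\<^sup>2 / (2 * v)))"
    by (simp flip: ennreal_plus)
  finally show ?thesis .
qed

section \<open>Discretised paths and their average\<close>

definition avg :: "nat \<Rightarrow> (nat \<Rightarrow> real) \<Rightarrow> real" where
  "avg n f = (\<Sum>k=1..n. f k) / real n"

lemma avg_mono: "(\<And>k. 1 \<le> k \<Longrightarrow> k \<le> n \<Longrightarrow> f k \<le> g k) \<Longrightarrow> avg n f \<le> avg n g"
  unfolding avg_def by (intro divide_right_mono sum_mono) auto

lemma avg_cong: "(\<And>k. 1 \<le> k \<Longrightarrow> k \<le> n \<Longrightarrow> f k = g k) \<Longrightarrow> avg n f = avg n g"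
  unfolding avg_def by (intro arg_cong2[where f="(/)"] sum.cong) auto

lemma avg_add: "avg n (\<lambda>k. f k + g k) = avg n f + avg n g"
  unfolding avg_def by (simp add: sum.distrib add_divide_distrib)

lemma avg_diff: "avg n (\<lambda>k. f k - g k) = avg n f - avg n g"
  unfolding avg_def by (simp add: sum_subtractf diff_divide_distrib)

lemma avg_uminus: "avg n (\<lambda>k. - f k) = - avg n f"
  unfolding avg_def by (simp add: sum_negf)

lemma avg_cmult: "avg n (\<lambda>k. c * f k) = c * avg n f"
  unfolding avg_def by (simp add: sum_distrib_left)

lemma avg_const: "n > 0 \<Longrightarrow> avg n (\<lambda>k. c) = c"
  unfolding avg_def by simp

lemma avg_nonneg: "(\<And>k. 1 \<le> k \<Longrightarrow> k \<le> n \<Longrightarrow> 0 \<le> f k) \<Longrightarrow> 0 \<le> avg n f"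
  unfolding avg_def by (intro divide_nonneg_nonneg sum_nonneg) auto

lemma measurable_avg [measurable]:
  "(\<And>k. (\<lambda>x. f x k) \<in> borel_measurable M) \<Longrightarrow> (\<lambda>x. avg n (f x)) \<in> borel_measurable M"
  unfolding avg_def by (intro borel_measurable_divide borel_measurable_sum borel_measurable_const)

text \<open>The sum stops at n because \<open>gauss n\<close> has only the coordinates below n; this
  makes all values of \<open>drift_walk\<close> measurable and the path a function on all natural
  numbers. The scaling gives variance \<open>k / n\<close> at \<open>k \<le> n\<close>.\<close>

definition walk :: "nat \<Rightarrow> (nat \<Rightarrow> real) \<Rightarrow> nat \<Rightarrow> real" where
  "walk n c k = (\<Sum>i<min k n. c i) / sqrt (real n)"

definition drift_walk :: "real \<Rightarrow> nat \<Rightarrow> (nat \<Rightarrow> real) \<Rightarrow> nat \<Rightarrow> real" where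
  "drift_walk \<nu> n \<xi> k = \<nu> * real k / real n + walk n \<xi> k"

lemma measurable_drift_walk [measurable]: "(\<lambda>\<xi>. drift_walk \<nu> n \<xi> k) \<in> borel_measurable (gauss n)"
  unfolding drift_walk_def walk_def by measurable

lemma walk_shift: "walk n (shift n b \<xi>) k = walk n \<xi> k + walk n b k"
proof -
  have "(\<Sum>i<min k n. shift n b \<xi> i) = (\<Sum>i<min k n. \<xi> i + b i)"
    by (intro sum.cong) (auto simp: shift_def)
  then show ?thesis by (simp add: walk_def sum.distrib add_divide_distrib)
qed

lemma drift_walk_shift: "drift_walk \<nu> n (shift n b \<xi>) = (\<lambda>k. drift_walk \<nu> n \<xi> k + walk n b k)"
  by (simp add: drift_walk_def walk_shift fun_eq_iff)

lemma drift_walk_reflect: "drift_walk \<nu> n (\<lambda>i\<in>{..<n}. - \<xi> i) k = - drift_walk (- \<nu>) n \<xi> k"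
proof -
  have "(\<Sum>i<min k n. (\<lambda>i\<in>{..<n}. - \<xi> i) i) = (\<Sum>i<min k n. - \<xi> i)"
    by (intro sum.cong) auto
  then show ?thesis by (simp add: drift_walk_def walk_def sum_negf)
qed

lemma walk_scale: "walk n (\<lambda>i. c * b i) k = c * walk n b k"
  by (simp add: walk_def sum_distrib_left)

lemma walk_0 [simp]: "walk n b 0 = 0" by (simp add: walk_def)
text \<open>With \<open>Y\<close> the average of the path \<open>V\<close>, \<open>area_mean \<nu> n\<close> and \<open>area_var n\<close> are the mean and the
  variance of \<open>Y\<close>, and \<open>profile n k\<close> is the covariance of \<open>V k\<close> and \<open>Y\<close> divided by \<open>area_var n\<close>.\<close>

definition area_var :: "nat \<Rightarrow> real" where
  "area_var n = (real n + 1) * (2 * real n + 1) / (6 * (real n)\<^sup>2)"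

text \<open>The average of the walk has the coefficients (n - i) / (n sqrt n). Division by
  \<open>area_var n\<close> is the normalisation for which a shift by c times this vector raises the
  average by exactly c.\<close>

definition area_dir :: "nat \<Rightarrow> nat \<Rightarrow> real" where
  "area_dir n i = (real n - real i) / (real n * sqrt (real n) * area_var n)"

definition profile :: "nat \<Rightarrow> nat \<Rightarrow> real" where
  "profile n = walk n (area_dir n)"

lemma area_var_ge: "n > 0 \<Longrightarrow> 1 / 3 \<le> area_var n"
  by (simp add: area_var_def field_simps power2_eq_square)

lemma area_var_pos: "n > 0 \<Longrightarrow> 0 < area_var n"
  using area_var_ge[of n] by linarith

lemma area_var_le: assumes "n \<ge> 10" shows "area_var n \<le> 2 / 5"
proof -
  have "10 * real n \<le> real n * real n" using assms by (intro mult_right_mono) auto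
  moreover have "real n \<ge> 10" using assms by simp
  ultimately have "5 + real n * 15 \<le> real n * (real n * 2)" by linarith
  then show ?thesis using assms by (simp add: area_var_def field_simps power2_eq_square)
qed

lemma profile_Suc: assumes "k < n"
  shows "profile n (Suc k) - profile n k = (real n - real k) / ((real n)\<^sup>2 * area_var n)"
proof -
  have "profile n (Suc k) - profile n k = area_dir n k / sqrt (real n)"
    using assms by (simp add: profile_def walk_def min_def add_divide_distrib)
  also have "\<dots> = (real n - real k) / (real n * (sqrt (real n) * sqrt (real n)) * area_var n)"
    by (simp add: area_dir_def ac_simps)
  finally show ?thesis by (simp add: power2_eq_square)
qed

lemma profile_0 [simp]: "profile n 0 = 0" by (simp add: profile_def)

text \<open>In the limit this is the parabola 3 (u - u^2 / 2), the function of least Dirichlet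
  energy on [0, 1] among those with value 0 at 0 and integral 1; its energy is 3.\<close>

lemma profile_eq: assumes "k \<le> n" "n > 0"
  shows "profile n k = real k / real n * (1 - real k / real n / 2 + 1 / (2 * real n)) / area_var n"
  using assms(1)
proof (induction k)
  case (Suc k)
  have "profile n (Suc k) = profile n k + (real n - real k) / ((real n)\<^sup>2 * area_var n)"
    using profile_Suc[of k n] Suc by simp
  also have "\<dots> = (real n * real k - real k * real k / 2 + real k / 2 + (real n - real k)) / ((real n)\<^sup>2 * area_var n)"
  proof -
    have "profile n k = (real n * real k - real k * real k / 2 + real k / 2) / ((real n)\<^sup>2 * area_var n)"
      using Suc assms area_var_pos[of n] by (simp add: field_simps power2_eq_square)
    then show ?thesis by (simp only: add_divide_distrib)
  qed
  also have "\<dots> = real (Suc k) / real n * (1 - real (Suc k) / real n / 2 + 1 / (2 * real n)) / area_var n"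
    using assms area_var_pos[of n] by (simp add: field_simps power2_eq_square)
  finally show ?case .
qed simp

lemma profile_upper: assumes "k \<le> n" "n > 0" shows "profile n k \<le> 3 * (real k / real n)"
proof (cases "k = 0")
  case False
  have "profile n k \<le> (real k / real n) / area_var n"
    unfolding profile_eq[OF assms] using assms False area_var_pos[of n]
    by (intro divide_right_mono) (auto simp: field_simps)
  also have "\<dots> \<le> (real k / real n) / (1/3)"
    using assms area_var_ge[of n] area_var_pos[of n] by (intro divide_left_mono) auto
  finally show ?thesis by (simp add: mult.commute)
qed simp

lemma profile_lower: assumes "k \<le> n" "n \<ge> 10" shows "5 / 4 * (real k / real n) \<le> profile n k"
proof -
  have n: "n > 0" using assms by simp
  have "5 / 4 * (real k / real n) = (real k / real n / 2) / (2 / 5)" by simp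
  also have "\<dots> \<le> (real k / real n / 2) / area_var n"
    using area_var_le[OF assms(2)] area_var_pos[OF n] by (intro divide_left_mono) auto
  also have "\<dots> \<le> profile n k"
  proof -
    have "real k / real n * (1 / 2) \<le> real k / real n * (1 - real k / real n / 2 + 1 / (2 * real n))"
      using assms by (intro mult_left_mono) (auto simp: field_simps)
    then show ?thesis unfolding profile_eq[OF assms(1) n] using area_var_pos[OF n]
      by (intro divide_right_mono) auto
  qed
  finally show ?thesis .
qed

lemma profile_nonneg: assumes "k \<le> n" "n > 0" shows "0 \<le> profile n k"
  unfolding profile_eq[OF assms] using assms area_var_pos[of n]
  by (intro divide_nonneg_pos mult_nonneg_nonneg) (auto simp: field_simps)

text \<open>The term with index i occurs in the inner sums for i < k and k up to n, that is n - i
  times.\<close>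

lemma sum_double_avg:
  "(\<Sum>k=1..n. \<Sum>i<k. f i) = (\<Sum>i<n. (real n - real i) * f i)"
proof (induction n)
  case (Suc n)
  have "(\<Sum>i<Suc n. (real (Suc n) - real i) * f i) = (\<Sum>i<Suc n. (real n - real i) * f i + f i)"
    by (intro sum.cong) (auto simp: algebra_simps)
  then show ?case using Suc by (simp add: sum.distrib)
qed simp

lemma avg_walk: "n > 0 \<Longrightarrow> avg n (walk n c) = area_var n * lin n (area_dir n) c"
proof -
  assume n: "n > 0"
  have "(\<Sum>k=1..n. walk n c k) = (\<Sum>k=1..n. \<Sum>i<k. c i) / sqrt (real n)"
    unfolding sum_divide_distrib by (intro sum.cong) (auto simp: walk_def min_def sum_divide_distrib)
  also have "\<dots> = (\<Sum>i<n. (real n - real i) * c i) / sqrt (real n)"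
    by (simp only: sum_double_avg)
  finally have "avg n (walk n c) = (\<Sum>i<n. (real n - real i) * c i) / sqrt (real n) / real n"
    by (simp add: avg_def)
  also have "\<dots> = area_var n * lin n (area_dir n) c"
    unfolding lin_def area_dir_def sum_distrib_left sum_divide_distrib
    using n area_var_pos[OF n] by (intro sum.cong) auto
  finally show ?thesis .
qed

lemma sum_squares_rev: "(\<Sum>i<n. (real n - real i)\<^sup>2) = real n * (real n + 1) * (2 * real n + 1) / 6"
proof -
  have "(\<Sum>i<n. (real n - real i)\<^sup>2) = (\<Sum>i<n. (real (Suc i))\<^sup>2)"
    by (rule sum.reindex_bij_witness[of _ "\<lambda>i. n - Suc i" "\<lambda>i. n - Suc i"]) (auto simp: of_nat_diff)
  also have "\<dots> = real n * (real n + 1) * (2 * real n + 1) / 6"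
    by (induction n) (auto simp: field_simps power2_eq_square)
  finally show ?thesis .
qed

lemma sum_area_dir_sq: assumes "n > 0" shows "(\<Sum>i<n. (area_dir n i)\<^sup>2) = 1 / area_var n"
proof -
  have "(\<Sum>i<n. (area_dir n i)\<^sup>2) = (\<Sum>i<n. (real n - real i)\<^sup>2) / ((real n)^3 * (area_var n)\<^sup>2)"
    unfolding sum_divide_distrib
    by (intro sum.cong) (auto simp: area_dir_def power_divide power_mult_distrib power3_eq_cube power2_eq_square)
  also have "\<dots> = area_var n / (area_var n)\<^sup>2"
  proof -
    have e: "area_var n * (real n)^3 = real n * (real n + 1) * (2 * real n + 1) / 6"
      using assms by (simp add: area_var_def field_simps power2_eq_square power3_eq_cube)
    then show ?thesis unfolding sum_squares_rev using assms area_var_pos[OF assms]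
      by (subst e[symmetric]) (simp add: field_simps)
  qed
  finally show ?thesis using area_var_pos[OF assms] by (simp add: power2_eq_square)
qed

lemma avg_profile: assumes "n > 0" shows "avg n (profile n) = 1"
  unfolding profile_def avg_walk[OF assms] using sum_area_dir_sq[OF assms] area_var_pos[OF assms]
  by (simp add: lin_def power2_eq_square[symmetric])

definition area_mean :: "real \<Rightarrow> nat \<Rightarrow> real" where
  "area_mean \<nu> n = \<nu> * (real n + 1) / (2 * real n)"

lemma area_mean_abs: "n > 0 \<Longrightarrow> \<bar>area_mean \<nu> n\<bar> \<le> \<bar>\<nu>\<bar>"
proof -
  assume n: "n > 0"
  have "\<bar>area_mean \<nu> n\<bar> = \<bar>\<nu>\<bar> * ((real n + 1) / (2 * real n))" by (simp add: area_mean_def abs_mult)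
  also have "\<dots> \<le> \<bar>\<nu>\<bar> * 1" using n by (intro mult_left_mono) (auto simp: field_simps)
  finally show ?thesis by simp
qed

lemma avg_drift_walk: assumes "n > 0" shows "avg n (drift_walk \<nu> n \<xi>) = area_mean \<nu> n + area_var n * lin n (area_dir n) \<xi>"
proof -
  have "(\<Sum>k=1..n. \<nu> * real k / real n) = \<nu> / real n * (\<Sum>k=1..n. real k)"
    by (simp add: sum_distrib_left)
  also have "(\<Sum>k=1..n. real k) = real n * (real n + 1) / 2"
    by (induction n) (auto simp: field_simps)
  finally have "avg n (\<lambda>k. \<nu> * real k / real n) = area_mean \<nu> n"
    using assms by (simp add: avg_def area_mean_def field_simps)
  then show ?thesis unfolding drift_walk_def avg_add avg_walk[OF assms] by simp
qed

text \<open>A shift by c times \<open>area_dir\<close> adds c times \<open>profile\<close> to the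
  path and c to its average. The inner integral therefore runs over all values of the average, with
  their Gaussian law, and depends on the outer variable only through the residual path.\<close>

lemma drift_walk_disintegrate:
  assumes F: "(\<lambda>\<xi>. F (drift_walk \<nu> n \<xi>)) \<in> borel_measurable (gauss n)" and n: "n > 0"
  shows "(\<integral>\<^sup>+\<xi>. F (drift_walk \<nu> n \<xi>) \<partial>gauss n) = (\<integral>\<^sup>+\<xi>. (\<integral>\<^sup>+c. F (\<lambda>k. drift_walk \<nu> n \<xi> k + c * profile n k) *
      ennreal (normal_density (area_mean \<nu> n) (sqrt (area_var n)) (avg n (drift_walk \<nu> n \<xi>) + c)) \<partial>lborel) \<partial>gauss n)"
proof -
  have v: "area_var n > 0" using n by (rule area_var_pos)
  have pair_density: "1 / area_var n * normal_density 0 (sqrt (1 / area_var n)) (lin n (area_dir n) \<xi> + c * (1 / area_var n))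
     = normal_density (area_mean \<nu> n) (sqrt (area_var n)) (avg n (drift_walk \<nu> n \<xi>) + c)" for c \<xi>
  proof -
    have "1 / area_var n * normal_density 0 (sqrt (1 / area_var n)) (lin n (area_dir n) \<xi> + c * (1 / area_var n))
      = 1 / sqrt (2 * pi * area_var n) * exp (- ((area_var n * lin n (area_dir n) \<xi> + c)\<^sup>2) / (2 * area_var n))"
    proof -
      have "1 / area_var n * (1 / sqrt (2 * pi * (1 / area_var n))) = 1 / sqrt (2 * pi * area_var n)"
        using v by (simp add: real_sqrt_mult real_sqrt_divide field_simps)
      moreover have "(lin n (area_dir n) \<xi> + c * (1 / area_var n))\<^sup>2 / (2 * (1 / area_var n)) = (area_var n * lin n (area_dir n) \<xi> + c)\<^sup>2 / (2 * area_var n)"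
        using v by (simp add: field_simps power2_eq_square)
      ultimately show ?thesis using v by (simp add: normal_density_def)
    qed
    then show ?thesis using v by (simp add: normal_density_def avg_drift_walk[OF n])
  qed
  have "(\<integral>\<^sup>+\<xi>. F (drift_walk \<nu> n \<xi>) \<partial>gauss n) = (\<integral>\<^sup>+\<xi>. (\<integral>\<^sup>+c. F (drift_walk \<nu> n (shift n (\<lambda>i. c * area_dir n i) \<xi>)) *
      ennreal (1 / area_var n * normal_density 0 (sqrt (1 / area_var n)) (lin n (area_dir n) \<xi> + c * (1 / area_var n))) \<partial>lborel) \<partial>gauss n)"
    by (rule gauss_disintegrate[OF F]) (simp_all add: sum_area_dir_sq[OF n] v)
  then show ?thesis unfolding pair_density drift_walk_shift walk_scale profile_def[symmetric] .
qed

text \<open>Coefficients of the centred value \<open>V k\<close> after its regression on the average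
  has been subtracted.\<close>

definition resid_coeff :: "nat \<Rightarrow> nat \<Rightarrow> nat \<Rightarrow> real" where
  "resid_coeff n k i = of_bool (i < k) / sqrt (real n) - profile n k * area_var n * area_dir n i"

lemma lin_of_bool: "k \<le> n \<Longrightarrow> (\<Sum>i<n::nat. of_bool (i < k) * f i) = (\<Sum>i<k. (f i :: real))"
  by (rule sum.mono_neutral_cong_right) auto

lemma resid_eq:
  assumes "k \<le> n" "n > 0"
  shows "drift_walk \<nu> n \<xi> k - profile n k * avg n (drift_walk \<nu> n \<xi>) = (\<nu> * real k / real n - profile n k * area_mean \<nu> n) + lin n (resid_coeff n k) \<xi>"
proof -
  have "lin n (resid_coeff n k) \<xi> = (\<Sum>i<n. of_bool (i < k) * (\<xi> i / sqrt (real n))) - profile n k * area_var n * lin n (area_dir n) \<xi>"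
    unfolding lin_def resid_coeff_def sum_distrib_left sum_subtractf[symmetric]
    by (intro sum.cong) (auto simp: algebra_simps)
  also have "(\<Sum>i<n. of_bool (i < k) * (\<xi> i / sqrt (real n))) = walk n \<xi> k"
    unfolding lin_of_bool[OF assms(1)] using assms by (simp add: walk_def min_def sum_divide_distrib)
  finally show ?thesis unfolding avg_drift_walk[OF assms(2)] by (simp add: drift_walk_def algebra_simps)
qed

text \<open>Pythagoras: of the variance \<open>k / n\<close> of \<open>V k\<close>, the regression
  on the average takes away \<open>area_var n\<close> times the square of
  \<open>profile n k\<close>.\<close>

lemma resid_coeff_sq_le:
  assumes "k \<le> n" "n > 0"
  shows "(\<Sum>i<n. (resid_coeff n k i)\<^sup>2) \<le> real k / real n"
proof -
  have "(resid_coeff n k i)\<^sup>2 = of_bool (i < k) * (1 / real n) - 2 * profile n k * area_var n * (of_bool (i < k) * (area_dir n i / sqrt (real n))) + (profile n k * area_var n)\<^sup>2 * (area_dir n i)\<^sup>2" for i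
    by (auto simp: resid_coeff_def power2_eq_square algebra_simps real_sqrt_mult[symmetric])
  then have "(\<Sum>i<n. (resid_coeff n k i)\<^sup>2) = (\<Sum>i<n. of_bool (i < k) * (1 / real n))
     - 2 * profile n k * area_var n * (\<Sum>i<n. of_bool (i < k) * (area_dir n i / sqrt (real n))) + (profile n k * area_var n)\<^sup>2 * (\<Sum>i<n. (area_dir n i)\<^sup>2)"
    by (simp only: sum.distrib sum_subtractf sum_distrib_left)
  also have "(\<Sum>i<n. of_bool (i < k) * (area_dir n i / sqrt (real n))) = profile n k"
    unfolding lin_of_bool[OF assms(1)] using assms by (simp add: profile_def walk_def min_def sum_divide_distrib)
  also have "(\<Sum>i<n. of_bool (i < k) * (1 / real n)) = real k / real n"
    unfolding lin_of_bool[OF assms(1)] by simp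
  also have "real k / real n - 2 * profile n k * area_var n * profile n k + (profile n k * area_var n)\<^sup>2 * (\<Sum>i<n. (area_dir n i)\<^sup>2)
     = real k / real n - area_var n * (profile n k)\<^sup>2"
    unfolding sum_area_dir_sq[OF assms(2)] using area_var_pos[OF assms(2)] by (simp add: power2_eq_square field_simps)
  finally show ?thesis using area_var_pos[OF assms(2)] by simp
qed

lemma resid_mean_abs:
  assumes "k \<le> n" "n > 0"
  shows "\<bar>\<nu> * real k / real n - profile n k * area_mean \<nu> n\<bar> \<le> 4 * \<bar>\<nu>\<bar> * (real k / real n)"
proof -
  have "\<bar>\<nu> * real k / real n - profile n k * area_mean \<nu> n\<bar> \<le> \<bar>\<nu> * (real k / real n)\<bar> + \<bar>profile n k * area_mean \<nu> n\<bar>"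
    using abs_triangle_ineq4[of "\<nu> * (real k / real n)" "profile n k * area_mean \<nu> n"] by simp
  also have "\<dots> \<le> \<bar>\<nu>\<bar> * (real k / real n) + (3 * (real k / real n)) * \<bar>\<nu>\<bar>"
    unfolding abs_mult using area_mean_abs[OF assms(2), of \<nu>] profile_upper[OF assms] profile_nonneg[OF assms]
    by (intro add_mono mult_mono) auto
  finally show ?thesis by simp
qed

section \<open>Elementary inequalities\<close>

lemma emeasure_diameter_le:
  fixes S :: "real set"
  assumes "\<And>s s'. s \<in> S \<Longrightarrow> s' \<in> S \<Longrightarrow> s < s' \<Longrightarrow> s' - s \<le> L" and "0 \<le> L"
  shows "emeasure lborel S \<le> ennreal L"
proof (cases "S = {}")
  case False
  then obtain s0 where s0: "s0 \<in> S" by auto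
  have b: "\<bar>s - s0\<bar> \<le> L" if "s \<in> S" for s
    using assms(1)[of s s0] assms(1)[of s0 s] s0 that assms(2) by (cases s s0 rule: linorder_cases) auto
  have bb: "bdd_below S" by (rule bdd_belowI[of _ "s0 - L"]) (use b in \<open>force simp: abs_le_iff\<close>)
  have ba: "bdd_above S" by (rule bdd_aboveI[of _ "s0 + L"]) (use b in \<open>force simp: abs_le_iff\<close>)
  have "Sup S \<le> Inf S + L"
  proof (rule cSup_least[OF False])
    fix s assume s: "s \<in> S"
    have "s - L \<le> Inf S"
    proof (rule cInf_greatest[OF False])
      fix s' assume "s' \<in> S"
      then show "s - L \<le> s'" using assms(1)[of s' s] s assms(2) by (cases "s' < s") auto
    qed
    then show "s \<le> Inf S + L" by simp
  qed
  then have d: "Sup S - Inf S \<le> L" by simp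
  have "Inf S \<le> Sup S" using bb ba s0 by (meson cInf_lower cSup_upper order_trans)
  have "emeasure lborel S \<le> emeasure lborel {Inf S..Sup S}"
    using cInf_lower[OF _ bb] cSup_upper[OF _ ba] by (intro emeasure_mono) auto
  also have "\<dots> = ennreal (Sup S - Inf S)" using \<open>Inf S \<le> Sup S\<close> by simp
  also have "\<dots> \<le> ennreal L" using d by (rule ennreal_leI)
  finally show ?thesis .
qed (use assms in simp)

text \<open>Arithmetic-geometric mean inequality. It serves to replace a product of three dependent
  factors by a sum whose expectation can be taken term by term.\<close>

lemma mult3_le_cubes:
  fixes a b c :: real
  assumes "0 \<le> a" "0 \<le> b" "0 \<le> c"
  shows "a * b * c \<le> (a^3 + b^3 + c^3) / 3"
proof -
  have "a^3 + b^3 + c^3 - 3 * (a * b * c) = (a + b + c) * ((a - b)\<^sup>2 + (b - c)\<^sup>2 + (c - a)\<^sup>2) / 2"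
    by (simp add: power2_eq_square power3_eq_cube algebra_simps)
  also have "\<dots> \<ge> 0" using assms by simp
  finally show ?thesis by simp
qed

lemma sum_exp_le:
  fixes u :: real
  assumes "0 < u"
  shows "(\<Sum>k=1..n. exp (- (real k * u))) \<le> 1 / u"
proof -
  have "(exp u - 1) * (\<Sum>k=1..n. exp (- (real k * u))) = 1 - exp (- (real n * u))"
  proof (induction n)
    case (Suc n)
    have e: "exp u * exp (- (real (Suc n) * u)) = exp (- (real n * u))"
      by (simp add: exp_add[symmetric] algebra_simps)
    have "(exp u - 1) * (\<Sum>k=1..Suc n. exp (- (real k * u)))
        = (exp u - 1) * (\<Sum>k=1..n. exp (- (real k * u))) + (exp u * exp (- (real (Suc n) * u)) - exp (- (real (Suc n) * u)))"
      by (simp add: algebra_simps del: of_nat_Suc)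
    then show ?case unfolding e Suc.IH by simp
  qed simp
  then have "(exp u - 1) * (\<Sum>k=1..n. exp (- (real k * u))) \<le> 1" by simp
  moreover have "u * (\<Sum>k=1..n. exp (- (real k * u))) \<le> (exp u - 1) * (\<Sum>k=1..n. exp (- (real k * u)))"
    by (intro mult_right_mono sum_nonneg) (use exp_ge_add_one_self[of u] in linarith, auto)
  ultimately show ?thesis using assms by (simp add: field_simps)
qed

section \<open>Conditioning on the residual path\<close>

definition negpart :: "real \<Rightarrow> real" where "negpart a = max 0 (- a)"

lemma abs_negpart: "\<bar>a\<bar> = a + 2 * negpart a" by (simp add: negpart_def)
lemma negpart_nonneg: "0 \<le> negpart a" by (simp add: negpart_def)
lemma negpart_mono: "a \<le> b \<Longrightarrow> negpart b \<le> negpart a" by (simp add: negpart_def)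
lemma measurable_negpart [measurable]: "negpart \<in> borel_measurable borel"
  unfolding negpart_def[abs_def] by measurable

definition abs_avg :: "nat \<Rightarrow> (nat \<Rightarrow> real) \<Rightarrow> real" where "abs_avg n V = avg n (\<lambda>k. \<bar>V k\<bar>)"

text \<open>Measures how far the slope of \<open>abs_avg\<close> along \<open>profile\<close> can
  fall below 1: it is at least 1 minus twice this quantity.\<close>

definition neg_profile :: "nat \<Rightarrow> (nat \<Rightarrow> real) \<Rightarrow> real" where
  "neg_profile n V = avg n (\<lambda>k. if V k < 0 then profile n k else 0)"

definition neg_avg :: "nat \<Rightarrow> (nat \<Rightarrow> real) \<Rightarrow> real" where
  "neg_avg n V = avg n (\<lambda>k. negpart (V k))"

text \<open>The constant 25000 has to satisfy two demands: 24 / 25000 must stay below 1 / 1024, so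
  that the exponential factor in \<open>excess\<close> is beaten at late times, and the bound must
  still hold for every path that is not atypical and has positive sign. The bound 1 / 8 keeps the
  slope of \<open>abs_avg\<close> at least 3 / 4.\<close>

definition mostly_pos :: "nat \<Rightarrow> real \<Rightarrow> (nat \<Rightarrow> real) \<Rightarrow> bool" where
  "mostly_pos n x V \<longleftrightarrow> neg_avg n V \<le> x / 25000 \<and> neg_profile n V \<le> 1 / 8"

lemma abs_avg_eq: "abs_avg n V = avg n V + 2 * neg_avg n V"
  unfolding abs_avg_def neg_avg_def abs_negpart avg_add avg_cmult ..

text \<open>For b at least 0, the value of |a + b| is |a| + b if a is at least 0, and at least |a| -
  b otherwise. Averaging this with b = t times the profile, whose average is 1, gives the
  claim.\<close>

lemma abs_avg_slope:
  assumes "0 \<le> t" "n > 0"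
  shows "abs_avg n V + t * (1 - 2 * neg_profile n V) \<le> abs_avg n (\<lambda>k. V k + t * profile n k)"
proof -
  have "abs_avg n V + t * (1 - 2 * neg_profile n V)
      = avg n (\<lambda>k. \<bar>V k\<bar> + (t * profile n k - (2 * t) * (if V k < 0 then profile n k else 0)))"
    unfolding avg_add avg_diff avg_cmult abs_avg_def neg_profile_def avg_profile[OF assms(2)] by (simp add: algebra_simps)
  also have "\<dots> \<le> abs_avg n (\<lambda>k. V k + t * profile n k)"
    unfolding abs_avg_def
  proof (rule avg_mono)
    fix k assume "1 \<le> k" "k \<le> n"
    then have "0 \<le> t * profile n k" using assms profile_nonneg by simp
    moreover have "\<bar>a\<bar> + (b - 2 * (if a < 0 then b else 0)) \<le> \<bar>a + b\<bar>" if "0 \<le> b" for a b :: real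
      using that by auto
    moreover have "(2 * t) * (if V k < 0 then profile n k else 0) = 2 * (if V k < 0 then t * profile n k else 0)"
      by simp
    ultimately show "\<bar>V k\<bar> + (t * profile n k - (2 * t) * (if V k < 0 then profile n k else 0)) \<le> \<bar>V k + t * profile n k\<bar>"
      by metis
  qed
  finally show ?thesis .
qed

lemma neg_profile_antimono:
  assumes "n > 0" "\<And>k. 1 \<le> k \<Longrightarrow> k \<le> n \<Longrightarrow> V k \<le> V' k" shows "neg_profile n V' \<le> neg_profile n V"
  unfolding neg_profile_def
proof (rule avg_mono)
  fix k assume "1 \<le> k" "k \<le> n"
  then show "(if V' k < 0 then profile n k else 0) \<le> (if V k < 0 then profile n k else 0)"
    using assms(2)[of k] profile_nonneg[of k n] assms(1) by auto
qed

lemma neg_avg_antimono: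
  assumes "\<And>k. 1 \<le> k \<Longrightarrow> k \<le> n \<Longrightarrow> V k \<le> V' k" shows "neg_avg n V' \<le> neg_avg n V"
  unfolding neg_avg_def using assms by (intro avg_mono negpart_mono) auto

lemma neg_profile_nonneg: "n > 0 \<Longrightarrow> 0 \<le> neg_profile n V"
  unfolding neg_profile_def by (intro avg_nonneg) (auto simp: profile_nonneg)

lemma neg_avg_nonneg: "0 \<le> neg_avg n V"
  unfolding neg_avg_def by (intro avg_nonneg negpart_nonneg)

lemma measurable_abs_avg [measurable]:
  "(\<And>k. (\<lambda>x. f x k) \<in> borel_measurable M) \<Longrightarrow> (\<lambda>x. abs_avg n (f x)) \<in> borel_measurable M"
  unfolding abs_avg_def by measurable

lemma measurable_neg_profile [measurable]:
  "(\<And>k. (\<lambda>x. f x k) \<in> borel_measurable M) \<Longrightarrow> (\<lambda>x. neg_profile n (f x)) \<in> borel_measurable M"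
  unfolding neg_profile_def by measurable

lemma measurable_neg_avg [measurable]:
  "(\<And>k. (\<lambda>x. f x k) \<in> borel_measurable M) \<Longrightarrow> (\<lambda>x. neg_avg n (f x)) \<in> borel_measurable M"
  unfolding neg_avg_def by measurable

lemma measurable_mostly_pos [measurable]:
  assumes [measurable]: "\<And>k. (\<lambda>x. f x k) \<in> borel_measurable M"
  shows "Measurable.pred M (\<lambda>x. mostly_pos n a (f x))"
  unfolding mostly_pos_def by measurable

text \<open>Bounds the factor by which the contribution of one residual path can exceed the Gaussian
  density at x. The first factor bounds the reciprocal of the slope, the second the growth of the
  Gaussian density when its argument falls below x by at most twice the average negative part. Both
  minima are what \<open>mostly_pos\<close> guarantees.\<close>

definition excess :: "nat \<Rightarrow> real \<Rightarrow> (nat \<Rightarrow> real) \<Rightarrow> real" where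
  "excess n x V = (1 + 4 * min (neg_profile n V) (1 / 8)) * exp (4 * x * min (2 * neg_avg n V) (2 * x / 25000))"

text \<open>The path V moved along the profile until its average is z; it depends only on the
  residual of V.\<close>

abbreviation resid :: "nat \<Rightarrow> real \<Rightarrow> (nat \<Rightarrow> real) \<Rightarrow> nat \<Rightarrow> real" where
  "resid n z V \<equiv> \<lambda>k. V k + (z - avg n V) * profile n k"

lemma avg_resid: "n > 0 \<Longrightarrow> avg n (\<lambda>k. V k + c * profile n k) = avg n V + c"
  unfolding avg_add avg_cmult by (simp add: avg_profile)

text \<open>For z below x the difference of squares is (x - z) (x + z - 2 m), where x + z - 2 m is
  at most 8 x / 3 because |m| is at most x / 3. Division by 2 v, which is at least 2 / 3, yields 4 x
  times \<open>\<delta>\<close>.\<close>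

lemma normal_density_shift_le:
  assumes "\<bar>m\<bar> \<le> \<nu>" "1 / 3 \<le> v" "3 * \<nu> \<le> x" "x / 2 \<le> z" "x - \<delta> \<le> z" "0 \<le> \<delta>"
  shows "normal_density m (sqrt v) z \<le> normal_density m (sqrt v) x * exp (4 * x * \<delta>)"
proof -
  have x0: "0 \<le> x" and s: "0 \<le> x + z - 2 * m" using assms by linarith+
  have "(x - m)\<^sup>2 - (z - m)\<^sup>2 = (x - z) * (x + z - 2 * m)"
    by (simp add: power2_eq_square algebra_simps)
  also have "\<dots> \<le> \<delta> * (8 / 3 * x)"
  proof (cases "z \<le> x")
    case True
    have "x + z - 2 * m \<le> 8 / 3 * x" using True assms by linarith
    then show ?thesis using True assms s by (intro mult_mono) auto
  next
    case False
    then have "(x - z) * (x + z - 2 * m) \<le> 0" using s by (intro mult_nonpos_nonneg) auto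
    also have "0 \<le> \<delta> * (8 / 3 * x)" using assms x0 by simp
    finally show ?thesis .
  qed
  finally have d: "(x - m)\<^sup>2 - (z - m)\<^sup>2 \<le> \<delta> * (8 / 3 * x)" .
  have "((x - m)\<^sup>2 - (z - m)\<^sup>2) / (2 * v) \<le> (\<delta> * (8 / 3 * x)) / (2 * v)"
    using d assms by (intro divide_right_mono) auto
  also have "\<dots> \<le> (\<delta> * (8 / 3 * x)) / (2 / 3)"
    using assms x0 by (intro divide_left_mono) auto
  finally have "- (z - m)\<^sup>2 / (2 * v) \<le> - (x - m)\<^sup>2 / (2 * v) + 4 * x * \<delta>"
    unfolding diff_divide_distrib by (simp add: mult.commute mult.left_commute)
  then have "exp (- (z - m)\<^sup>2 / (2 * v)) \<le> exp (- (x - m)\<^sup>2 / (2 * v) + 4 * x * \<delta>)"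
    by (simp only: exp_le_cancel_iff)
  then have "1 / sqrt (2 * pi * v) * exp (- (z - m)\<^sup>2 / (2 * v))
     \<le> 1 / sqrt (2 * pi * v) * (exp (- (x - m)\<^sup>2 / (2 * v)) * exp (4 * x * \<delta>))"
    unfolding exp_add by (rule mult_left_mono) (use assms in simp)
  then show ?thesis using assms by (simp add: normal_density_def)
qed

text \<open>The residual is fixed and c varies. Every admissible c makes the average at least x / 2,
  hence the path at least \<open>resid n (x/2) V\<close>. The negative part of this one path
  controls, for all admissible c at once, the slope of \<open>abs_avg\<close> and the distance by
  which the average stays below x. The slope bounds the length of the set of admissible c, the
  distance bounds the Gaussian density on it.\<close>

lemma good_slice:
  assumes n: "n \<ge> 10" and x: "x > 0" "3 * \<bar>\<nu>\<bar> \<le> x" and xy: "x < y"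
  shows "(\<integral>\<^sup>+c. indicator {V. mostly_pos n x V \<and> x < abs_avg n V \<and> abs_avg n V < y} (\<lambda>k. V k + c * profile n k)
      * ennreal (normal_density (area_mean \<nu> n) (sqrt (area_var n)) (avg n V + c)) \<partial>lborel)
    \<le> ennreal ((y - x) * normal_density (area_mean \<nu> n) (sqrt (area_var n)) x * excess n x (resid n (x/2) V))"
proof -
  have n0: "n > 0" using n by simp
  define S where "S = {c. mostly_pos n x (\<lambda>k. V k + c * profile n k) \<and> x < abs_avg n (\<lambda>k. V k + c * profile n k) \<and> abs_avg n (\<lambda>k. V k + c * profile n k) < y}"
  have [measurable]: "S \<in> sets borel" unfolding S_def by measurable
  define k0 where "k0 = min (neg_profile n (resid n (x/2) V)) (1/8)"
  define \<delta> where "\<delta> = min (2 * neg_avg n (resid n (x/2) V)) (2 * x / 25000)"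
  have k0: "0 \<le> k0" "k0 \<le> 1/8" unfolding k0_def using neg_profile_nonneg[OF n0] by auto
  have \<delta>0: "0 \<le> \<delta>" unfolding \<delta>_def using x neg_avg_nonneg by auto
  have Sz: "x / 2 \<le> avg n V + c" "x - \<delta> \<le> avg n V + c" "neg_profile n (\<lambda>k. V k + c * profile n k) \<le> k0" if "c \<in> S" for c
  proof -
    have a: "avg n (\<lambda>k. V k + c * profile n k) = avg n V + c" by (rule avg_resid[OF n0])
    have g: "neg_avg n (\<lambda>k. V k + c * profile n k) \<le> x / 25000" "neg_profile n (\<lambda>k. V k + c * profile n k) \<le> 1/8"
      "x < avg n V + c + 2 * neg_avg n (\<lambda>k. V k + c * profile n k)"
      using that a unfolding S_def mostly_pos_def abs_avg_eq by auto
    show h: "x / 2 \<le> avg n V + c" using g x by linarith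
    have le: "resid n (x/2) V k \<le> V k + c * profile n k" if "k \<le> n" for k
      using h profile_nonneg[OF that n0] by (intro add_left_mono mult_right_mono) auto
    have "neg_avg n (\<lambda>k. V k + c * profile n k) \<le> neg_avg n (resid n (x/2) V)" by (intro neg_avg_antimono le)
    then show "x - \<delta> \<le> avg n V + c" unfolding \<delta>_def using g by auto
    have "neg_profile n (\<lambda>k. V k + c * profile n k) \<le> neg_profile n (resid n (x/2) V)" by (intro neg_profile_antimono n0 le)
    then show "neg_profile n (\<lambda>k. V k + c * profile n k) \<le> k0" using g unfolding k0_def by auto
  qed
  have "emeasure lborel S \<le> ennreal ((y - x) * (1 + 4 * k0))"
  proof (rule emeasure_diameter_le)
    fix c c' assume c: "c \<in> S" "c' \<in> S" "c < c'"
    have "abs_avg n (\<lambda>k. V k + c * profile n k) + (c' - c) * (1 - 2 * neg_profile n (\<lambda>k. V k + c * profile n k))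
      \<le> abs_avg n (\<lambda>k. (V k + c * profile n k) + (c' - c) * profile n k)"
      using c by (intro abs_avg_slope n0) auto
    also have "(\<lambda>k. (V k + c * profile n k) + (c' - c) * profile n k) = (\<lambda>k. V k + c' * profile n k)"
      by (simp add: algebra_simps)
    finally have "(c' - c) * (1 - 2 * neg_profile n (\<lambda>k. V k + c * profile n k)) \<le> y - x"
      using c unfolding S_def by auto
    moreover have "(c' - c) * (1 - 2 * k0) \<le> (c' - c) * (1 - 2 * neg_profile n (\<lambda>k. V k + c * profile n k))"
      using c Sz(3)[OF c(1)] by (intro mult_left_mono) auto
    ultimately have "(c' - c) * (1 - 2 * k0) \<le> y - x" by linarith
    then have "(c' - c) * (1 - 2 * k0) * (1 + 4 * k0) \<le> (y - x) * (1 + 4 * k0)"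
      using k0 by (intro mult_right_mono) auto
    moreover have "(c' - c) * 1 \<le> (c' - c) * ((1 - 2 * k0) * (1 + 4 * k0))"
    proof (rule mult_left_mono)
      have "k0 * k0 \<le> (1/8) * k0" using k0 by (intro mult_right_mono) auto
      then show "1 \<le> (1 - 2 * k0) * (1 + 4 * k0)" using k0 by (simp add: algebra_simps)
    qed (use c in simp)
    ultimately show "c' - c \<le> (y - x) * (1 + 4 * k0)" by (simp add: mult.assoc)
  qed (use xy k0 in auto)
  then have "ennreal (normal_density (area_mean \<nu> n) (sqrt (area_var n)) x * exp (4 * x * \<delta>)) * emeasure lborel S
     \<le> ennreal (normal_density (area_mean \<nu> n) (sqrt (area_var n)) x * exp (4 * x * \<delta>)) * ennreal ((y - x) * (1 + 4 * k0))"
    by (intro mult_left_mono) auto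
  also have "\<dots> = ennreal ((y - x) * normal_density (area_mean \<nu> n) (sqrt (area_var n)) x * ((1 + 4 * k0) * exp (4 * x * \<delta>)))"
    using xy k0 by (simp add: ennreal_mult'[symmetric] ac_simps)
  also have "(1 + 4 * k0) * exp (4 * x * \<delta>) = excess n x (resid n (x/2) V)"
    by (simp only: excess_def k0_def \<delta>_def)
  finally have fin: "ennreal (normal_density (area_mean \<nu> n) (sqrt (area_var n)) x * exp (4 * x * \<delta>)) * emeasure lborel S
    \<le> ennreal ((y - x) * normal_density (area_mean \<nu> n) (sqrt (area_var n)) x * excess n x (resid n (x/2) V))" .
  have "(\<integral>\<^sup>+c. indicator {V. mostly_pos n x V \<and> x < abs_avg n V \<and> abs_avg n V < y} (\<lambda>k. V k + c * profile n k)
      * ennreal (normal_density (area_mean \<nu> n) (sqrt (area_var n)) (avg n V + c)) \<partial>lborel)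
     \<le> (\<integral>\<^sup>+c. ennreal (normal_density (area_mean \<nu> n) (sqrt (area_var n)) x * exp (4 * x * \<delta>)) * indicator S c \<partial>lborel)"
  proof (rule nn_integral_mono)
    fix c
    show "indicator {V. mostly_pos n x V \<and> x < abs_avg n V \<and> abs_avg n V < y} (\<lambda>k. V k + c * profile n k)
      * ennreal (normal_density (area_mean \<nu> n) (sqrt (area_var n)) (avg n V + c))
      \<le> ennreal (normal_density (area_mean \<nu> n) (sqrt (area_var n)) x * exp (4 * x * \<delta>)) * indicator S c"
    proof (cases "c \<in> S")
      case True
      have "normal_density (area_mean \<nu> n) (sqrt (area_var n)) (avg n V + c) \<le> normal_density (area_mean \<nu> n) (sqrt (area_var n)) x * exp (4 * x * \<delta>)"
        by (rule normal_density_shift_le[OF area_mean_abs[OF n0] area_var_ge[OF n0] x(2) Sz(1,2)[OF True] \<delta>0])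
      then show ?thesis using True by (simp add: S_def indicator_def ennreal_leI)
    next
      case False
      then have "indicator {V. mostly_pos n x V \<and> x < abs_avg n V \<and> abs_avg n V < y} (\<lambda>k. V k + c * profile n k) = (0::ennreal)"
        unfolding S_def by (simp add: indicator_def)
      then show ?thesis by simp
    qed
  qed
  also have "\<dots> = ennreal (normal_density (area_mean \<nu> n) (sqrt (area_var n)) x * exp (4 * x * \<delta>)) * emeasure lborel S"
    by (rule nn_integral_cmult_indicator) simp
  finally show ?thesis using fin by (rule order_trans)
qed

text \<open>As a function G of the average, \<open>abs_avg\<close> lies above the average and
  increases at most at speed 1. Right after the last point up to x at which G is at most x, it
  therefore stays in the interval from x to y over a length of at least y - x. All these averages
  are at most y and to the right of the mean, where the Gaussian density is at least its value at
  y.\<close>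

lemma low_slice:
  assumes n: "n > 0" and xy: "x < y" and V: "avg n (\<lambda>k. \<bar>resid n 0 V k\<bar>) < x - \<bar>\<nu>\<bar>"
  shows "ennreal ((y - x) * normal_density (area_mean \<nu> n) (sqrt (area_var n)) y) \<le>
    (\<integral>\<^sup>+c. indicator {V. 0 < avg n V \<and> x \<le> abs_avg n V \<and> abs_avg n V \<le> y} (\<lambda>k. V k + c * profile n k)
      * ennreal (normal_density (area_mean \<nu> n) (sqrt (area_var n)) (avg n V + c)) \<partial>lborel)"
proof -
  let ?f = "normal_density (area_mean \<nu> n) (sqrt (area_var n))"
  define G where "G z = abs_avg n (resid n z V)" for z
  have lip: "G z' \<le> G z + (z' - z)" if "z \<le> z'" for z z'
  proof -
    have "G z' \<le> avg n (\<lambda>k. \<bar>resid n z V k\<bar> + (z' - z) * profile n k)"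
      unfolding G_def abs_avg_def
    proof (rule avg_mono)
      fix k assume "1 \<le> k" "k \<le> n"
      then have "0 \<le> (z' - z) * profile n k" using profile_nonneg n that by simp
      then show "\<bar>resid n z' V k\<bar> \<le> \<bar>resid n z V k\<bar> + (z' - z) * profile n k"
      proof -
        have "resid n z' V k = resid n z V k + (z' - z) * profile n k" by (simp add: algebra_simps)
        then show ?thesis using \<open>0 \<le> (z' - z) * profile n k\<close> by linarith
      qed
    qed
    then show ?thesis unfolding avg_add avg_cmult avg_profile[OF n] by (simp add: G_def abs_avg_def)
  qed
  have Gge: "z \<le> G z" for z
    unfolding G_def abs_avg_eq avg_resid[OF n] using neg_avg_nonneg[of n "resid n z V"] by simp
  have contG: "continuous_on UNIV G"
    unfolding G_def abs_avg_def avg_def by (intro continuous_intros) (use n in simp)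
  have G0: "G \<bar>\<nu>\<bar> \<le> x" using lip[of 0 "\<bar>\<nu>\<bar>"] V by (simp add: G_def abs_avg_def)
  \<comment> \<open>The left end \<open>\<bar>\<nu>\<bar>\<close> keeps the averages positive and to
    the right of the Gaussian mean.\<close>
  define A where "A = {z\<in>{\<bar>\<nu>\<bar>..x}. G z \<le> x}"
  have "closed A" unfolding A_def
    by (intro continuous_on_closed_Collect_le continuous_on_subset[OF contG] continuous_on_const) auto
  have A: "\<bar>\<nu>\<bar> \<in> A" using G0 Gge[of "\<bar>\<nu>\<bar>"] by (auto simp: A_def)
  have bA: "bdd_above A" by (auto simp: A_def)
  define z1 where "z1 = Sup A"
  have z1: "z1 \<in> A" unfolding z1_def using \<open>closed A\<close> A bA by (intro closed_contains_Sup) auto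
  have mx: "z \<le> z1" if "z \<in> A" for z unfolding z1_def using that bA by (intro cSup_upper)
  have in_set: "0 < z \<and> x \<le> G z \<and> G z \<le> y \<and> ?f y \<le> ?f z" if z: "z1 < z" "z \<le> z1 + (y - x)" for z
  proof -
    have z1': "\<bar>\<nu>\<bar> \<le> z1" "z1 \<le> x" "G z1 \<le> x" using z1 by (auto simp: A_def)
    have "x \<le> G z"
    proof (cases "z \<le> x")
      case True
      have "z \<notin> A" using mx[of z] z by auto
      then show ?thesis using True z z1' by (auto simp: A_def)
    next
      case False then show ?thesis using Gge[of z] by linarith
    qed
    moreover have "G z \<le> y" using lip[of z1 z] z z1' by linarith
    moreover have "?f y \<le> ?f z"
    proof -
      have m: "area_mean \<nu> n \<le> z" using area_mean_abs[OF n, of \<nu>] z z1' by linarith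
      have "(z - area_mean \<nu> n)\<^sup>2 \<le> (y - area_mean \<nu> n)\<^sup>2" using m z z1' by (intro power_mono) auto
      then have "exp (- (y - area_mean \<nu> n)\<^sup>2 / (2 * area_var n)) \<le> exp (- (z - area_mean \<nu> n)\<^sup>2 / (2 * area_var n))"
        using area_var_pos[OF n] by (simp add: divide_right_mono)
      then show ?thesis using area_var_pos[OF n] by (simp add: normal_density_def divide_right_mono)
    qed
    ultimately show ?thesis using z z1' by auto
  qed
  let ?I = "{z1 - avg n V<..z1 - avg n V + (y - x)}"
  have "ennreal ((y - x) * ?f y) = ennreal (?f y) * emeasure lborel ?I"
    using xy by (simp add: ennreal_mult' mult.commute)
  also have "\<dots> = (\<integral>\<^sup>+c. ennreal (?f y) * indicator ?I c \<partial>lborel)"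
    by (rule nn_integral_cmult_indicator[symmetric]) simp
  also have "\<dots> \<le> (\<integral>\<^sup>+c. indicator {V. 0 < avg n V \<and> x \<le> abs_avg n V \<and> abs_avg n V \<le> y} (\<lambda>k. V k + c * profile n k)
      * ennreal (?f (avg n V + c)) \<partial>lborel)"
  proof (rule nn_integral_mono)
    fix c
    show "ennreal (?f y) * indicator ?I c \<le> indicator {V. 0 < avg n V \<and> x \<le> abs_avg n V \<and> abs_avg n V \<le> y} (\<lambda>k. V k + c * profile n k)
      * ennreal (?f (avg n V + c))"
    proof (cases "c \<in> ?I")
      case True
      then have "0 < avg n V + c \<and> x \<le> G (avg n V + c) \<and> G (avg n V + c) \<le> y \<and> ?f y \<le> ?f (avg n V + c)"
        by (intro in_set) auto
      then show ?thesis using True by (simp add: G_def avg_resid[OF n] ennreal_leI)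
    qed simp
  qed
  finally show ?thesis .
qed

lemma exp_mean_sum_le:
  fixes a :: "nat \<Rightarrow> real"
  assumes "0 < K"
  shows "exp ((\<Sum>k=1..K. a k) / real K) \<le> (\<Sum>k=1..K. exp (a k)) / real K"
proof -
  have "convex_on UNIV (exp :: real \<Rightarrow> real)"
    by (rule f''_ge0_imp_convex[where f'=exp and f''=exp]) (auto intro!: derivative_eq_intros)
  then have "exp (\<Sum>k\<in>{1..K}. (1 / real K) *\<^sub>R a k) \<le> (\<Sum>k\<in>{1..K}. (1 / real K) * exp (a k))"
    using assms by (intro convex_on_sum) auto
  then show ?thesis by (simp add: sum_divide_distrib)
qed

lemma negpart_exp_le: assumes "0 < \<theta>" shows "negpart a \<le> exp (- (\<theta> * a)) / \<theta>"
proof -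
  have "\<theta> * negpart a \<le> exp (- (\<theta> * a))"
    using exp_ge_add_one_self[of "- (\<theta> * a)"] exp_gt_zero[of "- (\<theta> * a)"]
    by (auto simp: negpart_def max_def)
  then show ?thesis using assms by (simp add: field_simps)
qed

lemma exp_negpart_le: assumes "0 \<le> \<theta>" shows "exp (\<theta> * negpart a) \<le> 1 + exp (- (\<theta> * a))"
  by (auto simp: negpart_def max_def)

text \<open>Linear in a at the price of the factor exp b: suited to a random a of small expectation
  under a deterministic cap b.\<close>

lemma exp_min_le:
  assumes "0 \<le> a" "0 \<le> b"
  shows "exp (min a b) \<le> 1 + a * exp (b::real)"
proof -
  have "exp (min a b) - 1 \<le> min a b * exp (min a b)"
    using exp_ge_add_one_self[of "- min a b"] mult_right_mono[of "1 - min a b" "exp (- min a b)" "exp (min a b)"]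
    by (simp add: exp_minus field_simps)
  also have "\<dots> \<le> a * exp b" using assms by (intro mult_mono) auto
  finally show ?thesis by simp
qed

text \<open>The times up to K = n / 64 and the later ones need different arguments. Jensen's
  inequality over all times would produce the exponent 24 x, but the exponential moments of the
  residual path are known to decay only for exponents below x; since the early times are a fraction
  1 / 64 of all, the exponent there becomes 24 x / 64 = 3 x / 8. At late times negative values are
  so improbable that the crude factor exp(24 x^2 / 25000) is affordable.\<close>

lemma excess_le:
  assumes n: "n = 64 * K" and K: "K > 0" and x: "x > 0"
  shows "excess n x V \<le> 1 + (20 / 3) * avg n (\<lambda>k. profile n k * exp (- (x / 2 * V k)))
    + (\<Sum>k=1..K. exp (- (3 * x / 8 * V k))) / (3 * real K)
    + 16 * exp (24 * x\<^sup>2 / 25000) * (\<Sum>k=Suc K..n. exp (- (x / 2 * V k))) / real n"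
proof -
  have n0: "n > 0" using n K by simp
  define k0 where "k0 = min (neg_profile n V) (1/8)"
  define D1 where "D1 = 2 * (\<Sum>k=1..K. negpart (V k)) / real n"
  define D2 where "D2 = 2 * (\<Sum>k=Suc K..n. negpart (V k)) / real n"
  have D: "2 * neg_avg n V = D1 + D2"
  proof -
    have "(\<Sum>k=1..n. negpart (V k)) = (\<Sum>k=1..K. negpart (V k)) + (\<Sum>k=Suc K..n. negpart (V k))"
    proof -
      have "{1..n} = {1..K} \<union> {Suc K..n}" using n by auto
      then show ?thesis by (simp add: sum.union_disjoint)
    qed
    then show ?thesis by (simp add: neg_avg_def avg_def D1_def D2_def add_divide_distrib)
  qed
  have D0: "0 \<le> D1" "0 \<le> D2" unfolding D1_def D2_def by (auto intro!: divide_nonneg_nonneg sum_nonneg negpart_nonneg)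
  have k0: "0 \<le> k0" "k0 \<le> 1 / 8" "k0 \<le> neg_profile n V" unfolding k0_def using neg_profile_nonneg[OF n0] by auto
  have "excess n x V = (1 + 4 * k0) * exp (4 * x * min (D1 + D2) (2 * x / 25000))"
    by (simp add: excess_def k0_def D)
  also have "\<dots> \<le> (1 + 4 * k0) * exp (4 * x * (D1 + min D2 (2 * x / 25000)))"
    using k0 D0 x by (intro mult_left_mono) auto
  also have "\<dots> = (1 + 4 * k0) * exp (4 * x * D1) * exp (4 * x * min D2 (2 * x / 25000))"
    by (simp add: distrib_left exp_add)
  \<comment> \<open>The cubes turn the rate 4 x in the exponents into 12 x.\<close>
  also have "\<dots> \<le> ((1 + 4 * k0)^3 + exp (4 * x * D1)^3 + exp (4 * x * min D2 (2 * x / 25000))^3) / 3"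
    using k0 by (intro mult3_le_cubes) auto
  finally have *: "excess n x V \<le> \<dots>" .
  have A: "(1 + 4 * k0)^3 \<le> 1 + 20 * avg n (\<lambda>k. profile n k * exp (- (x / 2 * V k)))"
  proof -
    have "k0 * k0 \<le> (1/8) * k0" using k0 by (intro mult_right_mono) auto
    moreover have "k0 * (k0 * k0) \<le> (1/8) * (k0 * k0)" using k0 by (intro mult_right_mono) auto
    ultimately have "(1 + 4 * k0)^3 \<le> 1 + 20 * k0"
      using k0 by (simp add: power3_eq_cube algebra_simps)
    also have "k0 \<le> avg n (\<lambda>k. profile n k * exp (- (x / 2 * V k)))"
    proof -
      have "neg_profile n V \<le> avg n (\<lambda>k. profile n k * exp (- (x / 2 * V k)))"
        unfolding neg_profile_def
      proof (rule avg_mono)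
        fix k assume "1 \<le> k" "k \<le> n"
        then have h: "0 \<le> profile n k" using profile_nonneg n0 by simp
        show "(if V k < 0 then profile n k else 0) \<le> profile n k * exp (- (x / 2 * V k))"
        proof (cases "V k < 0")
          case True
          then have "x / 2 * V k < 0" using x by (simp add: mult_pos_neg)
          then show ?thesis using True h mult_left_mono[of 1 "exp (- (x / 2 * V k))" "profile n k"] by simp
        qed (use h in simp)
      qed
      then show ?thesis using k0 by linarith
    qed
    finally show ?thesis by simp
  qed
  have B: "exp (4 * x * D1)^3 \<le> 1 + (\<Sum>k=1..K. exp (- (3 * x / 8 * V k))) / real K"
  proof -
    have "exp (4 * x * D1)^3 = exp (12 * x * D1)" by (simp add: exp_of_nat_mult[symmetric])
    also have "12 * x * D1 = (\<Sum>k=1..K. 3 * x / 8 * negpart (V k)) / real K"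
      unfolding D1_def n sum_distrib_left[symmetric] using K by (simp add: field_simps)
    also have "exp \<dots> \<le> (\<Sum>k=1..K. exp (3 * x / 8 * negpart (V k))) / real K"
      by (rule exp_mean_sum_le[OF K])
    also have "\<dots> \<le> (\<Sum>k=1..K. 1 + exp (- (3 * x / 8 * V k))) / real K"
      using x by (intro divide_right_mono sum_mono exp_negpart_le) auto
    also have "\<dots> = 1 + (\<Sum>k=1..K. exp (- (3 * x / 8 * V k))) / real K"
      using K by (simp add: sum.distrib add_divide_distrib)
    finally show ?thesis .
  qed
  have C: "exp (4 * x * min D2 (2 * x / 25000))^3 \<le> 1 + 48 * exp (24 * x\<^sup>2 / 25000) * (\<Sum>k=Suc K..n. exp (- (x / 2 * V k))) / real n"
  proof -
    have "exp (4 * x * min D2 (2 * x / 25000))^3 = exp (12 * x * min D2 (2 * x / 25000))"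
      by (simp add: exp_of_nat_mult[symmetric])
    also have "12 * x * min D2 (2 * x / 25000) = min (12 * x * D2) (24 * x\<^sup>2 / 25000)"
      using x by (simp add: min_mult_distrib_left power2_eq_square)
    also have "exp \<dots> \<le> 1 + (12 * x * D2) * exp (24 * x\<^sup>2 / 25000)"
      using x D0 by (intro exp_min_le) auto
    also have "12 * x * D2 \<le> 12 * x * (2 * (\<Sum>k=Suc K..n. exp (- (x / 2 * V k)) / (x / 2)) / real n)"
      unfolding D2_def using x
      by (intro mult_left_mono divide_right_mono sum_mono negpart_exp_le) auto
    also have "\<dots> = 48 * (\<Sum>k=Suc K..n. exp (- (x / 2 * V k))) / real n"
      unfolding sum_divide_distrib[symmetric] using x by (simp add: field_simps)
    finally show ?thesis by (simp add: mult_right_mono ac_simps)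
  qed
  show ?thesis using * A B C by (simp add: field_simps)
qed

text \<open>The value at k of the path moved to average x / 2 is Gaussian, with mean at least (5 x /
  8 - 4 |\<open>\<nu>\<close>|) k / n and variance at most k / n.\<close>

lemma resid_exp:
  assumes kn: "k \<le> n" and n: "n \<ge> 10" and x: "0 \<le> x" and \<theta>: "0 \<le> \<theta>"
  shows "(\<integral>\<^sup>+\<xi>. ennreal (exp (- (\<theta> * resid n (x / 2) (drift_walk \<nu> n \<xi>) k))) \<partial>gauss n)
    \<le> ennreal (exp (real k / real n * \<theta> * (4 * \<bar>\<nu>\<bar> + \<theta> / 2 - 5 / 8 * x)))"
proof -
  have n0: "n > 0" using n by simp
  define m where "m = \<nu> * real k / real n - profile n k * area_mean \<nu> n + x / 2 * profile n k"
  have y: "resid n (x / 2) (drift_walk \<nu> n \<xi>) k = m + lin n (resid_coeff n k) \<xi>" for \<xi>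
    using resid_eq[OF kn n0, of \<nu> \<xi>] by (simp add: m_def algebra_simps)
  have l: "lin n (\<lambda>i. - \<theta> * resid_coeff n k i) \<xi> = - \<theta> * lin n (resid_coeff n k) \<xi>" for \<xi>
    unfolding lin_def sum_distrib_left by (simp add: mult.assoc)
  have "(\<integral>\<^sup>+\<xi>. ennreal (exp (- (\<theta> * resid n (x / 2) (drift_walk \<nu> n \<xi>) k))) \<partial>gauss n)
     = (\<integral>\<^sup>+\<xi>. ennreal (exp (- \<theta> * m)) * ennreal (exp (lin n (\<lambda>i. - \<theta> * resid_coeff n k i) \<xi>)) \<partial>gauss n)"
    unfolding y l by (intro nn_integral_cong) (simp add: ennreal_mult'[symmetric] exp_add[symmetric] algebra_simps)
  also have "\<dots> = ennreal (exp (- \<theta> * m)) * ennreal (exp ((\<Sum>i<n. (- \<theta> * resid_coeff n k i)\<^sup>2) / 2))"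
    by (subst nn_integral_cmult) (auto simp: gauss_mgf)
  also have "(\<Sum>i<n. (- \<theta> * resid_coeff n k i)\<^sup>2) = \<theta>\<^sup>2 * (\<Sum>i<n. (resid_coeff n k i)\<^sup>2)"
    by (simp add: power_mult_distrib sum_distrib_left)
  also have "ennreal (exp (- \<theta> * m)) * ennreal (exp (\<theta>\<^sup>2 * (\<Sum>i<n. (resid_coeff n k i)\<^sup>2) / 2))
      = ennreal (exp (- \<theta> * m + \<theta>\<^sup>2 * (\<Sum>i<n. (resid_coeff n k i)\<^sup>2) / 2))"
    by (simp add: ennreal_mult'[symmetric] exp_add[symmetric])
  also have "\<dots> \<le> ennreal (exp (real k / real n * \<theta> * (4 * \<bar>\<nu>\<bar> + \<theta> / 2 - 5 / 8 * x)))"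
  proof -
    have "5 / 8 * x * (real k / real n) - 4 * \<bar>\<nu>\<bar> * (real k / real n) \<le> m"
    proof -
      have "x / 2 * (5 / 4 * (real k / real n)) \<le> x / 2 * profile n k"
        using x profile_lower[OF kn n] by (intro mult_left_mono) auto
      then show ?thesis using resid_mean_abs[OF kn n0, of \<nu>] unfolding m_def by linarith
    qed
    then have "\<theta> * (5 / 8 * x * (real k / real n) - 4 * \<bar>\<nu>\<bar> * (real k / real n)) \<le> \<theta> * m"
      using \<theta> by (rule mult_left_mono)
    moreover have "\<theta>\<^sup>2 * (\<Sum>i<n. (resid_coeff n k i)\<^sup>2) / 2 \<le> \<theta>\<^sup>2 * (real k / real n) / 2"
      using resid_coeff_sq_le[OF kn n0] by (intro divide_right_mono mult_left_mono) auto
    ultimately have "- \<theta> * m + \<theta>\<^sup>2 * (\<Sum>i<n. (resid_coeff n k i)\<^sup>2) / 2 \<le> real k / real n * \<theta> * (4 * \<bar>\<nu>\<bar> + \<theta> / 2 - 5 / 8 * x)"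
      by (simp add: power2_eq_square algebra_simps)
    then show ?thesis by (simp add: ennreal_leI)
  qed
  finally show ?thesis .
qed

text \<open>The drift is absorbed by \<open>32 * \<bar>\<nu>\<bar> \<le> x\<close>: what remains of
  the mean is 5 / 8 - 4 / 32 = 1 / 2. Decay requires c < 1.\<close>

lemma resid_exp':
  assumes kn: "k \<le> n" and n: "n \<ge> 10" and x: "x > 0" "32 * \<bar>\<nu>\<bar> \<le> x"
    and \<theta>: "\<theta> = c * x" "0 \<le> c" "d \<le> c * (1 / 2 - c / 2)"
  shows "(\<integral>\<^sup>+\<xi>. ennreal (exp (- (\<theta> * resid n (x / 2) (drift_walk \<nu> n \<xi>) k))) \<partial>gauss n)
    \<le> ennreal (exp (- (real k * (d * x\<^sup>2 / real n))))"
proof -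
  have "4 * \<bar>\<nu>\<bar> + \<theta> / 2 - 5 / 8 * x \<le> - x * (1 / 2 - c / 2)"
    using x unfolding \<theta>(1) by (simp add: field_simps)
  then have "real k / real n * \<theta> * (4 * \<bar>\<nu>\<bar> + \<theta> / 2 - 5 / 8 * x) \<le> real k / real n * \<theta> * (- x * (1 / 2 - c / 2))"
    using x \<theta> by (intro mult_left_mono) auto
  also have "\<dots> = - (real k / real n * x\<^sup>2 * (c * (1 / 2 - c / 2)))"
    by (simp add: \<theta>(1) power2_eq_square)
  also have "\<dots> \<le> - (real k / real n * x\<^sup>2 * d)"
    unfolding neg_le_iff_le by (intro mult_left_mono \<theta>(3)) auto
  also have "\<dots> = - (real k * (d * x\<^sup>2 / real n))" by simp
  finally have "exp (real k / real n * \<theta> * (4 * \<bar>\<nu>\<bar> + \<theta> / 2 - 5 / 8 * x)) \<le> exp (- (real k * (d * x\<^sup>2 / real n)))"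
    by simp
  then show ?thesis
    using resid_exp[OF kn n, of x \<theta> \<nu>] x \<theta> by (meson ennreal_leI mult_nonneg_nonneg order_less_imp_le order_trans)
qed

lemma nn_integral_sum_le:
  fixes f :: "'i \<Rightarrow> 'a \<Rightarrow> real"
  assumes [measurable]: "\<And>k. k \<in> A \<Longrightarrow> f k \<in> borel_measurable M" and nn: "\<And>k x. k \<in> A \<Longrightarrow> 0 \<le> f k x" "\<And>k. k \<in> A \<Longrightarrow> 0 \<le> c k"
    and le: "\<And>k. k \<in> A \<Longrightarrow> (\<integral>\<^sup>+x. ennreal (f k x) \<partial>M) \<le> ennreal (c k)"
  shows "(\<integral>\<^sup>+x. ennreal (\<Sum>k\<in>A. f k x) \<partial>M) \<le> ennreal (\<Sum>k\<in>A. c k)"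
proof -
  have "(\<integral>\<^sup>+x. ennreal (\<Sum>k\<in>A. f k x) \<partial>M) = (\<integral>\<^sup>+x. (\<Sum>k\<in>A. ennreal (f k x)) \<partial>M)"
    using nn by (simp add: sum_ennreal)
  also have "\<dots> = (\<Sum>k\<in>A. \<integral>\<^sup>+x. ennreal (f k x) \<partial>M)"
    by (rule nn_integral_sum) measurable
  also have "\<dots> \<le> (\<Sum>k\<in>A. ennreal (c k))" by (intro sum_mono le)
  also have "\<dots> = ennreal (\<Sum>k\<in>A. c k)" using nn by (simp add: sum_ennreal)
  finally show ?thesis .
qed

text \<open>The early terms form geometric sums over k with ratio exp(- const x^2 / n); divided by n
  they are of order 1 / x^2, so only times of order n / x^2 matter. A late term is at most exp(24
  x^2 / 25000 - x^2 / 512), which is below exp(- x^2 / 1024) and hence below 1024 / x^2. The three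
  contributions 160, 342 and 16384 are rounded up to 20000.\<close>

lemma excess_expectation:
  assumes n: "n = 64 * K" and K: "K > 0" and x: "x > 0" "32 * \<bar>\<nu>\<bar> \<le> x"
  shows "(\<integral>\<^sup>+\<xi>. ennreal (excess n x (resid n (x / 2) (drift_walk \<nu> n \<xi>))) \<partial>gauss n) \<le> ennreal (1 + 20000 / x\<^sup>2)"
proof -
  have n10: "n \<ge> 10" and n0: "n > 0" using n K by auto
  interpret G: prob_space "gauss n" by (rule prob_space_gauss)
  define y where "y \<xi> k = resid n (x / 2) (drift_walk \<nu> n \<xi>) k" for \<xi> k
  have [measurable]: "(\<lambda>\<xi>. y \<xi> k) \<in> borel_measurable (gauss n)" for k unfolding y_def by measurable
  let ?E = "exp (24 * x\<^sup>2 / 25000)"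
  define A where "A \<xi> = (\<Sum>k=1..n. 20 / (3 * real n) * profile n k * exp (- (x / 2 * y \<xi> k)))" for \<xi>
  define B where "B \<xi> = (\<Sum>k=1..K. 1 / (3 * real K) * exp (- (3 * x / 8 * y \<xi> k)))" for \<xi>
  define C where "C \<xi> = (\<Sum>k=Suc K..n. 16 * ?E / real n * exp (- (x / 2 * y \<xi> k)))" for \<xi>
  have nnA: "0 \<le> A \<xi>" for \<xi> unfolding A_def using n0 profile_nonneg by (intro sum_nonneg mult_nonneg_nonneg) auto
  have nnB: "0 \<le> B \<xi>" for \<xi> unfolding B_def by (intro sum_nonneg mult_nonneg_nonneg) auto
  have nnC: "0 \<le> C \<xi>" for \<xi> unfolding C_def by (intro sum_nonneg mult_nonneg_nonneg) auto
  have [measurable]: "A \<in> borel_measurable (gauss n)" "B \<in> borel_measurable (gauss n)" "C \<in> borel_measurable (gauss n)"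
    unfolding A_def[abs_def] B_def[abs_def] C_def[abs_def] by measurable
  have cm: "(\<integral>\<^sup>+\<xi>. ennreal (c * exp (- (\<theta> * y \<xi> k))) \<partial>gauss n) \<le> ennreal (c * b)"
    if "0 \<le> c" "(\<integral>\<^sup>+\<xi>. ennreal (exp (- (\<theta> * y \<xi> k))) \<partial>gauss n) \<le> ennreal b" for c b \<theta> k
    using that by (simp add: ennreal_mult' nn_integral_cmult mult_left_mono)
  have half: "(\<integral>\<^sup>+\<xi>. ennreal (exp (- (x / 2 * y \<xi> k))) \<partial>gauss n) \<le> ennreal (exp (- (real k * (1 / 8 * x\<^sup>2 / real n))))"
    if "k \<le> n" for k
    unfolding y_def by (rule resid_exp'[OF that n10 x, where c="1/2"]) auto
  have th: "(\<integral>\<^sup>+\<xi>. ennreal (exp (- (3 * x / 8 * y \<xi> k))) \<partial>gauss n) \<le> ennreal (exp (- (real k * (1 / 16 * x\<^sup>2 / real n))))"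
    if "k \<le> n" for k
    unfolding y_def by (rule resid_exp'[OF that n10 x, where c="3/8"]) auto
  have EA: "(\<integral>\<^sup>+\<xi>. ennreal (A \<xi>) \<partial>gauss n) \<le> ennreal (160 / x\<^sup>2)"
  proof -
    have "(\<integral>\<^sup>+\<xi>. ennreal (A \<xi>) \<partial>gauss n) \<le> ennreal (\<Sum>k=1..n. 20 / real n * exp (- (real k * (1 / 8 * x\<^sup>2 / real n))))"
      unfolding A_def
    proof (rule nn_integral_sum_le)
      fix k assume k: "k \<in> {1..n}"
      have "real k / real n \<le> 1" using k by simp
      moreover have "profile n k \<le> 3 * (real k / real n)" using k n0 by (intro profile_upper) auto
      ultimately have "profile n k \<le> 3" by linarith
      then have "20 / (3 * real n) * profile n k \<le> 20 / real n" using n0 by (simp add: field_simps)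
      then have c: "ennreal (20 / (3 * real n) * profile n k * exp (- (real k * (1 / 8 * x\<^sup>2 / real n)))) \<le> ennreal (20 / real n * exp (- (real k * (1 / 8 * x\<^sup>2 / real n))))"
        by (intro ennreal_leI mult_right_mono) auto
      show "(\<integral>\<^sup>+\<xi>. ennreal (20 / (3 * real n) * profile n k * exp (- (x / 2 * y \<xi> k))) \<partial>gauss n) \<le> ennreal (20 / real n * exp (- (real k * (1 / 8 * x\<^sup>2 / real n))))"
        by (rule order_trans[OF cm c]) (use k half profile_nonneg n0 in auto)
    qed (use profile_nonneg n0 in auto)
    also have "(\<Sum>k=1..n. 20 / real n * exp (- (real k * (1 / 8 * x\<^sup>2 / real n)))) \<le> 20 / real n * (1 / (1 / 8 * x\<^sup>2 / real n))"
      unfolding sum_distrib_left[symmetric] using x n0 by (intro mult_left_mono sum_exp_le) auto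
    also have "\<dots> = 160 / x\<^sup>2" using n0 x by simp
    finally show ?thesis by (simp add: ennreal_leI)
  qed
  have EB: "(\<integral>\<^sup>+\<xi>. ennreal (B \<xi>) \<partial>gauss n) \<le> ennreal (342 / x\<^sup>2)"
  proof -
    have "(\<integral>\<^sup>+\<xi>. ennreal (B \<xi>) \<partial>gauss n) \<le> ennreal (\<Sum>k=1..K. 1 / (3 * real K) * exp (- (real k * (1 / 16 * x\<^sup>2 / real n))))"
      unfolding B_def
    proof (rule nn_integral_sum_le)
      fix k assume "k \<in> {1..K}"
      then have "k \<le> n" using n by simp
      then show "(\<integral>\<^sup>+\<xi>. ennreal (1 / (3 * real K) * exp (- (3 * x / 8 * y \<xi> k))) \<partial>gauss n)
        \<le> ennreal (1 / (3 * real K) * exp (- (real k * (1 / 16 * x\<^sup>2 / real n))))"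
        by (intro cm th) auto
    qed auto
    also have "(\<Sum>k=1..K. 1 / (3 * real K) * exp (- (real k * (1 / 16 * x\<^sup>2 / real n)))) \<le> 1 / (3 * real K) * (1 / (1 / 16 * x\<^sup>2 / real n))"
      unfolding sum_distrib_left[symmetric] using x n0 by (intro mult_left_mono sum_exp_le) auto
    also have "\<dots> \<le> 342 / x\<^sup>2" using n K x by (simp add: field_simps)
    finally show ?thesis by (simp add: ennreal_leI)
  qed
  have EC: "(\<integral>\<^sup>+\<xi>. ennreal (C \<xi>) \<partial>gauss n) \<le> ennreal (16384 / x\<^sup>2)"
  proof -
    have "(\<integral>\<^sup>+\<xi>. ennreal (C \<xi>) \<partial>gauss n) \<le> ennreal (\<Sum>k=Suc K..n. 16 * ?E / real n * exp (- (x\<^sup>2 / 512)))"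
      unfolding C_def
    proof (rule nn_integral_sum_le)
      fix k assume k: "k \<in> {Suc K..n}"
      have "x\<^sup>2 / 512 \<le> real k * (1 / 8 * x\<^sup>2 / real n)"
      proof -
        have "1 / 64 \<le> real k / real n" using k n K by (simp add: field_simps)
        then have "1 / 64 * (x\<^sup>2 / 8) \<le> real k / real n * (x\<^sup>2 / 8)" by (intro mult_right_mono) auto
        then show ?thesis by simp
      qed
      then have c: "ennreal (16 * ?E / real n * exp (- (real k * (1 / 8 * x\<^sup>2 / real n)))) \<le> ennreal (16 * ?E / real n * exp (- (x\<^sup>2 / 512)))"
        by (intro ennreal_leI mult_left_mono) auto
      show "(\<integral>\<^sup>+\<xi>. ennreal (16 * ?E / real n * exp (- (x / 2 * y \<xi> k))) \<partial>gauss n) \<le> ennreal (16 * ?E / real n * exp (- (x\<^sup>2 / 512)))"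
        by (rule order_trans[OF cm c]) (use k half in auto)
    qed auto
    also have "(\<Sum>k=Suc K..n. 16 * ?E / real n * exp (- (x\<^sup>2 / 512))) \<le> 16384 / x\<^sup>2"
    proof -
      have "(\<Sum>k=Suc K..n. 16 * ?E / real n * exp (- (x\<^sup>2 / 512))) = real (n - K) / real n * (16 * (?E * exp (- (x\<^sup>2 / 512))))"
        by (simp add: Suc_diff_le)
      also have "\<dots> \<le> 1 * (16 * (?E * exp (- (x\<^sup>2 / 512))))"
        using n0 by (intro mult_right_mono) auto
      also have "?E * exp (- (x\<^sup>2 / 512)) = exp (24 * x\<^sup>2 / 25000 - x\<^sup>2 / 512)" by (simp add: exp_add[symmetric])
      also have "\<dots> \<le> exp (- (x\<^sup>2 / 1024))" by (simp add: power2_eq_square)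
      also have "\<dots> \<le> 1 / (x\<^sup>2 / 1024)"
      proof -
        have "x\<^sup>2 / 1024 \<le> exp (x\<^sup>2 / 1024)" using exp_ge_add_one_self[of "x\<^sup>2 / 1024"] by linarith
        then have "inverse (exp (x\<^sup>2 / 1024)) \<le> inverse (x\<^sup>2 / 1024)"
          using x by (intro le_imp_inverse_le) auto
        then show ?thesis by (simp add: exp_minus)
      qed
      finally show ?thesis using x by simp
    qed
    finally show ?thesis by (simp add: ennreal_leI)
  qed
  have "(\<integral>\<^sup>+\<xi>. ennreal (excess n x (resid n (x / 2) (drift_walk \<nu> n \<xi>))) \<partial>gauss n)
     \<le> (\<integral>\<^sup>+\<xi>. 1 + ennreal (A \<xi>) + ennreal (B \<xi>) + ennreal (C \<xi>) \<partial>gauss n)"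
  proof (rule nn_integral_mono)
    fix \<xi>
    have "excess n x (y \<xi>) \<le> 1 + A \<xi> + B \<xi> + C \<xi>"
      unfolding A_def B_def C_def using excess_le[OF n K x(1), of "y \<xi>"]
      by (simp add: avg_def sum_distrib_left sum_divide_distrib mult.assoc)
    then have "ennreal (excess n x (y \<xi>)) \<le> ennreal (1 + A \<xi> + B \<xi> + C \<xi>)" by (rule ennreal_leI)
    also have "\<dots> = 1 + ennreal (A \<xi>) + ennreal (B \<xi>) + ennreal (C \<xi>)"
      using nnA nnB nnC by simp
    finally show "ennreal (excess n x (resid n (x / 2) (drift_walk \<nu> n \<xi>))) \<le> 1 + ennreal (A \<xi>) + ennreal (B \<xi>) + ennreal (C \<xi>)"
      unfolding y_def .
  qed
  also have "\<dots> = 1 + (\<integral>\<^sup>+\<xi>. ennreal (A \<xi>) \<partial>gauss n) + (\<integral>\<^sup>+\<xi>. ennreal (B \<xi>) \<partial>gauss n) + (\<integral>\<^sup>+\<xi>. ennreal (C \<xi>) \<partial>gauss n)"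
    by (simp add: nn_integral_add G.emeasure_space_1)
  also have "\<dots> \<le> ennreal 1 + ennreal (160 / x\<^sup>2) + ennreal (342 / x\<^sup>2) + ennreal (16384 / x\<^sup>2)"
    by (intro add_mono EA EB EC) simp
  also have "\<dots> = ennreal (1 + 160 / x\<^sup>2 + 342 / x\<^sup>2 + 16384 / x\<^sup>2)"
  proof -
    have "ennreal a + ennreal b + ennreal c + ennreal d = ennreal (a + b + c + d)"
      if "0 \<le> a" "0 \<le> b" "0 \<le> c" "0 \<le> d" for a b c d using that by simp
    then show ?thesis by this auto
  qed
  also have "\<dots> \<le> ennreal (1 + 20000 / x\<^sup>2)" by (intro ennreal_leI) (simp add: divide_right_mono)
  finally show ?thesis .
qed

lemma good_bound:
  assumes n: "n = 64 * K" and K: "K > 0" and x: "x > 0" "32 * \<bar>\<nu>\<bar> \<le> x" and xy: "x < y"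
  shows "emeasure (gauss n) {\<xi>\<in>space (gauss n). mostly_pos n x (drift_walk \<nu> n \<xi>) \<and> x < abs_avg n (drift_walk \<nu> n \<xi>) \<and> abs_avg n (drift_walk \<nu> n \<xi>) < y}
    \<le> ennreal ((y - x) * normal_density (area_mean \<nu> n) (sqrt (area_var n)) x * (1 + 20000 / x\<^sup>2))"
proof -
  have n10: "n \<ge> 10" and n0: "n > 0" using n K by auto
  let ?F = "indicator {V. mostly_pos n x V \<and> x < abs_avg n V \<and> abs_avg n V < y} :: _ \<Rightarrow> ennreal"
  let ?c = "(y - x) * normal_density (area_mean \<nu> n) (sqrt (area_var n)) x"
  have Fm: "(\<lambda>\<xi>. ?F (drift_walk \<nu> n \<xi>)) \<in> borel_measurable (gauss n)"
    unfolding indicator_def mem_Collect_eq by measurable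
  have "emeasure (gauss n) {\<xi>\<in>space (gauss n). mostly_pos n x (drift_walk \<nu> n \<xi>) \<and> x < abs_avg n (drift_walk \<nu> n \<xi>) \<and> abs_avg n (drift_walk \<nu> n \<xi>) < y}
     = (\<integral>\<^sup>+\<xi>. indicator {\<xi>\<in>space (gauss n). mostly_pos n x (drift_walk \<nu> n \<xi>) \<and> x < abs_avg n (drift_walk \<nu> n \<xi>) \<and> abs_avg n (drift_walk \<nu> n \<xi>) < y} \<xi> \<partial>gauss n)"
    by (subst nn_integral_indicator) auto
  also have "\<dots> = (\<integral>\<^sup>+\<xi>. ?F (drift_walk \<nu> n \<xi>) \<partial>gauss n)"
    by (intro nn_integral_cong) (auto simp: indicator_def)
  also have "\<dots> = (\<integral>\<^sup>+\<xi>. (\<integral>\<^sup>+c. ?F (\<lambda>k. drift_walk \<nu> n \<xi> k + c * profile n k) *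
      ennreal (normal_density (area_mean \<nu> n) (sqrt (area_var n)) (avg n (drift_walk \<nu> n \<xi>) + c)) \<partial>lborel) \<partial>gauss n)"
    by (rule drift_walk_disintegrate[OF Fm n0])
  also have "\<dots> \<le> (\<integral>\<^sup>+\<xi>. ennreal (?c * excess n x (resid n (x/2) (drift_walk \<nu> n \<xi>))) \<partial>gauss n)"
    using good_slice[OF n10 x(1) _ xy] x by (intro nn_integral_mono) auto
  also have "\<dots> = (\<integral>\<^sup>+\<xi>. ennreal ?c * ennreal (excess n x (resid n (x/2) (drift_walk \<nu> n \<xi>))) \<partial>gauss n)"
    using xy by (simp add: ennreal_mult')
  also have "\<dots> = ennreal ?c * (\<integral>\<^sup>+\<xi>. ennreal (excess n x (resid n (x/2) (drift_walk \<nu> n \<xi>))) \<partial>gauss n)"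
    unfolding excess_def by (rule nn_integral_cmult) measurable
  also have "\<dots> \<le> ennreal ?c * ennreal (1 + 20000 / x\<^sup>2)"
    by (intro mult_left_mono excess_expectation[OF n K x]) auto
  also have "\<dots> = ennreal (?c * (1 + 20000 / x\<^sup>2))" using xy by (simp add: ennreal_mult')
  finally show ?thesis .
qed

section \<open>Lower bound from paths of positive average\<close>

lemma lin_abs_expectation:
  assumes "(\<Sum>i<n. (c i)\<^sup>2) \<le> 1"
  shows "(\<integral>\<^sup>+\<xi>. ennreal \<bar>lin n c \<xi>\<bar> \<partial>gauss n) \<le> ennreal 4"
proof -
  have l: "lin n (\<lambda>i. - c i) \<xi> = - lin n c \<xi>" for \<xi> by (simp add: lin_def sum_negf)
  have "(\<integral>\<^sup>+\<xi>. ennreal \<bar>lin n c \<xi>\<bar> \<partial>gauss n) \<le> (\<integral>\<^sup>+\<xi>. ennreal (exp (lin n c \<xi>)) + ennreal (exp (lin n (\<lambda>i. - c i) \<xi>)) \<partial>gauss n)"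
  proof (rule nn_integral_mono)
    fix \<xi>
    have "\<bar>lin n c \<xi>\<bar> \<le> exp (lin n c \<xi>) + exp (- lin n c \<xi>)"
      using exp_ge_add_one_self[of "lin n c \<xi>"] exp_ge_add_one_self[of "- lin n c \<xi>"]
        exp_gt_zero[of "lin n c \<xi>"] exp_gt_zero[of "- lin n c \<xi>"] by linarith
    then show "ennreal \<bar>lin n c \<xi>\<bar> \<le> ennreal (exp (lin n c \<xi>)) + ennreal (exp (lin n (\<lambda>i. - c i) \<xi>))"
      unfolding l by (simp flip: ennreal_plus add: ennreal_leI)
  qed
  also have "\<dots> = ennreal (exp ((\<Sum>i<n. (c i)\<^sup>2) / 2)) + ennreal (exp ((\<Sum>i<n. (c i)\<^sup>2) / 2))"
    by (subst nn_integral_add) (auto simp: gauss_mgf)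
  also have "\<dots> = ennreal (2 * exp ((\<Sum>i<n. (c i)\<^sup>2) / 2))" by (simp flip: ennreal_plus)
  also have "\<dots> \<le> ennreal 4"
  proof (rule ennreal_leI)
    have "exp ((\<Sum>i<n. (c i)\<^sup>2) / 2) \<le> exp (1 / 2)" using assms by simp
    also have "\<dots> \<le> 2" using exp_half_le2 by simp
    finally show "2 * exp ((\<Sum>i<n. (c i)\<^sup>2) / 2) \<le> 4" by simp
  qed
  finally show ?thesis .
qed

text \<open>The residual path moved to average 0 has expected mean absolute value at most 4
  |\<open>\<nu>\<close>| + 4, while x - |\<open>\<nu>\<close>| is at least x / 2. By Markov's
  inequality the assumption of \<open>low_slice\<close> fails with probability at most (8
  |\<open>\<nu>\<close>| + 8) / x; this is where the error of order 1 / x arises.\<close>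

lemma low_bound:
  assumes n: "n > 0" and x: "x > 0" "2 * \<bar>\<nu>\<bar> \<le> x" "8 * \<bar>\<nu>\<bar> + 8 \<le> x" and xy: "x < y"
  shows "ennreal ((y - x) * normal_density (area_mean \<nu> n) (sqrt (area_var n)) y * (1 - (8 * \<bar>\<nu>\<bar> + 8) / x)) \<le>
    emeasure (gauss n) {\<xi>\<in>space (gauss n). 0 < avg n (drift_walk \<nu> n \<xi>) \<and> x \<le> abs_avg n (drift_walk \<nu> n \<xi>) \<and> abs_avg n (drift_walk \<nu> n \<xi>) \<le> y}"
proof -
  interpret G: prob_space "gauss n" by (rule prob_space_gauss)
  let ?F = "indicator {V. 0 < avg n V \<and> x \<le> abs_avg n V \<and> abs_avg n V \<le> y} :: _ \<Rightarrow> ennreal"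
  let ?c = "(y - x) * normal_density (area_mean \<nu> n) (sqrt (area_var n)) y"
  define D where "D \<xi> = avg n (\<lambda>k. \<bar>resid n 0 (drift_walk \<nu> n \<xi>) k\<bar>)" for \<xi>
  have [measurable]: "D \<in> borel_measurable (gauss n)" unfolding D_def[abs_def] by measurable
  have Dn: "0 \<le> D \<xi>" for \<xi> unfolding D_def by (intro avg_nonneg) auto
  have ED: "(\<integral>\<^sup>+\<xi>. ennreal (D \<xi>) \<partial>gauss n) \<le> ennreal (4 * \<bar>\<nu>\<bar> + 4)"
  proof -
    have "(\<integral>\<^sup>+\<xi>. ennreal (D \<xi>) \<partial>gauss n) = (\<integral>\<^sup>+\<xi>. ennreal (\<Sum>k=1..n. 1 / real n * \<bar>resid n 0 (drift_walk \<nu> n \<xi>) k\<bar>) \<partial>gauss n)"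
      unfolding D_def avg_def sum_divide_distrib by simp
    also have "\<dots> \<le> ennreal (\<Sum>k=1..n. 1 / real n * (4 * \<bar>\<nu>\<bar> + 4))"
    proof (rule nn_integral_sum_le)
      fix k assume k: "k \<in> {1..n}"
      have kn: "real k / real n \<le> 1" using k by simp
      have "(\<integral>\<^sup>+\<xi>. ennreal (1 / real n * \<bar>resid n 0 (drift_walk \<nu> n \<xi>) k\<bar>) \<partial>gauss n)
        \<le> (\<integral>\<^sup>+\<xi>. ennreal (1 / real n) * (ennreal (4 * \<bar>\<nu>\<bar>) + ennreal \<bar>lin n (resid_coeff n k) \<xi>\<bar>) \<partial>gauss n)"
      proof (rule nn_integral_mono)
        fix \<xi>
        have "4 * \<bar>\<nu>\<bar> * (real k / real n) \<le> 4 * \<bar>\<nu>\<bar> * 1" using kn by (intro mult_left_mono) auto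
        then have "\<bar>resid n 0 (drift_walk \<nu> n \<xi>) k\<bar> \<le> 4 * \<bar>\<nu>\<bar> + \<bar>lin n (resid_coeff n k) \<xi>\<bar>"
          using resid_eq[of k n \<nu> \<xi>] resid_mean_abs[of k n \<nu>] k n by (simp add: mult.commute)
        then have "ennreal (1 / real n * \<bar>resid n 0 (drift_walk \<nu> n \<xi>) k\<bar>) \<le> ennreal (1 / real n * (4 * \<bar>\<nu>\<bar> + \<bar>lin n (resid_coeff n k) \<xi>\<bar>))"
          by (intro ennreal_leI mult_left_mono) auto
        then show "ennreal (1 / real n * \<bar>resid n 0 (drift_walk \<nu> n \<xi>) k\<bar>)
          \<le> ennreal (1 / real n) * (ennreal (4 * \<bar>\<nu>\<bar>) + ennreal \<bar>lin n (resid_coeff n k) \<xi>\<bar>)"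
          by (simp add: ennreal_mult'[symmetric] ennreal_plus[symmetric] del: ennreal_plus)
      qed
      also have "\<dots> = ennreal (1 / real n) * (ennreal (4 * \<bar>\<nu>\<bar>) + (\<integral>\<^sup>+\<xi>. ennreal \<bar>lin n (resid_coeff n k) \<xi>\<bar> \<partial>gauss n))"
        by (simp add: nn_integral_cmult nn_integral_add G.emeasure_space_1)
      also have "\<dots> \<le> ennreal (1 / real n) * (ennreal (4 * \<bar>\<nu>\<bar>) + ennreal 4)"
        using order_trans[OF resid_coeff_sq_le kn] k n by (intro mult_left_mono add_left_mono lin_abs_expectation) auto
      also have "\<dots> = ennreal (1 / real n * (4 * \<bar>\<nu>\<bar> + 4))"
      proof -
        have a: "ennreal (4 * \<bar>\<nu>\<bar>) + ennreal 4 = ennreal (4 * \<bar>\<nu>\<bar> + 4)"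
          by (rule ennreal_plus[symmetric]) auto
        have b: "ennreal (1 / real n * (4 * \<bar>\<nu>\<bar> + 4)) = ennreal (1 / real n) * ennreal (4 * \<bar>\<nu>\<bar> + 4)"
          by (rule ennreal_mult') simp
        show ?thesis unfolding a b ..
      qed
      finally show "(\<integral>\<^sup>+\<xi>. ennreal (1 / real n * \<bar>resid n 0 (drift_walk \<nu> n \<xi>) k\<bar>) \<partial>gauss n) \<le> ennreal (1 / real n * (4 * \<bar>\<nu>\<bar> + 4))" .
    qed auto
    also have "(\<Sum>k=1..n. 1 / real n * (4 * \<bar>\<nu>\<bar> + 4)) = 4 * \<bar>\<nu>\<bar> + 4" using n by simp
    finally show ?thesis .
  qed
  have Fm: "(\<lambda>\<xi>. ?F (drift_walk \<nu> n \<xi>)) \<in> borel_measurable (gauss n)"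
    unfolding indicator_def mem_Collect_eq by measurable
  have PD: "ennreal (1 - (8 * \<bar>\<nu>\<bar> + 8) / x) \<le> emeasure (gauss n) {\<xi>\<in>space (gauss n). D \<xi> < x - \<bar>\<nu>\<bar>}"
  proof -
    have "emeasure (gauss n) {\<xi>\<in>space (gauss n). \<not> D \<xi> < x - \<bar>\<nu>\<bar>}
      = (\<integral>\<^sup>+\<xi>. indicator {\<xi>\<in>space (gauss n). \<not> D \<xi> < x - \<bar>\<nu>\<bar>} \<xi> \<partial>gauss n)"
      by (subst nn_integral_indicator) auto
    also have "\<dots> \<le> (\<integral>\<^sup>+\<xi>. ennreal (2 / x) * ennreal (D \<xi>) \<partial>gauss n)"
    proof (rule nn_integral_mono)
      fix \<xi>
      show "indicator {\<xi>\<in>space (gauss n). \<not> D \<xi> < x - \<bar>\<nu>\<bar>} \<xi> \<le> ennreal (2 / x) * ennreal (D \<xi>)"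
      proof (cases "D \<xi> < x - \<bar>\<nu>\<bar>")
        case False
        then have "x / 2 \<le> D \<xi>" using x by linarith
        then have "1 \<le> 2 / x * D \<xi>" using x by (simp add: field_simps)
        then have "ennreal 1 \<le> ennreal (2 / x * D \<xi>)" by (rule ennreal_leI)
        also have "ennreal (2 / x * D \<xi>) = ennreal (2 / x) * ennreal (D \<xi>)"
          using x by (intro ennreal_mult') simp
        finally have "1 \<le> ennreal (2 / x) * ennreal (D \<xi>)" by (simp only: ennreal_1)
        then show ?thesis by (auto simp: indicator_def)
      qed (simp add: indicator_def)
    qed
    also have "\<dots> = ennreal (2 / x) * (\<integral>\<^sup>+\<xi>. ennreal (D \<xi>) \<partial>gauss n)" by (rule nn_integral_cmult) measurable
    also have "\<dots> \<le> ennreal (2 / x) * ennreal (4 * \<bar>\<nu>\<bar> + 4)" by (intro mult_left_mono ED) auto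
    also have "\<dots> = ennreal (2 / x * (4 * \<bar>\<nu>\<bar> + 4))"
      by (rule ennreal_mult'[symmetric]) (use x in simp)
    also have "2 / x * (4 * \<bar>\<nu>\<bar> + 4) = (8 * \<bar>\<nu>\<bar> + 8) / x" by (simp add: field_simps)
    finally have "measure (gauss n) {\<xi>\<in>space (gauss n). \<not> D \<xi> < x - \<bar>\<nu>\<bar>} \<le> (8 * \<bar>\<nu>\<bar> + 8) / x"
      using x by (simp add: G.emeasure_eq_measure)
    moreover have "measure (gauss n) {\<xi>\<in>space (gauss n). \<not> D \<xi> < x - \<bar>\<nu>\<bar>} = 1 - measure (gauss n) {\<xi>\<in>space (gauss n). D \<xi> < x - \<bar>\<nu>\<bar>}"
      by (rule G.prob_neg) measurable
    ultimately show ?thesis by (simp add: G.emeasure_eq_measure ennreal_leI)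
  qed
  have "ennreal (?c * (1 - (8 * \<bar>\<nu>\<bar> + 8) / x)) = ennreal ?c * ennreal (1 - (8 * \<bar>\<nu>\<bar> + 8) / x)"
    using xy by (simp add: ennreal_mult')
  also have "\<dots> \<le> ennreal ?c * emeasure (gauss n) {\<xi>\<in>space (gauss n). D \<xi> < x - \<bar>\<nu>\<bar>}"
    by (intro mult_left_mono PD) auto
  also have "\<dots> = (\<integral>\<^sup>+\<xi>. ennreal ?c * indicator {\<xi>\<in>space (gauss n). D \<xi> < x - \<bar>\<nu>\<bar>} \<xi> \<partial>gauss n)"
    by (rule nn_integral_cmult_indicator[symmetric]) measurable
  also have "\<dots> \<le> (\<integral>\<^sup>+\<xi>. (\<integral>\<^sup>+c. ?F (\<lambda>k. drift_walk \<nu> n \<xi> k + c * profile n k) *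
      ennreal (normal_density (area_mean \<nu> n) (sqrt (area_var n)) (avg n (drift_walk \<nu> n \<xi>) + c)) \<partial>lborel) \<partial>gauss n)"
  proof (rule nn_integral_mono)
    fix \<xi>
    show "ennreal ?c * indicator {\<xi>\<in>space (gauss n). D \<xi> < x - \<bar>\<nu>\<bar>} \<xi> \<le> (\<integral>\<^sup>+c. ?F (\<lambda>k. drift_walk \<nu> n \<xi> k + c * profile n k) *
      ennreal (normal_density (area_mean \<nu> n) (sqrt (area_var n)) (avg n (drift_walk \<nu> n \<xi>) + c)) \<partial>lborel)"
      using low_slice[OF n xy, of "drift_walk \<nu> n \<xi>" \<nu>] unfolding D_def[symmetric]
      by (cases "D \<xi> < x - \<bar>\<nu>\<bar>") (auto simp: indicator_def)
  qed
  also have "\<dots> = (\<integral>\<^sup>+\<xi>. ?F (drift_walk \<nu> n \<xi>) \<partial>gauss n)"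
    by (rule drift_walk_disintegrate[OF Fm n, symmetric])
  also have "\<dots> = (\<integral>\<^sup>+\<xi>. indicator {\<xi>\<in>space (gauss n). 0 < avg n (drift_walk \<nu> n \<xi>) \<and> x \<le> abs_avg n (drift_walk \<nu> n \<xi>) \<and> abs_avg n (drift_walk \<nu> n \<xi>) \<le> y} \<xi> \<partial>gauss n)"
    by (intro nn_integral_cong) (auto simp: indicator_def)
  also have "\<dots> = emeasure (gauss n) {\<xi>\<in>space (gauss n). 0 < avg n (drift_walk \<nu> n \<xi>) \<and> x \<le> abs_avg n (drift_walk \<nu> n \<xi>) \<and> abs_avg n (drift_walk \<nu> n \<xi>) \<le> y}"
    by (subst nn_integral_indicator) auto
  finally show ?thesis .
qed

section \<open>Coarse paths and energy\<close>

text \<open>The truncated subtraction makes the ramp vanish up to the start of block j; it rises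
  linearly over the q steps of the block and equals 1 afterwards.\<close>

definition ramp :: "nat \<Rightarrow> nat \<Rightarrow> nat \<Rightarrow> real" where
  "ramp q j k = real (min (k - j * q) q) / real q"

text \<open>Increments of the ramp, multiplied by sqrt n to undo the scaling of
  \<open>walk\<close>.\<close>

definition ramp_dir :: "nat \<Rightarrow> nat \<Rightarrow> nat \<Rightarrow> nat \<Rightarrow> real" where
  "ramp_dir n q j i = (if i div q = j then sqrt (real n) / real q else 0)"

definition block_incr :: "nat \<Rightarrow> (nat \<Rightarrow> real) \<Rightarrow> nat \<Rightarrow> real" where
  "block_incr q V j = V (j * q + q) - V (j * q)"

text \<open>For paths starting at 0 this is the piecewise linear interpolation at the multiples of
  q.\<close>

definition coarse :: "nat \<Rightarrow> nat \<Rightarrow> (nat \<Rightarrow> real) \<Rightarrow> nat \<Rightarrow> real" where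
  "coarse d q V k = (\<Sum>j<d. block_incr q V j * ramp q j k)"

text \<open>Dirichlet integral of the interpolation when the d blocks fill the unit time
  interval.\<close>

definition energy :: "nat \<Rightarrow> nat \<Rightarrow> (nat \<Rightarrow> real) \<Rightarrow> real" where
  "energy d q V = real d * (\<Sum>j<d. (block_incr q V j)\<^sup>2)"

definition rough :: "nat \<Rightarrow> nat \<Rightarrow> (nat \<Rightarrow> real) \<Rightarrow> real" where
  "rough d q V = avg (d * q) (\<lambda>k. \<bar>V k - coarse d q V k\<bar>)"

lemma ramp_bounds: "0 \<le> ramp q j k" "q > 0 \<Longrightarrow> ramp q j k \<le> 1"
  by (auto simp: ramp_def)

lemma min_full: "x + q \<le> k \<Longrightarrow> min (k - x) q = (q::nat)"
  by arith

lemma sum_lessThan_add: "(\<Sum>i<a + q. f i) = (\<Sum>i<a. f i) + (\<Sum>i=a..<a+q::nat. (f i :: real))"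
  by (subst sum.union_disjoint[symmetric]) (auto intro!: sum.cong)

lemma sum_blocks: 
  fixes d q :: nat and f :: "nat \<Rightarrow> real"
  shows "(\<Sum>j<d. \<Sum>i=j*q..<j*q+q. f i) = (\<Sum>i<d*q. f i)"
proof (induction d)
  case (Suc d)
  have "Suc d * q = d * q + q" by simp
  then show ?case using Suc sum_lessThan_add[of f "d * q" q] by (simp only: sum.lessThan_Suc)
qed simp

lemma block_sum:
  fixes d q :: nat and g :: "nat \<Rightarrow> nat \<Rightarrow> real"
  assumes "q > 0"
  shows "(\<Sum>j<d. \<Sum>i=j*q..<j*q+q. g (i div q) i) = (\<Sum>i<d*q. (g (i div q) i :: real))"
    "(\<Sum>i<d*q. g (i div q) i) = (\<Sum>j<d. \<Sum>i=j*q..<j*q+q. g j i)"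
proof -
  show 1: "(\<Sum>j<d. \<Sum>i=j*q..<j*q+q. g (i div q) i) = (\<Sum>i<d*q. (g (i div q) i :: real))"
    by (rule sum_blocks)
  have "i div q = j" if "i \<in> {j*q..<j*q+q}" for i j
    using that assms by (auto intro!: div_nat_eqI simp: algebra_simps)
  then show "(\<Sum>i<d*q. g (i div q) i) = (\<Sum>j<d. \<Sum>i=j*q..<j*q+q. g j i)"
    unfolding 1[symmetric] by (intro sum.cong refl) simp
qed

lemma block_card: "(\<Sum>i=j*q..<j*q+q. of_bool (i < k)) = real (min (k - j * q) q)"
proof -
  have "(\<Sum>i=j*q..<j*q+q. of_bool (i < k)) = real (card ({j*q..<j*q+q} \<inter> {i. i < k}))"
    by (simp add: of_bool_def sum.If_cases)
  also have "{j*q..<j*q+q} \<inter> {i. i < k} = {j*q..<min k (j*q+q)}" by auto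
  also have "card {j*q..<min k (j*q+q)} = min (k - j * q) q" by auto
  finally show ?thesis .
qed

lemma sum_ramp_dir:
  assumes "q > 0" "n = d * q" "j < d"
  shows "(\<Sum>i<n. ramp_dir n q j i * f i) = sqrt (real n) / real q * (\<Sum>i=j*q..<j*q+q. f i)"
proof -
  have "(\<Sum>i<n. ramp_dir n q j i * f i) = (\<Sum>m<d. \<Sum>i=m*q..<m*q+q. (if m = j then sqrt (real n) / real q else 0) * f i)"
    using block_sum(2)[OF assms(1), where d=d and g="\<lambda>m i. (if m = j then sqrt (real n) / real q else 0) * f i"]
    unfolding ramp_dir_def assms(2) .
  also have "\<dots> = (\<Sum>m<d. if m = j then sqrt (real n) / real q * (\<Sum>i=j*q..<j*q+q. f i) else 0)"
    by (intro sum.cong) (auto simp: sum_distrib_left)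
  finally show ?thesis using assms by simp
qed

lemma walk_ramp_dir:
  assumes "q > 0" "n = d * q" "j < d"
  shows "walk n (ramp_dir n q j) k = ramp q j k"
proof -
  have jn: "j * q + q \<le> n" using assms mult_le_mono1[of "Suc j" d q] by simp
  have "(\<Sum>i<min k n. ramp_dir n q j i) = (\<Sum>i<n. of_bool (i < min k n) * ramp_dir n q j i)"
    by (rule lin_of_bool[symmetric]) simp
  also have "\<dots> = (\<Sum>i<n. ramp_dir n q j i * of_bool (i < min k n))"
    by (simp add: mult.commute)
  also have "\<dots> = sqrt (real n) / real q * real (min (min k n - j * q) q)"
    unfolding sum_ramp_dir[OF assms] block_card ..
  also have "min (min k n - j * q) q = min (k - j * q) q" using jn by auto
  finally show ?thesis using assms by (simp add: walk_def ramp_def)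
qed

lemma sum_ramp_dir_sq:
  assumes "q > 0" "n = d * q" "j < d"
  shows "(\<Sum>i<n. (ramp_dir n q j i)\<^sup>2) = real d"
proof -
  have "(\<Sum>i<n. (ramp_dir n q j i)\<^sup>2) = (\<Sum>i<n. ramp_dir n q j i * (sqrt (real n) / real q))"
    by (intro sum.cong) (auto simp: ramp_dir_def power2_eq_square)
  also have "\<dots> = real d" unfolding sum_ramp_dir[OF assms] using assms by (simp add: field_simps)
  finally show ?thesis .
qed

lemma block_incr_drift_walk:
  assumes "q > 0" "n = d * q" "j < d"
  shows "block_incr q (drift_walk \<nu> n \<xi>) j = (\<nu> + lin n (ramp_dir n q j) \<xi>) / real d"
proof -
  have jn: "j * q + q \<le> n" using assms mult_le_mono1[of "Suc j" d q] by simp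
  have s: "1 / sqrt (real n) = sqrt (real n) / real q / real d"
    using assms by (simp add: field_simps real_sqrt_mult[symmetric])
  have "walk n \<xi> (j*q+q) - walk n \<xi> (j*q) = (\<Sum>i=j*q..<j*q+q. \<xi> i) * (1 / sqrt (real n))"
    using jn by (simp add: walk_def min_def sum_lessThan_add add_divide_distrib)
  also have "\<dots> = lin n (ramp_dir n q j) \<xi> / real d"
    unfolding lin_def sum_ramp_dir[OF assms] s by simp
  finally have l: "walk n \<xi> (j*q+q) - walk n \<xi> (j*q) = lin n (ramp_dir n q j) \<xi> / real d" .
  have "\<nu> * real (j * q + q) / real n - \<nu> * real (j * q) / real n = \<nu> / real d"
    using assms by (simp add: field_simps)
  then show ?thesis using l by (simp add: block_incr_def drift_walk_def add_divide_distrib)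
qed

lemma sum_ramp: assumes "q > 0" "k \<le> d * q" shows "(\<Sum>j<d. ramp q j k) = real k / real q"
proof -
  have "(\<Sum>j<d. ramp q j k) = (\<Sum>j<d. \<Sum>i=j*q..<j*q+q. of_bool (i < k)) / real q"
    by (simp add: block_card ramp_def sum_divide_distrib)
  also have "(\<Sum>j<d. \<Sum>i=j*q..<j*q+q. of_bool (i < k)) = (\<Sum>i<d*q. of_bool (i < k) * (1::real))"
    using sum_blocks[of "\<lambda>i. of_bool (i < k)" q d] by (simp only: mult_1_right)
  also have "\<dots> = real k" unfolding lin_of_bool[OF assms(2)] by simp
  finally show ?thesis .
qed

lemma block_incr_ramp: assumes "q > 0" shows "block_incr q (ramp q j) i = of_bool (i = j)"
proof (cases i j rule: linorder_cases)
  case less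
  then have "i * q + q \<le> j * q" using mult_le_mono1[of "Suc i" j q] by simp
  then show ?thesis using less assms by (simp add: block_incr_def ramp_def)
next
  case greater
  then have "j * q + q \<le> i * q" using mult_le_mono1[of "Suc j" i q] by simp
  then show ?thesis using greater assms min_full[of "j * q" q "i * q"] min_full[of "j * q" q "i * q + q"]
    by (simp add: block_incr_def ramp_def)
qed (use assms in \<open>simp add: block_incr_def ramp_def\<close>)

lemma block_incr_add_ramp: "q > 0 \<Longrightarrow> block_incr q (\<lambda>k. V k + s * ramp q j k) i = block_incr q V i + s * of_bool (i = j)"
  using block_incr_ramp[of q j i] by (simp add: block_incr_def algebra_simps)

lemma coarse_add_ramp:
  assumes "q > 0" "j < d"
  shows "coarse d q (\<lambda>k. V k + s * ramp q j k) k = coarse d q V k + s * ramp q j k"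
proof -
  have "(\<Sum>i<d. s * of_bool (i = j) * ramp q i k) = (\<Sum>i<d. if i = j then s * ramp q j k else 0)"
    by (intro sum.cong) auto
  also have "\<dots> = s * ramp q j k" using assms by simp
  finally show ?thesis unfolding coarse_def block_incr_add_ramp[OF assms(1)] by (simp add: algebra_simps sum.distrib)
qed

lemma rough_add_ramp:
  assumes "q > 0" "j < d"
  shows "rough d q (\<lambda>k. V k + s * ramp q j k) = rough d q V"
  unfolding rough_def coarse_add_ramp[OF assms] by simp

definition rough_coeff :: "nat \<Rightarrow> nat \<Rightarrow> nat \<Rightarrow> nat \<Rightarrow> real" where
  "rough_coeff n q k i = (of_bool (i < k) - ramp q (i div q) k) / sqrt (real n)"

text \<open>Interpolation reproduces a linear drift exactly, so the drift cancels and a centred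
  linear form remains, a discrete bridge over the block that contains k.\<close>

lemma rough_lin:
  assumes q: "q > 0" "n = d * q" "d > 0" and k: "k \<le> n"
  shows "drift_walk \<nu> n \<xi> k - coarse d q (drift_walk \<nu> n \<xi>) k = lin n (rough_coeff n q k) \<xi>"
proof -
  have "coarse d q (drift_walk \<nu> n \<xi>) k = (\<Sum>j<d. (\<nu> + lin n (ramp_dir n q j) \<xi>) / real d * ramp q j k)"
    unfolding coarse_def by (intro sum.cong) (auto simp: block_incr_drift_walk[OF q(1,2)])
  also have "\<dots> = \<nu> / real d * (\<Sum>j<d. ramp q j k) + (\<Sum>j<d. lin n (ramp_dir n q j) \<xi> / real d * ramp q j k)"
    by (simp add: sum_distrib_left sum.distrib add_divide_distrib algebra_simps)
  also have "\<nu> / real d * (\<Sum>j<d. ramp q j k) = \<nu> * real k / real n"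
    using k q by (subst sum_ramp) auto
  also have "(\<Sum>j<d. lin n (ramp_dir n q j) \<xi> / real d * ramp q j k) = (\<Sum>i<n. \<xi> i * ramp q (i div q) k / sqrt (real n))"
  proof -
    have s: "sqrt (real n) / real q / real d = 1 / sqrt (real n)"
      using q by (simp add: field_simps real_sqrt_mult[symmetric])
    have "(\<Sum>j<d. lin n (ramp_dir n q j) \<xi> / real d * ramp q j k) = (\<Sum>j<d. (\<Sum>i=j*q..<j*q+q. \<xi> i) * (sqrt (real n) / real q / real d) * ramp q j k)"
      unfolding lin_def by (intro sum.cong) (auto simp: sum_ramp_dir[OF q(1,2)])
    also have "\<dots> = (\<Sum>j<d. \<Sum>i=j*q..<j*q+q. \<xi> i * ramp q j k / sqrt (real n))"
      unfolding s by (simp add: sum_distrib_right sum_divide_distrib)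
    also have "\<dots> = (\<Sum>i<d*q. \<xi> i * ramp q (i div q) k / sqrt (real n))"
      by (rule block_sum(2)[OF q(1), symmetric])
    finally show ?thesis using q by simp
  qed
  finally have c: "coarse d q (drift_walk \<nu> n \<xi>) k = \<nu> * real k / real n + (\<Sum>i<n. \<xi> i * ramp q (i div q) k / sqrt (real n))" .
  have "lin n (rough_coeff n q k) \<xi> = walk n \<xi> k - (\<Sum>i<n. \<xi> i * ramp q (i div q) k / sqrt (real n))"
  proof -
    have "lin n (rough_coeff n q k) \<xi> = (\<Sum>i<n. of_bool (i < k) * (\<xi> i / sqrt (real n))) - (\<Sum>i<n. \<xi> i * ramp q (i div q) k / sqrt (real n))"
      unfolding lin_def rough_coeff_def sum_subtractf[symmetric] by (intro sum.cong) (auto simp: diff_divide_distrib algebra_simps)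
    then show ?thesis unfolding lin_of_bool[OF k] using k by (simp add: walk_def min_def sum_divide_distrib)
  qed
  then show ?thesis by (simp add: c drift_walk_def[of \<nu> n \<xi> k])
qed

text \<open>Earlier blocks are already completed by both the path and its interpolation, later ones
  have not begun in either. Only the q increments of the block of k remain, each with squared
  coefficient at most 1 / n.\<close>

lemma rough_coeff_sq_le:
  assumes q: "q > 0" "n = d * q" "d > 0"
  shows "(\<Sum>i<n. (rough_coeff n q k i)\<^sup>2) \<le> 1 / real d"
proof -
  have le: "(rough_coeff n q k i)\<^sup>2 \<le> of_bool (i div q = k div q) / real n" for i
  proof (cases "i div q" "k div q" rule: linorder_cases)
    case less
    then have "(i div q) * q + q \<le> (k div q) * q" using mult_le_mono1[of "Suc (i div q)" "k div q" q] by simp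
    also have "\<dots> \<le> k" by simp
    finally have a: "(i div q) * q + q \<le> k" .
    have "i < (i div q) * q + q" using q(1) by (metis add.commute dividend_less_times_div mult.commute)
    then have "rough_coeff n q k i = 0" using a q by (simp add: rough_coeff_def ramp_def min_full)
    then show ?thesis by simp
  next
    case greater
    then have "(k div q) * q + q \<le> (i div q) * q" using mult_le_mono1[of "Suc (k div q)" "i div q" q] by simp
    moreover have "k < (k div q) * q + q" using q(1) by (metis add.commute dividend_less_times_div mult.commute)
    ultimately have "k \<le> (i div q) * q" by simp
    moreover have "\<not> i < k" using \<open>k \<le> (i div q) * q\<close> div_times_less_eq_dividend[of i q] by linarith
    ultimately have "rough_coeff n q k i = 0" by (simp add: rough_coeff_def ramp_def)
    then show ?thesis by simp
  next
    case equal
    have "\<bar>of_bool (i < k) - ramp q (i div q) k\<bar> \<le> 1"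
      using ramp_bounds[of q "i div q" k] q by (auto simp: of_bool_def)
    then have "(of_bool (i < k) - ramp q (i div q) k)\<^sup>2 \<le> 1" by (simp add: abs_square_le_1)
    then show ?thesis using equal by (simp add: rough_coeff_def power_divide divide_right_mono)
  qed
  have "(\<Sum>i<n. (rough_coeff n q k i)\<^sup>2) \<le> (\<Sum>i<d*q. of_bool (i div q = k div q) / real n)"
    unfolding q(2)[symmetric] by (intro sum_mono le)
  also have "\<dots> = (\<Sum>j<d. \<Sum>i=j*q..<j*q+q. of_bool (j = k div q) / real n)"
    by (rule block_sum(2)[OF q(1)])
  also have "\<dots> = (\<Sum>j<d. if j = k div q then real q / real n else 0)"
    by (intro sum.cong) auto
  also have "\<dots> \<le> real q / real n" by simp
  also have "\<dots> = 1 / real d" using q by simp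
  finally show ?thesis .
qed

lemma measurable_block_incr [measurable]:
  "(\<And>k. (\<lambda>x. f x k) \<in> borel_measurable M) \<Longrightarrow> (\<lambda>x. block_incr q (f x) j) \<in> borel_measurable M"
  unfolding block_incr_def by measurable

lemma measurable_coarse [measurable]:
  "(\<And>k. (\<lambda>x. f x k) \<in> borel_measurable M) \<Longrightarrow> (\<lambda>x. coarse d q (f x) k) \<in> borel_measurable M"
  unfolding coarse_def by (intro borel_measurable_sum borel_measurable_times measurable_block_incr borel_measurable_const)

lemma measurable_rough [measurable]:
  assumes [measurable]: "\<And>k. (\<lambda>x. f x k) \<in> borel_measurable M"
  shows "(\<lambda>x. rough d q (f x)) \<in> borel_measurable M"
  unfolding rough_def by measurable

lemma measurable_energy [measurable]:
  "(\<And>k. (\<lambda>x. f x k) \<in> borel_measurable M) \<Longrightarrow> (\<lambda>x. energy d q (f x)) \<in> borel_measurable M"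
  unfolding energy_def by measurable

text \<open>Jensen's inequality moves the exponential inside the average over k, which avoids a
  union bound over the n times. The choice \<open>\<kappa> = r d\<close> minimises the exponent -
  \<open>\<kappa>\<close> r + \<open>\<kappa>\<close>^2 / (2 d).\<close>

lemma rough_tail:
  assumes q: "q > 0" "n = d * q" "d > 0" and r: "0 \<le> r"
  shows "emeasure (gauss n) {\<xi>\<in>space (gauss n). r \<le> rough d q (drift_walk \<nu> n \<xi>)} \<le> ennreal (2 * exp (- (r\<^sup>2 * real d / 2)))"
proof -
  have n0: "n > 0" using q by simp
  define \<kappa> where "\<kappa> = r * real d"
  have l0: "0 \<le> \<kappa>" using r by (simp add: \<kappa>_def)
  have "emeasure (gauss n) {\<xi>\<in>space (gauss n). r \<le> rough d q (drift_walk \<nu> n \<xi>)}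
    = (\<integral>\<^sup>+\<xi>. indicator {\<xi>\<in>space (gauss n). r \<le> rough d q (drift_walk \<nu> n \<xi>)} \<xi> \<partial>gauss n)"
    by (subst nn_integral_indicator) auto
  also have "\<dots> \<le> (\<integral>\<^sup>+\<xi>. ennreal (\<Sum>k=1..n. exp (- \<kappa> * r) / real n * (exp (lin n (\<lambda>i. \<kappa> * rough_coeff n q k i) \<xi>)
      + exp (lin n (\<lambda>i. - \<kappa> * rough_coeff n q k i) \<xi>))) \<partial>gauss n)"
  proof (rule nn_integral_mono)
    fix \<xi>
    have l: "lin n (\<lambda>i. c * rough_coeff n q k i) \<xi> = c * lin n (rough_coeff n q k) \<xi>" for c k
      by (simp add: lin_def sum_distrib_left mult.assoc)
    let ?S = "(\<Sum>k=1..n. exp (- \<kappa> * r) / real n * (exp (lin n (\<lambda>i. \<kappa> * rough_coeff n q k i) \<xi>) + exp (lin n (\<lambda>i. - \<kappa> * rough_coeff n q k i) \<xi>)))"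
    show "indicator {\<xi>\<in>space (gauss n). r \<le> rough d q (drift_walk \<nu> n \<xi>)} \<xi> \<le> ennreal ?S"
    proof (cases "r \<le> rough d q (drift_walk \<nu> n \<xi>)")
      case True
      have "1 \<le> exp (- \<kappa> * r) * exp (\<kappa> * rough d q (drift_walk \<nu> n \<xi>))"
        using True l0 by (simp add: exp_add[symmetric] mult_left_mono)
      also have "\<kappa> * rough d q (drift_walk \<nu> n \<xi>) = (\<Sum>k=1..n. \<kappa> * \<bar>lin n (rough_coeff n q k) \<xi>\<bar>) / real n"
        using rough_lin[OF q, of _ \<nu> \<xi>] by (simp add: rough_def avg_def sum_distrib_left q(2)[symmetric])
      also have "exp \<dots> \<le> (\<Sum>k=1..n. exp (\<kappa> * \<bar>lin n (rough_coeff n q k) \<xi>\<bar>)) / real n"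
        by (rule exp_mean_sum_le[OF n0])
      also have "\<dots> \<le> (\<Sum>k=1..n. exp (lin n (\<lambda>i. \<kappa> * rough_coeff n q k i) \<xi>) + exp (lin n (\<lambda>i. - \<kappa> * rough_coeff n q k i) \<xi>)) / real n"
        unfolding l
      proof (intro divide_right_mono sum_mono)
        fix k
        show "exp (\<kappa> * \<bar>lin n (rough_coeff n q k) \<xi>\<bar>) \<le> exp (\<kappa> * lin n (rough_coeff n q k) \<xi>) + exp (- \<kappa> * lin n (rough_coeff n q k) \<xi>)"
          by (cases "lin n (rough_coeff n q k) \<xi> \<ge> 0") auto
      qed simp
      also have "exp (- \<kappa> * r) * \<dots> = ?S" by (simp add: sum_distrib_left sum_divide_distrib)
      finally have "1 \<le> ?S" by simp
      then have "ennreal 1 \<le> ennreal ?S" by (rule ennreal_leI)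
      then show ?thesis by (simp add: indicator_def)
    qed (simp add: indicator_def)
  qed
  also have "\<dots> \<le> ennreal (\<Sum>k=1..n. exp (- \<kappa> * r) / real n * (2 * exp (\<kappa>\<^sup>2 / (2 * real d))))"
  proof (rule nn_integral_sum_le)
    fix k
    have mg: "(\<integral>\<^sup>+\<xi>. ennreal (exp (lin n (\<lambda>i. c * rough_coeff n q k i) \<xi>)) \<partial>gauss n) \<le> ennreal (exp (\<kappa>\<^sup>2 / (2 * real d)))"
      if "c\<^sup>2 = \<kappa>\<^sup>2" for c
    proof -
      have "(\<Sum>i<n. (c * rough_coeff n q k i)\<^sup>2) = \<kappa>\<^sup>2 * (\<Sum>i<n. (rough_coeff n q k i)\<^sup>2)"
        by (simp add: power_mult_distrib sum_distrib_left that)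
      also have "\<dots> \<le> \<kappa>\<^sup>2 * (1 / real d)" by (intro mult_left_mono rough_coeff_sq_le q) auto
      finally show ?thesis unfolding gauss_mgf by (intro ennreal_leI) simp
    qed
    have "(\<integral>\<^sup>+\<xi>. ennreal (exp (- \<kappa> * r) / real n * (exp (lin n (\<lambda>i. \<kappa> * rough_coeff n q k i) \<xi>) + exp (lin n (\<lambda>i. - \<kappa> * rough_coeff n q k i) \<xi>))) \<partial>gauss n)
      = (\<integral>\<^sup>+\<xi>. ennreal (exp (- \<kappa> * r) / real n) * (ennreal (exp (lin n (\<lambda>i. \<kappa> * rough_coeff n q k i) \<xi>)) + ennreal (exp (lin n (\<lambda>i. - \<kappa> * rough_coeff n q k i) \<xi>))) \<partial>gauss n)"
      by (intro nn_integral_cong) (subst ennreal_mult', simp, simp add: ennreal_plus)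
    also have "\<dots> = ennreal (exp (- \<kappa> * r) / real n) * ((\<integral>\<^sup>+\<xi>. ennreal (exp (lin n (\<lambda>i. \<kappa> * rough_coeff n q k i) \<xi>)) \<partial>gauss n)
       + (\<integral>\<^sup>+\<xi>. ennreal (exp (lin n (\<lambda>i. - \<kappa> * rough_coeff n q k i) \<xi>)) \<partial>gauss n))"
      by (subst nn_integral_cmult, measurable, subst nn_integral_add) auto
    also have "\<dots> \<le> ennreal (exp (- \<kappa> * r) / real n) * (ennreal (exp (\<kappa>\<^sup>2 / (2 * real d))) + ennreal (exp (\<kappa>\<^sup>2 / (2 * real d))))"
      by (intro mult_left_mono add_mono mg) auto
    also have "\<dots> = ennreal (exp (- \<kappa> * r) / real n * (2 * exp (\<kappa>\<^sup>2 / (2 * real d))))"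
      by (subst ennreal_mult', simp, simp flip: ennreal_plus)
    finally show "(\<integral>\<^sup>+\<xi>. ennreal (exp (- \<kappa> * r) / real n * (exp (lin n (\<lambda>i. \<kappa> * rough_coeff n q k i) \<xi>) + exp (lin n (\<lambda>i. - \<kappa> * rough_coeff n q k i) \<xi>))) \<partial>gauss n)
      \<le> ennreal (exp (- \<kappa> * r) / real n * (2 * exp (\<kappa>\<^sup>2 / (2 * real d))))" .
  qed auto
  also have "(\<Sum>k=1..n. exp (- \<kappa> * r) / real n * (2 * exp (\<kappa>\<^sup>2 / (2 * real d)))) = 2 * exp (- \<kappa> * r + \<kappa>\<^sup>2 / (2 * real d))"
    using n0 by (simp add: mult_exp_exp)
  also have "- \<kappa> * r + \<kappa>\<^sup>2 / (2 * real d) = - (r\<^sup>2 * real d / 2)"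
    using q by (simp add: \<kappa>_def power2_eq_square field_simps)
  finally show ?thesis .
qed

lemma block_incr_tail:
  assumes q: "q > 0" "n = d * q" "j < d" and r: "\<bar>\<nu>\<bar> \<le> real d * r"
  shows "emeasure (gauss n) {\<xi>\<in>space (gauss n). r \<le> \<bar>block_incr q (drift_walk \<nu> n \<xi>) j\<bar>} \<le> ennreal (2 * exp (- (real d * r - \<bar>\<nu>\<bar>)\<^sup>2 / (2 * real d)))"
proof -
  have d: "d > 0" using q by simp
  have "emeasure (gauss n) {\<xi>\<in>space (gauss n). r \<le> \<bar>block_incr q (drift_walk \<nu> n \<xi>) j\<bar>}
    \<le> emeasure (gauss n) {\<xi>\<in>space (gauss n). real d * r - \<bar>\<nu>\<bar> \<le> \<bar>lin n (ramp_dir n q j) \<xi>\<bar>}"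
  proof (rule emeasure_mono)
    show "{\<xi>\<in>space (gauss n). r \<le> \<bar>block_incr q (drift_walk \<nu> n \<xi>) j\<bar>} \<subseteq> {\<xi>\<in>space (gauss n). real d * r - \<bar>\<nu>\<bar> \<le> \<bar>lin n (ramp_dir n q j) \<xi>\<bar>}"
    proof safe
      fix \<xi> assume "r \<le> \<bar>block_incr q (drift_walk \<nu> n \<xi>) j\<bar>"
      then have "real d * r \<le> real d * \<bar>block_incr q (drift_walk \<nu> n \<xi>) j\<bar>" by (intro mult_left_mono) auto
      also have "\<dots> = \<bar>\<nu> + lin n (ramp_dir n q j) \<xi>\<bar>" unfolding block_incr_drift_walk[OF q] using d by simp
      finally show "real d * r - \<bar>\<nu>\<bar> \<le> \<bar>lin n (ramp_dir n q j) \<xi>\<bar>" by linarith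
    qed
  qed measurable
  also have "\<dots> \<le> ennreal (2 * exp (- (real d * r - \<bar>\<nu>\<bar>)\<^sup>2 / (2 * real d)))"
    using sum_ramp_dir_sq[OF q] d r by (intro gauss_tail) auto
  finally show ?thesis .
qed

text \<open>The weighted density is a multiple of the centred normal density with variance 1 / (1 -
  \<open>\<kappa>\<close>).\<close>

lemma exp_square_integral:
  assumes "\<kappa> < 1"
  shows "(\<integral>\<^sup>+w. ennreal (exp (\<kappa> / 2 * w\<^sup>2)) \<partial>std_normal_distribution) = ennreal (1 / sqrt (1 - \<kappa>))"
proof -
  define s where "s = 1 / sqrt (1 - \<kappa>)"
  have s: "s > 0" "s\<^sup>2 = 1 / (1 - \<kappa>)" using assms by (auto simp: s_def power_divide)
  have e: "std_normal_density w * exp (\<kappa> / 2 * w\<^sup>2) = s * normal_density 0 s w" for w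
  proof -
    have "s * normal_density 0 s w = 1 / sqrt (2 * pi) * exp (- (w\<^sup>2) / (2 * s\<^sup>2))"
      using s(1) by (simp add: normal_density_def real_sqrt_mult)
    also have "- (w\<^sup>2) / (2 * s\<^sup>2) = - w\<^sup>2 / 2 + \<kappa> / 2 * w\<^sup>2"
      unfolding s(2) using assms by (simp add: field_simps)
    finally show ?thesis by (simp add: std_normal_density_def mult_exp_exp)
  qed
  have "(\<integral>\<^sup>+w. ennreal (exp (\<kappa> / 2 * w\<^sup>2)) \<partial>std_normal_distribution)
    = (\<integral>\<^sup>+w. ennreal (std_normal_density w) * ennreal (exp (\<kappa> / 2 * w\<^sup>2)) \<partial>lborel)"
    by (subst nn_integral_density) auto
  also have "\<dots> = (\<integral>\<^sup>+w. ennreal s * ennreal (normal_density 0 s w) \<partial>lborel)"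
    using s(1) by (intro nn_integral_cong) (simp only: ennreal_mult'[symmetric] normal_density_nonneg e less_imp_le)
  also have "\<dots> = ennreal s * (\<integral>\<^sup>+w. ennreal (normal_density 0 s w) \<partial>lborel)"
    by (rule nn_integral_cmult) simp
  also have "(\<integral>\<^sup>+w. ennreal (normal_density 0 s w) \<partial>lborel) = 1"
    using prob_space.emeasure_space_1[OF prob_space_normal_density[OF s(1), of 0]] by (simp add: emeasure_density)
  finally show ?thesis by (simp add: s_def)
qed

lemma gauss_exp_square:
  assumes "\<kappa> < 1"
  shows "(\<integral>\<^sup>+w. ennreal (exp (\<kappa> / 2 * (\<Sum>j<d. (w j)\<^sup>2))) \<partial>gauss d) = ennreal ((1 / sqrt (1 - \<kappa>)) ^ d)"
proof -
  interpret N: prob_space std_normal_distribution using real_dist_normal_dist by (simp add: real_distribution_def)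
  interpret P: product_prob_space "\<lambda>_::nat. std_normal_distribution" by standard
  have "(\<integral>\<^sup>+w. ennreal (exp (\<kappa> / 2 * (\<Sum>j<d. (w j)\<^sup>2))) \<partial>gauss d) = (\<integral>\<^sup>+w. (\<Prod>j\<in>{..<d}. ennreal (exp (\<kappa> / 2 * (w j)\<^sup>2))) \<partial>gauss d)"
    by (intro nn_integral_cong) (simp add: prod_ennreal exp_sum sum_distrib_left)
  also have "\<dots> = (\<Prod>j\<in>{..<d}. (\<integral>\<^sup>+w. ennreal (exp (\<kappa> / 2 * w\<^sup>2)) \<partial>std_normal_distribution))"
    unfolding gauss_def by (rule P.product_nn_integral_prod) auto
  also have "\<dots> = ennreal ((1 / sqrt (1 - \<kappa>)) ^ d)"
    unfolding exp_square_integral[OF assms] using assms by (simp add: ennreal_power)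
  finally show ?thesis .
qed

text \<open>Linearising the square by an auxiliary Gaussian vector reduces the exponential moment of
  the energy to the moment generating function.\<close>

lemma exp_energy:
  assumes q: "q > 0" "n = d * q" "d > 0" and l: "0 \<le> \<kappa>" "\<kappa> < 1"
  shows "(\<integral>\<^sup>+\<xi>. ennreal (exp (\<kappa> / 2 * (\<Sum>j<d. (lin n (ramp_dir n q j) \<xi> / sqrt (real d))\<^sup>2))) \<partial>gauss n)
    = ennreal ((1 / sqrt (1 - \<kappa>)) ^ d)"
proof -
  interpret Gn: prob_space "gauss n" by (rule prob_space_gauss)
  interpret Gd: prob_space "gauss d" by (rule prob_space_gauss)
  interpret P: pair_sigma_finite "gauss n" "gauss d" ..
  define g where "g j \<xi> = lin n (ramp_dir n q j) \<xi> / sqrt (real d)" for j \<xi>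
  have [measurable]: "g j \<in> borel_measurable (gauss n)" for j unfolding g_def[abs_def] by measurable
  have "(\<integral>\<^sup>+\<xi>. ennreal (exp (\<kappa> / 2 * (\<Sum>j<d. (g j \<xi>)\<^sup>2))) \<partial>gauss n)
     = (\<integral>\<^sup>+\<xi>. (\<integral>\<^sup>+w. ennreal (exp (lin d (\<lambda>j. sqrt \<kappa> * g j \<xi>) w)) \<partial>gauss d) \<partial>gauss n)"
    unfolding gauss_mgf using l by (simp add: power_mult_distrib sum_distrib_left[symmetric])
  also have "\<dots> = (\<integral>\<^sup>+w. (\<integral>\<^sup>+\<xi>. ennreal (exp (lin d (\<lambda>j. sqrt \<kappa> * g j \<xi>) w)) \<partial>gauss n) \<partial>gauss d)"
    unfolding lin_def by (rule P.Fubini'[symmetric]) measurable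
  also have "\<dots> = (\<integral>\<^sup>+w. ennreal (exp (\<kappa> / 2 * (\<Sum>j<d. (w j)\<^sup>2))) \<partial>gauss d)"
  proof (rule nn_integral_cong)
    fix w
    define c where "c i = (\<Sum>j<d. sqrt \<kappa> * w j / sqrt (real d) * ramp_dir n q j i)" for i
    have "lin d (\<lambda>j. sqrt \<kappa> * g j \<xi>) w = lin n c \<xi>" for \<xi>
    proof -
      have "lin n c \<xi> = (\<Sum>i<n. \<Sum>j<d. sqrt \<kappa> * w j / sqrt (real d) * (ramp_dir n q j i * \<xi> i))"
        unfolding lin_def c_def sum_distrib_right by (simp add: mult.assoc)
      also have "\<dots> = (\<Sum>j<d. \<Sum>i<n. sqrt \<kappa> * w j / sqrt (real d) * (ramp_dir n q j i * \<xi> i))"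
        by (rule sum.swap)
      also have "\<dots> = (\<Sum>j<d. sqrt \<kappa> * g j \<xi> * w j)"
        by (intro sum.cong refl, subst sum_distrib_left[symmetric]) (simp add: g_def lin_def)
      finally show ?thesis by (simp add: lin_def[of d])
    qed
    then have "(\<integral>\<^sup>+\<xi>. ennreal (exp (lin d (\<lambda>j. sqrt \<kappa> * g j \<xi>) w)) \<partial>gauss n) = ennreal (exp ((\<Sum>i<n. (c i)\<^sup>2) / 2))"
      by (simp add: gauss_mgf)
    also have "(\<Sum>i<n. (c i)\<^sup>2) = (\<Sum>i<n. \<kappa> * (w (i div q))\<^sup>2 / real d * (sqrt (real n) / real q)\<^sup>2)"
    proof (rule sum.cong)
      fix i assume "i \<in> {..<n}"
      then have id: "i div q < d" using q by (simp add: less_mult_imp_div_less)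
      have "c i = (\<Sum>j<d. if j = i div q then sqrt \<kappa> * w j / sqrt (real d) * (sqrt (real n) / real q) else 0)"
        unfolding c_def ramp_dir_def by (intro sum.cong) auto
      then have "c i = sqrt \<kappa> * w (i div q) / sqrt (real d) * (sqrt (real n) / real q)" using id by simp
      then show "(c i)\<^sup>2 = \<kappa> * (w (i div q))\<^sup>2 / real d * (sqrt (real n) / real q)\<^sup>2"
        using l by (simp add: power_mult_distrib power_divide)
    qed simp
    also have "\<dots> = (\<Sum>j<d. \<Sum>i=j*q..<j*q+q. \<kappa> * (w j)\<^sup>2 / real d * (sqrt (real n) / real q)\<^sup>2)"
      unfolding q(2) by (rule block_sum(2)[OF q(1)])
    also have "\<dots> = (\<Sum>j<d. \<kappa> * (w j)\<^sup>2)"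
    proof -
      have "real q * (\<kappa> * (w j)\<^sup>2 / real d * (sqrt (real n) / real q)\<^sup>2) = \<kappa> * (w j)\<^sup>2" for j
        using q by (simp add: power_divide power2_eq_square)
      then show ?thesis by simp
    qed
    finally show "(\<integral>\<^sup>+\<xi>. ennreal (exp (lin d (\<lambda>j. sqrt \<kappa> * g j \<xi>) w)) \<partial>gauss n) = ennreal (exp (\<kappa> / 2 * (\<Sum>j<d. (w j)\<^sup>2)))"
      by (simp add: sum_distrib_left[symmetric])
  qed
  finally show ?thesis unfolding g_def using gauss_exp_square[OF l(2)] by simp
qed

lemma sqrt_energy: "sqrt (energy d q V) = L2_set (\<lambda>j. sqrt (real d) * block_incr q V j) {..<d}"
  by (simp add: energy_def L2_set_def power_mult_distrib sum_distrib_left)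

text \<open>The square root of the energy is a Euclidean norm in which the drift has length
  |\<open>\<nu>\<close>|. The triangle inequality removes the drift, and Markov's inequality is
  applied to the exponential moment of the squares that remain.\<close>

lemma energy_tail:
  assumes q: "q > 0" "n = d * q" "d > 0" and l: "0 \<le> \<kappa>" "\<kappa> < 1" and r: "\<bar>\<nu>\<bar> \<le> r"
  shows "emeasure (gauss n) {\<xi>\<in>space (gauss n). r\<^sup>2 \<le> energy d q (drift_walk \<nu> n \<xi>)}
    \<le> ennreal ((1 / sqrt (1 - \<kappa>)) ^ d * exp (- (\<kappa> / 2 * (r - \<bar>\<nu>\<bar>)\<^sup>2)))"
proof -
  let ?G = "\<lambda>\<xi>. \<Sum>j<d. (lin n (ramp_dir n q j) \<xi> / sqrt (real d))\<^sup>2"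
  have "emeasure (gauss n) {\<xi>\<in>space (gauss n). r\<^sup>2 \<le> energy d q (drift_walk \<nu> n \<xi>)}
    = (\<integral>\<^sup>+\<xi>. indicator {\<xi>\<in>space (gauss n). r\<^sup>2 \<le> energy d q (drift_walk \<nu> n \<xi>)} \<xi> \<partial>gauss n)"
    by (subst nn_integral_indicator) auto
  also have "\<dots> \<le> (\<integral>\<^sup>+\<xi>. ennreal (exp (- (\<kappa> / 2 * (r - \<bar>\<nu>\<bar>)\<^sup>2))) * ennreal (exp (\<kappa> / 2 * ?G \<xi>)) \<partial>gauss n)"
  proof (rule nn_integral_mono)
    fix \<xi>
    show "indicator {\<xi>\<in>space (gauss n). r\<^sup>2 \<le> energy d q (drift_walk \<nu> n \<xi>)} \<xi>
      \<le> ennreal (exp (- (\<kappa> / 2 * (r - \<bar>\<nu>\<bar>)\<^sup>2))) * ennreal (exp (\<kappa> / 2 * ?G \<xi>))"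
    proof (cases "r\<^sup>2 \<le> energy d q (drift_walk \<nu> n \<xi>)")
      case True
      have "r \<le> sqrt (energy d q (drift_walk \<nu> n \<xi>))" using True r by (intro real_le_rsqrt) auto
      also have "\<dots> = L2_set (\<lambda>j. \<nu> / sqrt (real d) + lin n (ramp_dir n q j) \<xi> / sqrt (real d)) {..<d}"
        unfolding sqrt_energy
      proof (rule L2_set_cong)
        fix j assume "j \<in> {..<d}"
        then have "sqrt (real d) * block_incr q (drift_walk \<nu> n \<xi>) j = (\<nu> + lin n (ramp_dir n q j) \<xi>) * (sqrt (real d) / real d)"
          using block_incr_drift_walk[OF q(1,2), of j \<nu> \<xi>] by simp
        also have "sqrt (real d) / real d = 1 / sqrt (real d)" using q(3) by (simp add: field_simps)
        finally show "sqrt (real d) * block_incr q (drift_walk \<nu> n \<xi>) j = \<nu> / sqrt (real d) + lin n (ramp_dir n q j) \<xi> / sqrt (real d)"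
          by (simp add: add_divide_distrib)
      qed simp
      also have "\<dots> \<le> L2_set (\<lambda>j. \<nu> / sqrt (real d)) {..<d} + L2_set (\<lambda>j. lin n (ramp_dir n q j) \<xi> / sqrt (real d)) {..<d}"
        by (rule L2_set_triangle_ineq)
      also have "L2_set (\<lambda>j. \<nu> / sqrt (real d)) {..<d} = \<bar>\<nu>\<bar>"
        using q by (simp add: L2_set_def power_divide)
      also have "L2_set (\<lambda>j. lin n (ramp_dir n q j) \<xi> / sqrt (real d)) {..<d} = sqrt (?G \<xi>)"
        by (simp add: L2_set_def)
      finally have "r - \<bar>\<nu>\<bar> \<le> sqrt (?G \<xi>)" by simp
      then have "(r - \<bar>\<nu>\<bar>)\<^sup>2 \<le> (sqrt (?G \<xi>))\<^sup>2" using r by (intro power_mono) auto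
      also have "(sqrt (?G \<xi>))\<^sup>2 = ?G \<xi>" by (simp add: sum_nonneg)
      finally have "(r - \<bar>\<nu>\<bar>)\<^sup>2 \<le> ?G \<xi>" .
      then have "\<kappa> / 2 * (r - \<bar>\<nu>\<bar>)\<^sup>2 \<le> \<kappa> / 2 * ?G \<xi>" using l by (intro mult_left_mono) auto
      then have "1 \<le> exp (- (\<kappa> / 2 * (r - \<bar>\<nu>\<bar>)\<^sup>2) + \<kappa> / 2 * ?G \<xi>)" unfolding one_le_exp_iff by linarith
      then have "ennreal 1 \<le> ennreal (exp (- (\<kappa> / 2 * (r - \<bar>\<nu>\<bar>)\<^sup>2)) * exp (\<kappa> / 2 * ?G \<xi>))"
        unfolding exp_add by (rule ennreal_leI)
      then have "1 \<le> ennreal (exp (- (\<kappa> / 2 * (r - \<bar>\<nu>\<bar>)\<^sup>2))) * ennreal (exp (\<kappa> / 2 * ?G \<xi>))"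
        by (subst (asm) ennreal_mult') auto
      then show ?thesis by (auto simp: indicator_def)
    qed (simp add: indicator_def)
  qed
  also have "\<dots> = ennreal (exp (- (\<kappa> / 2 * (r - \<bar>\<nu>\<bar>)\<^sup>2))) * ennreal ((1 / sqrt (1 - \<kappa>)) ^ d)"
    unfolding exp_energy[OF q l, symmetric] by (rule nn_integral_cmult) measurable
  also have "\<dots> = ennreal ((1 / sqrt (1 - \<kappa>)) ^ d * exp (- (\<kappa> / 2 * (r - \<bar>\<nu>\<bar>)\<^sup>2)))"
    using l by (subst ennreal_mult'[symmetric]) (auto simp: mult.commute)
  finally show ?thesis .
qed

section \<open>Smoothing along ramps\<close>

abbreviation paths :: "(nat \<Rightarrow> real) measure" where "paths \<equiv> Pi\<^sub>M UNIV (\<lambda>_. borel)"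

definition path_prob :: "real \<Rightarrow> nat \<Rightarrow> ((nat \<Rightarrow> real) \<Rightarrow> bool) \<Rightarrow> real" where
  "path_prob \<nu> n E = measure (gauss n) {\<xi>\<in>space (gauss n). E (drift_walk \<nu> n \<xi>)}"

lemma pred_paths:
  assumes E: "Measurable.pred paths E" and f: "\<And>k. (\<lambda>x. f x k) \<in> borel_measurable M"
  shows "Measurable.pred M (\<lambda>x. E (f x))"
proof -
  have "f \<in> measurable M paths"
    by (rule measurable_PiM_single') (use f in \<open>auto simp: space_PiM\<close>)
  then show ?thesis by (rule measurable_compose[OF _ E])
qed

lemma pred_drift_walk [measurable]: "Measurable.pred paths E \<Longrightarrow> Measurable.pred (gauss n) (\<lambda>\<xi>. E (drift_walk \<nu> n \<xi>))"
  by (rule pred_paths[OF _ measurable_drift_walk])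

lemma emeasure_path_prob: "emeasure (gauss n) {\<xi>\<in>space (gauss n). E (drift_walk \<nu> n \<xi>)} = ennreal (path_prob \<nu> n E)"
  unfolding path_prob_def by (rule finite_measure.emeasure_eq_measure)
    (rule prob_space.finite_measure[OF prob_space_gauss])

lemma path_prob_nonneg: "0 \<le> path_prob \<nu> n E" by (simp add: path_prob_def)

lemma path_prob_le_1: "path_prob \<nu> n E \<le> 1"
  unfolding path_prob_def by (rule prob_space.prob_le_1[OF prob_space_gauss])

lemma path_prob_mono:
  assumes "Measurable.pred paths F" "\<And>V. E V \<Longrightarrow> F V" shows "path_prob \<nu> n E \<le> path_prob \<nu> n F"
  unfolding path_prob_def
  by (rule finite_measure.finite_measure_mono[OF prob_space.finite_measure[OF prob_space_gauss]])
    (use assms pred_drift_walk[OF assms(1), where n=n and \<nu>=\<nu>] in auto)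

lemma path_prob_disj:
  assumes "Measurable.pred paths E" "Measurable.pred paths F"
  shows "path_prob \<nu> n (\<lambda>V. E V \<or> F V) \<le> path_prob \<nu> n E + path_prob \<nu> n F"
proof -
  have [measurable]: "Measurable.pred (gauss n) (\<lambda>\<xi>. E (drift_walk \<nu> n \<xi>))" "Measurable.pred (gauss n) (\<lambda>\<xi>. F (drift_walk \<nu> n \<xi>))"
    using assms by (auto intro: pred_drift_walk)
  have "{\<xi>\<in>space (gauss n). E (drift_walk \<nu> n \<xi>) \<or> F (drift_walk \<nu> n \<xi>)} = {\<xi>\<in>space (gauss n). E (drift_walk \<nu> n \<xi>)} \<union> {\<xi>\<in>space (gauss n). F (drift_walk \<nu> n \<xi>)}"
    by auto
  then show ?thesis unfolding path_prob_def
    by (simp add: measure_Un_le)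
qed

lemma path_prob_ex_le:
  assumes "finite I" "\<And>i. i \<in> I \<Longrightarrow> Measurable.pred paths (E i)"
  shows "path_prob \<nu> n (\<lambda>V. \<exists>i\<in>I. E i V) \<le> (\<Sum>i\<in>I. path_prob \<nu> n (E i))"
  using assms
proof (induction I rule: finite_induct)
  case empty
  then show ?case by (simp add: path_prob_def)
next
  case (insert i I)
  have "Measurable.pred paths (\<lambda>V. \<exists>i\<in>I. E i V)" using insert by (intro pred_intros_finite) auto
  then have "path_prob \<nu> n (\<lambda>V. E i V \<or> (\<exists>i\<in>I. E i V)) \<le> path_prob \<nu> n (E i) + path_prob \<nu> n (\<lambda>V. \<exists>i\<in>I. E i V)"
    using insert by (intro path_prob_disj) auto
  then show ?case using insert by auto
qed

lemma path_prob_reflect: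
  assumes "Measurable.pred paths E"
  shows "path_prob \<nu> n (\<lambda>V. E (\<lambda>k. - V k)) = path_prob (- \<nu>) n E"
proof -
  have m: "Measurable.pred paths (\<lambda>V. E (\<lambda>k. - V k))" by (rule pred_paths[OF assms]) measurable
  note [measurable] = pred_drift_walk[OF m, where n=n and \<nu>=\<nu>] pred_drift_walk[OF assms, where n=n and \<nu>="- \<nu>"]
  let ?f = "\<lambda>\<xi>. indicator {\<xi>\<in>space (gauss n). E (drift_walk (- \<nu>) n \<xi>)} \<xi> :: ennreal"
  have "ennreal (path_prob (- \<nu>) n E) = (\<integral>\<^sup>+\<xi>. ?f \<xi> \<partial>gauss n)"
    unfolding emeasure_path_prob[symmetric] by (subst nn_integral_indicator) auto
  also have "\<dots> = (\<integral>\<^sup>+\<xi>. ?f (\<lambda>i\<in>{..<n}. - \<xi> i) \<partial>gauss n)"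
    by (rule gauss_reflect[symmetric]) measurable
  also have "\<dots> = (\<integral>\<^sup>+\<xi>. indicator {\<xi>\<in>space (gauss n). E (\<lambda>k. - drift_walk \<nu> n \<xi> k)} \<xi> \<partial>gauss n)"
  proof (rule nn_integral_cong)
    fix \<xi> assume "\<xi> \<in> space (gauss n)"
    moreover have "drift_walk (- \<nu>) n (\<lambda>i\<in>{..<n}. - \<xi> i) = (\<lambda>k. - drift_walk \<nu> n \<xi> k)"
      using drift_walk_reflect[of "- \<nu>" n \<xi>] by auto
    ultimately show "?f (\<lambda>i\<in>{..<n}. - \<xi> i) = indicator {\<xi>\<in>space (gauss n). E (\<lambda>k. - drift_walk \<nu> n \<xi> k)} \<xi>"
      by (auto simp: indicator_def space_gauss)
  qed
  also have "\<dots> = ennreal (path_prob \<nu> n (\<lambda>V. E (\<lambda>k. - V k)))"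
    unfolding emeasure_path_prob[symmetric] by (subst nn_integral_indicator) auto
  finally show ?thesis by (simp add: path_prob_nonneg)
qed

text \<open>With these bounds a path whose \<open>abs_avg\<close> is at least x cannot be
  insensitive to all ramps; see \<open>slope_exists\<close>.\<close>

definition tame :: "nat \<Rightarrow> nat \<Rightarrow> real \<Rightarrow> (nat \<Rightarrow> real) \<Rightarrow> bool" where
  "tame d q x V \<longleftrightarrow> rough d q V \<le> x / 2 \<and> (\<forall>j<d. \<bar>block_incr q V j\<bar> \<le> x)"

text \<open>A subgradient of the convex functional \<open>abs_avg\<close> in the direction of the
  ramp j; at zeros of V the convention sgn 0 = 0 selects one.\<close>

definition slope :: "nat \<Rightarrow> nat \<Rightarrow> nat \<Rightarrow> (nat \<Rightarrow> real) \<Rightarrow> real" where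
  "slope n q j V = avg n (\<lambda>k. sgn (V k) * ramp q j k)"

lemma measurable_slope [measurable]:
  "(\<And>k. (\<lambda>x. f x k) \<in> borel_measurable M) \<Longrightarrow> (\<lambda>x. slope n q j (f x)) \<in> borel_measurable M"
  unfolding slope_def
  by (intro measurable_avg borel_measurable_times borel_measurable_const borel_measurable_sgn) auto

lemma pred_tame [measurable]: "Measurable.pred paths (tame d q x)"
  unfolding tame_def[abs_def] by measurable

lemma slope_le: "abs_avg n V + s * slope n q j V \<le> abs_avg n (\<lambda>k. V k + s * ramp q j k)"
proof -
  have "abs_avg n V + s * slope n q j V = avg n (\<lambda>k. \<bar>V k\<bar> + s * (sgn (V k) * ramp q j k))"
    unfolding avg_add avg_cmult abs_avg_def slope_def ..
  also have "\<dots> \<le> abs_avg n (\<lambda>k. V k + s * ramp q j k)"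
    unfolding abs_avg_def
  proof (rule avg_mono)
    fix k
    have "\<bar>a\<bar> + sgn a * b \<le> \<bar>a + b\<bar>" for a b :: real by (cases a "0::real" rule: linorder_cases) auto
    from this[of "V k" "s * ramp q j k"]
    show "\<bar>V k\<bar> + s * (sgn (V k) * ramp q j k) \<le> \<bar>V k + s * ramp q j k\<bar>" by (simp add: ac_simps)
  qed
  finally show ?thesis .
qed

lemma avg_sum: "avg n (\<lambda>k. \<Sum>j\<in>J. f j k) = (\<Sum>j\<in>J. avg n (f j))"
  unfolding avg_def by (subst sum.swap) (simp add: sum_divide_distrib)

text \<open>Writing |V| = sgn V (V - U) + sgn V U with the interpolation U, the average of the first
  term is at most \<open>rough\<close>, hence at most x / 2, and that of the second is the sum of
  the block increments times the slopes. If all slopes were below 1 / (2 d), the second would be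
  below x / 2.\<close>

lemma slope_exists:
  assumes n: "n = d * q" "d > 0" and V: "tame d q x V" "x \<le> abs_avg n V" "0 < x"
  shows "\<exists>j<d. 1 / (2 * real d) \<le> \<bar>slope n q j V\<bar>"
proof (rule ccontr)
  assume "\<not> ?thesis"
  then have sl: "\<bar>slope n q j V\<bar> < 1 / (2 * real d)" if "j < d" for j using that by force
  have "abs_avg n V = avg n (\<lambda>k. sgn (V k) * (V k - coarse d q V k) + sgn (V k) * coarse d q V k)"
    unfolding abs_avg_def by (intro avg_cong) (simp add: abs_sgn algebra_simps)
  also have "\<dots> = avg n (\<lambda>k. sgn (V k) * (V k - coarse d q V k)) + avg n (\<lambda>k. sgn (V k) * coarse d q V k)"
    by (rule avg_add)
  also have "avg n (\<lambda>k. sgn (V k) * (V k - coarse d q V k)) \<le> rough d q V"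
    unfolding rough_def n(1)
  proof (rule avg_mono)
    fix k
    show "sgn (V k) * (V k - coarse d q V k) \<le> \<bar>V k - coarse d q V k\<bar>"
      by (cases "V k" "0::real" rule: linorder_cases) auto
  qed
  also have "avg n (\<lambda>k. sgn (V k) * coarse d q V k) = (\<Sum>j<d. block_incr q V j * slope n q j V)"
  proof -
    have "avg n (\<lambda>k. sgn (V k) * coarse d q V k) = avg n (\<lambda>k. \<Sum>j<d. block_incr q V j * (sgn (V k) * ramp q j k))"
      unfolding coarse_def sum_distrib_left by (intro avg_cong sum.cong) auto
    then show ?thesis unfolding avg_sum avg_cmult slope_def .
  qed
  also have "(\<Sum>j<d. block_incr q V j * slope n q j V) < (\<Sum>j<d. x * (1 / (2 * real d)))"
  proof (rule sum_strict_mono)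
    fix j assume j: "j \<in> {..<d}"
    have "block_incr q V j * slope n q j V \<le> \<bar>block_incr q V j\<bar> * \<bar>slope n q j V\<bar>" by (simp add: abs_mult[symmetric])
    also have "\<dots> \<le> x * \<bar>slope n q j V\<bar>" using V(1) j by (intro mult_right_mono) (auto simp: tame_def)
    also have "\<dots> < x * (1 / (2 * real d))" using sl[of j] j V(3) by (intro mult_strict_left_mono) auto
    finally show "block_incr q V j * slope n q j V < x * (1 / (2 * real d))" .
  qed (use n in auto)
  also have "(\<Sum>j<d. x * (1 / (2 * real d))) = x / 2" using n by simp
  finally show False using V by (simp add: tame_def)
qed

text \<open>Smoothing: the path is moved along a ramp on which the functional has slope bounded away
  from zero, so that only a small portion of the shifts hits a short interval. This converts tail
  probabilities into bounds for the density.\<close>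

lemma smooth_direction:
  assumes q: "q > 0" "n = d * q" "j < d" and x: "0 < x" and ab: "a < b"
    and \<epsilon>: "\<epsilon> = 1 \<or> \<epsilon> = - 1"
    and E: "Measurable.pred paths E" and E': "Measurable.pred paths E'"
    and thick: "\<And>V s. \<bar>s\<bar> \<le> 1 / (real d * (x + 1)) \<Longrightarrow> E (\<lambda>k. V k + s * ramp q j k) \<Longrightarrow> E' V"
  shows "path_prob \<nu> n (\<lambda>V. E V \<and> \<bar>block_incr q V j\<bar> \<le> x \<and> 1 / (2 * real d) \<le> \<epsilon> * slope n q j V \<and> a < abs_avg n V \<and> abs_avg n V < b)
    \<le> exp (1 + \<bar>\<nu>\<bar>) * (real d * (x + 1)) * (2 * real d * (b - a)) * path_prob \<nu> n E'"
proof -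
  have d: "d > 0" using q by simp
  interpret G: prob_space "gauss n" by (rule prob_space_gauss)
  interpret P: pair_sigma_finite "gauss n" lborel ..
  \<comment> \<open>For shifts up to s0 the Cameron-Martin weight stays below exp(1 +
    |\<open>\<nu>\<close>|): on the event that the block increment is at most x, the linear form is
    bounded by d (x + 1) + |\<open>\<nu>\<close>|, and s0 d (x + 1) = 1.\<close>
  define s0 where "s0 = 1 / (real d * (x + 1))"
  have s0: "0 < s0" "s0 \<le> 1" "s0 * (real d * (x + 1)) = 1"
  proof -
    have "1 * 1 \<le> real d * (x + 1)" using d x by (intro mult_mono) auto
    then show "0 < s0" "s0 \<le> 1" "s0 * (real d * (x + 1)) = 1" using d x by (auto simp: s0_def field_simps)
  qed
  define E0 where "E0 V \<longleftrightarrow> E V \<and> \<bar>block_incr q V j\<bar> \<le> x \<and> 1 / (2 * real d) \<le> \<epsilon> * slope n q j V \<and> a < abs_avg n V \<and> abs_avg n V < b" for V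
  have E0m: "Measurable.pred paths E0"
    unfolding E0_def[abs_def] using E by measurable
  define I where "I V = (indicator (Collect E0) V :: ennreal)" for V
  have Im: "(\<lambda>x. I (f x)) \<in> borel_measurable M" if "\<And>k. (\<lambda>x. f x k) \<in> borel_measurable M" for M :: "'z measure" and f
    using pred_paths[OF E0m that] unfolding I_def indicator_def mem_Collect_eq by measurable
  let ?C = "ennreal (exp (1 + \<bar>\<nu>\<bar>))"
  let ?V = "\<lambda>s \<xi> k. drift_walk \<nu> n \<xi> k + (\<epsilon> * s) * ramp q j k"
  have mV: "(\<lambda>p. ?V (snd p) (fst p) k) \<in> borel_measurable (gauss n \<Otimes>\<^sub>M lborel)" for k
    by (intro borel_measurable_add borel_measurable_times borel_measurable_const measurable_compose[OF measurable_fst measurable_drift_walk]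
        measurable_compose[OF measurable_snd measurable_ident_sets]) auto
  have one: "ennreal (path_prob \<nu> n E0) \<le> ?C * (\<integral>\<^sup>+\<xi>. I (?V s \<xi>) \<partial>gauss n)" if s: "0 \<le> s" "s \<le> s0" for s
  proof -
    have "ennreal (path_prob \<nu> n E0) = (\<integral>\<^sup>+\<xi>. I (drift_walk \<nu> n \<xi>) \<partial>gauss n)"
    proof -
      have "ennreal (path_prob \<nu> n E0) = (\<integral>\<^sup>+\<xi>. indicator {\<xi>\<in>space (gauss n). E0 (drift_walk \<nu> n \<xi>)} \<xi> \<partial>gauss n)"
        unfolding emeasure_path_prob[symmetric] using pred_drift_walk[OF E0m, where n=n and \<nu>=\<nu>] by (subst nn_integral_indicator) auto
      also have "\<dots> = (\<integral>\<^sup>+\<xi>. I (drift_walk \<nu> n \<xi>) \<partial>gauss n)"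
        by (intro nn_integral_cong) (auto simp: I_def indicator_def)
      finally show ?thesis .
    qed
    also have "\<dots> = (\<integral>\<^sup>+\<xi>. I (drift_walk \<nu> n (shift n (\<lambda>i. (\<epsilon> * s) * ramp_dir n q j i) \<xi>))
        * ennreal (exp (- lin n (\<lambda>i. (\<epsilon> * s) * ramp_dir n q j i) \<xi> - (\<Sum>i<n. ((\<epsilon> * s) * ramp_dir n q j i)\<^sup>2) / 2)) \<partial>gauss n)"
      by (rule gauss_shift) (intro Im measurable_drift_walk)
    also have "\<dots> \<le> (\<integral>\<^sup>+\<xi>. ?C * I (?V s \<xi>) \<partial>gauss n)"
    proof (rule nn_integral_mono)
      fix \<xi>
      have v: "drift_walk \<nu> n (shift n (\<lambda>i. (\<epsilon> * s) * ramp_dir n q j i) \<xi>) = ?V s \<xi>"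
        unfolding drift_walk_shift walk_scale walk_ramp_dir[OF q] ..
      have l: "lin n (\<lambda>i. (\<epsilon> * s) * ramp_dir n q j i) \<xi> = (\<epsilon> * s) * lin n (ramp_dir n q j) \<xi>"
        by (simp add: lin_def sum_distrib_left mult.assoc)
      show "I (drift_walk \<nu> n (shift n (\<lambda>i. (\<epsilon> * s) * ramp_dir n q j i) \<xi>))
        * ennreal (exp (- lin n (\<lambda>i. (\<epsilon> * s) * ramp_dir n q j i) \<xi> - (\<Sum>i<n. ((\<epsilon> * s) * ramp_dir n q j i)\<^sup>2) / 2)) \<le> ?C * I (?V s \<xi>)"
      proof (cases "E0 (?V s \<xi>)")
        case True
        have "\<bar>block_incr q (drift_walk \<nu> n \<xi>) j + \<epsilon> * s\<bar> \<le> x"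
          using True block_incr_add_ramp[OF q(1), of "drift_walk \<nu> n \<xi>" "\<epsilon> * s" j j] by (simp add: E0_def)
        moreover have "\<bar>\<epsilon> * s\<bar> = s" using \<epsilon> s by auto
        ultimately have "\<bar>block_incr q (drift_walk \<nu> n \<xi>) j\<bar> \<le> x + s" by linarith
        then have "real d * \<bar>block_incr q (drift_walk \<nu> n \<xi>) j\<bar> \<le> real d * (x + s)" by (intro mult_left_mono) auto
        moreover have "real d * \<bar>block_incr q (drift_walk \<nu> n \<xi>) j\<bar> = \<bar>\<nu> + lin n (ramp_dir n q j) \<xi>\<bar>"
          unfolding block_incr_drift_walk[OF q] using d by simp
        ultimately have "\<bar>lin n (ramp_dir n q j) \<xi>\<bar> \<le> real d * (x + s) + \<bar>\<nu>\<bar>" by linarith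
        then have "s * \<bar>lin n (ramp_dir n q j) \<xi>\<bar> \<le> s * (real d * (x + s) + \<bar>\<nu>\<bar>)" using s by (intro mult_left_mono)
        also have "\<dots> \<le> s0 * (real d * (x + 1)) + 1 * \<bar>\<nu>\<bar>"
          unfolding distrib_left using s s0 x by (intro add_mono mult_mono) auto
        finally have "s * \<bar>lin n (ramp_dir n q j) \<xi>\<bar> \<le> 1 + \<bar>\<nu>\<bar>" using s0 by simp
        moreover have "- ((\<epsilon> * s) * lin n (ramp_dir n q j) \<xi>) \<le> s * \<bar>lin n (ramp_dir n q j) \<xi>\<bar>"
        proof -
          have "\<bar>(\<epsilon> * s) * lin n (ramp_dir n q j) \<xi>\<bar> = s * \<bar>lin n (ramp_dir n q j) \<xi>\<bar>"
            by (simp only: abs_mult[of "\<epsilon> * s"] \<open>\<bar>\<epsilon> * s\<bar> = s\<close>)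
          then show ?thesis by linarith
        qed
        moreover have "0 \<le> (\<Sum>i<n. ((\<epsilon> * s) * ramp_dir n q j i)\<^sup>2) / 2" by (simp add: sum_nonneg)
        ultimately have "- lin n (\<lambda>i. (\<epsilon> * s) * ramp_dir n q j i) \<xi> - (\<Sum>i<n. ((\<epsilon> * s) * ramp_dir n q j i)\<^sup>2) / 2 \<le> 1 + \<bar>\<nu>\<bar>"
          unfolding l by linarith
        then have "ennreal (exp (- lin n (\<lambda>i. (\<epsilon> * s) * ramp_dir n q j i) \<xi> - (\<Sum>i<n. ((\<epsilon> * s) * ramp_dir n q j i)\<^sup>2) / 2)) \<le> ?C"
          by (intro ennreal_leI) simp
        then show ?thesis unfolding v using True by (simp add: I_def)
      next
        case False
        then show ?thesis unfolding v by (simp add: I_def)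
      qed
    qed
    also have "\<dots> = ?C * (\<integral>\<^sup>+\<xi>. I (?V s \<xi>) \<partial>gauss n)"
      by (intro nn_integral_cmult Im) measurable
    finally show ?thesis .
  qed
  \<comment> \<open>The bound \<open>one\<close> is averaged over all shifts in [0, s0]. After
    exchanging the integrals only the length of the set of shifts that lead into the event matters,
    for each fixed path.\<close>
  have "ennreal s0 * ennreal (path_prob \<nu> n E0) = (\<integral>\<^sup>+s. ennreal (path_prob \<nu> n E0) * indicator {0..s0} s \<partial>lborel)"
    using s0 by (subst nn_integral_cmult_indicator) (auto simp: mult.commute)
  also have "\<dots> \<le> (\<integral>\<^sup>+s. (\<integral>\<^sup>+\<xi>. ?C * (indicator {0..s0} s * I (?V s \<xi>)) \<partial>gauss n) \<partial>lborel)"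
  proof (rule nn_integral_mono)
    fix s :: real
    have "(\<integral>\<^sup>+\<xi>. ?C * (indicator {0..s0} s * I (?V s \<xi>)) \<partial>gauss n) = ?C * (indicator {0..s0} s * (\<integral>\<^sup>+\<xi>. I (?V s \<xi>) \<partial>gauss n))"
      by (subst nn_integral_cmult, (intro borel_measurable_times_ennreal Im; measurable), subst nn_integral_cmult, (intro Im; measurable), simp)
    then show "ennreal (path_prob \<nu> n E0) * indicator {0..s0} s \<le> (\<integral>\<^sup>+\<xi>. ?C * (indicator {0..s0} s * I (?V s \<xi>)) \<partial>gauss n)"
      using one[of s] by (cases "s \<in> {0..s0}") auto
  qed
  also have "\<dots> = (\<integral>\<^sup>+\<xi>. (\<integral>\<^sup>+s. ?C * (indicator {0..s0} s * I (?V s \<xi>)) \<partial>lborel) \<partial>gauss n)"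
  proof (rule P.Fubini')
    have "(\<lambda>p. I (?V (snd p) (fst p))) \<in> borel_measurable (gauss n \<Otimes>\<^sub>M lborel)"
      by (rule Im) (rule mV)
    moreover have "(\<lambda>p. indicator {0..s0} (snd p) :: ennreal) \<in> borel_measurable (gauss n \<Otimes>\<^sub>M lborel)"
      by measurable
    ultimately show "(\<lambda>(\<xi>, s). ?C * (indicator {0..s0} s * I (?V s \<xi>))) \<in> borel_measurable (gauss n \<Otimes>\<^sub>M lborel)"
      unfolding case_prod_beta by (intro borel_measurable_times_ennreal borel_measurable_const)
  qed
  also have "\<dots> \<le> (\<integral>\<^sup>+\<xi>. ?C * ennreal (2 * real d * (b - a)) * indicator {\<xi>\<in>space (gauss n). E' (drift_walk \<nu> n \<xi>)} \<xi> \<partial>gauss n)"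
  proof (rule nn_integral_mono)
    fix \<xi> assume \<xi>: "\<xi> \<in> space (gauss n)"
    define T where "T = {s \<in> {0..s0}. E0 (?V s \<xi>)}"
    have mV': "(\<lambda>s. ?V s \<xi> k) \<in> borel_measurable borel" for k by measurable
    have "Measurable.pred borel (\<lambda>s. s \<in> {0..s0} \<and> E0 (?V s \<xi>))"
      using pred_paths[OF E0m mV'] by measurable
    then have Tm: "T \<in> sets lborel" unfolding T_def by (simp add: pred_def)
    have "(\<integral>\<^sup>+s. ?C * (indicator {0..s0} s * I (?V s \<xi>)) \<partial>lborel) = (\<integral>\<^sup>+s. ?C * indicator T s \<partial>lborel)"
      by (intro nn_integral_cong) (auto simp: T_def I_def indicator_def)
    also have "\<dots> = ?C * emeasure lborel T" using Tm by (rule nn_integral_cmult_indicator)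
    also have "\<dots> \<le> ?C * (ennreal (2 * real d * (b - a)) * indicator {\<xi>\<in>space (gauss n). E' (drift_walk \<nu> n \<xi>)} \<xi>)"
    proof (cases "T = {}")
      case False
      then obtain s where "s \<in> T" by auto
      then have "E (?V s \<xi>)" "\<bar>\<epsilon> * s\<bar> \<le> 1 / (real d * (x + 1))" using \<epsilon> by (auto simp: T_def E0_def s0_def)
      then have "E' (drift_walk \<nu> n \<xi>)" by (intro thick[of "\<epsilon> * s"])
      \<comment> \<open>By the subgradient at the smaller of two shifts, \<open>abs_avg\<close>
        grows between them at a rate of at least 1 / (2 d), but by no more than b - a.\<close>
      moreover have "emeasure lborel T \<le> ennreal (2 * real d * (b - a))"
      proof (rule emeasure_diameter_le)
        fix s s' assume s: "s \<in> T" "s' \<in> T" "s < s'"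
        have "(\<lambda>k. ?V s \<xi> k + (\<epsilon> * (s' - s)) * ramp q j k) = ?V s' \<xi>"
          by (simp add: algebra_simps)
        then have "abs_avg n (?V s \<xi>) + (\<epsilon> * (s' - s)) * slope n q j (?V s \<xi>) \<le> abs_avg n (?V s' \<xi>)"
          using slope_le[of n "?V s \<xi>" "\<epsilon> * (s' - s)" q j] by simp
        moreover have "abs_avg n (?V s' \<xi>) < b" "a < abs_avg n (?V s \<xi>)" "1 / (2 * real d) \<le> \<epsilon> * slope n q j (?V s \<xi>)"
          using s by (auto simp: T_def E0_def)
        moreover have "(s' - s) * (1 / (2 * real d)) \<le> (s' - s) * (\<epsilon> * slope n q j (?V s \<xi>))"
          using s calculation by (intro mult_left_mono) auto
        ultimately have "(s' - s) * (1 / (2 * real d)) \<le> b - a" by (simp add: ac_simps)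
        then show "s' - s \<le> 2 * real d * (b - a)" using d by (simp add: field_simps)
      qed (use ab d in auto)
      ultimately show ?thesis using \<xi> by (intro mult_left_mono) auto
    qed simp
    finally show "(\<integral>\<^sup>+s. ?C * (indicator {0..s0} s * I (?V s \<xi>)) \<partial>lborel)
      \<le> ?C * ennreal (2 * real d * (b - a)) * indicator {\<xi>\<in>space (gauss n). E' (drift_walk \<nu> n \<xi>)} \<xi>"
      by (simp add: mult.assoc)
  qed
  also have "\<dots> = ?C * ennreal (2 * real d * (b - a)) * ennreal (path_prob \<nu> n E')"
    unfolding emeasure_path_prob[symmetric] using pred_drift_walk[OF E', where n=n and \<nu>=\<nu>] by (intro nn_integral_cmult_indicator) auto
  finally have "ennreal (s0 * path_prob \<nu> n E0) \<le> ennreal (exp (1 + \<bar>\<nu>\<bar>) * (2 * real d * (b - a)) * path_prob \<nu> n E')"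
    using s0 ab by (simp add: ennreal_mult' path_prob_nonneg)
  then have "s0 * path_prob \<nu> n E0 \<le> exp (1 + \<bar>\<nu>\<bar>) * (2 * real d * (b - a)) * path_prob \<nu> n E'"
    using ab by (subst (asm) ennreal_le_iff) (auto simp: path_prob_nonneg)
  then have "(real d * (x + 1)) * (s0 * path_prob \<nu> n E0) \<le> (real d * (x + 1)) * (exp (1 + \<bar>\<nu>\<bar>) * (2 * real d * (b - a)) * path_prob \<nu> n E')"
    using x by (intro mult_left_mono) auto
  also have "(real d * (x + 1)) * (s0 * path_prob \<nu> n E0) = (s0 * (real d * (x + 1))) * path_prob \<nu> n E0"
    by (simp only: ac_simps)
  finally have "path_prob \<nu> n E0 \<le> (real d * (x + 1)) * (exp (1 + \<bar>\<nu>\<bar>) * (2 * real d * (b - a)) * path_prob \<nu> n E')"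
    by (simp only: s0(3) mult_1_left)
  then show ?thesis unfolding E0_def[abs_def] by (simp only: ac_simps)
qed

text \<open>Union bound over the d ramps and the two signs of the slope; \<open>slope_exists\<close>
  provides one of these 2 d directions for each path.\<close>

lemma smooth:
  assumes q: "q > 0" "n = d * q" "d > 0" and x: "0 < x" "x \<le> a" and ab: "a < b"
    and E: "Measurable.pred paths E" and E': "Measurable.pred paths E'"
    and thick: "\<And>V s j. j < d \<Longrightarrow> \<bar>s\<bar> \<le> 1 / (real d * (x + 1)) \<Longrightarrow> E (\<lambda>k. V k + s * ramp q j k) \<Longrightarrow> E' V"
  shows "path_prob \<nu> n (\<lambda>V. E V \<and> tame d q x V \<and> a < abs_avg n V \<and> abs_avg n V < b)
    \<le> 4 * real d ^ 3 * exp (1 + \<bar>\<nu>\<bar>) * (x + 1) * (b - a) * path_prob \<nu> n E'"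
proof -
  let ?F = "\<lambda>(j, \<epsilon>) V. E V \<and> \<bar>block_incr q V j\<bar> \<le> x \<and> 1 / (2 * real d) \<le> \<epsilon> * slope n q j V \<and> a < abs_avg n V \<and> abs_avg n V < b"
  let ?I = "{..<d} \<times> {1, - 1 :: real}"
  let ?B = "exp (1 + \<bar>\<nu>\<bar>) * (real d * (x + 1)) * (2 * real d * (b - a)) * path_prob \<nu> n E'"
  have Fm: "Measurable.pred paths (?F p)" for p
    unfolding case_prod_beta using E by measurable
  have "path_prob \<nu> n (\<lambda>V. E V \<and> tame d q x V \<and> a < abs_avg n V \<and> abs_avg n V < b) \<le> path_prob \<nu> n (\<lambda>V. \<exists>p\<in>?I. ?F p V)"
  proof (rule path_prob_mono)
    show "Measurable.pred paths (\<lambda>V. \<exists>p\<in>?I. ?F p V)" by (intro pred_intros_finite Fm) auto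
    fix V assume V: "E V \<and> tame d q x V \<and> a < abs_avg n V \<and> abs_avg n V < b"
    then obtain j where j: "j < d" "1 / (2 * real d) \<le> \<bar>slope n q j V\<bar>"
      using slope_exists[OF q(2,3), of x V] x by auto
    have dj: "\<bar>block_incr q V j\<bar> \<le> x" using V j by (simp add: tame_def)
    show "\<exists>p\<in>?I. ?F p V"
    proof (cases "slope n q j V \<ge> 0")
      case True
      then show ?thesis using V j dj by (intro bexI[of _ "(j, 1)"]) auto
    next
      case False
      then show ?thesis using V j dj by (intro bexI[of _ "(j, - 1)"]) auto
    qed
  qed
  also have "\<dots> \<le> (\<Sum>p\<in>?I. path_prob \<nu> n (?F p))" by (rule path_prob_ex_le) (use Fm in auto)
  also have "\<dots> \<le> (\<Sum>p\<in>?I. ?B)"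
  proof (rule sum_mono)
    fix p assume p: "p \<in> ?I"
    obtain j \<epsilon> where [simp]: "p = (j, \<epsilon>)" by (cases p)
    have j: "j < d" "\<epsilon> = 1 \<or> \<epsilon> = - 1" using p by auto
    show "path_prob \<nu> n (?F p) \<le> ?B"
      using smooth_direction[OF q(1,2) j(1) x(1) ab j(2) E E' thick[OF j(1)], where \<nu>=\<nu>] by simp
  qed
  also have "\<dots> = 4 * real d ^ 3 * exp (1 + \<bar>\<nu>\<bar>) * (x + 1) * (b - a) * path_prob \<nu> n E'"
    by (simp add: card_cartesian_product power3_eq_cube)
  finally show ?thesis .
qed

section \<open>Chaining over dyadic grids\<close>

lemma ramp_mono: "q > 0 \<Longrightarrow> k \<le> l \<Longrightarrow> ramp q j k \<le> ramp q j l"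
  unfolding ramp_def by (intro divide_right_mono) auto

lemma sum_block_incr: "(\<Sum>j<d. block_incr q V j) = V (d * q) - V 0"
  unfolding block_incr_def by (induction d) (auto simp: add.commute)

lemma block_incr_ramp_bounds: "q' > 0 \<Longrightarrow> 0 \<le> block_incr q (ramp q' j) i" "q' > 0 \<Longrightarrow> block_incr q (ramp q' j) i \<le> 1"
  using ramp_mono[of q' "i * q" "i * q + q" j] ramp_bounds[of q' j "i * q + q"] ramp_bounds[of q' j "i * q"]
  by (auto simp: block_incr_def)

lemma coarse_ramp_bounds:
  assumes "q > 0" "q' > 0" shows "0 \<le> coarse d q (ramp q' j) k" "coarse d q (ramp q' j) k \<le> 1"
proof -
  show "0 \<le> coarse d q (ramp q' j) k"
    unfolding coarse_def using assms by (intro sum_nonneg mult_nonneg_nonneg block_incr_ramp_bounds ramp_bounds)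
  have "coarse d q (ramp q' j) k \<le> (\<Sum>i<d. block_incr q (ramp q' j) i * 1)"
    unfolding coarse_def using assms by (intro sum_mono mult_left_mono block_incr_ramp_bounds ramp_bounds)
  also have "\<dots> \<le> 1" using ramp_bounds[of q' j] assms sum_block_incr[of q "ramp q' j" d] by (simp add: ramp_def)
  finally show "coarse d q (ramp q' j) k \<le> 1" .
qed

lemma coarse_lin: "coarse d q (\<lambda>k. V k + s * g k) k = coarse d q V k + s * coarse d q g k"
proof -
  have "block_incr q (\<lambda>k. V k + s * g k) i = block_incr q V i + s * block_incr q g i" for i by (simp add: block_incr_def algebra_simps)
  then show ?thesis by (simp add: coarse_def algebra_simps sum.distrib sum_distrib_left)
qed

text \<open>The ramp may belong to another grid and then is not reproduced by the interpolation; but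
  both the ramp and its interpolation lie between 0 and 1, so they differ by at most 1.\<close>

lemma rough_perturb:
  assumes "q > 0" "q' > 0" "d > 0"
  shows "rough d q (\<lambda>k. V k + s * ramp q' j k) \<le> rough d q V + \<bar>s\<bar>"
proof -
  have "rough d q (\<lambda>k. V k + s * ramp q' j k) \<le> avg (d * q) (\<lambda>k. \<bar>V k - coarse d q V k\<bar> + \<bar>s\<bar>)"
    unfolding rough_def coarse_lin
  proof (rule avg_mono)
    fix k
    have "\<bar>ramp q' j k - coarse d q (ramp q' j) k\<bar> \<le> 1"
      using ramp_bounds[of q' j k] coarse_ramp_bounds[OF assms(1,2), of d j k] assms by auto
    then have "\<bar>s\<bar> * \<bar>ramp q' j k - coarse d q (ramp q' j) k\<bar> \<le> \<bar>s\<bar> * 1" by (intro mult_left_mono) auto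
    then have "\<bar>s * (ramp q' j k - coarse d q (ramp q' j) k)\<bar> \<le> \<bar>s\<bar>" by (simp add: abs_mult)
    moreover have "V k + s * ramp q' j k - (coarse d q V k + s * coarse d q (ramp q' j) k)
      = (V k - coarse d q V k) + s * (ramp q' j k - coarse d q (ramp q' j) k)" by (simp add: algebra_simps)
    ultimately show "\<bar>V k + s * ramp q' j k - (coarse d q V k + s * coarse d q (ramp q' j) k)\<bar> \<le> \<bar>V k - coarse d q V k\<bar> + \<bar>s\<bar>"
      by linarith
  qed
  also have "\<dots> = rough d q V + \<bar>s\<bar>"
    unfolding avg_add using assms by (simp add: rough_def avg_const)
  finally show ?thesis .
qed

text \<open>A thickened form of the failure of \<open>tame\<close>: the thresholds leave room for a
  shift of size x / 4 along a ramp of any grid.\<close>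

definition wild :: "nat \<Rightarrow> nat \<Rightarrow> real \<Rightarrow> (nat \<Rightarrow> real) \<Rightarrow> bool" where
  "wild d q x V \<longleftrightarrow> x / 4 \<le> rough d q V \<or> (\<exists>j<d. x / 2 \<le> \<bar>block_incr q V j\<bar>)"

lemma pred_wild [measurable]: "Measurable.pred paths (wild d q x)"
  unfolding wild_def[abs_def] by measurable

lemma wild_thick:
  assumes q: "q > 0" "q' > 0" "d > 0" and s: "\<bar>s\<bar> \<le> x / 4" and x: "x > 0"
    and V: "\<not> tame d q x (\<lambda>k. V k + s * ramp q' j k)"
  shows "wild d q x V"
proof (cases "rough d q (\<lambda>k. V k + s * ramp q' j k) \<le> x / 2")
  case False
  then show ?thesis using rough_perturb[OF q, of V s j] s by (auto simp: wild_def)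
next
  case True
  then obtain i where i: "i < d" "x < \<bar>block_incr q (\<lambda>k. V k + s * ramp q' j k) i\<bar>"
    using V by (auto simp: tame_def not_le)
  have "block_incr q (\<lambda>k. V k + s * ramp q' j k) i = block_incr q V i + s * block_incr q (ramp q' j) i" by (simp add: block_incr_def algebra_simps)
  moreover have "\<bar>s * block_incr q (ramp q' j) i\<bar> \<le> \<bar>s\<bar> * 1"
    unfolding abs_mult using block_incr_ramp_bounds[OF q(2), of q j i] by (intro mult_left_mono) auto
  ultimately have "x / 2 \<le> \<bar>block_incr q V i\<bar>" using i s x by linarith
  then show ?thesis using i by (auto simp: wild_def)
qed

text \<open>The roughness threshold contributes the exponent (x / 4)^2 d / 2. For an increment, the
  drift uses up at most half of d x / 2, and (d x / 4)^2 / (2 d) is the same number d x^2 /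
  32.\<close>

lemma path_prob_wild:
  assumes q: "q > 0" "n = d * q" "d > 0" and x: "x > 0" "4 * \<bar>\<nu>\<bar> \<le> real d * x"
  shows "path_prob \<nu> n (wild d q x) \<le> 4 * real d * exp (- (real d * x\<^sup>2 / 32))"
proof -
  let ?e = "exp (- (real d * x\<^sup>2 / 32))"
  have r: "path_prob \<nu> n (\<lambda>V. x / 4 \<le> rough d q V) \<le> 2 * ?e"
  proof -
    have "ennreal (path_prob \<nu> n (\<lambda>V. x / 4 \<le> rough d q V)) \<le> ennreal (2 * exp (- ((x/4)\<^sup>2 * real d / 2)))"
      unfolding emeasure_path_prob[symmetric] using x by (intro rough_tail q) auto
    also have "- ((x/4)\<^sup>2 * real d / 2) = - (real d * x\<^sup>2 / 32)" by (simp add: power_divide)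
    finally show ?thesis by (subst (asm) ennreal_le_iff) auto
  qed
  have dlt: "path_prob \<nu> n (\<lambda>V. x / 2 \<le> \<bar>block_incr q V j\<bar>) \<le> 2 * ?e" if j: "j < d" for j
  proof -
    have "\<bar>\<nu>\<bar> \<le> real d * (x / 2)" using x(2) unfolding times_divide_eq_right by linarith
    then have "ennreal (path_prob \<nu> n (\<lambda>V. x / 2 \<le> \<bar>block_incr q V j\<bar>)) \<le> ennreal (2 * exp (- (real d * (x/2) - \<bar>\<nu>\<bar>)\<^sup>2 / (2 * real d)))"
      unfolding emeasure_path_prob[symmetric] by (intro block_incr_tail q j)
    then have "path_prob \<nu> n (\<lambda>V. x / 2 \<le> \<bar>block_incr q V j\<bar>) \<le> 2 * exp (- (real d * (x/2) - \<bar>\<nu>\<bar>)\<^sup>2 / (2 * real d))"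
      by (subst (asm) ennreal_le_iff) auto
    also have "\<dots> \<le> 2 * ?e"
    proof -
      have "real d * x / 4 \<le> real d * (x/2) - \<bar>\<nu>\<bar>" using x(2) unfolding times_divide_eq_right by linarith
      then have "(real d * x / 4)\<^sup>2 \<le> (real d * (x/2) - \<bar>\<nu>\<bar>)\<^sup>2" using x by (intro power_mono) auto
      then have "(real d * x / 4)\<^sup>2 / (2 * real d) \<le> (real d * (x/2) - \<bar>\<nu>\<bar>)\<^sup>2 / (2 * real d)"
        by (intro divide_right_mono) auto
      moreover have "(real d * x / 4)\<^sup>2 / (2 * real d) = real d * x\<^sup>2 / 32"
        using q by (simp add: power2_eq_square)
      ultimately show ?thesis by simp
    qed
    finally show ?thesis .
  qed
  have "path_prob \<nu> n (wild d q x) \<le> path_prob \<nu> n (\<lambda>V. x / 4 \<le> rough d q V) + path_prob \<nu> n (\<lambda>V. \<exists>j\<in>{..<d}. x / 2 \<le> \<bar>block_incr q V j\<bar>)"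
    unfolding wild_def[abs_def] Bex_def lessThan_iff by (rule path_prob_disj) measurable
  also have "path_prob \<nu> n (\<lambda>V. \<exists>j\<in>{..<d}. x / 2 \<le> \<bar>block_incr q V j\<bar>) \<le> (\<Sum>j<d. path_prob \<nu> n (\<lambda>V. x / 2 \<le> \<bar>block_incr q V j\<bar>))"
    by (rule path_prob_ex_le) measurable
  also have "\<dots> \<le> (\<Sum>j<d. 2 * ?e)" by (intro sum_mono dlt) auto
  also have "path_prob \<nu> n (\<lambda>V. x / 4 \<le> rough d q V) + (\<Sum>j<d. 2 * ?e) \<le> 2 * ?e + real d * (2 * ?e)"
    using r by simp
  also have "\<dots> \<le> real d * (2 * ?e) + real d * (2 * ?e)" using q by simp
  finally show ?thesis by simp
qed

text \<open>The fifth power is the first that beats \<open>16 ^ m\<close> when c is multiplied by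
  2^m: the terms become 16^m / 32^m.\<close>

lemma exp_neg_le_power5: assumes "0 < (c::real)" shows "exp (- c) \<le> (5 / c) ^ 5"
proof -
  have "(c / 5) ^ 5 \<le> exp (c / 5) ^ 5"
    using exp_ge_add_one_self[of "c / 5"] assms by (intro power_mono) linarith+
  also have "exp (c / 5) ^ 5 = exp c" by (simp add: exp_of_nat_mult[symmetric])
  finally have "inverse (exp c) \<le> inverse ((c / 5) ^ 5)" using assms by (intro le_imp_inverse_le) auto
  then show ?thesis by (simp add: exp_minus power_divide)
qed

lemma sum_levels_le:
  assumes "0 < (c::real)"
  shows "(\<Sum>m=M..<N. 16 ^ m * exp (- (2 ^ m * c))) \<le> 2 * (5 / c) ^ 5"
proof -
  have "(\<Sum>m=M..<N. 16 ^ m * exp (- (2 ^ m * c))) \<le> (\<Sum>m<N. 16 ^ m * exp (- (2 ^ m * c)))"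
    by (rule sum_mono2) auto
  also have "\<dots> \<le> (\<Sum>m<N. (5 / c) ^ 5 * (1 / 2) ^ m)"
  proof (rule sum_mono)
    fix m
    have "(16::real) ^ m * exp (- (2 ^ m * c)) \<le> 16 ^ m * (5 / (2 ^ m * c)) ^ 5"
      using assms by (intro mult_left_mono exp_neg_le_power5) auto
    also have "\<dots> = (5 / c) ^ 5 * (16 ^ m / (2 ^ m) ^ 5)" by (simp add: power_divide power_mult_distrib ac_simps)
    also have "(16::real) ^ m / (2 ^ m) ^ 5 = (1 / 2) ^ m"
    proof -
      have "((2::real) ^ m) ^ 5 = 32 ^ m" by (simp add: power_mult[symmetric] mult.commute[of m]) (simp add: power_mult)
      then show ?thesis by (simp add: power_divide[symmetric])
    qed
    finally show "(16::real) ^ m * exp (- (2 ^ m * c)) \<le> (5 / c) ^ 5 * (1 / 2) ^ m" .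
  qed
  also have "\<dots> = (5 / c) ^ 5 * (\<Sum>m<N. (1 / 2) ^ m)" by (simp add: sum_distrib_left)
  also have "\<dots> \<le> (5 / c) ^ 5 * 2"
  proof (rule mult_left_mono)
    have "(\<Sum>m<N. (1 / 2 :: real) ^ m) = 2 - 2 * (1 / 2) ^ N" by (induction N) auto
    then show "(\<Sum>m<N. (1 / 2 :: real) ^ m) \<le> 2" by simp
  qed (use assms in simp)
  finally show ?thesis by simp
qed

text \<open>At each level a path is either tame, and then it is smoothed there, or it is passed on
  to the next finer level. A path smoothed at level m + 1 failed at level m; the smoothing costs
  8^(m+1), but the thickened failure has probability at most 4 2^m exp(- 2^m x^2 / 32). What is
  still not tame at level N, where blocks consist of a single step, is the remainder without the
  factor b - a.\<close>

lemma levels: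
  fixes x :: real
  assumes MN: "M \<le> N" and x: "0 < x" "4 \<le> 2 ^ M * x" "4 * \<bar>\<nu>\<bar> \<le> 2 ^ M * x" "x \<le> a" and ab: "a < b"
    and E: "Measurable.pred paths E" and E': "Measurable.pred paths E'"
    and thick: "\<And>V s j. j < 2 ^ M \<Longrightarrow> \<bar>s\<bar> \<le> 1 / (2 ^ M * (x + 1)) \<Longrightarrow>
        E (\<lambda>k. V k + s * ramp (2 ^ (N - M)) j k) \<Longrightarrow> E' V"
  shows "path_prob \<nu> (2 ^ N) (\<lambda>V. E V \<and> a < abs_avg (2 ^ N) V \<and> abs_avg (2 ^ N) V < b)
    \<le> exp (1 + \<bar>\<nu>\<bar>) * (x + 1) * (b - a) * (4 * 8 ^ M * path_prob \<nu> (2 ^ N) E' + (\<Sum>m=M..<N. 128 * 16 ^ m * exp (- (2 ^ m * (x\<^sup>2 / 32)))))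
      + 4 * 2 ^ N * exp (- (2 ^ N * (x\<^sup>2 / 32)))"
proof -
  let ?n = "2 ^ N :: nat"
  let ?c = "exp (1 + \<bar>\<nu>\<bar>) * (x + 1) * (b - a)"
  let ?I = "\<lambda>V. a < abs_avg ?n V \<and> abs_avg ?n V < b"
  define ok where "ok m = tame (2 ^ m) (2 ^ (N - m)) x" for m
  have [measurable]: "Measurable.pred paths (ok m)" for m unfolding ok_def by measurable
  note [measurable] = E E'
  have big: "4 \<le> 2 ^ m * x" "4 * \<bar>\<nu>\<bar> \<le> 2 ^ m * x" if "M \<le> m" for m
  proof -
    have le: "2 ^ M * x \<le> 2 ^ m * x" using that x by (intro mult_right_mono power_increasing) auto
    show "4 \<le> 2 ^ m * x" by (rule order_trans[OF x(2) le])
    show "4 * \<bar>\<nu>\<bar> \<le> 2 ^ m * x" by (rule order_trans[OF x(3) le])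
  qed
  have nm: "?n = 2 ^ m * 2 ^ (N - m)" if "m \<le> N" for m using that by (simp add: power_add[symmetric])
  have c0: "0 \<le> ?c" using x ab by simp
  have nokm: "path_prob \<nu> ?n (wild (2 ^ m) (2 ^ (N - m)) x) \<le> 4 * 2 ^ m * exp (- (2 ^ m * (x\<^sup>2 / 32)))" if "M \<le> m" "m \<le> N" for m
    using path_prob_wild[OF _ nm[OF that(2)] _ x(1), of \<nu>] big[OF that(1)] by simp
  have main: "path_prob \<nu> ?n (\<lambda>V. E V \<and> ?I V) \<le> ?c * (4 * 8 ^ M * path_prob \<nu> ?n E' + (\<Sum>m=M..<m. 128 * 16 ^ m * exp (- (2 ^ m * (x\<^sup>2 / 32)))))
      + path_prob \<nu> ?n (\<lambda>V. \<not> ok m V \<and> ?I V)" if "M \<le> m" "m \<le> N" for m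
    using that
  proof (induction m rule: dec_induct)
    case base
    have "path_prob \<nu> ?n (\<lambda>V. E V \<and> ?I V) \<le> path_prob \<nu> ?n (\<lambda>V. (E V \<and> ok M V \<and> ?I V) \<or> (\<not> ok M V \<and> ?I V))"
    proof (rule path_prob_mono)
      show "Measurable.pred paths (\<lambda>V. (E V \<and> ok M V \<and> ?I V) \<or> (\<not> ok M V \<and> ?I V))" by measurable
    qed blast
    also have "\<dots> \<le> path_prob \<nu> ?n (\<lambda>V. E V \<and> ok M V \<and> ?I V) + path_prob \<nu> ?n (\<lambda>V. \<not> ok M V \<and> ?I V)"
      by (rule path_prob_disj) measurable
    also have "path_prob \<nu> ?n (\<lambda>V. E V \<and> ok M V \<and> ?I V) \<le> 4 * real (2 ^ M) ^ 3 * exp (1 + \<bar>\<nu>\<bar>) * (x + 1) * (b - a) * path_prob \<nu> ?n E'"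
      unfolding ok_def
    proof (rule smooth)
      show "?n = 2 ^ M * 2 ^ (N - M)" by (rule nm[OF MN])
    next
      fix V s j assume "j < 2 ^ M" "\<bar>s\<bar> \<le> 1 / (real (2 ^ M) * (x + 1))" "E (\<lambda>k. V k + s * ramp (2 ^ (N - M)) j k)"
      then show "E' V" using thick[of j s V] by simp
    qed (simp_all add: x ab E E')
    also have "real (2 ^ M) ^ 3 = 8 ^ M" by (simp add: power_mult[symmetric] mult.commute[of M]) (simp add: power_mult)
    finally show ?case by (simp add: ac_simps)
  next
    case (step m)
    \<comment> \<open>The shifts used at level m + 1 stay within the margin x / 4 that
      \<open>wild\<close> allows at level m.\<close>
    have sb: "1 / (real (2 ^ Suc m) * (x + 1)) \<le> x / 4"
    proof -
      have "2 * 4 * 1 \<le> (2 * (2 ^ m * x)) * (x + 1)" using big[of m] step x by (intro mult_mono) auto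
      then have "1 \<le> x / 4 * (real (2 ^ Suc m) * (x + 1))" by (simp add: algebra_simps)
      moreover have "0 < real (2 ^ Suc m) * (x + 1)" using x by simp
      ultimately show ?thesis by (simp only: pos_divide_le_eq)
    qed
    have "path_prob \<nu> ?n (\<lambda>V. \<not> ok m V \<and> ?I V) \<le> path_prob \<nu> ?n (\<lambda>V. (\<not> ok m V \<and> ok (Suc m) V \<and> ?I V) \<or> (\<not> ok (Suc m) V \<and> ?I V))"
    proof (rule path_prob_mono)
      show "Measurable.pred paths (\<lambda>V. (\<not> ok m V \<and> ok (Suc m) V \<and> ?I V) \<or> (\<not> ok (Suc m) V \<and> ?I V))" by measurable
    qed blast
    also have "\<dots> \<le> path_prob \<nu> ?n (\<lambda>V. \<not> ok m V \<and> ok (Suc m) V \<and> ?I V) + path_prob \<nu> ?n (\<lambda>V. \<not> ok (Suc m) V \<and> ?I V)"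
      by (rule path_prob_disj) measurable
    also have "path_prob \<nu> ?n (\<lambda>V. \<not> ok m V \<and> ok (Suc m) V \<and> ?I V)
      \<le> 4 * real (2 ^ Suc m) ^ 3 * exp (1 + \<bar>\<nu>\<bar>) * (x + 1) * (b - a) * path_prob \<nu> ?n (wild (2 ^ m) (2 ^ (N - m)) x)"
      unfolding ok_def[of "Suc m"]
    proof (rule smooth)
      show "?n = 2 ^ Suc m * 2 ^ (N - Suc m)" using step by (intro nm) auto
      fix V s j assume s: "\<bar>s\<bar> \<le> 1 / (real (2 ^ Suc m) * (x + 1))" "\<not> ok m (\<lambda>k. V k + s * ramp (2 ^ (N - Suc m)) j k)"
      then have "\<bar>s\<bar> \<le> x / 4" using sb by linarith
      then show "wild (2 ^ m) (2 ^ (N - m)) x V"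
        by (rule wild_thick[rotated 3]) (use s x in \<open>auto simp: ok_def\<close>)
    qed (use x ab in \<open>auto intro: pred_wild\<close>)
    also have "\<dots> \<le> 4 * real (2 ^ Suc m) ^ 3 * exp (1 + \<bar>\<nu>\<bar>) * (x + 1) * (b - a) * (4 * 2 ^ m * exp (- (2 ^ m * (x\<^sup>2 / 32))))"
      using step x ab by (intro mult_left_mono nokm) auto
    also have "\<dots> = ?c * (128 * 16 ^ m * exp (- (2 ^ m * (x\<^sup>2 / 32))))"
    proof -
      \<comment> \<open>The factor 8^(m+1) of the smoothing and the factor 2^m of the union bound
        combine to 8 16^m.\<close>
      have "real (2 ^ Suc m) ^ 3 * 2 ^ m = 8 * 16 ^ m"
      proof -
        have "((2::real) ^ m) ^ 3 * 2 ^ m = (2 ^ m) ^ 4" by (simp add: power_numeral_reduce)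
        also have "\<dots> = 16 ^ m" by (simp add: power_mult[symmetric] mult.commute[of m]) (simp add: power_mult)
        finally show ?thesis by (simp add: power_mult_distrib)
      qed
      then have e: "16 * (real (2 ^ Suc m) ^ 3 * 2 ^ m) = 128 * 16 ^ m" by simp
      have "4 * A * X * Y * Z * (4 * B * D) = X * Y * Z * (16 * (A * B) * D)" for A B D X Y Z :: real
        by simp
      then show ?thesis unfolding e[symmetric] .
    qed
    finally have st: "path_prob \<nu> ?n (\<lambda>V. \<not> ok m V \<and> ?I V) \<le> ?c * (128 * 16 ^ m * exp (- (2 ^ m * (x\<^sup>2 / 32)))) + path_prob \<nu> ?n (\<lambda>V. \<not> ok (Suc m) V \<and> ?I V)" by simp
    have "path_prob \<nu> ?n (\<lambda>V. E V \<and> ?I V) \<le> ?c * (4 * 8 ^ M * path_prob \<nu> ?n E' + (\<Sum>m=M..<m. 128 * 16 ^ m * exp (- (2 ^ m * (x\<^sup>2 / 32)))))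
      + path_prob \<nu> ?n (\<lambda>V. \<not> ok m V \<and> ?I V)" using step by simp
    then show ?case using st step by (simp add: distrib_left)
  qed
  have "path_prob \<nu> ?n (\<lambda>V. \<not> ok N V \<and> ?I V) \<le> path_prob \<nu> ?n (wild (2 ^ N) (2 ^ (N - N)) x)"
  proof (rule path_prob_mono)
    fix V assume "\<not> ok N V \<and> ?I V"
    then show "wild (2 ^ N) (2 ^ (N - N)) x V"
      using wild_thick[of "2 ^ (N - N)" "2 ^ (N - N)" "2 ^ N" 0 x V] x by (simp add: ok_def)
  qed measurable
  also have "\<dots> \<le> 4 * 2 ^ N * exp (- (2 ^ N * (x\<^sup>2 / 32)))" by (rule nokm) (use MN in auto)
  finally show ?thesis using main[OF MN] by linarith
qed

text \<open>The exponent is split into halves. One half keeps the decay in x at the coarsest level;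
  in the other x is replaced by the fixed lower bound e, and it makes the sum over the levels
  converge to a constant that depends neither on x nor on N.\<close>

lemma levels_bound:
  fixes x :: real
  assumes MN: "M \<le> N" and e: "0 < e" "4 * (1 + \<bar>\<nu>\<bar>) \<le> 2 ^ M * e" and x: "e \<le> x" "x \<le> a" and ab: "a < b"
    and E: "Measurable.pred paths E" and E': "Measurable.pred paths E'"
    and thick: "\<And>V s j. j < 2 ^ M \<Longrightarrow> \<bar>s\<bar> \<le> 1 / (2 ^ M * (x + 1)) \<Longrightarrow>
        E (\<lambda>k. V k + s * ramp (2 ^ (N - M)) j k) \<Longrightarrow> E' V"
  shows "path_prob \<nu> (2 ^ N) (\<lambda>V. E V \<and> a < abs_avg (2 ^ N) V \<and> abs_avg (2 ^ N) V < b)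
    \<le> exp (1 + \<bar>\<nu>\<bar>) * (x + 1) * (b - a) * (4 * 8 ^ M * path_prob \<nu> (2 ^ N) E' + 256 * (320 / e\<^sup>2) ^ 5 * exp (- (2 ^ M * (x\<^sup>2 / 64))))
      + 4 * 2 ^ N * exp (- (2 ^ N * (x\<^sup>2 / 32)))"
proof -
  have "2 ^ M * e \<le> 2 ^ M * x" using x by (intro mult_left_mono) auto
  then have le: "4 * (1 + \<bar>\<nu>\<bar>) \<le> 2 ^ M * x" by (rule order_trans[OF e(2)])
  have b: "4 \<le> 2 ^ M * x" "4 * \<bar>\<nu>\<bar> \<le> 2 ^ M * x"
    by (rule order_trans[OF _ le], simp)+
  have x0: "0 < x" using e x by simp
  have "(\<Sum>m=M..<N. 128 * 16 ^ m * exp (- (2 ^ m * (x\<^sup>2 / 32)))) \<le> (\<Sum>m=M..<N. 128 * exp (- (2 ^ M * (x\<^sup>2 / 64))) * (16 ^ m * exp (- (2 ^ m * (e\<^sup>2 / 64)))))"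
  proof (rule sum_mono)
    fix m assume m: "m \<in> {M..<N}"
    have "2 ^ M * (x\<^sup>2 / 64) \<le> 2 ^ m * (x\<^sup>2 / 64)" using m by (intro mult_right_mono power_increasing) auto
    moreover have "2 ^ m * (e\<^sup>2 / 64) \<le> 2 ^ m * (x\<^sup>2 / 64)" using e x by (intro mult_left_mono divide_right_mono power_mono) auto
    moreover have "2 ^ m * (x\<^sup>2 / 32) = 2 ^ m * (x\<^sup>2 / 64) + 2 ^ m * (x\<^sup>2 / 64)" by simp
    ultimately have "- (2 ^ m * (x\<^sup>2 / 32)) \<le> - (2 ^ M * (x\<^sup>2 / 64)) + - (2 ^ m * (e\<^sup>2 / 64))" by linarith
    then have "exp (- (2 ^ m * (x\<^sup>2 / 32))) \<le> exp (- (2 ^ M * (x\<^sup>2 / 64)) + - (2 ^ m * (e\<^sup>2 / 64)))" by (simp only: exp_le_cancel_iff)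
    then have "128 * 16 ^ m * exp (- (2 ^ m * (x\<^sup>2 / 32))) \<le> 128 * 16 ^ m * (exp (- (2 ^ M * (x\<^sup>2 / 64))) * exp (- (2 ^ m * (e\<^sup>2 / 64))))"
      unfolding exp_add by (intro mult_left_mono) auto
    then show "128 * 16 ^ m * exp (- (2 ^ m * (x\<^sup>2 / 32))) \<le> 128 * exp (- (2 ^ M * (x\<^sup>2 / 64))) * (16 ^ m * exp (- (2 ^ m * (e\<^sup>2 / 64))))"
      by (simp only: ac_simps)
  qed
  also have "\<dots> = 128 * exp (- (2 ^ M * (x\<^sup>2 / 64))) * (\<Sum>m=M..<N. 16 ^ m * exp (- (2 ^ m * (e\<^sup>2 / 64))))"
    by (rule sum_distrib_left[symmetric])
  also have "\<dots> \<le> 128 * exp (- (2 ^ M * (x\<^sup>2 / 64))) * (2 * (5 / (e\<^sup>2 / 64)) ^ 5)"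
    using e by (intro mult_left_mono sum_levels_le) auto
  also have "\<dots> = 256 * (320 / e\<^sup>2) ^ 5 * exp (- (2 ^ M * (x\<^sup>2 / 64)))" by simp
  finally have S: "(\<Sum>m=M..<N. 128 * 16 ^ m * exp (- (2 ^ m * (x\<^sup>2 / 32)))) \<le> 256 * (320 / e\<^sup>2) ^ 5 * exp (- (2 ^ M * (x\<^sup>2 / 64)))" .
  have "exp (1 + \<bar>\<nu>\<bar>) * (x + 1) * (b - a) * (4 * 8 ^ M * path_prob \<nu> (2 ^ N) E' + (\<Sum>m=M..<N. 128 * 16 ^ m * exp (- (2 ^ m * (x\<^sup>2 / 32)))))
    \<le> exp (1 + \<bar>\<nu>\<bar>) * (x + 1) * (b - a) * (4 * 8 ^ M * path_prob \<nu> (2 ^ N) E' + 256 * (320 / e\<^sup>2) ^ 5 * exp (- (2 ^ M * (x\<^sup>2 / 64))))"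
    using x0 ab S by (intro mult_left_mono add_left_mono) auto
  moreover have "path_prob \<nu> (2 ^ N) (\<lambda>V. E V \<and> a < abs_avg (2 ^ N) V \<and> abs_avg (2 ^ N) V < b)
    \<le> exp (1 + \<bar>\<nu>\<bar>) * (x + 1) * (b - a) * (4 * 8 ^ M * path_prob \<nu> (2 ^ N) E' + (\<Sum>m=M..<N. 128 * 16 ^ m * exp (- (2 ^ m * (x\<^sup>2 / 32)))))
      + 4 * 2 ^ N * exp (- (2 ^ N * (x\<^sup>2 / 32)))"
    by (rule levels[OF MN x0 b x(2) ab E E'], rule thick; assumption)
  ultimately show ?thesis by linarith
qed

section \<open>Atypical paths\<close>

text \<open>The minimal energy at average x is close to 3 x^2. The threshold is written as a square
  because it is displaced as a norm in \<open>atypical_wide\<close>.\<close>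

definition atypical :: "nat \<Rightarrow> nat \<Rightarrow> real \<Rightarrow> (nat \<Rightarrow> real) \<Rightarrow> bool" where
  "atypical d q x V \<longleftrightarrow> (sqrt (3 + 1 / 10^8) * x)\<^sup>2 \<le> energy d q V \<or> x / 10^8 \<le> rough d q V"

lemma pred_atypical [measurable]: "Measurable.pred paths (atypical d q x)"
  unfolding atypical_def[abs_def] by measurable

lemma ramp_Suc:
  assumes "q > 0"
  shows "ramp q j (Suc k) - ramp q j k = of_bool (j = k div q) / real q"
proof -
  have "ramp q j (Suc k) - ramp q j k = (\<Sum>i=j*q..<j*q+q. of_bool (i < Suc k) - of_bool (i < k)) / real q"
    unfolding sum_subtractf block_card by (simp add: ramp_def diff_divide_distrib)
  also have "(\<Sum>i=j*q..<j*q+q. of_bool (i < Suc k) - of_bool (i < k)) = (\<Sum>i=j*q..<j*q+q. if i = k then 1 else (0::real))"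
    by (intro sum.cong) auto
  also have "\<dots> = of_bool (k \<in> {j*q..<j*q+q})" by simp
  also have "k \<in> {j*q..<j*q+q} \<longleftrightarrow> j = k div q"
  proof
    assume "j = k div q"
    then show "k \<in> {j*q..<j*q+q}" using assms dividend_less_times_div[of q k] by (simp add: mult.commute add.commute)
  next
    assume "k \<in> {j*q..<j*q+q}"
    then show "j = k div q" by (intro div_nat_eqI[symmetric]) (auto simp: mult.commute)
  qed
  finally show ?thesis .
qed

lemma coarse_Suc:
  assumes "q > 0" "k < d * q"
  shows "coarse d q V (Suc k) - coarse d q V k = block_incr q V (k div q) / real q"
proof -
  have "k div q < d" using assms by (simp add: less_mult_imp_div_less)
  have "coarse d q V (Suc k) - coarse d q V k = (\<Sum>j<d. block_incr q V j * (ramp q j (Suc k) - ramp q j k))"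
    unfolding coarse_def right_diff_distrib sum_subtractf ..
  also have "\<dots> = (\<Sum>j<d. if j = k div q then block_incr q V j / real q else 0)"
    unfolding ramp_Suc[OF assms(1)] by (intro sum.cong) auto
  finally show ?thesis using \<open>k div q < d\<close> by simp
qed

text \<open>Within each block the interpolation makes q equal steps, so refining the grid does not
  change its energy.\<close>

lemma fine_energy:
  assumes "q > 0"
  shows "real (d * q) * (\<Sum>k<d*q. (coarse d q V (Suc k) - coarse d q V k)\<^sup>2) = energy d q V"
proof -
  have "(\<Sum>k<d*q. (coarse d q V (Suc k) - coarse d q V k)\<^sup>2) = (\<Sum>k<d*q. (block_incr q V (k div q) / real q)\<^sup>2)"
    by (intro sum.cong) (auto simp: coarse_Suc[OF assms])
  also have "\<dots> = (\<Sum>j<d. \<Sum>i=j*q..<j*q+q. (block_incr q V j / real q)\<^sup>2)"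
    by (rule block_sum(2)[OF assms])
  also have "\<dots> = (\<Sum>j<d. (block_incr q V j)\<^sup>2) / real q"
    using assms by (simp add: sum_divide_distrib power_divide power2_eq_square)
  finally show ?thesis using assms by (simp add: energy_def)
qed

text \<open>The number \<open>1 / area_var n\<close> is the energy of \<open>profile n\<close>, the
  least energy of a discrete path with average 1.\<close>

lemma inv_area_var_ge: assumes "n > 0" shows "3 - 6 / real n \<le> 1 / area_var n"
proof -
  have "(3 - 6 / real n) * area_var n = 1 - 1 / (2 * real n) - 5 / (2 * (real n)\<^sup>2) - 1 / (real n)^3"
    using assms by (simp add: area_var_def field_simps power2_eq_square power3_eq_cube)
  also have "\<dots> \<le> 1"
  proof -
    have "0 \<le> 1 / (2 * real n)" "0 \<le> 5 / (2 * (real n)\<^sup>2)" "0 \<le> 1 / (real n)^3" by auto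
    then show ?thesis by linarith
  qed
  finally show ?thesis using area_var_pos[OF assms] by (simp only: pos_le_divide_eq)
qed

text \<open>\<open>profile n\<close> represents averaging with respect to the energy inner product and
  minimises the energy for a given average; near-minimisers are therefore close to it.\<close>

lemma profile_stability:
  assumes n: "n \<ge> 2^26" and w0: "w 0 = 0" and x: "x > 0"
    and en: "real n * (\<Sum>k<n. (w (Suc k) - w k)\<^sup>2) \<le> (3 + 1 / 10^8) * x\<^sup>2"
    and av: "(1 - 1 / 10^8) * x \<le> avg n w" and k: "k \<le> n"
  shows "\<bar>w k - x * profile n k\<bar> \<le> x / 2048"
proof -
  have n0: "n > 0" using n by simp
  have v: "area_var n > 0" using n0 by (rule area_var_pos)
  define e where "e i = w (Suc i) - w i" for i
  define f where "f i = area_dir n i / sqrt (real n)" for i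
  have fh: "profile n (Suc i) - profile n i = f i" if "i < n" for i
    using that by (simp add: f_def profile_def walk_def min_def add_divide_distrib)
  have tw: "(\<Sum>i<k. e i) = w k" for k unfolding e_def by (subst sum_lessThan_telescope) (simp add: w0)
  have th: "(\<Sum>i<k. f i) = profile n k" if "k \<le> n" for k
  proof -
    have "(\<Sum>i<k. f i) = (\<Sum>i<k. profile n (Suc i) - profile n i)" using that by (intro sum.cong) (auto simp: fh)
    then show ?thesis by (simp add: sum_lessThan_telescope)
  qed
  have ef: "real n * (\<Sum>i<n. e i * f i) = avg n w / area_var n"
  proof -
    have "(\<Sum>i<n. e i * f i) = (\<Sum>i<n. (real n - real i) * e i) / ((real n)\<^sup>2 * area_var n)"
      unfolding sum_divide_distrib
    proof (intro sum.cong refl)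
      fix i
      have "f i = (real n - real i) / (real n * (sqrt (real n) * sqrt (real n)) * area_var n)"
        by (simp add: f_def area_dir_def ac_simps)
      then show "e i * f i = (real n - real i) * e i / ((real n)\<^sup>2 * area_var n)"
        by (simp add: power2_eq_square)
    qed
    also have "(\<Sum>i<n. (real n - real i) * e i) = (\<Sum>k=1..n. w k)"
      unfolding sum_double_avg[symmetric] by (simp add: tw)
    finally show ?thesis using n0 by (simp add: avg_def power2_eq_square)
  qed
  have ff: "real n * (\<Sum>i<n. (f i)\<^sup>2) = 1 / area_var n"
    using n0 unfolding f_def power_divide sum_divide_distrib[symmetric] sum_area_dir_sq[OF n0] by simp
  have "real n * (\<Sum>i<n. (e i - x * f i)\<^sup>2) = real n * (\<Sum>i<n. (e i)\<^sup>2) - 2 * x * (real n * (\<Sum>i<n. e i * f i)) + x\<^sup>2 * (real n * (\<Sum>i<n. (f i)\<^sup>2))"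
    by (simp add: power2_eq_square algebra_simps sum.distrib sum_subtractf sum_distrib_left)
  also have "\<dots> \<le> (3 + 1 / 10^8) * x\<^sup>2 - 2 * x * ((1 - 1 / 10^8) * x / area_var n) + x\<^sup>2 * (1 / area_var n)"
    unfolding ef ff using en[folded e_def] av x v
    by (intro add_mono diff_mono mult_left_mono divide_right_mono) auto
  also have "\<dots> = x\<^sup>2 * (3 + 1 / 10^8 - (1 - 2 / 10^8) * (1 / area_var n))"
    by (simp add: power2_eq_square algebra_simps)
  \<comment> \<open>The tolerances of energy and average contribute 10^-8 and 6 10^-8, the
    discretisation at most 6 / 2^26; the sum is about 1.6 10^-7, below 2^-22.\<close>
  also have "\<dots> \<le> x\<^sup>2 * (1 / 2048)\<^sup>2"
  proof (rule mult_left_mono)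
    have "real (2^26) \<le> real n" using n by (rule of_nat_mono)
    then have "6 / real n \<le> 6 / 2^26" using n0 by (intro divide_left_mono) auto
    then have "3 - 6 / 2^26 \<le> 1 / area_var n" using inv_area_var_ge[OF n0] by linarith
    then show "3 + 1 / 10^8 - (1 - 2 / 10^8) * (1 / area_var n) \<le> (1 / 2048)\<^sup>2" by (simp add: power2_eq_square)
  qed simp
  finally have *: "real n * (\<Sum>i<n. (e i - x * f i)\<^sup>2) \<le> (x / 2048)\<^sup>2" by (simp add: power_divide)
  have "w k - x * profile n k = (\<Sum>i<k. e i - x * f i)"
    by (simp add: sum_subtractf sum_distrib_left[symmetric] tw th[OF k])
  \<comment> \<open>Cauchy-Schwarz: for paths starting at 0 the energy controls each single
    value.\<close>
  then have "(w k - x * profile n k)\<^sup>2 \<le> real k * (\<Sum>i<k. (e i - x * f i)\<^sup>2)"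
    using sum_squared_le_sum_of_squares[of "\<lambda>i. e i - x * f i" "{..<k}"] by (simp add: mult.commute)
  also have "\<dots> \<le> real n * (\<Sum>i<n. (e i - x * f i)\<^sup>2)"
    using k by (intro mult_mono sum_mono2 sum_nonneg) auto
  also have "\<dots> \<le> (x / 2048)\<^sup>2" by (rule *)
  finally show ?thesis using x by (simp add: abs_le_square_iff[symmetric])
qed

lemma avg_of_bool_less: assumes "n = 512 * k0" "0 < n" shows "avg n (\<lambda>k. if k < k0 then c else 0) \<le> (\<bar>c\<bar> :: real) / 512"
proof -
  have "(\<Sum>k=1..n. if k < k0 then c else 0) = (\<Sum>k\<in>{1..n} \<inter> {k. k < k0}. c)" by (subst sum.If_cases) auto
  also have "\<dots> \<le> real (card ({1..n} \<inter> {k. k < k0})) * \<bar>c\<bar>" by (simp add: mult_left_mono)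
  also have "\<dots> \<le> real k0 * \<bar>c\<bar>"
  proof (rule mult_right_mono)
    have "card ({1..n} \<inter> {k. k < k0}) \<le> card {..<k0}" by (rule card_mono) auto
    then show "real (card ({1..n} \<inter> {k. k < k0})) \<le> real k0" by simp
  qed simp
  finally have "avg n (\<lambda>k. if k < k0 then c else 0) \<le> real k0 * \<bar>c\<bar> / real n"
    unfolding avg_def by (rule divide_right_mono) simp
  also have "\<dots> = \<bar>c\<bar> / 512" using assms by simp
  finally show ?thesis .
qed

text \<open>Stability is applied to |U|, where U is the interpolation: taking absolute values does
  not raise the energy, and the average of |U| is close to that of |V|. So |U| is close to x times
  the profile. From k0 = n / 512 on, |U| is at least x / 512, whereas a single step changes U by at
  most x / 4096; hence U cannot change sign and keeps the sign it has at k0. Before k0 it is at most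
  13 x / 2048 in absolute value, during only a fraction 1 / 512 of the time.\<close>

lemma good_if_positive:
  assumes q: "q > 0" "n = d * q" and n: "n \<ge> 2^26" "n = 512 * k0" and x: "0 < x" "x \<le> abs_avg n V"
    and nb: "\<not> atypical d q x V" and pos: "0 \<le> coarse d q V k0"
  shows "mostly_pos n x V"
proof -
  have n0: "n > 0" "n \<ge> 10" "k0 > 0" "k0 \<le> n" using n by auto
  define U where "U = coarse d q V"
  have en: "energy d q V < (3 + 1 / 10^8) * x\<^sup>2" and ro: "avg n (\<lambda>k. \<bar>V k - U k\<bar>) < x / 10^8"
    using nb by (auto simp: atypical_def power_mult_distrib rough_def q(2) U_def)
  have fe: "real n * (\<Sum>k<n. (U (Suc k) - U k)\<^sup>2) = energy d q V"
    unfolding q(2) U_def by (rule fine_energy[OF q(1)])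
  have U0: "U 0 = 0" by (simp add: U_def coarse_def ramp_def)
  have close: "\<bar>\<bar>U k\<bar> - x * profile n k\<bar> \<le> x / 2048" if "k \<le> n" for k
  proof (rule profile_stability[OF n(1) _ x(1) _ _ that, where w="\<lambda>k. \<bar>U k\<bar>"])
    have "(\<Sum>k<n. (\<bar>U (Suc k)\<bar> - \<bar>U k\<bar>)\<^sup>2) \<le> (\<Sum>k<n. (U (Suc k) - U k)\<^sup>2)"
      by (intro sum_mono) (simp add: abs_le_square_iff[symmetric])
    then have "real n * (\<Sum>k<n. (\<bar>U (Suc k)\<bar> - \<bar>U k\<bar>)\<^sup>2) \<le> energy d q V"
      unfolding fe[symmetric] by (rule mult_left_mono) simp
    then show "real n * (\<Sum>k<n. (\<bar>U (Suc k)\<bar> - \<bar>U k\<bar>)\<^sup>2) \<le> (3 + 1 / 10^8) * x\<^sup>2" using en by linarith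
    have "abs_avg n V \<le> avg n (\<lambda>k. \<bar>U k\<bar> + \<bar>V k - U k\<bar>)" unfolding abs_avg_def by (intro avg_mono) auto
    then show "(1 - 1 / 10^8) * x \<le> avg n (\<lambda>k. \<bar>U k\<bar>)" unfolding avg_add using ro x by (simp add: algebra_simps)
  qed (simp add: U0)
  \<comment> \<open>The profile is at least 5 / 2048 here and the deviation at most x / 2048, which
    leaves 4 x / 2048.\<close>
  have big: "x / 512 \<le> \<bar>U k\<bar>" if "k0 \<le> k" "k \<le> n" for k
  proof -
    have "1 / 512 \<le> real k / real n" using that n n0 by (simp add: field_simps)
    then have "5 / 4 * (1 / 512) \<le> profile n k" using profile_lower[OF that(2) n0(2)] by linarith
    then have "x * (5 / 4 * (1 / 512)) \<le> x * profile n k" using x by (intro mult_left_mono) auto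
    then show ?thesis using close[OF that(2)] by linarith
  qed
  \<comment> \<open>The energy is below 4 x^2 and n is at least 2^26, so one step is at most 2 x /
    2^13.\<close>
  have inc: "\<bar>U (Suc k) - U k\<bar> \<le> x / 4096" if "k < n" for k
  proof -
    have "(U (Suc k) - U k)\<^sup>2 \<le> (\<Sum>k<n. (U (Suc k) - U k)\<^sup>2)" using that by (intro member_le_sum) auto
    then have "real n * (U (Suc k) - U k)\<^sup>2 \<le> energy d q V" unfolding fe[symmetric] by (rule mult_left_mono) simp
    also have "\<dots> \<le> 4 * x\<^sup>2"
    proof -
      have "(3 + 1 / 10^8) * x\<^sup>2 \<le> 4 * x\<^sup>2" by (intro mult_right_mono) auto
      then show ?thesis using en by linarith
    qed
    finally have "real n * (U (Suc k) - U k)\<^sup>2 \<le> 4 * x\<^sup>2" .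
    moreover have "real (2^26) * (U (Suc k) - U k)\<^sup>2 \<le> real n * (U (Suc k) - U k)\<^sup>2"
      by (rule mult_right_mono[OF of_nat_mono[OF n(1)]]) simp
    ultimately have "(U (Suc k) - U k)\<^sup>2 \<le> (x / 4096)\<^sup>2" by (simp add: power_divide)
    then show ?thesis using x by (simp add: abs_le_square_iff[symmetric])
  qed
  have Upos: "x / 512 \<le> U k" if "k0 \<le> k" "k \<le> n" for k
    using that
  proof (induction k rule: dec_induct)
    case base
    then show ?case using big[of k0] pos by (simp add: U_def)
  next
    case (step k)
    then show ?case using big[of "Suc k"] inc[of k] step x by linarith
  qed
  have Usmall: "\<bar>U k\<bar> \<le> 13 / 2048 * x" if "k < k0" for k
  proof -
    have "real k / real n \<le> 1 / 512" using that n n0 by (simp add: field_simps)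
    then have "profile n k \<le> 3 / 512" using profile_upper[of k n] that n0 by linarith
    then have "x * profile n k \<le> x * (3 / 512)" using x by (intro mult_left_mono) auto
    then show ?thesis using close[of k] that n0 by linarith
  qed
  have "neg_avg n V \<le> avg n (\<lambda>k. (if k < k0 then 13 / 2048 * x else 0) + \<bar>V k - U k\<bar>)"
    unfolding neg_avg_def
  proof (rule avg_mono)
    fix k assume "1 \<le> k" "k \<le> n"
    then show "negpart (V k) \<le> (if k < k0 then 13 / 2048 * x else 0) + \<bar>V k - U k\<bar>"
      using Usmall[of k] Upos[of k] x by (cases "k < k0") (auto simp: negpart_def)
  qed
  also have "\<dots> \<le> \<bar>13 / 2048 * x\<bar> / 512 + x / 10^8"
    unfolding avg_add using avg_of_bool_less[OF n(2) n0(1), of "13 / 2048 * x"] ro by linarith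
  also have "\<dots> \<le> x / 25000" using x by simp
  finally have 1: "neg_avg n V \<le> x / 25000" .
  \<comment> \<open>A negative value of V after k0 means a deviation of at least x / 512 from U; the
    factor 1536 / x turns it into at least 3, the upper bound of the profile.\<close>
  have "neg_profile n V \<le> avg n (\<lambda>k. (if k < k0 then 3 else 0) + 1536 / x * \<bar>V k - U k\<bar>)"
    unfolding neg_profile_def
  proof (rule avg_mono)
    fix k assume k: "1 \<le> k" "k \<le> n"
    have h3: "profile n k \<le> 3"
    proof -
      have "real k / real n \<le> 1" using k by simp
      then show ?thesis using profile_upper[OF k(2) n0(1)] by linarith
    qed
    have p: "0 \<le> 1536 / x * \<bar>V k - U k\<bar>" using x by simp
    show "(if V k < 0 then profile n k else 0) \<le> (if k < k0 then 3 else 0) + 1536 / x * \<bar>V k - U k\<bar>"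
    proof (cases "V k < 0 \<and> k0 \<le> k")
      case True
      then have "x / 512 \<le> \<bar>V k - U k\<bar>" using Upos[of k] k by linarith
      then have "1536 / x * (x / 512) \<le> 1536 / x * \<bar>V k - U k\<bar>" using x by (intro mult_left_mono) auto
      then show ?thesis using h3 x by simp
    qed (use h3 p profile_nonneg[OF k(2) n0(1)] in auto)
  qed
  also have "\<dots> \<le> \<bar>3\<bar> / 512 + 1536 / x * (x / 10^8)"
    unfolding avg_add avg_cmult using avg_of_bool_less[OF n(2) n0(1), of 3] ro x
    by (intro add_mono mult_left_mono) auto
  also have "\<dots> \<le> 1 / 8" using x by simp
  finally show ?thesis using 1 by (simp add: mostly_pos_def)
qed

lemma coarse_uminus: "coarse d q (\<lambda>k. - V k) = (\<lambda>k. - coarse d q V k)"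
proof -
  have "block_incr q (\<lambda>k. - V k) j = - block_incr q V j" for j by (simp add: block_incr_def)
  then show ?thesis by (simp add: coarse_def sum_negf fun_eq_iff)
qed

lemma atypical_uminus: "atypical d q x (\<lambda>k. - V k) = atypical d q x V"
proof -
  have "block_incr q (\<lambda>k. - V k) j = - block_incr q V j" for j by (simp add: block_incr_def)
  then have "energy d q (\<lambda>k. - V k) = energy d q V" by (simp add: energy_def)
  moreover have "rough d q (\<lambda>k. - V k) = rough d q V"
    unfolding rough_def coarse_uminus by (intro avg_cong) simp
  ultimately show ?thesis by (simp add: atypical_def)
qed

lemma good_or_bad:
  assumes q: "q > 0" "n = d * q" and n: "n \<ge> 2^26" "n = 512 * k0" and x: "0 < x" "x \<le> abs_avg n V"
    and nb: "\<not> atypical d q x V"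
  shows "mostly_pos n x V \<or> mostly_pos n x (\<lambda>k. - V k)"
proof -
  have Q: "abs_avg n (\<lambda>k. - V k) = abs_avg n V" by (simp add: abs_avg_def)
  show ?thesis
  proof (cases "coarse d q V k0 \<ge> 0")
    case True
    then show ?thesis using good_if_positive[OF q n x nb] by simp
  next
    case False
    then show ?thesis using good_if_positive[OF q n x(1), of "\<lambda>k. - V k"] x nb
      by (simp add: atypical_uminus coarse_uminus Q)
  qed
qed

text \<open>Thickening of \<open>atypical\<close> for shifts along ramps of the same grid: these
  leave \<open>rough\<close> unchanged and move the square root of the energy by at most 1.\<close>

definition atypical_wide :: "nat \<Rightarrow> nat \<Rightarrow> real \<Rightarrow> (nat \<Rightarrow> real) \<Rightarrow> bool" where
  "atypical_wide d q x V \<longleftrightarrow> (sqrt (3 + 1 / 10^8) * x - 1)\<^sup>2 \<le> energy d q V \<or> x / 10^8 \<le> rough d q V"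

lemma pred_atypical_wide [measurable]: "Measurable.pred paths (atypical_wide d q x)"
  unfolding atypical_wide_def[abs_def] by measurable

lemma atypical_thick:
  assumes q: "q > 0" "j < d" and x: "1 \<le> x" and s: "\<bar>s\<bar> \<le> 1 / (real d * (x + 1))"
    and V: "atypical d q x (\<lambda>k. V k + s * ramp q j k)"
  shows "atypical_wide d q x V"
proof (cases "x / 10^8 \<le> rough d q (\<lambda>k. V k + s * ramp q j k)")
  case True
  then show ?thesis using rough_add_ramp[OF q] by (simp add: atypical_wide_def)
next
  case False
  let ?r = "sqrt (3 + 1 / 10^8)"
  have r1: "1 \<le> ?r" by simp
  have "(?r * x)\<^sup>2 \<le> energy d q (\<lambda>k. V k + s * ramp q j k)" using V False by (simp add: atypical_def)
  then have "?r * x \<le> sqrt (energy d q (\<lambda>k. V k + s * ramp q j k))" by (rule real_le_rsqrt)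
  also have "\<dots> = L2_set (\<lambda>i. sqrt (real d) * block_incr q V i + sqrt (real d) * (s * of_bool (i = j))) {..<d}"
    unfolding sqrt_energy block_incr_add_ramp[OF q(1)] distrib_left ..
  also have "\<dots> \<le> L2_set (\<lambda>i. sqrt (real d) * block_incr q V i) {..<d} + L2_set (\<lambda>i. sqrt (real d) * (s * of_bool (i = j))) {..<d}"
    by (rule L2_set_triangle_ineq)
  also have "L2_set (\<lambda>i. sqrt (real d) * (s * of_bool (i = j))) {..<d} \<le> 1"
  proof -
    have "(\<Sum>i<d. (sqrt (real d) * (s * of_bool (i = j)))\<^sup>2) = (\<Sum>i<d. if i = j then real d * s\<^sup>2 else 0)"
      by (intro sum.cong) (auto simp: power_mult_distrib)
    also have "\<dots> = real d * s\<^sup>2" using q by simp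
    also have "\<dots> \<le> 1"
    proof -
      have d1: "1 \<le> real d" using q by simp
      have "\<bar>s\<bar> \<le> 1 / (real d * 1)" using s d1 x by (elim order_trans) (intro divide_left_mono mult_left_mono, auto)
      then have "s\<^sup>2 \<le> (1 / real d)\<^sup>2" by (simp add: abs_le_square_iff[symmetric])
      then have "real d * s\<^sup>2 \<le> real d * (1 / real d)\<^sup>2" by (rule mult_left_mono) simp
      also have "\<dots> = 1 / real d" using d1 by (simp add: power2_eq_square)
      also have "\<dots> \<le> 1" using d1 by simp
      finally show ?thesis .
    qed
    finally show ?thesis by (simp add: L2_set_def)
  qed
  finally have "?r * x - 1 \<le> sqrt (energy d q V)" unfolding sqrt_energy by simp
  moreover have "1 * 1 \<le> ?r * x" using r1 x by (intro mult_mono) auto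
  ultimately have "(?r * x - 1)\<^sup>2 \<le> (sqrt (energy d q V))\<^sup>2" by (intro power_mono) auto
  also have "\<dots> = energy d q V" by (simp add: energy_def sum_nonneg)
  finally show ?thesis by (simp add: atypical_wide_def)
qed

text \<open>Balance of the constants: with \<open>\<kappa>\<close> = 1 - 10^-9 the product of
  \<open>\<kappa>\<close> / 2 and 3 + 10^-8 still exceeds 3 / 2 + 10^-9, and with 2^60 blocks the
  exponent of the roughness bound is more than 57 x^2. The prefactor to the power 2^60 is a constant
  since the number of blocks is fixed. The loss of 1 + |\<open>\<nu>\<close>| in the energy norm is
  what produces the linear term K x.\<close>

lemma path_prob_atypical_wide:
  fixes \<nu> :: real
  obtains C K :: real where "C > 0" "K \<ge> 0"
    "\<And>x q. q > 0 \<Longrightarrow> 1 + \<bar>\<nu>\<bar> \<le> x \<Longrightarrow> path_prob \<nu> (2^60 * q) (atypical_wide (2^60) q x) \<le> C * exp (- (3 / 2 + 1 / 10^9) * x\<^sup>2 + K * x)"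
proof -
  define \<kappa> :: real where "\<kappa> = 1 - 1 / 10^9"
  define r where "r = sqrt (3 + 1 / 10^8)"
  define B where "B = 1 + \<bar>\<nu>\<bar>"
  define K where "K = \<kappa> * r * B"
  define C1 where "C1 = (1 / sqrt (1 - \<kappa>)) ^ (2^60)"
  have \<kappa>: "0 \<le> \<kappa>" "\<kappa> < 1" by (auto simp: \<kappa>_def)
  have r2: "r\<^sup>2 = 3 + 1 / 10^8" by (simp add: r_def)
  have r1: "1 \<le> r" by (simp add: r_def)
  have B1: "1 \<le> B" by (simp add: B_def)
  have K0: "0 \<le> K" unfolding K_def using \<kappa> r1 B1 by (intro mult_nonneg_nonneg) auto
  have C1: "0 < C1" unfolding C1_def by (rule zero_less_power) (simp add: \<kappa>_def)
  have main: "path_prob \<nu> (2^60 * q) (atypical_wide (2^60) q x) \<le> (C1 + 2) * exp (- (3 / 2 + 1 / 10^9) * x\<^sup>2 + K * x)"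
    if q: "q > 0" and x: "1 + \<bar>\<nu>\<bar> \<le> x" for x q
  proof -
    let ?n = "2^60 * q"
    let ?e = "exp (- (3 / 2 + 1 / 10^9) * x\<^sup>2 + K * x)"
    have x0: "0 < x" using x by linarith
    have rx: "B \<le> r * x"
    proof -
      have "1 * B \<le> r * x" using r1 x x0 by (intro mult_mono) (auto simp: B_def)
      then show ?thesis by simp
    qed
    have 1: "path_prob \<nu> ?n (\<lambda>V. (r * x - 1)\<^sup>2 \<le> energy (2^60) q V) \<le> C1 * ?e"
    proof -
      have "\<bar>\<nu>\<bar> \<le> r * x - 1" using rx by (simp add: B_def)
      then have "ennreal (path_prob \<nu> ?n (\<lambda>V. (r * x - 1)\<^sup>2 \<le> energy (2^60) q V)) \<le> ennreal (C1 * exp (- (\<kappa> / 2 * ((r * x - 1) - \<bar>\<nu>\<bar>)\<^sup>2)))"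
        unfolding emeasure_path_prob[symmetric] C1_def by (intro energy_tail q \<kappa>) auto
      then have "path_prob \<nu> ?n (\<lambda>V. (r * x - 1)\<^sup>2 \<le> energy (2^60) q V) \<le> C1 * exp (- (\<kappa> / 2 * ((r * x - 1) - \<bar>\<nu>\<bar>)\<^sup>2))"
        using C1 by (subst (asm) ennreal_le_iff) auto
      also have "\<dots> \<le> C1 * ?e"
      proof -
        have "(r * x - 1) - \<bar>\<nu>\<bar> = r * x - B" by (simp add: B_def)
        then have eq: "\<kappa> / 2 * ((r * x - 1) - \<bar>\<nu>\<bar>)\<^sup>2 = \<kappa> / 2 * (r\<^sup>2 * x\<^sup>2) - K * x + \<kappa> / 2 * B\<^sup>2"
          by (simp add: K_def power2_eq_square algebra_simps)
        have "\<kappa> / 2 * (r\<^sup>2 * x\<^sup>2) = (\<kappa> / 2 * (3 + 1 / 10^8)) * x\<^sup>2" by (simp add: r2)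
        moreover have "(3 / 2 + 1 / 10^9) * x\<^sup>2 \<le> (\<kappa> / 2 * (3 + 1 / 10^8)) * x\<^sup>2"
          by (intro mult_right_mono) (auto simp: \<kappa>_def)
        moreover have "0 \<le> \<kappa> / 2 * B\<^sup>2" using \<kappa> by simp
        ultimately have "- (\<kappa> / 2 * ((r * x - 1) - \<bar>\<nu>\<bar>)\<^sup>2) \<le> - (3 / 2 + 1 / 10^9) * x\<^sup>2 + K * x"
          unfolding eq by linarith
        then have "exp (- (\<kappa> / 2 * ((r * x - 1) - \<bar>\<nu>\<bar>)\<^sup>2)) \<le> ?e" by (simp only: exp_le_cancel_iff)
        then show ?thesis using C1 by (intro mult_left_mono) auto
      qed
      finally show ?thesis .
    qed
    have 2: "path_prob \<nu> ?n (\<lambda>V. x / 10^8 \<le> rough (2^60) q V) \<le> 2 * ?e"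
    proof -
      have "ennreal (path_prob \<nu> ?n (\<lambda>V. x / 10^8 \<le> rough (2^60) q V)) \<le> ennreal (2 * exp (- ((x / 10^8)\<^sup>2 * real (2^60) / 2)))"
        unfolding emeasure_path_prob[symmetric] using x0 by (intro rough_tail q) auto
      then have "path_prob \<nu> ?n (\<lambda>V. x / 10^8 \<le> rough (2^60) q V) \<le> 2 * exp (- ((x / 10^8)\<^sup>2 * real (2^60) / 2))"
        by (subst (asm) ennreal_le_iff) auto
      also have "\<dots> \<le> 2 * ?e"
      proof -
        have "(x / 10^8)\<^sup>2 * real (2^60) / 2 = (2^60 / (2 * 10^16)) * x\<^sup>2" by (simp add: power_divide)
        also have "\<dots> \<ge> (3 / 2 + 1 / 10^9) * x\<^sup>2" by (intro mult_right_mono) auto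
        finally have "- ((x / 10^8)\<^sup>2 * real (2^60) / 2) \<le> - (3 / 2 + 1 / 10^9) * x\<^sup>2 + K * x"
          using mult_nonneg_nonneg[OF K0 less_imp_le[OF x0]] by linarith
        then have "exp (- ((x / 10^8)\<^sup>2 * real (2^60) / 2)) \<le> ?e" by (simp only: exp_le_cancel_iff)
        then show ?thesis by simp
      qed
      finally show ?thesis .
    qed
    have "path_prob \<nu> ?n (atypical_wide (2^60) q x) \<le> path_prob \<nu> ?n (\<lambda>V. (r * x - 1)\<^sup>2 \<le> energy (2^60) q V) + path_prob \<nu> ?n (\<lambda>V. x / 10^8 \<le> rough (2^60) q V)"
      unfolding atypical_wide_def[abs_def] r_def[symmetric] by (rule path_prob_disj) measurable
    then show ?thesis using 1 2 by (simp add: distrib_right)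
  qed
  show ?thesis by (rule that[of "C1 + 2" K]) (use C1 K0 main in auto)
qed

section \<open>Interval bounds for the discretised functional\<close>

definition tail_rem :: "nat \<Rightarrow> real \<Rightarrow> real" where
  "tail_rem N x = 4 * 2 ^ N * exp (- (2 ^ N * (x\<^sup>2 / 32)))"

lemma tail_rem_tendsto: assumes "x > 0" shows "(\<lambda>N. tail_rem N x) \<longlonglongrightarrow> 0"
proof -
  have "((\<lambda>y::real. 4 * y * exp (- (y * (x\<^sup>2 / 32)))) \<longlongrightarrow> 0) at_top" using assms by real_asymp
  moreover have "filterlim (\<lambda>N. (2::real) ^ N) at_top sequentially"
    by real_asymp
  ultimately show ?thesis unfolding tail_rem_def by (rule filterlim_compose)
qed

text \<open>A crude bound, but valid on every half line to the right of a positive e; in the limit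
  it yields the absence of atoms and absolute continuity on the positive axis.\<close>

lemma discrete_lipschitz:
  assumes e: "0 < e"
  obtains L N0 where "\<And>a b N. N0 \<le> N \<Longrightarrow> e \<le> a \<Longrightarrow> a < b \<Longrightarrow>
    path_prob \<nu> (2 ^ N) (\<lambda>V. a < abs_avg (2 ^ N) V \<and> abs_avg (2 ^ N) V < b) \<le> L * (b - a) + tail_rem N e"
proof -
  obtain M where "4 * (1 + \<bar>\<nu>\<bar>) / e < 2 ^ M" using real_arch_pow[of 2] by auto
  then have M: "4 * (1 + \<bar>\<nu>\<bar>) \<le> 2 ^ M * e" using e by (simp add: field_simps)
  let ?c = "4 * 8 ^ M + 256 * (320 / e\<^sup>2) ^ 5 * exp (- (2 ^ M * (e\<^sup>2 / 64)))"
  have "path_prob \<nu> (2 ^ N) (\<lambda>V. a < abs_avg (2 ^ N) V \<and> abs_avg (2 ^ N) V < b) \<le> exp (1 + \<bar>\<nu>\<bar>) * (e + 1) * ?c * (b - a) + tail_rem N e"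
    if N: "M \<le> N" and ab: "e \<le> a" "a < b" for a b N
  proof -
    have "path_prob \<nu> (2 ^ N) (\<lambda>V. True \<and> a < abs_avg (2 ^ N) V \<and> abs_avg (2 ^ N) V < b)
      \<le> exp (1 + \<bar>\<nu>\<bar>) * (e + 1) * (b - a) * (4 * 8 ^ M * path_prob \<nu> (2 ^ N) (\<lambda>V. True) + 256 * (320 / e\<^sup>2) ^ 5 * exp (- (2 ^ M * (e\<^sup>2 / 64))))
      + 4 * 2 ^ N * exp (- (2 ^ N * (e\<^sup>2 / 32)))"
      by (rule levels_bound[OF N e M order_refl ab]) auto
    also have "\<dots> \<le> exp (1 + \<bar>\<nu>\<bar>) * (e + 1) * (b - a) * (4 * 8 ^ M * 1 + 256 * (320 / e\<^sup>2) ^ 5 * exp (- (2 ^ M * (e\<^sup>2 / 64))))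
      + 4 * 2 ^ N * exp (- (2 ^ N * (e\<^sup>2 / 32)))"
      using e ab by (intro add_right_mono mult_left_mono path_prob_le_1) auto
    finally show ?thesis by (simp add: tail_rem_def ac_simps)
  qed
  then show ?thesis by (rule that)
qed

definition pair_density :: "real \<Rightarrow> nat \<Rightarrow> real \<Rightarrow> real" where
  "pair_density \<nu> n x = normal_density (area_mean \<nu> n) (sqrt (area_var n)) x + normal_density (- area_mean \<nu> n) (sqrt (area_var n)) x"

lemma area_mean_uminus: "area_mean (- \<nu>) n = - area_mean \<nu> n" by (simp add: area_mean_def)

text \<open>If \<open>abs_avg\<close> exceeds x, then the path is mostly positive, or its reflection
  is, or it is atypical. Reflection turns the drift \<open>\<nu>\<close> into -
  \<open>\<nu>\<close>, so the first two cases give the two Gaussian densities; the third is chained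
  from level 60, the level at which \<open>atypical\<close> is defined.\<close>

lemma discrete_upper:
  fixes \<nu> :: real
  obtains C K where "C > 0" "K \<ge> 0"
    "\<And>x y N. 60 \<le> N \<Longrightarrow> 1 + 32 * \<bar>\<nu>\<bar> \<le> x \<Longrightarrow> x < y \<Longrightarrow>
      path_prob \<nu> (2 ^ N) (\<lambda>V. x < abs_avg (2 ^ N) V \<and> abs_avg (2 ^ N) V < y)
      \<le> (y - x) * (pair_density \<nu> (2 ^ N) x * (1 + 20000 / x\<^sup>2) + C * (x + 1) * exp (- (3 / 2 + 1 / 10^9) * x\<^sup>2 + K * x)) + tail_rem N x"
proof -
  obtain C K where C: "C > 0" and K: "K \<ge> 0" and Bb:
    "\<And>x q. q > 0 \<Longrightarrow> 1 + \<bar>\<nu>\<bar> \<le> x \<Longrightarrow> path_prob \<nu> (2^60 * q) (atypical_wide (2^60) q x) \<le> C * exp (- (3 / 2 + 1 / 10^9) * x\<^sup>2 + K * x)"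
    using path_prob_atypical_wide[of \<nu>] by metis
  define e where "e = 1 + \<bar>\<nu>\<bar>"
  define D where "D = 256 * (320 / e\<^sup>2) ^ 5"
  define C' where "C' = exp (1 + \<bar>\<nu>\<bar>) * (4 * 8 ^ 60 * C + D)"
  have e0: "0 < e" by (simp add: e_def)
  have D0: "0 \<le> D" by (simp add: D_def)
  have C'0: "0 < C'" unfolding C'_def using C D0 by (intro mult_pos_pos add_pos_nonneg) auto
  show ?thesis
  proof (rule that[OF C'0 K])
    fix x y :: real and N :: nat
    assume N: "60 \<le> N" and x: "1 + 32 * \<bar>\<nu>\<bar> \<le> x" and xy: "x < y"
    have x0: "x > 0" "1 \<le> x" "32 * \<bar>\<nu>\<bar> \<le> x" "e \<le> x" using x by (auto simp: e_def)
    let ?n = "2 ^ N :: nat"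
    let ?I = "\<lambda>V. x < abs_avg ?n V \<and> abs_avg ?n V < y"
    let ?q = "2 ^ (N - 60) :: nat"
    let ?E = "exp (- (3 / 2 + 1 / 10^9) * x\<^sup>2 + K * x)"
    have nq: "?n = 2^60 * ?q" using N by (simp only: power_add[symmetric]) simp
    have n64: "?n = 64 * 2 ^ (N - 6)" using N power_add[of "2::nat" 6 "N - 6"] by simp
    have n512: "?n = 512 * 2 ^ (N - 9)" using N power_add[of "2::nat" 9 "N - 9"] by simp
    have n26: "2 ^ 26 \<le> ?n" using N by (intro power_increasing) auto
    have gm: "Measurable.pred paths (mostly_pos ?n x)" by (rule measurable_mostly_pos) measurable
    have gm': "Measurable.pred paths (\<lambda>V. mostly_pos ?n x (\<lambda>k. - V k))" by (rule measurable_mostly_pos) measurable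
    note [measurable] = gm gm'
    have g1: "path_prob \<nu>' ?n (\<lambda>V. mostly_pos ?n x V \<and> ?I V) \<le> (y - x) * normal_density (area_mean \<nu>' ?n) (sqrt (area_var ?n)) x * (1 + 20000 / x\<^sup>2)"
      if "\<bar>\<nu>'\<bar> = \<bar>\<nu>\<bar>" for \<nu>'
    proof -
      have "ennreal (path_prob \<nu>' ?n (\<lambda>V. mostly_pos ?n x V \<and> ?I V)) \<le> ennreal ((y - x) * normal_density (area_mean \<nu>' ?n) (sqrt (area_var ?n)) x * (1 + 20000 / x\<^sup>2))"
        unfolding emeasure_path_prob[symmetric] using that x0 xy by (intro good_bound[OF n64]) auto
      then show ?thesis using xy by (subst (asm) ennreal_le_iff) auto
    qed
    have g2: "path_prob \<nu> ?n (\<lambda>V. mostly_pos ?n x (\<lambda>k. - V k) \<and> ?I V) \<le> (y - x) * normal_density (- area_mean \<nu> ?n) (sqrt (area_var ?n)) x * (1 + 20000 / x\<^sup>2)"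
    proof -
      have "path_prob \<nu> ?n (\<lambda>V. mostly_pos ?n x (\<lambda>k. - V k) \<and> ?I V) = path_prob \<nu> ?n (\<lambda>V. (\<lambda>V. mostly_pos ?n x V \<and> ?I V) (\<lambda>k. - V k))"
        by (simp add: abs_avg_def)
      also have "\<dots> = path_prob (- \<nu>) ?n (\<lambda>V. mostly_pos ?n x V \<and> ?I V)" by (rule path_prob_reflect) measurable
      finally show ?thesis using g1[of "- \<nu>"] by (simp add: area_mean_uminus)
    qed
    have bd: "path_prob \<nu> ?n (\<lambda>V. atypical (2^60) ?q x V \<and> ?I V) \<le> (y - x) * (C' * (x + 1) * ?E) + tail_rem N x"
    proof -
      have "path_prob \<nu> ?n (\<lambda>V. atypical (2^60) ?q x V \<and> ?I V)
        \<le> exp (1 + \<bar>\<nu>\<bar>) * (x + 1) * (y - x) * (4 * 8 ^ 60 * path_prob \<nu> ?n (atypical_wide (2^60) ?q x) + D * exp (- (2 ^ 60 * (x\<^sup>2 / 64))))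
          + 4 * 2 ^ N * exp (- (2 ^ N * (x\<^sup>2 / 32)))"
        unfolding D_def
      proof (rule levels_bound[OF N e0 _ x0(4) order_refl xy])
        show "4 * (1 + \<bar>\<nu>\<bar>) \<le> 2 ^ 60 * e" by (simp add: e_def)
        fix V s j assume "j < 2 ^ 60" "\<bar>s\<bar> \<le> 1 / (2 ^ 60 * (x + 1))" "atypical (2 ^ 60) ?q x (\<lambda>k. V k + s * ramp ?q j k)"
        then show "atypical_wide (2 ^ 60) ?q x V" by (intro atypical_thick[OF _ _ x0(2)]) auto
      qed measurable
      also have "\<dots> \<le> exp (1 + \<bar>\<nu>\<bar>) * (x + 1) * (y - x) * (4 * 8 ^ 60 * (C * ?E) + D * ?E) + 4 * 2 ^ N * exp (- (2 ^ N * (x\<^sup>2 / 32)))"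
      proof (intro add_right_mono mult_left_mono add_mono)
        show "path_prob \<nu> ?n (atypical_wide (2^60) ?q x) \<le> C * ?E" unfolding nq using x0 by (intro Bb) (auto simp: e_def)
        have "(3 / 2 + 1 / 10^9) * x\<^sup>2 \<le> (2 ^ 60 / 64) * x\<^sup>2" by (intro mult_right_mono) auto
        moreover have "2 ^ 60 * (x\<^sup>2 / 64) = (2 ^ 60 / 64) * x\<^sup>2" "0 \<le> K * x" using K x0 by auto
        ultimately have "- (2 ^ 60 * (x\<^sup>2 / 64)) \<le> - (3 / 2 + 1 / 10^9) * x\<^sup>2 + K * x"
          by linarith
        then show "exp (- (2 ^ 60 * (x\<^sup>2 / 64))) \<le> ?E" by (simp only: exp_le_cancel_iff)
      qed (use D0 x0 xy in auto)
      also have "exp (1 + \<bar>\<nu>\<bar>) * (x + 1) * (y - x) * (4 * 8 ^ 60 * (C * ?E) + D * ?E) = (y - x) * (C' * (x + 1) * ?E)"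
        unfolding C'_def by (simp only: distrib_left distrib_right ac_simps)
      finally show ?thesis by (simp add: tail_rem_def)
    qed
    have "path_prob \<nu> ?n ?I \<le> path_prob \<nu> ?n (\<lambda>V. (mostly_pos ?n x V \<and> ?I V) \<or> ((mostly_pos ?n x (\<lambda>k. - V k) \<and> ?I V) \<or> (atypical (2^60) ?q x V \<and> ?I V)))"
    proof (rule path_prob_mono)
      fix V assume "?I V"
      then show "(mostly_pos ?n x V \<and> ?I V) \<or> ((mostly_pos ?n x (\<lambda>k. - V k) \<and> ?I V) \<or> (atypical (2^60) ?q x V \<and> ?I V))"
        using good_or_bad[OF _ nq n26 n512 x0(1), of V] by auto
    qed measurable
    also have "\<dots> \<le> path_prob \<nu> ?n (\<lambda>V. mostly_pos ?n x V \<and> ?I V) + path_prob \<nu> ?n (\<lambda>V. (mostly_pos ?n x (\<lambda>k. - V k) \<and> ?I V) \<or> (atypical (2^60) ?q x V \<and> ?I V))"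
      by (rule path_prob_disj) measurable
    also have "path_prob \<nu> ?n (\<lambda>V. (mostly_pos ?n x (\<lambda>k. - V k) \<and> ?I V) \<or> (atypical (2^60) ?q x V \<and> ?I V))
      \<le> path_prob \<nu> ?n (\<lambda>V. mostly_pos ?n x (\<lambda>k. - V k) \<and> ?I V) + path_prob \<nu> ?n (\<lambda>V. atypical (2^60) ?q x V \<and> ?I V)"
      by (rule path_prob_disj) measurable
    finally have "path_prob \<nu> ?n ?I \<le> (y - x) * normal_density (area_mean \<nu> ?n) (sqrt (area_var ?n)) x * (1 + 20000 / x\<^sup>2)
      + ((y - x) * normal_density (- area_mean \<nu> ?n) (sqrt (area_var ?n)) x * (1 + 20000 / x\<^sup>2) + ((y - x) * (C' * (x + 1) * ?E) + tail_rem N x))"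
      using g1[of \<nu>] g2 bd by linarith
    also have "\<dots> = (y - x) * (pair_density \<nu> ?n x * (1 + 20000 / x\<^sup>2) + C' * (x + 1) * ?E) + tail_rem N x"
      by (simp only: pair_density_def distrib_left distrib_right ac_simps)
    finally show "path_prob \<nu> ?n ?I \<le> (y - x) * (pair_density \<nu> ?n x * (1 + 20000 / x\<^sup>2) + C' * (x + 1) * ?E) + tail_rem N x" .
  qed
qed

text \<open>Paths of positive and of negative average form disjoint events, and reflection carries
  the second into the first with opposite drift.\<close>

lemma discrete_lower:
  assumes n: "n > 0" and x: "8 * \<bar>\<nu>\<bar> + 8 \<le> x" and xy: "x < y"
  shows "(y - x) * pair_density \<nu> n y * (1 - (8 * \<bar>\<nu>\<bar> + 8) / x) \<le> path_prob \<nu> n (\<lambda>V. x \<le> abs_avg n V \<and> abs_avg n V \<le> y)"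
proof -
  let ?J = "\<lambda>V. x \<le> abs_avg n V \<and> abs_avg n V \<le> y"
  have low: "(y - x) * normal_density (area_mean \<nu>' n) (sqrt (area_var n)) y * (1 - (8 * \<bar>\<nu>\<bar> + 8) / x) \<le> path_prob \<nu>' n (\<lambda>V. 0 < avg n V \<and> ?J V)"
    if "\<bar>\<nu>'\<bar> = \<bar>\<nu>\<bar>" for \<nu>'
  proof -
    have "ennreal ((y - x) * normal_density (area_mean \<nu>' n) (sqrt (area_var n)) y * (1 - (8 * \<bar>\<nu>'\<bar> + 8) / x)) \<le> ennreal (path_prob \<nu>' n (\<lambda>V. 0 < avg n V \<and> ?J V))"
      unfolding emeasure_path_prob[symmetric] using n x xy that by (intro low_bound) auto
    then show ?thesis by (subst (asm) ennreal_le_iff) (auto simp: path_prob_nonneg that)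
  qed
  have r: "path_prob \<nu> n (\<lambda>V. avg n V < 0 \<and> ?J V) = path_prob (- \<nu>) n (\<lambda>V. 0 < avg n V \<and> ?J V)"
  proof -
    have "path_prob \<nu> n (\<lambda>V. avg n V < 0 \<and> ?J V) = path_prob \<nu> n (\<lambda>V. (\<lambda>V. 0 < avg n V \<and> ?J V) (\<lambda>k. - V k))"
      by (simp add: abs_avg_def avg_uminus)
    also have "\<dots> = path_prob (- \<nu>) n (\<lambda>V. 0 < avg n V \<and> ?J V)" by (rule path_prob_reflect) measurable
    finally show ?thesis .
  qed
  have "path_prob \<nu> n (\<lambda>V. 0 < avg n V \<and> ?J V) + path_prob \<nu> n (\<lambda>V. avg n V < 0 \<and> ?J V)
      = measure (gauss n) ({\<xi>\<in>space (gauss n). 0 < avg n (drift_walk \<nu> n \<xi>) \<and> ?J (drift_walk \<nu> n \<xi>)} \<union> {\<xi>\<in>space (gauss n). avg n (drift_walk \<nu> n \<xi>) < 0 \<and> ?J (drift_walk \<nu> n \<xi>)})"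
    unfolding path_prob_def
  proof (rule finite_measure.finite_measure_Union[symmetric])
    show "finite_measure (gauss n)" by (rule prob_space.finite_measure[OF prob_space_gauss])
    show "{\<xi>\<in>space (gauss n). 0 < avg n (drift_walk \<nu> n \<xi>) \<and> ?J (drift_walk \<nu> n \<xi>)} \<in> sets (gauss n)"
      "{\<xi>\<in>space (gauss n). avg n (drift_walk \<nu> n \<xi>) < 0 \<and> ?J (drift_walk \<nu> n \<xi>)} \<in> sets (gauss n)" by measurable
  qed auto
  also have "\<dots> \<le> path_prob \<nu> n ?J"
    unfolding path_prob_def
  proof (rule finite_measure.finite_measure_mono)
    show "finite_measure (gauss n)" by (rule prob_space.finite_measure[OF prob_space_gauss])
    show "{\<xi>\<in>space (gauss n). ?J (drift_walk \<nu> n \<xi>)} \<in> sets (gauss n)" by measurable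
  qed auto
  finally show ?thesis using low[of \<nu>] low[of "- \<nu>"] unfolding r pair_density_def area_mean_uminus by (simp add: distrib_left distrib_right)
qed

lemma area_var_tendsto: "(\<lambda>N. area_var (2 ^ N)) \<longlonglongrightarrow> 1 / 3"
proof -
  have "((\<lambda>y::real. (y + 1) * (2 * y + 1) / (6 * y\<^sup>2)) \<longlongrightarrow> 1 / 3) at_top" by real_asymp
  moreover have "filterlim (\<lambda>N. (2::real) ^ N) at_top sequentially"
    by real_asymp
  ultimately have "(\<lambda>N. ((2::real) ^ N + 1) * (2 * 2 ^ N + 1) / (6 * (2 ^ N)\<^sup>2)) \<longlonglongrightarrow> 1 / 3" by (rule filterlim_compose)
  then show ?thesis by (simp add: area_var_def)
qed

lemma area_mean_tendsto: "(\<lambda>N. area_mean \<nu> (2 ^ N)) \<longlonglongrightarrow> \<nu> / 2"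
proof -
  have "((\<lambda>y::real. \<nu> * ((y + 1) / (2 * y))) \<longlongrightarrow> \<nu> * (1 / 2)) at_top" by (intro tendsto_mult_left) real_asymp
  moreover have "filterlim (\<lambda>N. (2::real) ^ N) at_top sequentially"
    by real_asymp
  ultimately have "(\<lambda>N. \<nu> * (((2::real) ^ N + 1) / (2 * 2 ^ N))) \<longlonglongrightarrow> \<nu> * (1 / 2)" by (rule filterlim_compose)
  then show ?thesis by (simp add: area_mean_def)
qed

definition lim_density :: "real \<Rightarrow> real \<Rightarrow> real" where
  "lim_density \<nu> x = normal_density (\<nu> / 2) (sqrt (1 / 3)) x + normal_density (- \<nu> / 2) (sqrt (1 / 3)) x"

lemma pair_density_tendsto: "(\<lambda>N. pair_density \<nu> (2 ^ N) x) \<longlonglongrightarrow> lim_density \<nu> x"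
proof -
  have "(\<lambda>N. pair_density \<nu> (2 ^ N) x) \<longlonglongrightarrow> normal_density (\<nu> / 2) (sqrt (1 / 3)) x + normal_density (- (\<nu> / 2)) (sqrt (1 / 3)) x"
    unfolding pair_density_def normal_density_def
    by (intro tendsto_intros area_var_tendsto area_mean_tendsto) auto
  then show ?thesis by (simp add: lim_density_def)
qed

lemma lim_density_eq: "lim_density \<nu> x = sqrt (6 / pi) * exp (- (3 * \<nu>\<^sup>2 / 8) - 3 * x\<^sup>2 / 2) * cosh (3 * \<nu> * x / 2)"
proof -
  have n: "normal_density m (sqrt (1 / 3)) x = sqrt (3 / (2 * pi)) * exp (- (3 * (x - m)\<^sup>2 / 2))" for m
    by (simp add: normal_density_def real_sqrt_divide real_sqrt_mult field_simps)
  have e1: "exp (- (3 * (x - \<nu> / 2)\<^sup>2 / 2)) = exp (- (3 * \<nu>\<^sup>2 / 8) - 3 * x\<^sup>2 / 2) * exp (3 * \<nu> * x / 2)"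
    unfolding exp_add[symmetric] by (rule arg_cong[where f=exp]) (simp add: power2_eq_square field_simps)
  have e2: "exp (- (3 * (x - (- \<nu> / 2))\<^sup>2 / 2)) = exp (- (3 * \<nu>\<^sup>2 / 8) - 3 * x\<^sup>2 / 2) * exp (- (3 * \<nu> * x / 2))"
    unfolding exp_add[symmetric] by (rule arg_cong[where f=exp]) (simp add: power2_eq_square field_simps)
  have "sqrt (6 / pi) = sqrt (4 * (3 / (2 * pi)))" by (rule arg_cong[where f=sqrt]) simp
  also have "\<dots> = 2 * sqrt (3 / (2 * pi))" unfolding real_sqrt_mult by simp
  finally have s: "sqrt (6 / pi) = 2 * sqrt (3 / (2 * pi))" .
  show ?thesis unfolding lim_density_def n e1 e2 s cosh_def by (simp add: algebra_simps)
qed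

section \<open>Densities from interval bounds\<close>

text \<open>An inequality does not pass to complements, so the pi-lambda theorem cannot be applied
  to it directly. The difference of the distribution functions is nondecreasing and right-continuous
  and defines a measure \<open>\<mu>3\<close>; then \<open>\<mu>1\<close> plus \<open>\<mu>3\<close>
  equals \<open>\<mu>2\<close> on half-open intervals, and an equality does extend to all Borel
  sets.\<close>

lemma measure_le_of_Ioc:
  fixes \<mu>1 \<mu>2 :: "real measure"
  assumes f1: "finite_borel_measure \<mu>1" and f2: "finite_borel_measure \<mu>2"
    and le: "\<And>a b. a < b \<Longrightarrow> measure \<mu>1 {a<..b} \<le> measure \<mu>2 {a<..b}"
    and A: "A \<in> sets borel"
  shows "measure \<mu>1 A \<le> measure \<mu>2 A"
proof -
  interpret m1: finite_borel_measure \<mu>1 by fact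
  interpret m2: finite_borel_measure \<mu>2 by fact
  define G where "G x = cdf \<mu>2 x - cdf \<mu>1 x" for x
  have Ioc: "measure \<mu> {a<..b} = cdf \<mu> b - cdf \<mu> a" if "finite_borel_measure \<mu>" "a < b" for \<mu> :: "real measure" and a b
    using finite_borel_measure.cdf_diff_eq[OF that] by simp
  have G: "G x \<le> G y" if "x \<le> y" for x y
  proof (cases "x = y")
    case False
    then have "x < y" using that by simp
    then show ?thesis using le[of x y] Ioc[OF f1] Ioc[OF f2] by (simp add: G_def)
  qed simp
  have Gr: "continuous (at_right x) G" for x
    unfolding G_def by (intro continuous_diff m1.cdf_is_right_cont m2.cdf_is_right_cont)
  define \<mu>3 where "\<mu>3 = interval_measure G"
  have s3 [measurable_cong]: "sets \<mu>3 = sets borel" by (simp add: \<mu>3_def)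
  have E3: "emeasure \<mu>3 {a<..b} = ennreal (G b - G a)" if "a \<le> b" for a b
    unfolding \<mu>3_def by (rule emeasure_interval_measure_Ioc[OF that G Gr])
  note s1 = m1.M_is_borel and s2 = m2.M_is_borel
  have P: "emeasure \<mu>1 {a<..b} + emeasure \<mu>3 {a<..b} = emeasure \<mu>2 {a<..b}" if "a \<le> b" for a b
  proof (cases "a = b")
    case False
    then have ab: "a < b" using that by simp
    have "emeasure \<mu>1 {a<..b} + emeasure \<mu>3 {a<..b} = ennreal (measure \<mu>1 {a<..b}) + ennreal (G b - G a)"
      unfolding E3[OF that] by (simp add: m1.emeasure_eq_measure)
    also have "\<dots> = ennreal (measure \<mu>1 {a<..b} + (G b - G a))"
      using G[OF that] by (simp add: ennreal_plus)
    also have "measure \<mu>1 {a<..b} + (G b - G a) = measure \<mu>2 {a<..b}"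
      using Ioc[OF f1 ab] Ioc[OF f2 ab] by (simp add: G_def)
    finally show ?thesis by (simp add: m2.emeasure_eq_measure)
  qed simp
  have fin3: "emeasure \<mu>3 UNIV \<le> emeasure \<mu>2 UNIV"
  proof -
    let ?I = "\<lambda>n::nat. {- real n<..real n}"
    have U: "(\<Union>n. ?I n) = UNIV"
    by (rule UN_Ioc_eq_UNIV)
    have "emeasure \<mu>3 (\<Union>n. ?I n) = (SUP n. emeasure \<mu>3 (?I n))"
      by (rule SUP_emeasure_incseq[symmetric]) (auto simp: incseq_def s1 s2 s3)
    also have "\<dots> \<le> emeasure \<mu>2 UNIV"
    proof (rule SUP_least)
      fix n
      have "emeasure \<mu>3 (?I n) \<le> emeasure \<mu>2 (?I n)" using P[of "- real n" "real n", symmetric] by (simp add: add_increasing)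
      also have "\<dots> \<le> emeasure \<mu>2 UNIV" by (rule emeasure_mono) (auto simp: s2)
      finally show "emeasure \<mu>3 (?I n) \<le> emeasure \<mu>2 UNIV" .
    qed
    finally show ?thesis unfolding U .
  qed
  then have fin3': "finite_measure \<mu>3"
    by (intro finite_measureI) (auto simp: \<mu>3_def top_unique m2.emeasure_eq_measure)
  interpret m3: finite_measure \<mu>3 by fact
  have sp: "space \<mu>1 = UNIV" "space \<mu>2 = UNIV" "space \<mu>3 = UNIV"
    using s1 s2 s3 by (simp_all add: sets_eq_imp_space_eq)
  let ?G = "range (\<lambda>(a, b). {a<..b::real})"
  have PM: "measure \<mu>1 {a<..b} + measure \<mu>3 {a<..b} = measure \<mu>2 {a<..b}" for a b
  proof (cases "a \<le> b")
    case True
    have "ennreal (measure \<mu>1 {a<..b} + measure \<mu>3 {a<..b}) = ennreal (measure \<mu>2 {a<..b})"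
      using P[OF True] by (simp add: m1.emeasure_eq_measure m2.emeasure_eq_measure m3.emeasure_eq_measure ennreal_plus)
    then show ?thesis by (subst (asm) ennreal_inj) auto
  qed simp
  have PU: "measure \<mu>1 UNIV + measure \<mu>3 UNIV = measure \<mu>2 UNIV"
  proof -
    let ?I = "\<lambda>n::nat. {- real n<..real n}"
    have U: "(\<Union>n. ?I n) = UNIV"
    by (rule UN_Ioc_eq_UNIV)
    have "(\<lambda>n. measure \<mu>1 (?I n) + measure \<mu>3 (?I n)) \<longlonglongrightarrow> measure \<mu>1 (\<Union>n. ?I n) + measure \<mu>3 (\<Union>n. ?I n)"
      by (intro tendsto_add m1.finite_Lim_measure_incseq m3.finite_Lim_measure_incseq) (auto simp: incseq_def s1 s2 s3)
    moreover have "(\<lambda>n. measure \<mu>2 (?I n)) \<longlonglongrightarrow> measure \<mu>2 (\<Union>n. ?I n)"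
      by (intro m2.finite_Lim_measure_incseq) (auto simp: incseq_def s1 s2 s3)
    ultimately show ?thesis unfolding PM U by (rule LIMSEQ_unique)
  qed
  have "measure \<mu>1 A + measure \<mu>3 A = measure \<mu>2 A"
  proof -
    have "Int_stable ?G" "?G \<subseteq> Pow UNIV" "A \<in> sigma_sets UNIV ?G"
      using A by (auto simp: borel_sigma_sets_Ioc Int_stable_def)
    then show ?thesis
    proof (induction rule: sigma_sets_induct_disjoint)
      case (basic A)
      then show ?case using PM by auto
    next
      case empty
      then show ?case by simp
    next
      case (compl A)
      then have "A \<in> sets borel" by (simp add: borel_sigma_sets_Ioc)
      then have "measure \<mu>1 (UNIV - A) = measure \<mu>1 UNIV - measure \<mu>1 A" "measure \<mu>2 (UNIV - A) = measure \<mu>2 UNIV - measure \<mu>2 A"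
        "measure \<mu>3 (UNIV - A) = measure \<mu>3 UNIV - measure \<mu>3 A"
        using m1.finite_measure_compl[of A] m2.finite_measure_compl[of A] m3.finite_measure_compl[of A] by (auto simp: sp s1 s2 s3)
      then show ?case using PU compl by simp
    next
      case (union A)
      then have "\<And>i. A i \<in> sets borel" by (auto simp: borel_sigma_sets_Ioc)
      then have "(\<lambda>i. measure \<mu>1 (A i)) sums measure \<mu>1 (\<Union>i. A i)" "(\<lambda>i. measure \<mu>2 (A i)) sums measure \<mu>2 (\<Union>i. A i)"
        "(\<lambda>i. measure \<mu>3 (A i)) sums measure \<mu>3 (\<Union>i. A i)"
        using union by (auto intro!: m1.finite_measure_UNION m2.finite_measure_UNION m3.finite_measure_UNION simp: s1 s2 s3)
      then have "(\<lambda>i. measure \<mu>1 (A i) + measure \<mu>3 (A i)) sums (measure \<mu>1 (\<Union>i. A i) + measure \<mu>3 (\<Union>i. A i))"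
        by (intro sums_add)
      then have "(\<lambda>i. measure \<mu>2 (A i)) sums (measure \<mu>1 (\<Union>i. A i) + measure \<mu>3 (\<Union>i. A i))"
        using union by simp
      then show ?case using \<open>(\<lambda>i. measure \<mu>2 (A i)) sums measure \<mu>2 (\<Union>i. A i)\<close> by (rule sums_unique2)
    qed
  qed
  then show ?thesis using measure_nonneg[of \<mu>3 A] by linarith
qed

lemma emeasure_density_indicator:
  assumes "A \<in> sets M" "B \<in> sets M"
  shows "emeasure (density M (indicator B)) A = emeasure M (B \<inter> A)"
proof -
  have "emeasure (density M (indicator B)) A = (\<integral>\<^sup>+x. indicator B x * indicator A x \<partial>M)"
    by (rule emeasure_density) (use assms in auto)
  also have "\<dots> = (\<integral>\<^sup>+x. indicator (B \<inter> A) x \<partial>M)" by (simp add: indicator_inter_arith)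
  also have "\<dots> = emeasure M (B \<inter> A)" by (rule nn_integral_indicator) (use assms in auto)
  finally show ?thesis .
qed

lemma finite_borel_measure_density:
  assumes "finite_measure M" "sets M = sets (borel :: real measure)" "B \<in> sets borel"
  shows "finite_borel_measure (density M (indicator B))"
proof -
  interpret finite_measure M by fact
  have "finite_measure (density M (indicator B))"
    by (rule finite_measureI) (use assms emeasure_density_indicator[OF sets.top[of M], of B] in \<open>auto simp: emeasure_eq_measure\<close>)
  then show ?thesis using assms by (auto simp: finite_borel_measure_def finite_borel_measure_axioms_def)
qed

lemma measure_density_indicator:
  assumes "A \<in> sets M" "B \<in> sets M"
  shows "measure (density M (indicator B)) A = measure M (B \<inter> A)"
  using emeasure_density_indicator[OF assms] by (simp add: measure_def)

lemma finite_borel_measure_lborel_Ioc: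
  assumes "0 \<le> s"
  shows "finite_borel_measure (density lborel (\<lambda>x. ennreal s * indicator {p<..q::real} x))"
proof -
  have "finite_measure (density lborel (\<lambda>x. ennreal s * indicator {p<..q::real} x))"
    by (rule finite_measureI) (cases "p \<le> q"; simp add: emeasure_density nn_integral_cmult_indicator ennreal_mult_eq_top_iff)
  then show ?thesis by (auto simp: finite_borel_measure_def finite_borel_measure_axioms_def)
qed

lemma measure_lborel_Ioc_density:
  assumes "0 \<le> s" "A \<in> sets borel"
  shows "measure (density lborel (\<lambda>x. ennreal s * indicator {p<..q::real} x)) A = s * measure lborel ({p<..q} \<inter> A)"
proof -
  have "emeasure (density lborel (\<lambda>x. ennreal s * indicator {p<..q::real} x)) A = (\<integral>\<^sup>+x. ennreal s * indicator ({p<..q} \<inter> A) x \<partial>lborel)"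
    using assms by (subst emeasure_density) (auto simp: indicator_inter_arith mult.assoc)
  also have "\<dots> = ennreal s * emeasure lborel ({p<..q} \<inter> A)"
    using assms by (intro nn_integral_cmult_indicator) auto
  finally show ?thesis using assms by (simp add: measure_def enn2real_mult)
qed

text \<open>Comparison of \<open>\<mu>\<close> restricted to the interval from p to q with s times
  Lebesgue measure restricted to it.\<close>

lemma Ioc_bound_upper:
  assumes \<mu>: "real_distribution \<mu>" and s: "0 \<le> s"
    and le: "\<And>a b. p \<le> a \<Longrightarrow> a < b \<Longrightarrow> b \<le> q \<Longrightarrow> measure \<mu> {a<..b} \<le> s * (b - a)"
    and A: "A \<in> sets borel" "A \<subseteq> {p<..q}"
  shows "measure \<mu> A \<le> s * measure lborel A"
proof -
  interpret real_distribution \<mu> by fact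
  have fm: "finite_measure \<mu>" by (rule finite_measure_axioms)
  have "measure (density \<mu> (indicator {p<..q})) A \<le> measure (density lborel (\<lambda>x. ennreal s * indicator {p<..q} x)) A"
  proof (rule measure_le_of_Ioc[OF finite_borel_measure_density[OF fm] finite_borel_measure_lborel_Ioc[OF s] _ A(1)])
    fix a b :: real assume "a < b"
    have i: "{p<..q} \<inter> {a<..b} = {max p a<..min q b}" by auto
    show "measure (density \<mu> (indicator {p<..q})) {a<..b} \<le> measure (density lborel (\<lambda>x. ennreal s * indicator {p<..q} x)) {a<..b}"
      using le[of "max p a" "min q b"] s
      by (cases "max p a < min q b") (auto simp: measure_density_indicator measure_lborel_Ioc_density i)
  qed auto
  moreover have "{p<..q} \<inter> A = A" using A by auto
  ultimately show ?thesis using A s by (simp add: measure_density_indicator measure_lborel_Ioc_density)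
qed

lemma Ioc_bound_lower:
  assumes \<mu>: "real_distribution \<mu>" and s: "0 \<le> s"
    and le: "\<And>a b. p \<le> a \<Longrightarrow> a < b \<Longrightarrow> b \<le> q \<Longrightarrow> s * (b - a) \<le> measure \<mu> {a<..b}"
    and A: "A \<in> sets borel" "A \<subseteq> {p<..q}"
  shows "s * measure lborel A \<le> measure \<mu> A"
proof -
  interpret real_distribution \<mu> by fact
  have fm: "finite_measure \<mu>" by (rule finite_measure_axioms)
  have "measure (density lborel (\<lambda>x. ennreal s * indicator {p<..q} x)) A \<le> measure (density \<mu> (indicator {p<..q})) A"
  proof (rule measure_le_of_Ioc[OF finite_borel_measure_lborel_Ioc[OF s] finite_borel_measure_density[OF fm] _ A(1)])
    fix a b :: real assume "a < b"
    have i: "{p<..q} \<inter> {a<..b} = {max p a<..min q b}" by auto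
    show "measure (density lborel (\<lambda>x. ennreal s * indicator {p<..q} x)) {a<..b} \<le> measure (density \<mu> (indicator {p<..q})) {a<..b}"
      using le[of "max p a" "min q b"] s
      by (cases "max p a < min q b") (auto simp: measure_density_indicator measure_lborel_Ioc_density i)
  qed auto
  moreover have "{p<..q} \<inter> A = A" using A by auto
  ultimately show ?thesis using A s by (simp add: measure_density_indicator measure_lborel_Ioc_density)
qed

text \<open>The set on which f exceeds s by at least 1 / (k + 1) would have too much mass unless it
  is null, and these sets exhaust the exceptional set.\<close>

lemma AE_density_le:
  fixes f :: "real \<Rightarrow> real"
  assumes f [measurable]: "f \<in> borel_measurable borel" and f0: "\<And>x. 0 \<le> f x" and \<mu>: "\<mu> = density lborel (\<lambda>x. ennreal (f x))"
    and fin: "finite_measure \<mu>"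
    and le: "\<And>A. A \<in> sets borel \<Longrightarrow> A \<subseteq> {p<..q} \<Longrightarrow> measure \<mu> A \<le> s * measure lborel A"
  shows "AE x in lborel. x \<in> {p<..q} \<longrightarrow> f x \<le> (s::real)"
proof -
  interpret finite_measure \<mu> by fact
  define B where "B k = {x \<in> {p<..q}. s + 1 / real (Suc k) \<le> f x}" for k
  have Bm: "B k \<in> sets borel" for k unfolding B_def by measurable
  have bounded: "emeasure lborel (B k) < \<infinity>" for k
  proof -
    have "emeasure lborel (B k) \<le> emeasure lborel {p<..q}" by (rule emeasure_mono) (auto simp: B_def)
    also have "\<dots> < \<infinity>" by (cases "p \<le> q") auto
    finally show ?thesis .
  qed
  have "B k \<in> null_sets lborel" for k
  proof -
    have "ennreal (s + 1 / real (Suc k)) * emeasure lborel (B k) = (\<integral>\<^sup>+x. ennreal (s + 1 / real (Suc k)) * indicator (B k) x \<partial>lborel)"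
      using Bm by (intro nn_integral_cmult_indicator[symmetric]) auto
    also have "\<dots> \<le> (\<integral>\<^sup>+x. ennreal (f x) * indicator (B k) x \<partial>lborel)"
      by (intro nn_integral_mono) (auto simp: B_def indicator_def intro!: ennreal_leI)
    also have "\<dots> = emeasure \<mu> (B k)" unfolding \<mu> using Bm by (intro emeasure_density[symmetric]) auto
    finally have "ennreal ((s + 1 / real (Suc k)) * measure lborel (B k)) \<le> ennreal (measure \<mu> (B k))"
      using bounded[of k] by (cases "0 \<le> s + 1 / real (Suc k)")
        (auto simp: emeasure_eq_measure emeasure_eq_ennreal_measure ennreal_mult' ennreal_neg mult_nonpos_nonneg)
    then have "(s + 1 / real (Suc k)) * measure lborel (B k) \<le> measure \<mu> (B k)"
      by (subst (asm) ennreal_le_iff) auto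
    also have "\<dots> \<le> s * measure lborel (B k)" using Bm by (intro le) (auto simp: B_def)
    finally have "1 / real (Suc k) * measure lborel (B k) \<le> 0" by (simp add: algebra_simps)
    then have "measure lborel (B k) = 0" using measure_nonneg[of lborel "B k"] by (simp add: field_simps)
    then show ?thesis using Bm bounded[of k] by (auto simp: null_sets_def emeasure_eq_ennreal_measure)
  qed
  then have "(\<Union>k. B k) \<in> null_sets lborel" by (intro null_sets_UN) auto
  moreover have "{x \<in> space lborel. \<not> (x \<in> {p<..q} \<longrightarrow> f x \<le> s)} \<subseteq> (\<Union>k. B k)"
  proof
    fix x assume "x \<in> {x \<in> space lborel. \<not> (x \<in> {p<..q} \<longrightarrow> f x \<le> s)}"
    then have x: "x \<in> {p<..q}" "0 < f x - s" by auto
    then obtain k where "1 / real (Suc k) < f x - s" using reals_Archimedean[OF x(2)] by (auto simp: inverse_eq_divide)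
    then show "x \<in> (\<Union>k. B k)" using x by (auto simp: B_def intro!: exI[of _ k])
  qed
  ultimately show ?thesis by (rule AE_I')
qed

lemma AE_density_ge:
  fixes f :: "real \<Rightarrow> real"
  assumes f [measurable]: "f \<in> borel_measurable borel" and f0: "\<And>x. 0 \<le> f x" and \<mu>: "\<mu> = density lborel (\<lambda>x. ennreal (f x))"
    and fin: "finite_measure \<mu>"
    and le: "\<And>A. A \<in> sets borel \<Longrightarrow> A \<subseteq> {p<..q} \<Longrightarrow> s * measure lborel A \<le> measure \<mu> A"
  shows "AE x in lborel. x \<in> {p<..q} \<longrightarrow> (s::real) \<le> f x"
proof -
  interpret finite_measure \<mu> by fact
  define B where "B k = {x \<in> {p<..q}. f x \<le> s - 1 / real (Suc k)}" for k
  have Bm: "B k \<in> sets borel" for k unfolding B_def by measurable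
  have bounded: "emeasure lborel (B k) < \<infinity>" for k
  proof -
    have "emeasure lborel (B k) \<le> emeasure lborel {p<..q}" by (rule emeasure_mono) (auto simp: B_def)
    also have "\<dots> < \<infinity>" by (cases "p \<le> q") auto
    finally show ?thesis .
  qed
  have "B k \<in> null_sets lborel" for k
  proof (cases "B k = {}")
    case False
    then obtain x where "f x \<le> s - 1 / real (Suc k)" by (auto simp: B_def)
    then have pos: "0 \<le> s - 1 / real (Suc k)" by (rule order_trans[OF f0])
    have "emeasure \<mu> (B k) = (\<integral>\<^sup>+x. ennreal (f x) * indicator (B k) x \<partial>lborel)"
      unfolding \<mu> using Bm by (intro emeasure_density) auto
    also have "\<dots> \<le> (\<integral>\<^sup>+x. ennreal (s - 1 / real (Suc k)) * indicator (B k) x \<partial>lborel)"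
      by (intro nn_integral_mono) (auto simp: B_def indicator_def intro!: ennreal_leI)
    also have "\<dots> = ennreal (s - 1 / real (Suc k)) * emeasure lborel (B k)"
      using Bm by (intro nn_integral_cmult_indicator) auto
    finally have "ennreal (measure \<mu> (B k)) \<le> ennreal ((s - 1 / real (Suc k)) * measure lborel (B k))"
      using bounded[of k] pos by (simp add: emeasure_eq_measure emeasure_eq_ennreal_measure ennreal_mult')
    then have "measure \<mu> (B k) \<le> (s - 1 / real (Suc k)) * measure lborel (B k)"
      using pos by (subst (asm) ennreal_le_iff) auto
    moreover have "s * measure lborel (B k) \<le> measure \<mu> (B k)" using Bm by (intro le) (auto simp: B_def)
    ultimately have "1 / real (Suc k) * measure lborel (B k) \<le> 0" by (simp add: algebra_simps)
    then have "measure lborel (B k) = 0" using measure_nonneg[of lborel "B k"] by (simp add: field_simps)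
    then show ?thesis using Bm bounded[of k] by (auto simp: null_sets_def emeasure_eq_ennreal_measure)
  qed simp
  then have "(\<Union>k. B k) \<in> null_sets lborel" by (intro null_sets_UN) auto
  moreover have "{x \<in> space lborel. \<not> (x \<in> {p<..q} \<longrightarrow> s \<le> f x)} \<subseteq> (\<Union>k. B k)"
  proof
    fix x assume "x \<in> {x \<in> space lborel. \<not> (x \<in> {p<..q} \<longrightarrow> s \<le> f x)}"
    then have x: "x \<in> {p<..q}" "0 < s - f x" by auto
    then obtain k where "1 / real (Suc k) < s - f x" using reals_Archimedean[OF x(2)] by (auto simp: inverse_eq_divide)
    then show "x \<in> (\<Union>k. B k)" using x by (auto simp: B_def intro!: exI[of _ k])
  qed
  ultimately show ?thesis by (rule AE_I')
qed

text \<open>Density bounds are obtained on small rational intervals first; continuity of the bounding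
  functions turns these countably many statements into a bound almost everywhere.\<close>

lemma density_from_intervals:
  fixes \<mu> :: "real measure" and l :: "real \<Rightarrow> real \<Rightarrow> real"
  assumes \<mu>: "real_distribution \<mu>"
    and lip: "\<And>e. 0 < e \<Longrightarrow> \<exists>L. \<forall>a b. e \<le> a \<longrightarrow> a < b \<longrightarrow> measure \<mu> {a<..<b} \<le> L * (b - a)"
    and nonpos: "measure \<mu> {..0} = 0"
    and x0: "0 < x0"
    and up: "\<And>x y. x0 \<le> x \<Longrightarrow> x < y \<Longrightarrow> measure \<mu> {x<..<y} \<le> u x * (y - x)"
    and low: "\<And>x y. x0 \<le> x \<Longrightarrow> x < y \<Longrightarrow> l x y * (y - x) \<le> measure \<mu> {x..y}"
    and cu: "\<And>x. x0 < x \<Longrightarrow> isCont u x"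
    and cl: "\<And>x. x0 < x \<Longrightarrow> isCont (\<lambda>p. l (fst p) (snd p)) (x, x)"
    and um [measurable]: "u \<in> borel_measurable borel" and lm [measurable]: "(\<lambda>x. l x x) \<in> borel_measurable borel"
  obtains f where "\<And>x. 0 \<le> f x" "f \<in> borel_measurable borel" "\<mu> = density lborel (\<lambda>x. ennreal (f x))"
    "\<And>x. x0 < x \<Longrightarrow> l x x \<le> f x \<and> f x \<le> u x"
proof -
  interpret real_distribution \<mu> by fact
  have fm: "finite_measure \<mu>" by (rule finite_measure_axioms)
  have atom: "measure \<mu> {x} = 0" if x: "0 < x" for x
  proof (rule ccontr)
    assume ne: "measure \<mu> {x} \<noteq> 0"
    define m where "m = measure \<mu> {x}"
    have m: "0 < m" using ne by (simp add: m_def zero_less_measure_iff)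
    obtain L where L: "\<And>a b. x / 2 \<le> a \<Longrightarrow> a < b \<Longrightarrow> measure \<mu> {a<..<b} \<le> L * (b - a)"
      using lip[of "x / 2"] x by auto
    \<comment> \<open>Chosen so that the Lipschitz bound leaves the interval from x - h to x + h at
      most half of the supposed atom, while the interval stays to the right of x / 2.\<close>
    define h where "h = min (x / 2) (m / (4 * (\<bar>L\<bar> + 1)))"
    have h: "0 < h" using x m by (simp add: h_def)
    have h2: "h \<le> x / 2" unfolding h_def by (rule min.cobounded1)
    have h3: "h \<le> m / (4 * (\<bar>L\<bar> + 1))" unfolding h_def by (rule min.cobounded2)
    note h = h h2 h3
    have "m \<le> measure \<mu> {x - h<..<x + h}" unfolding m_def using h by (intro finite_measure_mono) auto
    also have "\<dots> \<le> L * ((x + h) - (x - h))" using h by (intro L) auto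
    also have "\<dots> = 2 * (L * h)" by simp
    also have "L * h \<le> (\<bar>L\<bar> + 1) * h" using h by (intro mult_right_mono) auto
    also have "2 * ((\<bar>L\<bar> + 1) * h) \<le> 2 * ((\<bar>L\<bar> + 1) * (m / (4 * (\<bar>L\<bar> + 1))))"
      using h by (intro mult_left_mono) auto
    also have "\<dots> = m / 2" by (simp add: field_simps)
    finally show False using m by simp
  qed
  have Ioc: "measure \<mu> {a<..b} = measure \<mu> {a<..<b}" "measure \<mu> {a<..b} = measure \<mu> {a..b}" if ab: "0 < a" "a < b" for a b
  proof -
    have "{a<..b} = {a<..<b} \<union> {b}" using ab by auto
    moreover have "measure \<mu> ({a<..<b} \<union> {b}) = measure \<mu> {a<..<b} + measure \<mu> {b}"
      by (rule finite_measure_Union) auto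
    ultimately show "measure \<mu> {a<..b} = measure \<mu> {a<..<b}" using atom[of b] ab by simp
    have "{a..b} = {a} \<union> {a<..b}" using ab by auto
    moreover have "measure \<mu> ({a} \<union> {a<..b}) = measure \<mu> {a} + measure \<mu> {a<..b}"
      by (rule finite_measure_Union) auto
    ultimately show "measure \<mu> {a<..b} = measure \<mu> {a..b}" using atom[of a] ab by simp
  qed
  \<comment> \<open>The Lipschitz bound gives absolute continuity on each interval from 1 / (k + 1)
    to k + 1; these exhaust the positive axis, and \<open>nonpos\<close> deals with the
    rest.\<close>
  have ac: "absolutely_continuous lborel \<mu>"
    unfolding absolutely_continuous_def
  proof
    fix A :: "real set" assume A: "A \<in> null_sets lborel"
    then have Am: "A \<in> sets borel" by auto
    have "A \<inter> {1 / real (Suc k)<..real (Suc k)} \<in> null_sets \<mu>" for k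
    proof -
      have k0: "0 < 1 / real (Suc k)" by simp
      obtain L where L: "\<And>a b. 1 / real (Suc k) \<le> a \<Longrightarrow> a < b \<Longrightarrow> measure \<mu> {a<..<b} \<le> L * (b - a)"
        using lip[OF k0] by blast
      have "measure \<mu> (A \<inter> {1 / real (Suc k)<..real (Suc k)}) \<le> \<bar>L\<bar> * measure lborel (A \<inter> {1 / real (Suc k)<..real (Suc k)})"
      proof (rule Ioc_bound_upper[OF \<mu>])
        fix a b assume ab: "1 / real (Suc k) \<le> a" "a < b"
        have a0: "0 < a" using k0 ab(1) by (rule less_le_trans)
        have "L * (b - a) \<le> \<bar>L\<bar> * (b - a)" using ab by (intro mult_right_mono) auto
        then show "measure \<mu> {a<..b} \<le> \<bar>L\<bar> * (b - a)" using L[OF ab] Ioc(1)[OF a0 ab(2)] by simp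
      qed (use Am in auto)
      moreover have "emeasure lborel (A \<inter> {1 / real (Suc k)<..real (Suc k)}) = 0"
        by (rule null_setsD1[OF null_set_Int2[OF A]]) simp
      ultimately have "measure \<mu> (A \<inter> {1 / real (Suc k)<..real (Suc k)}) \<le> 0"
        by (simp add: measure_def[of lborel])
      then have "measure \<mu> (A \<inter> {1 / real (Suc k)<..real (Suc k)}) = 0"
        by (rule antisym[OF _ measure_nonneg])
      then show ?thesis using Am by (simp add: null_sets_def emeasure_eq_measure)
    qed
    then have "(\<Union>k. A \<inter> {1 / real (Suc k)<..real (Suc k)}) \<in> null_sets \<mu>" by (intro null_sets_UN) auto
    moreover have "{..0::real} \<in> null_sets \<mu>" using nonpos by (auto simp: null_sets_def emeasure_eq_measure)
    ultimately have "(\<Union>k. A \<inter> {1 / real (Suc k)<..real (Suc k)}) \<union> {..0} \<in> null_sets \<mu>" by (rule null_sets.Un)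
    moreover have "A \<subseteq> (\<Union>k. A \<inter> {1 / real (Suc k)<..real (Suc k)}) \<union> {..0}"
    proof
      fix x assume x: "x \<in> A"
      show "x \<in> (\<Union>k. A \<inter> {1 / real (Suc k)<..real (Suc k)}) \<union> {..0}"
      proof (cases "x \<le> 0")
        case False
        obtain k1 where k1: "1 / real (Suc k1) < x" using reals_Archimedean[of x] False by (auto simp: inverse_eq_divide)
        obtain k2 where k2: "x < real k2" using reals_Archimedean2 by blast
        let ?k = "max k1 k2"
        have "1 / real (Suc ?k) \<le> 1 / real (Suc k1)" by (intro divide_left_mono) auto
        then have "1 / real (Suc ?k) < x" using k1 by (rule le_less_trans)
        moreover have "x \<le> real (Suc ?k)" using k2 by simp
        ultimately show ?thesis using x by (intro UnI1 UN_I[of ?k] IntI) (simp_all only: greaterThanAtMost_iff UNIV_I simp_thms)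
      qed simp
    qed
    moreover have "A \<in> sets \<mu>" using Am by simp
    ultimately show "A \<in> null_sets \<mu>" by (metis null_sets_subset)
  qed
  obtain g where g [measurable]: "g \<in> borel_measurable lborel" and g\<mu>: "density lborel g = \<mu>"
    using sigma_finite_measure.Radon_Nikodym[OF sigma_finite_lborel ac] by auto
  have "(\<integral>\<^sup>+x. g x \<partial>lborel) \<noteq> \<infinity>"
  proof -
    have "(\<integral>\<^sup>+x. g x \<partial>lborel) = emeasure (density lborel g) (space lborel)" by (simp add: emeasure_density)
    also have "\<dots> = emeasure \<mu> UNIV" by (simp add: g\<mu>)
    finally show ?thesis by (simp add: emeasure_eq_measure)
  qed
  then have gfin: "AE x in lborel. g x \<noteq> \<infinity>" by (intro nn_integral_PInf_AE g)
  define f0 where "f0 x = enn2real (g x)" for x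
  have f0m [measurable]: "f0 \<in> borel_measurable borel" unfolding f0_def[abs_def] by measurable
  have f00: "0 \<le> f0 x" for x by (simp add: f0_def)
  have f0\<mu>: "\<mu> = density lborel (\<lambda>x. ennreal (f0 x))"
    unfolding g\<mu>[symmetric]
  proof (rule density_cong)
    show "AE x in lborel. g x = ennreal (f0 x)" using gfin by eventually_elim (auto simp: f0_def less_top)
  qed measurable
  have u0: "0 \<le> u x" if "x0 < x" for x
  proof -
    have "0 \<le> measure \<mu> {x<..<x + 1}" by (rule measure_nonneg)
    also have "\<dots> \<le> u x * ((x + 1) - x)" by (rule up) (use that in auto)
    finally show ?thesis by simp
  qed
  have upAE: "AE x in lborel. x0 < x \<longrightarrow> f0 x \<le> u x"
  proof -
    define R where "R = {(p, q, s). x0 \<le> p \<and> 0 \<le> s \<and> (\<forall>x\<in>{p..q}. u x \<le> s)} \<inter> \<rat> \<times> \<rat> \<times> \<rat>"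
    have cR: "countable R" unfolding R_def by (intro countable_Int2 countable_SIGMA countable_rat)
    have AEr: "AE x in lborel. x \<in> {fst r<..fst (snd r)} \<longrightarrow> f0 x \<le> snd (snd r)" if "r \<in> R" for r
    proof -
      obtain p q s where r: "r = (p, q, s)" by (cases r) auto
      have prp: "x0 \<le> p" "0 \<le> s" "\<And>x. p \<le> x \<Longrightarrow> x \<le> q \<Longrightarrow> u x \<le> s" using that r by (auto simp: R_def)
      have "AE x in lborel. x \<in> {p<..q} \<longrightarrow> f0 x \<le> s"
      proof (rule AE_density_le[OF f0m f00 f0\<mu> fm], rule Ioc_bound_upper[OF \<mu> prp(2)])
        fix a b assume ab: "p \<le> a" "a < b" "b \<le> q"
        have "measure \<mu> {a<..b} \<le> u a * (b - a)" using up[of a b] Ioc(1)[of a b] ab prp x0 by simp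
        also have "\<dots> \<le> s * (b - a)" using prp(3)[of a] ab by (intro mult_right_mono) auto
        finally show "measure \<mu> {a<..b} \<le> s * (b - a)" .
      qed
      then show ?thesis using r by simp
    qed
    have "AE x in lborel. \<forall>r\<in>R. x \<in> {fst r<..fst (snd r)} \<longrightarrow> f0 x \<le> snd (snd r)"
      unfolding AE_ball_countable[OF cR] using AEr by blast
    then show ?thesis
    proof eventually_elim
      case (elim x)
      show ?case
      proof (rule impI, rule ccontr)
        assume x: "x0 < x" and "\<not> f0 x \<le> u x"
        then obtain s where s: "s \<in> \<rat>" "u x < s" "s < f0 x" using Rats_dense_in_real[of "u x" "f0 x"] by auto
        have "eventually (\<lambda>y. u y < s) (at x)" using cu[OF x] s(2) by (intro order_tendstoD) (auto simp: isCont_def)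
        then obtain d where d: "0 < d" "\<And>y. y \<noteq> x \<Longrightarrow> dist y x < d \<Longrightarrow> u y < s" by (auto simp: eventually_at)
        define d' where "d' = min d (x - x0)"
        obtain p where p: "p \<in> \<rat>" "x - d' < p" "p < x" using Rats_dense_in_real[of "x - d'" x] d(1) x by (auto simp: d'_def)
        obtain q where q: "q \<in> \<rat>" "x < q" "q < x + d'" using Rats_dense_in_real[of x "x + d'"] d(1) x by (auto simp: d'_def)
        have us: "u y \<le> s" if "p \<le> y" "y \<le> q" for y
        proof (cases "y = x")
          case False
          have "\<bar>y - x\<bar> < d'" using that p(2) q(3) by linarith
          then have "dist y x < d" by (simp add: d'_def dist_real_def)
          then show ?thesis using d(2)[OF False] by simp
        qed (use s in simp)
        have "0 \<le> s" using u0[OF x] s by simp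
        have "x0 \<le> p" using p(2) by (simp add: d'_def)
        then have "(p, q, s) \<in> R" using p(1) q(1) s(1) us \<open>0 \<le> s\<close> by (simp add: R_def)
        from bspec[OF elim this] have "f0 x \<le> s" using p q by simp
        then show False using s by simp
      qed
    qed
  qed
  have loAE: "AE x in lborel. x0 < x \<longrightarrow> l x x \<le> f0 x"
  proof -
    define R where "R = {(p, q, s). x0 \<le> p \<and> 0 \<le> s \<and> (\<forall>x\<in>{p..q}. \<forall>y\<in>{p..q}. s \<le> l x y)} \<inter> \<rat> \<times> \<rat> \<times> \<rat>"
    have cR: "countable R" unfolding R_def by (intro countable_Int2 countable_SIGMA countable_rat)
    have AEr: "AE x in lborel. x \<in> {fst r<..fst (snd r)} \<longrightarrow> snd (snd r) \<le> f0 x" if "r \<in> R" for r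
    proof -
      obtain p q s where r: "r = (p, q, s)" by (cases r) auto
      have prp: "x0 \<le> p" "0 \<le> s" "\<And>x y. p \<le> x \<Longrightarrow> x \<le> q \<Longrightarrow> p \<le> y \<Longrightarrow> y \<le> q \<Longrightarrow> s \<le> l x y" using that r by (auto simp: R_def)
      have "AE x in lborel. x \<in> {p<..q} \<longrightarrow> s \<le> f0 x"
      proof (rule AE_density_ge[OF f0m f00 f0\<mu> fm], rule Ioc_bound_lower[OF \<mu> prp(2)])
        fix a b assume ab: "p \<le> a" "a < b" "b \<le> q"
        have "s * (b - a) \<le> l a b * (b - a)" using prp(3)[of a b] ab by (intro mult_right_mono) auto
        also have "\<dots> \<le> measure \<mu> {a<..b}" using low[of a b] Ioc(2)[of a b] ab prp x0 by simp
        finally show "s * (b - a) \<le> measure \<mu> {a<..b}" .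
      qed
      then show ?thesis using r by simp
    qed
    have "AE x in lborel. \<forall>r\<in>R. x \<in> {fst r<..fst (snd r)} \<longrightarrow> snd (snd r) \<le> f0 x"
      unfolding AE_ball_countable[OF cR] using AEr by blast
    then show ?thesis
    proof eventually_elim
      case (elim x)
      show ?case
      proof (rule impI, rule ccontr)
        assume x: "x0 < x" and "\<not> l x x \<le> f0 x"
        then obtain s where s: "s \<in> \<rat>" "s < l x x" "f0 x < s" using Rats_dense_in_real[of "f0 x" "l x x"] by auto
        have "((\<lambda>p. l (fst p) (snd p)) \<longlongrightarrow> l x x) (at (x, x))" using cl[OF x] by (simp add: isCont_def)
        then have "eventually (\<lambda>p. s < l (fst p) (snd p)) (at (x, x))" using s(2) by (intro order_tendstoD) auto
        then obtain d where d: "0 < d" "\<And>p. p \<noteq> (x, x) \<Longrightarrow> dist p (x, x) < d \<Longrightarrow> s < l (fst p) (snd p)" by (auto simp: eventually_at)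
        define d' where "d' = min (d / 2) (x - x0)"
        obtain p where p: "p \<in> \<rat>" "x - d' < p" "p < x" using Rats_dense_in_real[of "x - d'" x] d(1) x by (auto simp: d'_def)
        obtain q where q: "q \<in> \<rat>" "x < q" "q < x + d'" using Rats_dense_in_real[of x "x + d'"] d(1) x by (auto simp: d'_def)
        have us: "s \<le> l y z" if "p \<le> y" "y \<le> q" "p \<le> z" "z \<le> q" for y z
        proof (cases "(y, z) = (x, x)")
          case False
          have "\<bar>y - x\<bar> < d'" "\<bar>z - x\<bar> < d'" using that p(2) q(3) by linarith+
          then have "\<bar>y - x\<bar> < d / 2" "\<bar>z - x\<bar> < d / 2" by (simp_all add: d'_def)
          then have "dist (y, z) (x, x) < d"
            using real_sqrt_sum_squares_triangle_ineq[of "y - x" 0 0 "z - x"] by (simp add: dist_Pair_Pair dist_real_def)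
          then show ?thesis using d(2)[OF False] by simp
        qed (use s in simp)
        have "0 \<le> s" using s f00[of x] by simp
        have "x0 \<le> p" using p(2) by (simp add: d'_def)
        then have "(p, q, s) \<in> R" using p(1) q(1) s(1) us \<open>0 \<le> s\<close> by (simp add: R_def)
        from bspec[OF elim this] have "s \<le> f0 x" using p q by simp
        then show False using s by simp
      qed
    qed
  qed
  \<comment> \<open>Both interval bounds are divided by y - x, and y decreases to x. This makes u an
    admissible value in the modification below.\<close>
  have lu: "l x x \<le> u x" if x: "x0 < x" for x
  proof (rule tendsto_upperbound)
    have c: "((\<lambda>y. (x, y)) \<longlongrightarrow> (x, x)) (at_right x)" by (intro tendsto_intros)
    show "((\<lambda>y. l x y) \<longlongrightarrow> l x x) (at_right x)"
      using isCont_tendsto_compose[OF cl[OF x] c] by simp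
    show "eventually (\<lambda>y. l x y \<le> u x) (at_right x)"
      unfolding eventually_at_right_field
    proof (intro exI[of _ "x + 1"] conjI allI impI)
      fix y assume y: "x < y"
      have "l x y * (y - x) \<le> u x * (y - x)"
        using low[of x y] up[of x y] Ioc[of x y] x y x0 by linarith
      then show "l x y \<le> u x" using y by simp
    qed simp
  qed simp
  \<comment> \<open>On the null set where a bound fails the density is redefined as u, so that the
    bounds hold at every point beyond x0; an asymptotic expansion of f needs them at every
    point.\<close>
  define f where "f x = (if x0 < x \<and> \<not> (l x x \<le> f0 x \<and> f0 x \<le> u x) then u x else f0 x)" for x
  show ?thesis
  proof (rule that)
    show "0 \<le> f x" for x using u0 f00 by (auto simp: f_def)
    show fmm: "f \<in> borel_measurable borel" unfolding f_def[abs_def] by measurable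
    show "\<mu> = density lborel (\<lambda>x. ennreal (f x))"
      unfolding f0\<mu>
    proof (rule density_cong)
      show "AE x in lborel. ennreal (f0 x) = ennreal (f x)"
        using upAE loAE by eventually_elim (auto simp: f_def)
    qed (use fmm in measurable)
    show "l x x \<le> f x \<and> f x \<le> u x" if "x0 < x" for x using lu[OF that] that by (auto simp: f_def)
  qed
qed

section \<open>Riemann sums and limits of probabilities\<close>

lemma riemann_sum_error:
  fixes g :: "real \<Rightarrow> real"
  assumes g: "continuous_on {0..t} g" and \<delta>: "0 < \<delta>" "real n * \<delta> = t"
    and e: "\<And>x y. x \<in> {0..t} \<Longrightarrow> y \<in> {0..t} \<Longrightarrow> \<bar>x - y\<bar> \<le> \<delta> \<Longrightarrow> \<bar>g x - g y\<bar> \<le> e"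
  shows "m \<le> n \<Longrightarrow> \<bar>integral {0..real m * \<delta>} g - (\<Sum>k=1..m. \<delta> * g (real k * \<delta>))\<bar> \<le> real m * \<delta> * e"
proof (induction m)
  case (Suc m)
  have le: "real (Suc m) * \<delta> \<le> t" unfolding \<delta>(2)[symmetric] using Suc \<delta> by (intro mult_right_mono) auto
  let ?a = "real m * \<delta>" and ?b = "real (Suc m) * \<delta>"
  have ab: "0 \<le> ?a" "?a \<le> ?b" "?b - ?a = \<delta>" using \<delta> by (auto simp: algebra_simps)
  have io: "g integrable_on {0..?b}" using le by (intro integrable_continuous_real continuous_on_subset[OF g]) auto
  have i2: "g integrable_on {?a..?b}" using le ab by (intro integrable_continuous_real continuous_on_subset[OF g]) auto
  have "integral {0..?a} g + integral {?a..?b} g = integral {0..?b} g"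
    using ab by (intro Henstock_Kurzweil_Integration.integral_combine io) auto
  moreover have "\<bar>integral {?a..?b} g - \<delta> * g ?b\<bar> \<le> \<delta> * e"
  proof -
    have "norm (integral {?a..?b} (\<lambda>x. g x - g ?b)) \<le> e * (?b - ?a)"
    proof (rule integral_bound)
      show "continuous_on {?a..?b} (\<lambda>x. g x - g ?b)"
        using le ab by (intro continuous_intros continuous_on_subset[OF g]) auto
      fix x assume x: "x \<in> {?a..?b}"
      then have "0 \<le> x" "x \<le> t" "\<bar>x - ?b\<bar> \<le> \<delta>" using le ab unfolding atLeastAtMost_iff by linarith+
      moreover have "0 \<le> ?b" using ab by linarith
      ultimately show "norm (g x - g ?b) \<le> e" unfolding real_norm_def using le by (intro e) auto
    qed (use ab in auto)
    moreover have "integral {?a..?b} (\<lambda>x. g x - g ?b) = integral {?a..?b} g - \<delta> * g ?b"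
      using ab by (subst Henstock_Kurzweil_Integration.integral_diff[OF i2]) auto
    ultimately show ?thesis using ab by (simp add: mult.commute)
  qed
  moreover have "\<bar>integral {0..?a} g - (\<Sum>k=1..m. \<delta> * g (real k * \<delta>))\<bar> \<le> real m * \<delta> * e"
    using Suc by simp
  moreover have "(\<Sum>k=1..Suc m. \<delta> * g (real k * \<delta>)) = (\<Sum>k=1..m. \<delta> * g (real k * \<delta>)) + \<delta> * g ?b" by simp
  moreover have "real (Suc m) * \<delta> * e = real m * \<delta> * e + \<delta> * e" by (simp add: algebra_simps)
  ultimately show ?case by linarith
qed simp

lemma riemann_sum_tendsto:
  fixes g :: "real \<Rightarrow> real"
  assumes g: "continuous_on {0..t} g" and t: "0 < t"
  shows "(\<lambda>n. t / real n * (\<Sum>k=1..n. g (t * real k / real n))) \<longlonglongrightarrow> (LINT s:{0..t}|lborel. g s)"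
proof -
  have eq: "(LINT s:{0..t}|lborel. g s) = integral {0..t} g"
    by (rule set_borel_integral_eq_integral) (rule borel_integrable_atLeastAtMost', rule g)
  show ?thesis
    unfolding eq
  proof (rule LIMSEQ_I)
    fix r :: real assume r: "0 < r"
    define e where "e = r / (2 * t)"
    have e: "0 < e" using r t by (simp add: e_def)
    have "uniformly_continuous_on {0..t} g" by (rule compact_uniformly_continuous[OF g]) simp
    then obtain d where d: "0 < d" "\<And>x y. x \<in> {0..t} \<Longrightarrow> y \<in> {0..t} \<Longrightarrow> dist x y < d \<Longrightarrow> dist (g x) (g y) < e"
      using e unfolding uniformly_continuous_on_def by metis
    obtain n0 where n0: "t / d < real n0" using reals_Archimedean2 by blast
    show "\<exists>no. \<forall>n\<ge>no. norm (t / real n * (\<Sum>k=1..n. g (t * real k / real n)) - integral {0..t} g) < r"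
    proof (intro exI allI impI)
      fix n assume n: "n \<ge> max 1 n0"
      then have nn: "n > 0" "t / d < real n" using n0 by auto
      let ?\<delta> = "t / real n"
      have \<delta>: "0 < ?\<delta>" "real n * ?\<delta> = t" "?\<delta> < d" using nn t d by (auto simp: field_simps)
      have "\<bar>integral {0..real n * ?\<delta>} g - (\<Sum>k=1..n. ?\<delta> * g (real k * ?\<delta>))\<bar> \<le> real n * ?\<delta> * e"
      proof (rule riemann_sum_error[OF g \<delta>(1,2) _ order_refl])
        fix x y assume xy: "x \<in> {0..t}" "y \<in> {0..t}" "\<bar>x - y\<bar> \<le> ?\<delta>"
        then have "dist x y < d" using \<delta>(3) unfolding dist_real_def by linarith
        from d(2)[OF xy(1,2) this] show "\<bar>g x - g y\<bar> \<le> e" by (simp add: dist_real_def)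
      qed
      also have "(\<Sum>k=1..n. ?\<delta> * g (real k * ?\<delta>)) = t / real n * (\<Sum>k=1..n. g (t * real k / real n))"
        by (simp add: sum_distrib_left mult.commute)
      also have "real n * ?\<delta> * e < r" unfolding \<delta>(2) using r t by (simp add: e_def)
      finally show "norm (t / real n * (\<Sum>k=1..n. g (t * real k / real n)) - integral {0..t} g) < r"
        unfolding \<delta>(2) by (simp add: abs_minus_commute)
    qed
  qed
qed

text \<open>The open-set half of the portmanteau theorem: where the limit lies in U, so do all late
  approximations, and Fatou's lemma gives the inequality.\<close>

lemma (in prob_space) prob_open_le:
  fixes X :: "'a \<Rightarrow> real" and Y :: "nat \<Rightarrow> 'a \<Rightarrow> real"
  assumes [measurable]: "X \<in> borel_measurable M" "\<And>N. Y N \<in> borel_measurable M"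
    and lim: "AE \<omega> in M. (\<lambda>N. Y N \<omega>) \<longlonglongrightarrow> X \<omega>" and U: "open U"
    and le: "eventually (\<lambda>N. prob {\<omega>\<in>space M. Y N \<omega> \<in> U} \<le> c N) sequentially" and c: "c \<longlonglongrightarrow> c0"
  shows "prob {\<omega>\<in>space M. X \<omega> \<in> U} \<le> c0"
proof -
  have [measurable]: "U \<in> sets borel" using U by simp
  have c0: "0 \<le> c0"
    by (rule tendsto_lowerbound[OF c]) (use le in \<open>auto elim!: eventually_mono intro: order_trans[OF measure_nonneg]\<close>)
  let ?I = "\<lambda>N \<omega>. indicator {\<omega>\<in>space M. Y N \<omega> \<in> U} \<omega> :: ennreal"
  have "ennreal (prob {\<omega>\<in>space M. X \<omega> \<in> U}) = (\<integral>\<^sup>+\<omega>. indicator {\<omega>\<in>space M. X \<omega> \<in> U} \<omega> \<partial>M)"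
    by (subst nn_integral_indicator) (auto simp: emeasure_eq_measure)
  also have "\<dots> \<le> (\<integral>\<^sup>+\<omega>. liminf (\<lambda>N. ?I N \<omega>) \<partial>M)"
  proof (rule nn_integral_mono_AE)
    show "AE \<omega> in M. indicator {\<omega>\<in>space M. X \<omega> \<in> U} \<omega> \<le> liminf (\<lambda>N. ?I N \<omega>)"
      using lim AE_space
    proof eventually_elim
      case (elim \<omega>)
      show ?case
      proof (cases "X \<omega> \<in> U")
        case True
        then have "eventually (\<lambda>N. Y N \<omega> \<in> U) sequentially" using elim(1) U by (auto simp: tendsto_def)
        then have "eventually (\<lambda>N. 1 \<le> ?I N \<omega>) sequentially" by eventually_elim (use elim in auto)
        then have "1 \<le> liminf (\<lambda>N. ?I N \<omega>)" by (rule Liminf_bounded)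
        then show ?thesis using True elim by simp
      qed simp
    qed
  qed
  also have "\<dots> \<le> liminf (\<lambda>N. \<integral>\<^sup>+\<omega>. ?I N \<omega> \<partial>M)" by (rule nn_integral_liminf) measurable
  also have "\<dots> \<le> liminf (\<lambda>N. ennreal (c N))"
  proof (rule Liminf_mono)
    show "eventually (\<lambda>N. (\<integral>\<^sup>+\<omega>. ?I N \<omega> \<partial>M) \<le> ennreal (c N)) sequentially"
      using le
    proof eventually_elim
      case (elim N)
      have "(\<integral>\<^sup>+\<omega>. ?I N \<omega> \<partial>M) = ennreal (prob {\<omega>\<in>space M. Y N \<omega> \<in> U})"
        by (subst nn_integral_indicator) (auto simp: emeasure_eq_measure)
      then show ?case using elim by (simp add: ennreal_leI)
    qed
  qed
  also have "\<dots> = ennreal c0" by (rule lim_imp_Liminf) (auto intro: tendsto_ennrealI c)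
  finally show ?thesis using c0 by simp
qed

section \<open>Realisation by Brownian motion\<close>

context standard_brownian_motion
begin

text \<open>The division gives unit variance, and the restriction to indices below n makes the
  vector a point of the space of \<open>gauss n\<close>.\<close>

definition incr :: "real \<Rightarrow> nat \<Rightarrow> 'a \<Rightarrow> nat \<Rightarrow> real" where
  "incr t n \<omega> = (\<lambda>i\<in>{..<n}. (W (t * real (Suc i) / real n) \<omega> - W (t * real i / real n) \<omega>) / sqrt (t / real n))"

lemma distr_incr:
  assumes t: "0 < t" and n: "n > 0"
  shows "distr M (Pi\<^sub>M {..<n} (\<lambda>_. borel)) (incr t n) = gauss n"
    and "incr t n \<in> measurable M (gauss n)"
proof -
  define \<tau> where "\<tau> i = t * real i / real n" for i :: nat
  define X where "X i \<omega> = (W (\<tau> (Suc i)) \<omega> - W (\<tau> i) \<omega>) / sqrt (t / real n)" for i \<omega>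
  have st: "0 < sqrt (t / real n)" using t n by simp
  have \<tau>: "0 \<le> \<tau> i" "\<tau> i < \<tau> (Suc i)" "\<tau> (Suc i) - \<tau> i = t / real n" for i
    using t n by (auto simp: \<tau>_def field_simps)
  have iv: "indep_vars (\<lambda>_. borel) X {..<n}"
    unfolding X_def
    by (rule indep_vars_compose2[OF independent_increments, where Y="\<lambda>i x. x / sqrt (t / real n)"]) (use \<tau> in auto)
  have dX: "distributed M lborel (X i) (\<lambda>x. ennreal (std_normal_density x))" for i
    using normal_standard_normal_convert[OF st, of "\<lambda>\<omega>. W (\<tau> (Suc i)) \<omega> - W (\<tau> i) \<omega>" 0]
      gaussian_increments[OF \<tau>(1,2), of i] \<tau>(3)[of i] by (simp add: X_def[abs_def])
  have rv: "X i \<in> borel_measurable M" for i using distributed_measurable[OF dX[of i]] by simp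
  have dist: "distr M borel (X i) = std_normal_distribution" for i
  proof -
    have "distr M borel (X i) = distr M lborel (X i)" by (rule distr_cong) auto
    then show ?thesis using distributed_distr_eq_density[OF dX[of i]] by simp
  qed
  have inc: "incr t n = (\<lambda>\<omega>. \<lambda>i\<in>{..<n}. X i \<omega>)" by (simp add: incr_def X_def \<tau>_def fun_eq_iff)
  have "{..<n} \<noteq> {}" using n by auto
  from indep_vars_iff_distr_eq_PiM[where M'="\<lambda>_. borel" and X=X, OF this rv] iv
  have "distr M (Pi\<^sub>M {..<n} (\<lambda>_. borel)) (incr t n) = Pi\<^sub>M {..<n} (\<lambda>i. distr M borel (X i))"
    unfolding inc by simp
  then show "distr M (Pi\<^sub>M {..<n} (\<lambda>_. borel)) (incr t n) = gauss n" by (simp add: dist gauss_def)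
  show "incr t n \<in> measurable M (gauss n)"
    unfolding inc measurable_cong_sets[OF refl sets_gauss] using rv by (intro measurable_restrict) auto
qed

lemma prob_incr:
  assumes t: "0 < t" and n: "n > 0" and E: "Measurable.pred paths E"
  shows "prob {\<omega>\<in>space M. E (drift_walk \<nu> n (incr t n \<omega>))} = path_prob \<nu> n E"
proof -
  have m: "incr t n \<in> measurable M (Pi\<^sub>M {..<n} (\<lambda>_. borel))"
    using distr_incr(2)[OF t n] unfolding measurable_cong_sets[OF refl sets_gauss] .
  have S: "{\<xi>\<in>space (gauss n). E (drift_walk \<nu> n \<xi>)} \<in> sets (Pi\<^sub>M {..<n} (\<lambda>_. borel))"
    using pred_drift_walk[OF E, where n=n and \<nu>=\<nu>] unfolding sets_gauss[symmetric] by (simp add: pred_def)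
  have "path_prob \<nu> n E = measure (distr M (Pi\<^sub>M {..<n} (\<lambda>_. borel)) (incr t n)) {\<xi>\<in>space (gauss n). E (drift_walk \<nu> n \<xi>)}"
    unfolding distr_incr(1)[OF t n] by (simp add: path_prob_def)
  also have "\<dots> = prob (incr t n -` {\<xi>\<in>space (gauss n). E (drift_walk \<nu> n \<xi>)} \<inter> space M)"
    by (rule measure_distr[OF m S])
  also have "incr t n -` {\<xi>\<in>space (gauss n). E (drift_walk \<nu> n \<xi>)} \<inter> space M = {\<omega>\<in>space M. E (drift_walk \<nu> n (incr t n \<omega>))}"
    using measurable_space[OF distr_incr(2)[OF t n]] by auto
  finally show ?thesis by simp
qed

lemma drift_walk_incr:
  assumes t: "0 < t" and n: "n > 0" and k: "k \<le> n" and W0: "W 0 \<omega> = 0"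
  shows "drift_walk \<nu> n (incr t n \<omega>) k = \<nu> * real k / real n + W (t * real k / real n) \<omega> / sqrt t"
proof -
  have "(\<Sum>i<k. incr t n \<omega> i) = (\<Sum>i<k. W (t * real (Suc i) / real n) \<omega> - W (t * real i / real n) \<omega>) / sqrt (t / real n)"
    unfolding sum_divide_distrib using k by (intro sum.cong) (auto simp: incr_def)
  also have "(\<Sum>i<k. W (t * real (Suc i) / real n) \<omega> - W (t * real i / real n) \<omega>) = W (t * real k / real n) \<omega>"
    using sum_lessThan_telescope[of "\<lambda>i. W (t * real i / real n) \<omega>" k] W0 by simp
  finally show ?thesis using k t n by (simp add: drift_walk_def walk_def min_def real_sqrt_divide)
qed

definition riemann_abs :: "real \<Rightarrow> real \<Rightarrow> real \<Rightarrow> nat \<Rightarrow> 'a \<Rightarrow> real" where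
  "riemann_abs \<mu> \<sigma> t n \<omega> = t / real n * (\<Sum>k=1..n. \<bar>\<mu> * (t * real k / real n) + \<sigma> * W (t * real k / real n) \<omega>\<bar>)"

lemma riemann_abs_measurable [measurable]: "0 < t \<Longrightarrow> riemann_abs \<mu> \<sigma> t n \<in> borel_measurable M"
  unfolding riemann_abs_def[abs_def]
  by (intro borel_measurable_times borel_measurable_sum borel_measurable_abs borel_measurable_add
      borel_measurable_const random_variable) auto

lemma riemann_abs_tendsto:
  assumes t: "0 < t" and \<omega>: "\<omega> \<in> space M"
  shows "(\<lambda>n. riemann_abs \<mu> \<sigma> t n \<omega>) \<longlonglongrightarrow> abs_integral \<mu> \<sigma> W t \<omega>"
proof -
  have "continuous_on {0..t} (\<lambda>s. \<bar>\<mu> * s + \<sigma> * W s \<omega>\<bar>)"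
    by (intro continuous_intros continuous_on_subset[OF continuous_paths[OF \<omega>]]) auto
  from riemann_sum_tendsto[OF this t] show ?thesis by (simp add: riemann_abs_def abs_integral_def)
qed

lemma abs_integral_measurable [measurable]: "0 < t \<Longrightarrow> abs_integral \<mu> \<sigma> W t \<in> borel_measurable M"
  by (rule borel_measurable_LIMSEQ_real[OF riemann_abs_tendsto riemann_abs_measurable])

text \<open>Brownian scaling: measuring time in units of t and space in units of
  \<open>\<sigma>\<close> sqrt t turns the drift into \<open>\<mu> * sqrt t / \<sigma>\<close> and
  takes the factor \<open>\<sigma> * t * sqrt t\<close> out of the integral.\<close>

lemma riemann_abs_eq:
  assumes t: "0 < t" and \<sigma>: "0 < \<sigma>" and n: "n > 0" and W0: "W 0 \<omega> = 0"
  shows "riemann_abs \<mu> \<sigma> t n \<omega> = \<sigma> * t * sqrt t * abs_avg n (drift_walk (\<mu> * sqrt t / \<sigma>) n (incr t n \<omega>))"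
proof -
  have "\<sigma> * t * sqrt t * abs_avg n (drift_walk (\<mu> * sqrt t / \<sigma>) n (incr t n \<omega>))
    = avg n (\<lambda>k. \<sigma> * t * sqrt t * \<bar>drift_walk (\<mu> * sqrt t / \<sigma>) n (incr t n \<omega>) k\<bar>)"
    unfolding abs_avg_def avg_cmult ..
  also have "\<dots> = avg n (\<lambda>k. t * \<bar>\<mu> * (t * real k / real n) + \<sigma> * W (t * real k / real n) \<omega>\<bar>)"
  proof (rule avg_cong)
    fix k assume k: "1 \<le> k" "k \<le> n"
    let ?s = "t * real k / real n"
    have "\<sigma> * sqrt t * drift_walk (\<mu> * sqrt t / \<sigma>) n (incr t n \<omega>) k = \<mu> * ?s + \<sigma> * W ?s \<omega>"
      unfolding drift_walk_incr[OF t n k(2) W0] using t \<sigma> by (simp add: field_simps)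
    then have "\<bar>\<mu> * ?s + \<sigma> * W ?s \<omega>\<bar> = \<bar>\<sigma> * sqrt t\<bar> * \<bar>drift_walk (\<mu> * sqrt t / \<sigma>) n (incr t n \<omega>) k\<bar>"
      by (simp only: abs_mult[symmetric])
    then show "\<sigma> * t * sqrt t * \<bar>drift_walk (\<mu> * sqrt t / \<sigma>) n (incr t n \<omega>) k\<bar> = t * \<bar>\<mu> * ?s + \<sigma> * W ?s \<omega>\<bar>"
      using t \<sigma> by simp
  qed
  also have "\<dots> = riemann_abs \<mu> \<sigma> t n \<omega>" unfolding avg_cmult by (simp add: avg_def riemann_abs_def)
  finally show ?thesis by simp
qed

lemma prob_riemann_abs:
  assumes t: "0 < t" and \<sigma>: "0 < \<sigma>" and n: "n > 0" and [measurable]: "U \<in> sets borel"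
  shows "prob {\<omega>\<in>space M. riemann_abs \<mu> \<sigma> t n \<omega> \<in> U} = path_prob (\<mu> * sqrt t / \<sigma>) n (\<lambda>V. \<sigma> * t * sqrt t * abs_avg n V \<in> U)"
proof -
  let ?\<nu> = "\<mu> * sqrt t / \<sigma>"
  let ?E = "\<lambda>V. \<sigma> * t * sqrt t * abs_avg n V \<in> U"
  have Em: "Measurable.pred paths ?E" by measurable
  have [measurable]: "{\<omega>\<in>space M. ?E (drift_walk ?\<nu> n (incr t n \<omega>))} \<in> sets M"
    using measurable_compose[OF distr_incr(2)[OF t n] pred_drift_walk[OF Em, where n=n and \<nu>="?\<nu>"]] by (simp add: pred_def)
  have [measurable]: "riemann_abs \<mu> \<sigma> t n \<in> borel_measurable M" using t by (rule riemann_abs_measurable)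
  have "prob {\<omega>\<in>space M. riemann_abs \<mu> \<sigma> t n \<omega> \<in> U} = prob {\<omega>\<in>space M. ?E (drift_walk ?\<nu> n (incr t n \<omega>))}"
    \<comment> \<open>The two events agree only almost surely, because W 0 = 0 holds only almost
      surely.\<close>
    by (rule finite_measure_eq_AE) (use start_zero in \<open>eventually_elim, simp add: riemann_abs_eq[OF t \<sigma> n]\<close>, measurable)
  then show ?thesis using prob_incr[OF t n Em, of ?\<nu>] by simp
qed

text \<open>If the integral of a continuous nonnegative function is 0, its value at t is 0; then the
  increment of W over [0, t] equals - \<open>\<mu>\<close> t / \<open>\<sigma>\<close>, which has
  probability 0 since the increment is Gaussian.\<close>

lemma abs_integral_pos:
  assumes t: "0 < t" and \<sigma>: "0 < \<sigma>"
  shows "prob {\<omega>\<in>space M. abs_integral \<mu> \<sigma> W t \<omega> \<le> 0} = 0"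
proof -
  define c where "c = - \<mu> * t / \<sigma>"
  have D: "distributed M lborel (\<lambda>\<omega>. W t \<omega> - W 0 \<omega>) (\<lambda>x. ennreal (normal_density 0 (sqrt (t - 0)) x))"
    by (rule gaussian_increments) (use t in auto)
  have [measurable]: "(\<lambda>\<omega>. W t \<omega> - W 0 \<omega>) \<in> borel_measurable M" using distributed_measurable[OF D] by simp
  have "emeasure M ((\<lambda>\<omega>. W t \<omega> - W 0 \<omega>) -` {c} \<inter> space M) = (\<integral>\<^sup>+x. ennreal (normal_density 0 (sqrt (t - 0)) x) * indicator {c} x \<partial>lborel)"
    by (rule distributed_emeasure[OF D]) simp
  also have "\<dots> = 0" by (subst nn_integral_0_iff_AE) (auto intro!: AE_I[where N="{c}"] simp: indicator_def)
  finally have z: "AE \<omega> in M. W t \<omega> - W 0 \<omega> \<noteq> c"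
    by (intro AE_I'[of "(\<lambda>\<omega>. W t \<omega> - W 0 \<omega>) -` {c} \<inter> space M"]) (auto simp: null_sets_def)
  have "AE \<omega> in M. \<not> abs_integral \<mu> \<sigma> W t \<omega> \<le> 0"
    using z start_zero AE_space
  proof eventually_elim
    case (elim \<omega>)
    let ?g = "\<lambda>s. \<bar>\<mu> * s + \<sigma> * W s \<omega>\<bar>"
    have cont: "continuous_on {0..t} ?g"
      by (intro continuous_intros continuous_on_subset[OF continuous_paths]) (use elim in auto)
    have eq: "abs_integral \<mu> \<sigma> W t \<omega> = integral {0..t} ?g"
      unfolding abs_integral_def
      by (rule set_borel_integral_eq_integral) (rule borel_integrable_atLeastAtMost', rule cont)
    show ?case
    proof
      assume "abs_integral \<mu> \<sigma> W t \<omega> \<le> 0"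
      moreover have "0 \<le> integral {0..t} ?g"
        by (intro Henstock_Kurzweil_Integration.integral_nonneg integrable_continuous_real cont) auto
      ultimately have "integral {0..t} ?g = 0" unfolding eq by simp
      then have "?g t = 0" using integral_eq_0_iff[OF cont t] t by auto
      then have "\<sigma> * W t \<omega> = - \<mu> * t" by simp
      then have "W t \<omega> = c" using \<sigma> by (simp add: c_def field_simps)
      then show False using elim by simp
    qed
  qed
  then show ?thesis using t by (subst prob_eq_0) auto
qed

end

section \<open>Asymptotics\<close>

lemma normal_density_deriv:
  assumes "0 < s"
  shows "(normal_density m s has_real_derivative - ((x - m) / s\<^sup>2) * normal_density m s x) (at x)"
proof -
  let ?c = "1 / sqrt (2 * pi * s\<^sup>2)"
  have "((\<lambda>x. (x - m)\<^sup>2) has_real_derivative 2 * (x - m)) (at x)"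
    by (auto intro!: derivative_eq_intros)
  from DERIV_cdivide[OF DERIV_minus[OF this], of "2 * s\<^sup>2"]
  have "((\<lambda>x. - (x - m)\<^sup>2 / (2 * s\<^sup>2)) has_real_derivative - (2 * (x - m)) / (2 * s\<^sup>2)) (at x)" .
  then have "((\<lambda>x. - (x - m)\<^sup>2 / (2 * s\<^sup>2)) has_real_derivative - ((x - m) / s\<^sup>2)) (at x)"
    by (simp only: minus_divide_left[symmetric] mult_divide_mult_cancel_left_if) simp
  from DERIV_cmult[OF DERIV_fun_exp[OF this], of ?c]
  show ?thesis unfolding normal_density_def by (simp only: ac_simps)
qed

text \<open>The function s^2 / (x - m) times the density is, up to sign, an antiderivative of the
  integrand. Omitting the factor 1 + s^2 / (x - m)^2 gives an upper bound for the Gaussian tail,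
  replacing it by its value at a gives a lower one.\<close>

lemma normal_tail_integral:
  assumes s: "0 < s" and a: "m < a"
  shows "(\<integral>\<^sup>+x. ennreal (normal_density m s x * (1 + s\<^sup>2 / (x - m)\<^sup>2)) * indicator {a..} x \<partial>lborel)
    = ennreal (normal_density m s a * s\<^sup>2 / (a - m))"
proof -
  let ?F = "\<lambda>x. - (normal_density m s x * s\<^sup>2 / (x - m))"
  have "(\<integral>\<^sup>+x. ennreal (normal_density m s x * (1 + s\<^sup>2 / (x - m)\<^sup>2)) * indicator {a..} x \<partial>lborel) = ennreal (0 - ?F a)"
  proof (rule nn_integral_FTC_atLeast)
    fix x assume x: "a \<le> x"
    then have xm: "x - m \<noteq> 0" using a by simp
    have "(?F has_real_derivative - ((- ((x - m) / s\<^sup>2) * normal_density m s x * s\<^sup>2 * (x - m) - normal_density m s x * s\<^sup>2 * 1) / (x - m)\<^sup>2)) (at x)"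
      using xm by (auto intro!: derivative_eq_intros normal_density_deriv[OF s] simp: power2_eq_square)
    moreover have "- ((- ((x - m) / s\<^sup>2) * normal_density m s x * s\<^sup>2 * (x - m) - normal_density m s x * s\<^sup>2 * 1) / (x - m)\<^sup>2)
      = normal_density m s x * (1 + s\<^sup>2 / (x - m)\<^sup>2)"
    proof -
      have "- ((- (D / s\<^sup>2) * N * s\<^sup>2 * D - N * s\<^sup>2 * 1) / D\<^sup>2) = N * (1 + s\<^sup>2 / D\<^sup>2)" if "D \<noteq> 0" for D N :: real
        using that s by (simp add: field_simps power2_eq_square)
      then show ?thesis using xm by this
    qed
    ultimately show "(?F has_real_derivative normal_density m s x * (1 + s\<^sup>2 / (x - m)\<^sup>2)) (at x)" by simp
    show "0 \<le> normal_density m s x * (1 + s\<^sup>2 / (x - m)\<^sup>2)" by (intro mult_nonneg_nonneg) auto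
  next
    have "((\<lambda>x. 1 / sqrt (2 * pi * s\<^sup>2) * s\<^sup>2 / (x - m)) \<longlongrightarrow> 0) at_top" by real_asymp
    then show "(?F \<longlongrightarrow> 0) at_top"
    proof (rule Lim_null_comparison[rotated])
      show "eventually (\<lambda>x. norm (?F x) \<le> 1 / sqrt (2 * pi * s\<^sup>2) * s\<^sup>2 / (x - m)) at_top"
        using eventually_gt_at_top[of m]
      proof eventually_elim
        case (elim x)
        have "normal_density m s x \<le> 1 / sqrt (2 * pi * s\<^sup>2) * 1"
          unfolding normal_density_def using s by (intro mult_left_mono) auto
        then have "normal_density m s x * s\<^sup>2 / (x - m) \<le> 1 / sqrt (2 * pi * s\<^sup>2) * s\<^sup>2 / (x - m)"
          using elim by (intro divide_right_mono mult_right_mono) auto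
        then show ?case using elim by simp
      qed
    qed
  qed simp
  then show ?thesis by simp
qed

lemma normal_tail_upper:
  assumes s: "0 < s" and a: "m < a"
  shows "(\<integral>\<^sup>+x. ennreal (normal_density m s x) * indicator {a..} x \<partial>lborel) \<le> ennreal (normal_density m s a * s\<^sup>2 / (a - m))"
  unfolding normal_tail_integral[OF s a, symmetric]
proof (intro nn_integral_mono mult_right_mono ennreal_leI)
  fix x
  have "normal_density m s x * 1 \<le> normal_density m s x * (1 + s\<^sup>2 / (x - m)\<^sup>2)" by (intro mult_left_mono) auto
  then show "normal_density m s x \<le> normal_density m s x * (1 + s\<^sup>2 / (x - m)\<^sup>2)" by simp
qed simp

lemma normal_tail_lower:
  assumes s: "0 < s" and a: "m < a"
  shows "ennreal (normal_density m s a * s\<^sup>2 / (a - m)) \<le> ennreal (1 + s\<^sup>2 / (a - m)\<^sup>2) * (\<integral>\<^sup>+x. ennreal (normal_density m s x) * indicator {a..} x \<partial>lborel)"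
proof -
  have "ennreal (normal_density m s a * s\<^sup>2 / (a - m)) \<le> (\<integral>\<^sup>+x. ennreal (1 + s\<^sup>2 / (a - m)\<^sup>2) * (ennreal (normal_density m s x) * indicator {a..} x) \<partial>lborel)"
    unfolding normal_tail_integral[OF s a, symmetric]
  proof (rule nn_integral_mono)
    fix x
    show "ennreal (normal_density m s x * (1 + s\<^sup>2 / (x - m)\<^sup>2)) * indicator {a..} x \<le> ennreal (1 + s\<^sup>2 / (a - m)\<^sup>2) * (ennreal (normal_density m s x) * indicator {a..} x)"
    proof (cases "a \<le> x")
      case True
      have "s\<^sup>2 / (x - m)\<^sup>2 \<le> s\<^sup>2 / (a - m)\<^sup>2"
        using True a by (intro divide_left_mono power_mono mult_pos_pos zero_less_power) auto
      then have "normal_density m s x * (1 + s\<^sup>2 / (x - m)\<^sup>2) \<le> (1 + s\<^sup>2 / (a - m)\<^sup>2) * normal_density m s x"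
        by (subst mult.commute) (intro mult_right_mono, auto)
      then have "ennreal (normal_density m s x * (1 + s\<^sup>2 / (x - m)\<^sup>2)) \<le> ennreal ((1 + s\<^sup>2 / (a - m)\<^sup>2) * normal_density m s x)"
        by (rule ennreal_leI)
      also have "\<dots> = ennreal (1 + s\<^sup>2 / (a - m)\<^sup>2) * ennreal (normal_density m s x)" by (rule ennreal_mult) auto
      finally show ?thesis using True by simp
    qed simp
  qed
  also have "\<dots> = ennreal (1 + s\<^sup>2 / (a - m)\<^sup>2) * (\<integral>\<^sup>+x. ennreal (normal_density m s x) * indicator {a..} x \<partial>lborel)"
    by (rule nn_integral_cmult) measurable
  finally show ?thesis .
qed

lemma bigo_sandwich:
  fixes lo r up g :: "real \<Rightarrow> real"
  assumes "lo \<in> O[at_top](g)" "up \<in> O[at_top](g)" "eventually (\<lambda>x. lo x \<le> r x \<and> r x \<le> up x) at_top"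
  shows "r \<in> O[at_top](g)"
proof -
  have "(\<lambda>x. \<bar>lo x\<bar> + \<bar>up x\<bar>) \<in> O[at_top](g)" using assms by (intro sum_in_bigo) auto
  moreover have "r \<in> O[at_top](\<lambda>x. \<bar>lo x\<bar> + \<bar>up x\<bar>)"
    by (rule landau_o.bigI[of 1]) (use assms(3) in \<open>auto elim!: eventually_mono\<close>)
  ultimately show ?thesis by (rule landau_o.big_trans[rotated])
qed

text \<open>The factor cosh is at least 1; error terms are compared with what is left.\<close>

lemma lim_density_ge: "sqrt (6 / pi) * exp (- (3 * \<nu>\<^sup>2 / 8)) * exp (- (3 * x\<^sup>2 / 2)) \<le> lim_density \<nu> x"
proof -
  have "lim_density \<nu> x = sqrt (6 / pi) * exp (- (3 * \<nu>\<^sup>2 / 8)) * exp (- (3 * x\<^sup>2 / 2)) * cosh (3 * \<nu> * x / 2)"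
    unfolding lim_density_eq by (simp add: mult_exp_exp)
  moreover have "sqrt (6 / pi) * exp (- (3 * \<nu>\<^sup>2 / 8)) * exp (- (3 * x\<^sup>2 / 2)) * 1 \<le> sqrt (6 / pi) * exp (- (3 * \<nu>\<^sup>2 / 8)) * exp (- (3 * x\<^sup>2 / 2)) * cosh (3 * \<nu> * x / 2)"
    by (intro mult_left_mono cosh_real_ge_1) auto
  ultimately show ?thesis by simp
qed

lemma lim_density_pos: "0 < lim_density \<nu> x"
  using lim_density_ge[of \<nu> x] by (rule less_le_trans[rotated]) simp

lemma lim_density_scale:
  assumes c: "0 < c"
  shows "lim_density \<nu> (x / c) / c = normal_density (c * \<nu> / 2) (c * sqrt (1 / 3)) x + normal_density (- (c * \<nu> / 2)) (c * sqrt (1 / 3)) x"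
proof -
  have "normal_density m (sqrt (1 / 3)) (x / c) / c = normal_density (c * m) (c * sqrt (1 / 3)) x" for m
  proof -
    have "(x / c - m)\<^sup>2 / (2 * (sqrt (1 / 3))\<^sup>2) = (x - c * m)\<^sup>2 / (2 * (c * sqrt (1 / 3))\<^sup>2)"
      using c by (simp add: power_mult_distrib field_simps power2_eq_square)
    moreover have "sqrt (2 * pi * (c * sqrt (1 / 3))\<^sup>2) = sqrt (2 * pi * (sqrt (1 / 3))\<^sup>2) * c"
    proof -
      have "2 * pi * (c * sqrt (1 / 3))\<^sup>2 = (2 * pi * (sqrt (1 / 3))\<^sup>2) * c\<^sup>2" by (simp add: power_mult_distrib)
      then have "sqrt (2 * pi * (c * sqrt (1 / 3))\<^sup>2) = sqrt (2 * pi * (sqrt (1 / 3))\<^sup>2) * sqrt (c\<^sup>2)"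
        using real_sqrt_mult[of "2 * pi * (sqrt (1 / 3))\<^sup>2" "c\<^sup>2"] by (rule ssubst)
      then show ?thesis using c by (simp only: real_sqrt_abs abs_of_pos)
    qed
    ultimately show ?thesis unfolding normal_density_def minus_divide_left[symmetric] by simp
  qed
  from this[of "\<nu> / 2"] this[of "- \<nu> / 2"] show ?thesis by (simp add: lim_density_def add_divide_distrib)
qed

text \<open>Two arguments, because the lower bound for the interval from x to y has the density at
  the right end and the error factor at the left end.\<close>

definition lower_fn :: "real \<Rightarrow> real \<Rightarrow> real \<Rightarrow> real \<Rightarrow> real" where
  "lower_fn \<nu> c x y = lim_density \<nu> (y / c) / c * (1 - (8 * \<bar>\<nu>\<bar> + 8) / (x / c))"

definition upper_fn :: "real \<Rightarrow> real \<Rightarrow> real \<Rightarrow> real \<Rightarrow> real \<Rightarrow> real" where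
  "upper_fn \<nu> c C K x = (lim_density \<nu> (x / c) * (1 + 20000 / (x / c)\<^sup>2)
     + C * (x / c + 1) * exp (- (3 / 2 + 1 / 10^9) * (x / c)\<^sup>2 + K * (x / c))) / c"

text \<open>The discrete bounds hold for all large N up to \<open>tail_rem\<close>, which tends to
  0. Upper bounds pass to the limit on open intervals; lower bounds on closed intervals are upper
  bounds for their complements, which are open as well.\<close>

lemma (in standard_brownian_motion) abs_integral_density:
  fixes \<mu> \<sigma> t :: real
  assumes t: "0 < t" and \<sigma>: "0 < \<sigma>"
  defines "\<nu> \<equiv> \<mu> * sqrt t / \<sigma>" and "c \<equiv> \<sigma> * t * sqrt t"
  obtains f C K where "\<And>x. 0 \<le> f x" "f \<in> borel_measurable borel" "0 < C" "0 \<le> K"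
    "distr M borel (abs_integral \<mu> \<sigma> W t) = density lborel (\<lambda>x. ennreal (f x))"
    "\<And>x. c * (32 * \<bar>\<nu>\<bar> + 9) < x \<Longrightarrow> lower_fn \<nu> c x x \<le> f x \<and> f x \<le> upper_fn \<nu> c C K x"
proof -
  have c: "0 < c" using t \<sigma> by (simp add: c_def)
  let ?X = "abs_integral \<mu> \<sigma> W t"
  have Xm [measurable]: "?X \<in> borel_measurable M" using t by (rule abs_integral_measurable)
  have Ym: "riemann_abs \<mu> \<sigma> t (2 ^ N) \<in> borel_measurable M" for N using t by (rule riemann_abs_measurable)
  have conv: "AE \<omega> in M. (\<lambda>N. riemann_abs \<mu> \<sigma> t (2 ^ N) \<omega>) \<longlonglongrightarrow> ?X \<omega>"
  proof (rule AE_I2)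
    fix \<omega> assume "\<omega> \<in> space M"
    moreover have "filterlim (\<lambda>N. 2 ^ N :: nat) sequentially sequentially"
      by (rule filterlim_subseq) (simp add: strict_mono_def)
    ultimately show "(\<lambda>N. riemann_abs \<mu> \<sigma> t (2 ^ N) \<omega>) \<longlonglongrightarrow> ?X \<omega>" using t
      by (intro filterlim_compose[OF riemann_abs_tendsto]) auto
  qed
  let ?\<mu> = "distr M borel ?X"
  have md: "measure ?\<mu> U = prob {\<omega>\<in>space M. ?X \<omega> \<in> U}" if "U \<in> sets borel" for U
    using that by (subst measure_distr) (auto intro!: arg_cong[where f=prob])
  have pr: "prob {\<omega>\<in>space M. riemann_abs \<mu> \<sigma> t (2 ^ N) \<omega> \<in> U} = path_prob \<nu> (2 ^ N) (\<lambda>V. c * abs_avg (2 ^ N) V \<in> U)"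
    if "U \<in> sets borel" for U N
    unfolding \<nu>_def c_def using that by (intro prob_riemann_abs[OF t \<sigma>]) auto
  have Ioo: "(\<lambda>V. c * abs_avg n V \<in> {x<..<y}) = (\<lambda>V. x / c < abs_avg n V \<and> abs_avg n V < y / c)" for n x y
    using c by (auto simp: fun_eq_iff field_simps)
  have Icc: "(\<lambda>V. c * abs_avg n V \<in> {x..y}) = (\<lambda>V. x / c \<le> abs_avg n V \<and> abs_avg n V \<le> y / c)" for n x y
    using c by (auto simp: fun_eq_iff field_simps)
  obtain C K where CK: "0 < C" "0 \<le> K" and upper:
    "\<And>x y N. 60 \<le> N \<Longrightarrow> 1 + 32 * \<bar>\<nu>\<bar> \<le> x \<Longrightarrow> x < y \<Longrightarrow>
      path_prob \<nu> (2 ^ N) (\<lambda>V. x < abs_avg (2 ^ N) V \<and> abs_avg (2 ^ N) V < y)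
      \<le> (y - x) * (pair_density \<nu> (2 ^ N) x * (1 + 20000 / x\<^sup>2) + C * (x + 1) * exp (- (3 / 2 + 1 / 10^9) * x\<^sup>2 + K * x)) + tail_rem N x"
    using discrete_upper[of \<nu>] by blast
  \<comment> \<open>After division by c this meets both the requirement 1 + 32
    |\<open>\<nu>\<close>| of the upper and 8 |\<open>\<nu>\<close>| + 8 of the lower discrete
    bound.\<close>
  let ?x0 = "c * (32 * \<bar>\<nu>\<bar> + 9)"
  have x0: "0 < ?x0" using c by (intro mult_pos_pos) auto
  have xc: "32 * \<bar>\<nu>\<bar> + 9 \<le> x / c" if "?x0 \<le> x" for x
    using that c by (simp add: pos_le_divide_eq mult.commute)
  have cl: "continuous (at p) (\<lambda>p. lim_density \<nu> (g p))" if "continuous (at p) g" for p and g :: "'z::t2_space \<Rightarrow> real"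
    unfolding lim_density_def normal_density_def by (intro continuous_intros that) auto
  have "\<exists>f. (\<forall>x. 0 \<le> f x) \<and> f \<in> borel_measurable borel \<and> ?\<mu> = density lborel (\<lambda>x. ennreal (f x)) \<and>
     (\<forall>x. ?x0 < x \<longrightarrow> lower_fn \<nu> c x x \<le> f x \<and> f x \<le> upper_fn \<nu> c C K x)"
  proof (rule density_from_intervals[where \<mu>="?\<mu>" and l="lower_fn \<nu> c" and u="upper_fn \<nu> c C K" and ?x0.0="?x0"])
    show "real_distribution ?\<mu>" by (rule real_distribution_distr) simp
  next
    fix e :: real assume e: "0 < e"
    have ec: "0 < e / c" using e c by simp
    have "\<exists>L N0. \<forall>a b N. N0 \<le> N \<longrightarrow> e / c \<le> a \<longrightarrow> a < b \<longrightarrow>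
      path_prob \<nu> (2 ^ N) (\<lambda>V. a < abs_avg (2 ^ N) V \<and> abs_avg (2 ^ N) V < b) \<le> L * (b - a) + tail_rem N (e / c)"
    proof (rule discrete_lipschitz[OF ec, of \<nu>])
      fix L N0 assume "\<And>a b N. N0 \<le> N \<Longrightarrow> e / c \<le> a \<Longrightarrow> a < b \<Longrightarrow>
        path_prob \<nu> (2 ^ N) (\<lambda>V. a < abs_avg (2 ^ N) V \<and> abs_avg (2 ^ N) V < b) \<le> L * (b - a) + tail_rem N (e / c)"
      then show ?thesis by (intro exI[of _ L] exI[of _ N0] allI impI)
    qed
    then obtain L N0 where L: "\<forall>a b N. N0 \<le> N \<longrightarrow> e / c \<le> a \<longrightarrow> a < b \<longrightarrow>
      path_prob \<nu> (2 ^ N) (\<lambda>V. a < abs_avg (2 ^ N) V \<and> abs_avg (2 ^ N) V < b) \<le> L * (b - a) + tail_rem N (e / c)" by (elim exE)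
    show "\<exists>L. \<forall>a b. e \<le> a \<longrightarrow> a < b \<longrightarrow> measure ?\<mu> {a<..<b} \<le> L * (b - a)"
    proof (intro exI[of _ "L / c"] allI impI)
      fix a b assume ab: "e \<le> a" "a < b"
      have "prob {\<omega>\<in>space M. ?X \<omega> \<in> {a<..<b}} \<le> L * (b / c - a / c) + 0"
      proof (rule prob_open_le[OF Xm Ym conv])
        show "eventually (\<lambda>N. prob {\<omega>\<in>space M. riemann_abs \<mu> \<sigma> t (2 ^ N) \<omega> \<in> {a<..<b}} \<le> L * (b / c - a / c) + tail_rem N (e / c)) sequentially"
          using eventually_ge_at_top[of N0]
        proof eventually_elim
          case (elim N)
          then show ?case unfolding pr[OF borel_open[OF open_greaterThanLessThan]] Ioo
            using ab c by (intro L[rule_format] divide_right_mono divide_strict_right_mono) simp_all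
        qed
        show "(\<lambda>N. L * (b / c - a / c) + tail_rem N (e / c)) \<longlonglongrightarrow> L * (b / c - a / c) + 0"
          by (intro tendsto_add tendsto_const tail_rem_tendsto ec)
      qed simp
      then show "measure ?\<mu> {a<..<b} \<le> L / c * (b - a)" by (simp add: md diff_divide_distrib[symmetric])
    qed
  next
    show "measure ?\<mu> {..0} = 0" using abs_integral_pos[OF t \<sigma>, of \<mu>] by (simp add: md)
  next
    show "0 < ?x0" by (rule x0)
  next
    fix x y :: real assume x: "?x0 \<le> x" and xy: "x < y"
    let ?z = "x / c"
    let ?B = "C * (?z + 1) * exp (- (3 / 2 + 1 / 10^9) * ?z\<^sup>2 + K * ?z)"
    have z: "32 * \<bar>\<nu>\<bar> + 9 \<le> ?z" by (rule xc[OF x])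
    have z0: "0 < ?z" using z by linarith
    have zz: "?z < y / c" using xy c by (rule divide_strict_right_mono)
    have "prob {\<omega>\<in>space M. ?X \<omega> \<in> {x<..<y}} \<le> (y / c - ?z) * (lim_density \<nu> ?z * (1 + 20000 / ?z\<^sup>2) + ?B) + 0"
    proof (rule prob_open_le[OF Xm Ym conv])
      show "eventually (\<lambda>N. prob {\<omega>\<in>space M. riemann_abs \<mu> \<sigma> t (2 ^ N) \<omega> \<in> {x<..<y}}
        \<le> (y / c - ?z) * (pair_density \<nu> (2 ^ N) ?z * (1 + 20000 / ?z\<^sup>2) + ?B) + tail_rem N ?z) sequentially"
        using eventually_ge_at_top[of 60]
      proof eventually_elim
        case (elim N)
        show ?case unfolding pr[OF borel_open[OF open_greaterThanLessThan]] Ioo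
          by (rule upper[OF elim _ zz]) (use z in linarith)
      qed
    next
      show "(\<lambda>N. (y / c - ?z) * (pair_density \<nu> (2 ^ N) ?z * (1 + 20000 / ?z\<^sup>2) + ?B) + tail_rem N ?z)
        \<longlonglongrightarrow> (y / c - ?z) * (lim_density \<nu> ?z * (1 + 20000 / ?z\<^sup>2) + ?B) + 0"
        by (intro tendsto_add tendsto_mult tendsto_const pair_density_tendsto tail_rem_tendsto z0)
    qed simp
    also have "\<dots> = upper_fn \<nu> c C K x * (y - x)" by (simp add: upper_fn_def diff_divide_distrib[symmetric])
    finally show "measure ?\<mu> {x<..<y} \<le> upper_fn \<nu> c C K x * (y - x)" by (simp add: md)
    let ?l = "(y / c - ?z) * lim_density \<nu> (y / c) * (1 - (8 * \<bar>\<nu>\<bar> + 8) / ?z)"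
    have "prob {\<omega>\<in>space M. ?X \<omega> \<in> - {x..y}} \<le> 1 - ?l"
    proof (rule prob_open_le[OF Xm Ym conv])
      show "eventually (\<lambda>N. prob {\<omega>\<in>space M. riemann_abs \<mu> \<sigma> t (2 ^ N) \<omega> \<in> - {x..y}}
        \<le> 1 - (y / c - ?z) * pair_density \<nu> (2 ^ N) (y / c) * (1 - (8 * \<bar>\<nu>\<bar> + 8) / ?z)) sequentially"
      proof (rule always_eventually, rule allI)
        fix N
        have "prob {\<omega>\<in>space M. \<not> riemann_abs \<mu> \<sigma> t (2 ^ N) \<omega> \<in> {x..y}} = 1 - prob {\<omega>\<in>space M. riemann_abs \<mu> \<sigma> t (2 ^ N) \<omega> \<in> {x..y}}"
          by (rule prob_neg) (use Ym[of N] in measurable)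
        moreover have "(y / c - ?z) * pair_density \<nu> (2 ^ N) (y / c) * (1 - (8 * \<bar>\<nu>\<bar> + 8) / ?z) \<le> prob {\<omega>\<in>space M. riemann_abs \<mu> \<sigma> t (2 ^ N) \<omega> \<in> {x..y}}"
          unfolding pr[OF borel_closed[OF closed_atLeastAtMost]] Icc
          by (rule discrete_lower[OF _ _ zz], simp) (use z in linarith)
        ultimately show "prob {\<omega>\<in>space M. riemann_abs \<mu> \<sigma> t (2 ^ N) \<omega> \<in> - {x..y}}
          \<le> 1 - (y / c - ?z) * pair_density \<nu> (2 ^ N) (y / c) * (1 - (8 * \<bar>\<nu>\<bar> + 8) / ?z)" unfolding Compl_iff by linarith
      qed
      show "(\<lambda>N. 1 - (y / c - ?z) * pair_density \<nu> (2 ^ N) (y / c) * (1 - (8 * \<bar>\<nu>\<bar> + 8) / ?z)) \<longlonglongrightarrow> 1 - ?l"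
        by (intro tendsto_diff tendsto_mult tendsto_const pair_density_tendsto)
    qed (simp add: open_Compl)
    moreover have "prob {\<omega>\<in>space M. \<not> ?X \<omega> \<in> {x..y}} = 1 - prob {\<omega>\<in>space M. ?X \<omega> \<in> {x..y}}"
      by (rule prob_neg) measurable
    ultimately have "?l \<le> prob {\<omega>\<in>space M. ?X \<omega> \<in> {x..y}}" unfolding Compl_iff by linarith
    moreover have "?l = lower_fn \<nu> c x y * (y - x)" by (simp add: lower_fn_def diff_divide_distrib[symmetric])
    ultimately show "lower_fn \<nu> c x y * (y - x) \<le> measure ?\<mu> {x..y}" by (simp add: md)
  next
    fix x assume "?x0 < x"
    then have x: "x \<noteq> 0" using x0 by linarith
    show "isCont (upper_fn \<nu> c C K) x"
      unfolding upper_fn_def[abs_def] using x c by (intro continuous_intros cl) auto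
    show "isCont (\<lambda>p. lower_fn \<nu> c (fst p) (snd p)) (x, x)"
      unfolding lower_fn_def using x c by (intro continuous_intros cl) auto
  next
    show "upper_fn \<nu> c C K \<in> borel_measurable borel"
      unfolding upper_fn_def[abs_def] lim_density_def by measurable
    show "(\<lambda>x. lower_fn \<nu> c x x) \<in> borel_measurable borel"
      unfolding lower_fn_def[abs_def] lim_density_def by measurable
  next
    fix f assume "\<And>x. 0 \<le> f x" "f \<in> borel_measurable borel" "?\<mu> = density lborel (\<lambda>x. ennreal (f x))"
      "\<And>x. ?x0 < x \<Longrightarrow> lower_fn \<nu> c x x \<le> f x \<and> f x \<le> upper_fn \<nu> c C K x"
    then show ?thesis by (intro exI[of _ f] conjI allI impI) simp_all
  qed
  then show ?thesis using that CK by blast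
qed

text \<open>The Mills ratio bounds are written with a instead of m, so that the same factors serve
  the means m and - m and the two estimates can be added.\<close>

lemma normal_tail_bounds:
  assumes s: "0 < s" and m: "\<bar>m\<bar> \<le> a" and x: "a < x"
  obtains j where "0 \<le> j" "(\<integral>\<^sup>+u. ennreal (normal_density m s u) * indicator {x..} u \<partial>lborel) = ennreal j"
    "j \<le> normal_density m s x * (s\<^sup>2 / (x - a))"
    "normal_density m s x * (s\<^sup>2 / (x + a)) \<le> (1 + s\<^sup>2 / (x - a)\<^sup>2) * j"
proof -
  let ?T = "\<integral>\<^sup>+u. ennreal (normal_density m s u) * indicator {x..} u \<partial>lborel"
  let ?n = "normal_density m s x"
  have mx: "m < x" and a0: "0 \<le> a" and xa: "x - a \<le> x - m" "x - m \<le> x + a" "0 < x - a" using m x by auto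
  have n0: "0 \<le> ?n" by simp
  have up: "?T \<le> ennreal (?n * s\<^sup>2 / (x - m))" by (rule normal_tail_upper[OF s mx])
  have lo: "ennreal (?n * s\<^sup>2 / (x - m)) \<le> ennreal (1 + s\<^sup>2 / (x - m)\<^sup>2) * ?T" by (rule normal_tail_lower[OF s mx])
  obtain j where j: "0 \<le> j" "?T = ennreal j"
    using up by (cases ?T) (auto simp: top_unique)
  have "0 \<le> ?n * s\<^sup>2 / (x - m)" using mx n0 by simp
  then have ju: "j \<le> ?n * s\<^sup>2 / (x - m)" using up unfolding j(2) by simp
  have "ennreal (1 + s\<^sup>2 / (x - m)\<^sup>2) * ?T = ennreal ((1 + s\<^sup>2 / (x - m)\<^sup>2) * j)"
    unfolding j(2) by (rule ennreal_mult[symmetric]) (use j in auto)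
  moreover have "0 \<le> (1 + s\<^sup>2 / (x - m)\<^sup>2) * j" using j by simp
  ultimately have jl: "?n * s\<^sup>2 / (x - m) \<le> (1 + s\<^sup>2 / (x - m)\<^sup>2) * j" using lo by simp
  have "?n * (s\<^sup>2 / (x - m)) \<le> ?n * (s\<^sup>2 / (x - a))"
    using xa by (intro mult_left_mono[OF _ n0] divide_left_mono mult_pos_pos) auto
  with ju have A: "j \<le> ?n * (s\<^sup>2 / (x - a))" by simp
  have "?n * (s\<^sup>2 / (x + a)) \<le> ?n * (s\<^sup>2 / (x - m))"
    using xa by (intro mult_left_mono[OF _ n0] divide_left_mono mult_pos_pos) auto
  moreover have "(1 + s\<^sup>2 / (x - m)\<^sup>2) * j \<le> (1 + s\<^sup>2 / (x - a)\<^sup>2) * j"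
    using xa j(1) by (intro mult_right_mono add_left_mono divide_left_mono power_mono mult_pos_pos zero_less_power) auto
  ultimately have B: "?n * (s\<^sup>2 / (x + a)) \<le> (1 + s\<^sup>2 / (x - a)\<^sup>2) * j" using jl by simp
  show ?thesis by (rule that[OF j A B])
qed

text \<open>Beyond x the relative error r is at most C / x in absolute value, so the tail of f lies
  between (1 - C / x) and (1 + C / x) times the tail of g, and the Mills ratio of both Gaussians is
  s^2 / x up to a factor 1 + O(1 / x). The functions \<open>lo\<close> and \<open>up\<close> collect
  these factors.\<close>

lemma gaussian_pair_tail_asymp:
  fixes f r P :: "real \<Rightarrow> real" and m s :: real
  assumes s: "0 < s"
  defines "g \<equiv> \<lambda>x. normal_density m s x + normal_density (- m) s x"
  assumes f0: "\<And>x. 0 \<le> f x" and fm [measurable]: "f \<in> borel_measurable borel"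
    and fr: "eventually (\<lambda>x. f x = g x * (1 + r x)) at_top" and r: "r \<in> O[at_top](\<lambda>x. 1 / x)"
    and P: "\<And>x. ennreal (P x) = (\<integral>\<^sup>+u. ennreal (f u) * indicator {x..} u \<partial>lborel)" and P0: "\<And>x. 0 \<le> P x"
  shows "(\<lambda>x. P x / (g x * s\<^sup>2 / x) - 1) \<in> O[at_top](\<lambda>x. 1 / x)"
proof -
  from r obtain C where C: "0 < C" and ev: "eventually (\<lambda>x. norm (r x) \<le> C * norm (1 / x)) at_top"
    by (rule landau_o.bigE)
  from eventually_conj[OF fr ev] obtain x1 where x1: "\<And>x. x1 \<le> x \<Longrightarrow> f x = g x * (1 + r x) \<and> norm (r x) \<le> C * norm (1 / x)"
    unfolding eventually_at_top_linorder by blast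
  define a where "a = \<bar>m\<bar>"
  define lo where "lo = (\<lambda>x. (1 - C / x) * (x / (x + a)) / (1 + s\<^sup>2 / (x - a)\<^sup>2) - 1)"
  define up where "up = (\<lambda>x. (1 + C / x) * (x / (x - a)) - 1)"
  have a0: "0 \<le> a" by (simp add: a_def)
  have g0: "0 < g x" for x unfolding g_def using s by (intro add_pos_pos normal_density_pos)
  have gm [measurable]: "g \<in> borel_measurable borel" unfolding g_def by measurable
  have gap: "lo x \<le> P x / (g x * s\<^sup>2 / x) - 1 \<and> P x / (g x * s\<^sup>2 / x) - 1 \<le> up x"
    if x: "max (max x1 (C + 1)) (a + 1) \<le> x" for x
  proof -
    have xs: "x1 \<le> x" "C < x" "a < x" "0 < x" using x C by auto
    have m1: "\<bar>m\<bar> \<le> a" and m2: "\<bar>- m\<bar> \<le> a" by (auto simp: a_def)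
    obtain j1 where j1: "0 \<le> j1" "(\<integral>\<^sup>+u. ennreal (normal_density m s u) * indicator {x..} u \<partial>lborel) = ennreal j1"
      "j1 \<le> normal_density m s x * (s\<^sup>2 / (x - a))"
      "normal_density m s x * (s\<^sup>2 / (x + a)) \<le> (1 + s\<^sup>2 / (x - a)\<^sup>2) * j1"
      by (rule normal_tail_bounds[OF s m1 xs(3)])
    obtain j2 where j2: "0 \<le> j2" "(\<integral>\<^sup>+u. ennreal (normal_density (- m) s u) * indicator {x..} u \<partial>lborel) = ennreal j2"
      "j2 \<le> normal_density (- m) s x * (s\<^sup>2 / (x - a))"
      "normal_density (- m) s x * (s\<^sup>2 / (x + a)) \<le> (1 + s\<^sup>2 / (x - a)\<^sup>2) * j2"
      by (rule normal_tail_bounds[OF s m2 xs(3)])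
    define j where "j = j1 + j2"
    have j0: "0 \<le> j" using j1 j2 by (simp add: j_def)
    have ju: "j \<le> g x * (s\<^sup>2 / (x - a))" unfolding j_def g_def distrib_right by (rule add_mono[OF j1(3) j2(3)])
    have jl: "g x * (s\<^sup>2 / (x + a)) \<le> (1 + s\<^sup>2 / (x - a)\<^sup>2) * j"
      unfolding j_def g_def using add_mono[OF j1(4) j2(4)] by (simp only: distrib_right[of _ _ "s\<^sup>2 / (x + a)"] distrib_left[of _ j1 j2])
    have "(\<integral>\<^sup>+u. ennreal (g u) * indicator {x..} u \<partial>lborel)
      = (\<integral>\<^sup>+u. ennreal (normal_density m s u) * indicator {x..} u + ennreal (normal_density (- m) s u) * indicator {x..} u \<partial>lborel)"
      by (intro nn_integral_cong) (simp add: g_def ennreal_plus distrib_right)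
    also have "\<dots> = ennreal j1 + ennreal j2" unfolding j1(2)[symmetric] j2(2)[symmetric] by (rule nn_integral_add) measurable
    also have "\<dots> = ennreal j" using j1 j2 by (simp add: j_def ennreal_plus)
    finally have J: "(\<integral>\<^sup>+u. ennreal (g u) * indicator {x..} u \<partial>lborel) = ennreal j" .
    have rb: "\<bar>r u\<bar> \<le> C / x" if "x \<le> u" for u
    proof -
      have "norm (r u) \<le> C * norm (1 / u)" using x1[of u] that xs by auto
      also have "\<dots> = C / u" using that xs by simp
      also have "\<dots> \<le> C / x" using that xs C by (intro divide_left_mono) auto
      finally show ?thesis by simp
    qed
    have fu: "f u = g u * (1 + r u)" if "x \<le> u" for u using x1[of u] that xs by auto
    have int: "(\<integral>\<^sup>+u. ennreal k * (ennreal (g u) * indicator {x..} u) \<partial>lborel) = ennreal (k * j)" if "0 \<le> k" for k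
    proof -
      have "(\<integral>\<^sup>+u. ennreal k * (ennreal (g u) * indicator {x..} u) \<partial>lborel) = ennreal k * ennreal j"
        unfolding J[symmetric] by (rule nn_integral_cmult) measurable
      then show ?thesis using that j0 by (simp add: ennreal_mult)
    qed
    have k1: "0 \<le> 1 + C / x" and k2: "0 \<le> 1 - C / x" using xs C by (auto simp: field_simps)
    have "ennreal (P x) \<le> (\<integral>\<^sup>+u. ennreal (1 + C / x) * (ennreal (g u) * indicator {x..} u) \<partial>lborel)"
      unfolding P
    proof (rule nn_integral_mono)
      fix u
      show "ennreal (f u) * indicator {x..} u \<le> ennreal (1 + C / x) * (ennreal (g u) * indicator {x..} u)"
      proof (cases "x \<le> u")
        case True
        have "f u \<le> (1 + C / x) * g u" unfolding fu[OF True] mult.commute[of "g u"]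
          using rb[OF True] g0[of u] by (intro mult_right_mono) auto
        then have "ennreal (f u) \<le> ennreal ((1 + C / x) * g u)" by (rule ennreal_leI)
        then show ?thesis using True ennreal_mult[OF k1 less_imp_le[OF g0[of u]]] by simp
      qed simp
    qed
    also have "\<dots> = ennreal ((1 + C / x) * j)" by (rule int[OF k1])
    finally have Pu: "P x \<le> (1 + C / x) * j" using k1 j0 by (simp add: mult_nonneg_nonneg)
    have "(\<integral>\<^sup>+u. ennreal (1 - C / x) * (ennreal (g u) * indicator {x..} u) \<partial>lborel) \<le> ennreal (P x)"
      unfolding P
    proof (rule nn_integral_mono)
      fix u
      show "ennreal (1 - C / x) * (ennreal (g u) * indicator {x..} u) \<le> ennreal (f u) * indicator {x..} u"
      proof (cases "x \<le> u")
        case True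
        have "(1 - C / x) * g u \<le> f u" unfolding fu[OF True] mult.commute[of "g u"]
          using rb[OF True] g0[of u] by (intro mult_right_mono) auto
        then have "ennreal ((1 - C / x) * g u) \<le> ennreal (f u)" by (rule ennreal_leI)
        then show ?thesis using True ennreal_mult[OF k2 less_imp_le[OF g0[of u]]] by simp
      qed simp
    qed
    then have Pl: "(1 - C / x) * j \<le> P x" unfolding int[OF k2] using P0[of x] by simp
    let ?T = "g x * s\<^sup>2 / x"
    have T: "0 < ?T" using g0[of x] s xs by simp
    have "P x \<le> (1 + C / x) * (g x * (s\<^sup>2 / (x - a)))"
      using Pu mult_left_mono[OF ju k1] by linarith
    also have "\<dots> = (up x + 1) * ?T" using xs by (simp add: up_def)
    finally have U: "P x / ?T \<le> up x + 1" unfolding pos_divide_le_eq[OF T] .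
    have q: "0 < 1 + s\<^sup>2 / (x - a)\<^sup>2" by (intro add_pos_nonneg) auto
    have "(lo x + 1) * ?T = (1 - C / x) * ((g x * (s\<^sup>2 / (x + a))) / (1 + s\<^sup>2 / (x - a)\<^sup>2))"
      using xs by (simp add: lo_def)
    also have "\<dots> \<le> (1 - C / x) * j"
      by (rule mult_left_mono[OF _ k2], subst pos_divide_le_eq[OF q], subst mult.commute[of j], rule jl)
    also have "\<dots> \<le> P x" by (rule Pl)
    finally have L: "lo x + 1 \<le> P x / ?T" unfolding pos_le_divide_eq[OF T] .
    show ?thesis using U L by linarith
  qed
  show ?thesis
  proof (rule bigo_sandwich)
    show "eventually (\<lambda>x. lo x \<le> P x / (g x * s\<^sup>2 / x) - 1 \<and> P x / (g x * s\<^sup>2 / x) - 1 \<le> up x) at_top"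
      using eventually_ge_at_top by (rule eventually_mono) (rule gap)
    show "lo \<in> O[at_top](\<lambda>x. 1 / x)" unfolding lo_def by real_asymp
    show "up \<in> O[at_top](\<lambda>x. 1 / x)" unfolding up_def by real_asymp
  qed
qed

text \<open>Relative to exp(- 3 z^2 / 2), which bounds \<open>lim_density\<close> from below up to a
  constant, the last term of \<open>upper_fn\<close> is of order z exp(- 10^-9 z^2 + K z) and thus
  smaller than every power of 1 / z.\<close>

lemma density_ratio_asymp:
  fixes f :: "real \<Rightarrow> real"
  assumes c: "0 < c" and C: "0 < C"
    and b: "eventually (\<lambda>x. lower_fn \<nu> c x x \<le> f x \<and> f x \<le> upper_fn \<nu> c C K x) at_top"
  shows "(\<lambda>x. f x / (lim_density \<nu> (x / c) / c) - 1) \<in> O[at_top](\<lambda>x. 1 / x)"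
proof -
  define k where "k = sqrt (6 / pi) * exp (- (3 * \<nu>\<^sup>2 / 8))"
  have k: "0 < k" by (simp add: k_def)
  define D where "D = C / k"
  have D: "0 < D" using C k by (simp add: D_def)
  define A where "A = 8 * \<bar>\<nu>\<bar> + 8"
  define lo where "lo = (\<lambda>x. - (A / (x / c)))"
  define up where "up = (\<lambda>x. 20000 / (x / c)\<^sup>2 + D * (x / c + 1) * exp (- (1 / 10^9) * (x / c)\<^sup>2 + K * (x / c)))"
  show ?thesis
  proof (rule bigo_sandwich)
    show "lo \<in> O[at_top](\<lambda>x. 1 / x)" unfolding lo_def using c by real_asymp
    show "up \<in> O[at_top](\<lambda>x. 1 / x)" unfolding up_def using c D by real_asymp
    show "eventually (\<lambda>x. lo x \<le> f x / (lim_density \<nu> (x / c) / c) - 1 \<and> f x / (lim_density \<nu> (x / c) / c) - 1 \<le> up x) at_top"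
      using eventually_conj[OF b eventually_gt_at_top[of 0]]
    proof (rule eventually_mono, elim conjE)
      fix x :: real
      assume l: "lower_fn \<nu> c x x \<le> f x" and u: "f x \<le> upper_fn \<nu> c C K x" and x: "0 < x"
      define z where "z = x / c"
      have z: "0 < z" using x c by (simp add: z_def)
      define L where "L = lim_density \<nu> z"
      have L: "0 < L" unfolding L_def by (rule lim_density_pos)
      have Lk: "k * exp (- (3 * z\<^sup>2 / 2)) \<le> L" unfolding L_def k_def by (rule lim_density_ge)
      have g: "0 < L / c" using L c by simp
      have "(1 + lo x) * (L / c) = lower_fn \<nu> c x x" by (simp add: lower_fn_def lo_def A_def L_def z_def)
      then have "1 + lo x \<le> f x / (L / c)" using l g unfolding pos_le_divide_eq[OF g] by simp
      moreover have "f x / (L / c) \<le> 1 + up x"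
      proof -
        let ?e = "exp (- (1 / 10^9) * z\<^sup>2 + K * z)"
        have "C * (z + 1) * exp (- (3 / 2 + 1 / 10^9) * z\<^sup>2 + K * z) = D * (z + 1) * ?e * (k * exp (- (3 * z\<^sup>2 / 2)))"
        proof -
          have "- (3 / 2 + 1 / 10^9) * z\<^sup>2 + K * z = (- (1 / 10^9) * z\<^sup>2 + K * z) + (- (3 * z\<^sup>2 / 2))"
            by (simp add: algebra_simps)
          then have "exp (- (3 / 2 + 1 / 10^9) * z\<^sup>2 + K * z) = ?e * exp (- (3 * z\<^sup>2 / 2))" by (simp only: exp_add)
          moreover have "C = D * k" using k by (simp add: D_def)
          ultimately show ?thesis by (simp only: ac_simps)
        qed
        also have "\<dots> \<le> D * (z + 1) * ?e * L" using D z by (intro mult_left_mono[OF Lk] mult_nonneg_nonneg) auto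
        finally have "upper_fn \<nu> c C K x \<le> (L * (1 + 20000 / z\<^sup>2) + D * (z + 1) * ?e * L) / c"
          unfolding upper_fn_def z_def[symmetric] L_def[symmetric] using c by (intro divide_right_mono add_left_mono) auto
        also have "\<dots> = (1 + up x) * (L / c)"
          unfolding up_def z_def[symmetric] by (simp add: algebra_simps add_divide_distrib)
        finally show ?thesis using u unfolding pos_divide_le_eq[OF g] by linarith
      qed
      ultimately show "lo x \<le> f x / (lim_density \<nu> (x / c) / c) - 1 \<and> f x / (lim_density \<nu> (x / c) / c) - 1 \<le> up x"
        unfolding L_def z_def by linarith
    qed
  qed
qed

lemma lim_density_eq_unscaled:
  assumes \<sigma>: "0 < \<sigma>" and t: "0 < t"
  shows "lim_density (\<mu> * sqrt t / \<sigma>) (x / (\<sigma> * t * sqrt t)) / (\<sigma> * t * sqrt t) = sqrt (6 / (pi * \<sigma>\<^sup>2 * t ^ 3))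
     * exp (- (3 * \<mu>\<^sup>2 * t) / (8 * \<sigma>\<^sup>2) - (3 * x\<^sup>2) / (2 * \<sigma>\<^sup>2 * t ^ 3)) * cosh ((3 * \<mu> * x) / (2 * \<sigma>\<^sup>2 * t))"
proof -
  have st: "sqrt t * sqrt t = t" "0 < sqrt t" using t by auto
  have c2: "(\<sigma> * t * sqrt t)\<^sup>2 = \<sigma>\<^sup>2 * t ^ 3" using st by (simp add: power_mult_distrib power3_eq_cube power2_eq_square)
  have c0: "0 < \<sigma> * t * sqrt t" using \<sigma> t by simp
  have "sqrt (6 / pi) / (\<sigma> * t * sqrt t) = sqrt (6 / pi) / sqrt (\<sigma>\<^sup>2 * t ^ 3)"
    unfolding c2[symmetric] using c0 by simp
  also have "\<dots> = sqrt (6 / (pi * \<sigma>\<^sup>2 * t ^ 3))" by (simp add: real_sqrt_divide[symmetric] mult.assoc)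
  finally have 1: "sqrt (6 / pi) / (\<sigma> * t * sqrt t) = sqrt (6 / (pi * \<sigma>\<^sup>2 * t ^ 3))" .
  have 2: "- (3 * (\<mu> * sqrt t / \<sigma>)\<^sup>2 / 8) - 3 * (x / (\<sigma> * t * sqrt t))\<^sup>2 / 2
    = - (3 * \<mu>\<^sup>2 * t) / (8 * \<sigma>\<^sup>2) - (3 * x\<^sup>2) / (2 * \<sigma>\<^sup>2 * t ^ 3)"
    unfolding power_divide c2 using t by (simp add: power_mult_distrib ac_simps)
  have 3: "3 * (\<mu> * sqrt t / \<sigma>) * (x / (\<sigma> * t * sqrt t)) / 2 = (3 * \<mu> * x) / (2 * \<sigma>\<^sup>2 * t)"
    using st by (simp add: power2_eq_square)
  show ?thesis unfolding lim_density_eq 2 3 1[symmetric] by simp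
qed

theorem theorem6:
  fixes M :: "'a measure" and W :: "real \<Rightarrow> 'a \<Rightarrow> real" and \<mu> \<sigma> t :: real
  assumes "standard_brownian_motion M W" and "\<sigma> > 0" and "t > 0"
  shows
    "(\<exists>f :: real \<Rightarrow> real.
        (\<forall>x. 0 \<le> f x) \<and>
        distributed M lborel (abs_integral \<mu> \<sigma> W t) (\<lambda>x. ennreal (f x)) \<and>
        (\<exists>r \<in> O[at_top](\<lambda>x :: real. 1 / x). \<forall>\<^sub>F x in at_top.
           f x = sqrt (6 / (pi * \<sigma>\<^sup>2 * t ^ 3))
                 * exp (- (3 * \<mu>\<^sup>2 * t) / (8 * \<sigma>\<^sup>2) - (3 * x\<^sup>2) / (2 * \<sigma>\<^sup>2 * t ^ 3))
                 * cosh ((3 * \<mu> * x) / (2 * \<sigma>\<^sup>2 * t)) * (1 + r x))) \<and>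
     (\<exists>r \<in> O[at_top](\<lambda>x :: real. 1 / x). \<forall>\<^sub>F x in at_top.
        \<P>(\<omega> in M. abs_integral \<mu> \<sigma> W t \<omega> \<le> x)
          = 1 - sqrt ((2 * \<sigma>\<^sup>2 * t ^ 3) / (3 * pi)) * (1 / x)
                * exp (- (3 * \<mu>\<^sup>2 * t) / (8 * \<sigma>\<^sup>2) - (3 * x\<^sup>2) / (2 * \<sigma>\<^sup>2 * t ^ 3))
                * cosh ((3 * \<mu> * x) / (2 * \<sigma>\<^sup>2 * t)) * (1 + r x))"
proof -
  interpret standard_brownian_motion M W by fact
  let ?X = "abs_integral \<mu> \<sigma> W t"
  define \<nu> where "\<nu> = \<mu> * sqrt t / \<sigma>"
  define c where "c = \<sigma> * t * sqrt t"
  define g where "g = (\<lambda>x. lim_density \<nu> (x / c) / c)"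
  define E where "E = (\<lambda>x. exp (- (3 * \<mu>\<^sup>2 * t) / (8 * \<sigma>\<^sup>2) - (3 * x\<^sup>2) / (2 * \<sigma>\<^sup>2 * t ^ 3)) * cosh ((3 * \<mu> * x) / (2 * \<sigma>\<^sup>2 * t)))"
  have c: "0 < c" using assms(2,3) by (simp add: c_def)
  have g0: "0 < g x" for x using lim_density_pos[of \<nu> "x / c"] c by (simp add: g_def)
  have gE: "g x = sqrt (6 / (pi * \<sigma>\<^sup>2 * t ^ 3)) * E x" for x
    unfolding g_def \<nu>_def c_def E_def lim_density_eq_unscaled[OF assms(2,3)] by (simp only: mult.assoc)
  obtain f C K where f0: "\<And>x. 0 \<le> f x" and fm [measurable]: "f \<in> borel_measurable borel" and C: "0 < C" "0 \<le> K"
    and d: "distr M borel ?X = density lborel (\<lambda>x. ennreal (f x))"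
    and b: "\<And>x. c * (32 * \<bar>\<nu>\<bar> + 9) < x \<Longrightarrow> lower_fn \<nu> c x x \<le> f x \<and> f x \<le> upper_fn \<nu> c C K x"
    using abs_integral_density[OF assms(3,2), of \<mu>, folded \<nu>_def c_def] by blast
  have Xm [measurable]: "?X \<in> borel_measurable M" using assms(3) by (rule abs_integral_measurable)
  have dist: "distributed M lborel ?X (\<lambda>x. ennreal (f x))"
    unfolding distributed_def using d distr_cong[of M M lborel borel ?X ?X] by (simp add: measurable_lborel1)
  define r where "r = (\<lambda>x. f x / g x - 1)"
  have fr: "f x = g x * (1 + r x)" for x using g0[of x] by (simp add: r_def)
  have rO: "r \<in> O[at_top](\<lambda>x. 1 / x)" unfolding r_def g_def
  proof (rule density_ratio_asymp[OF c C(1)])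
    show "eventually (\<lambda>x. lower_fn \<nu> c x x \<le> f x \<and> f x \<le> upper_fn \<nu> c C K x) at_top"
      using eventually_gt_at_top by (rule eventually_mono) (rule b)
  qed
  define s where "s = c * sqrt (1 / 3)"
  have s: "0 < s" using c by (simp add: s_def)
  have s2: "s\<^sup>2 = \<sigma>\<^sup>2 * t ^ 3 / 3"
    using assms(3) by (simp add: s_def c_def power_mult_distrib power3_eq_cube power2_eq_square[of t])
  have g2: "g = (\<lambda>x. normal_density (c * \<nu> / 2) s x + normal_density (- (c * \<nu> / 2)) s x)"
    unfolding g_def s_def lim_density_scale[OF c] ..
  define P where "P = (\<lambda>x. prob {\<omega>\<in>space M. x \<le> ?X \<omega>})"
  have P: "ennreal (P x) = (\<integral>\<^sup>+u. ennreal (f u) * indicator {x..} u \<partial>lborel)" for x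
  proof -
    have "ennreal (P x) = emeasure (distr M borel ?X) {x..}"
      unfolding P_def emeasure_eq_measure[symmetric]
      by (subst emeasure_distr) (auto intro!: arg_cong[where f="emeasure M"])
    also have "\<dots> = (\<integral>\<^sup>+u. ennreal (f u) * indicator {x..} u \<partial>lborel)"
      unfolding d by (rule emeasure_density) auto
    finally show ?thesis .
  qed
  define q where "q = (\<lambda>x. P x / (g x * s\<^sup>2 / x) - 1)"
  have qO: "q \<in> O[at_top](\<lambda>x. 1 / x)"
    unfolding q_def g2
  proof (rule gaussian_pair_tail_asymp[OF s f0 fm _ rO P])
    show "eventually (\<lambda>x. f x = (normal_density (c * \<nu> / 2) s x + normal_density (- (c * \<nu> / 2)) s x) * (1 + r x)) at_top"
      unfolding fun_cong[OF g2, symmetric]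
      by (rule always_eventually) (rule allI, rule fr)
    show "0 \<le> P x" for x by (simp add: P_def)
  qed
  have cdf: "\<P>(\<omega> in M. ?X \<omega> \<le> x) = 1 - sqrt ((2 * \<sigma>\<^sup>2 * t ^ 3) / (3 * pi)) * (1 / x) * E x * (1 + q x)" if x: "0 < x" for x
  proof -
    \<comment> \<open>The tail P includes the point x itself, the complement of the distribution
      function does not; the density shows that the point carries no mass.\<close>
    have "prob {\<omega>\<in>space M. x = ?X \<omega>} = 0"
    proof -
      have "emeasure M {\<omega>\<in>space M. x = ?X \<omega>} = emeasure (distr M borel ?X) {x}"
        by (subst emeasure_distr) (auto intro!: arg_cong[where f="emeasure M"])
      also have "\<dots> = (\<integral>\<^sup>+u. ennreal (f u) * indicator {x} u \<partial>lborel)"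
        unfolding d by (rule emeasure_density) auto
      also have "\<dots> = 0"
        
      proof (subst nn_integral_0_iff_AE)
        show "AE u in lborel. ennreal (f u) * indicator {x} u = 0"
          using AE_lborel_singleton[of x] by (rule eventually_mono) simp
      qed measurable
      finally show ?thesis by (simp add: measure_def)
    qed
    moreover have "P x = prob {\<omega>\<in>space M. x < ?X \<omega>} + prob {\<omega>\<in>space M. x = ?X \<omega>}"
      unfolding P_def by (subst finite_measure_Union[symmetric]) (auto intro!: arg_cong[where f=prob])
    moreover have "prob {\<omega>\<in>space M. \<not> x < ?X \<omega>} = 1 - prob {\<omega>\<in>space M. x < ?X \<omega>}"
      by (rule prob_neg) measurable
    ultimately have "\<P>(\<omega> in M. ?X \<omega> \<le> x) = 1 - P x" by (simp add: not_less)
    also have "P x = g x * s\<^sup>2 / x * (1 + q x)" using g0[of x] s x by (simp add: q_def)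
    \<comment> \<open>With S = \<open>\<sigma>\<close>^2 t^3 the variance \<open>s\<^sup>2\<close>
      is S / 3, and the square of sqrt(6 / (pi S)) S / 3 is 2 S / (3 pi).\<close>
    also have "g x * s\<^sup>2 / x = sqrt ((2 * \<sigma>\<^sup>2 * t ^ 3) / (3 * pi)) * (1 / x) * E x"
    proof -
      define S where "S = \<sigma>\<^sup>2 * t ^ 3"
      have S: "0 < S" using assms(2,3) by (simp add: S_def)
      have "sqrt (6 / (pi * S)) * (S / 3) = sqrt (6 / (pi * S)) * sqrt ((S / 3)\<^sup>2)" using S by simp
      also have "\<dots> = sqrt (6 / (pi * S) * (S / 3)\<^sup>2)" by (rule real_sqrt_mult[symmetric])
      also have "6 / (pi * S) * (S / 3)\<^sup>2 = 2 * S / (3 * pi)" using S by (simp add: field_simps power2_eq_square)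
      finally have "sqrt (6 / (pi * \<sigma>\<^sup>2 * t ^ 3)) * s\<^sup>2 = sqrt ((2 * \<sigma>\<^sup>2 * t ^ 3) / (3 * pi))"
        unfolding s2 S_def by (simp only: mult.assoc)
      then have "sqrt (6 / (pi * \<sigma>\<^sup>2 * t ^ 3)) * s\<^sup>2 * (1 / x) * E x = sqrt ((2 * \<sigma>\<^sup>2 * t ^ 3) / (3 * pi)) * (1 / x) * E x"
        by (rule arg_cong[where f="\<lambda>z. z * (1 / x) * E x"])
      then show ?thesis unfolding gE by (simp only: divide_inverse mult_1_left ac_simps)
    qed
    finally show ?thesis .
  qed
  show ?thesis
  proof (rule conjI, rule exI[of _ f], rule conjI, rule allI, rule f0, rule conjI, rule dist, rule bexI[OF _ rO], goal_cases)
    case 1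
    show ?case
    proof (rule always_eventually, rule allI)
      fix x
      show "f x = sqrt (6 / (pi * \<sigma>\<^sup>2 * t ^ 3))
       * exp (- (3 * \<mu>\<^sup>2 * t) / (8 * \<sigma>\<^sup>2) - (3 * x\<^sup>2) / (2 * \<sigma>\<^sup>2 * t ^ 3)) * cosh ((3 * \<mu> * x) / (2 * \<sigma>\<^sup>2 * t)) * (1 + r x)"
        using fr[of x] unfolding gE E_def mult.assoc .
    qed
  next
    case 2
    show ?case
    proof (rule bexI[OF _ qO])
      show "eventually (\<lambda>x. \<P>(\<omega> in M. ?X \<omega> \<le> x) = 1 - sqrt ((2 * \<sigma>\<^sup>2 * t ^ 3) / (3 * pi)) * (1 / x)
       * exp (- (3 * \<mu>\<^sup>2 * t) / (8 * \<sigma>\<^sup>2) - (3 * x\<^sup>2) / (2 * \<sigma>\<^sup>2 * t ^ 3)) * cosh ((3 * \<mu> * x) / (2 * \<sigma>\<^sup>2 * t)) * (1 + q x)) at_top"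
        using eventually_gt_at_top[of 0]
      proof (rule eventually_mono)
        fix x :: real assume "0 < x"
        from cdf[OF this] show "\<P>(\<omega> in M. ?X \<omega> \<le> x) = 1 - sqrt ((2 * \<sigma>\<^sup>2 * t ^ 3) / (3 * pi)) * (1 / x)
         * exp (- (3 * \<mu>\<^sup>2 * t) / (8 * \<sigma>\<^sup>2) - (3 * x\<^sup>2) / (2 * \<sigma>\<^sup>2 * t ^ 3)) * cosh ((3 * \<mu> * x) / (2 * \<sigma>\<^sup>2 * t)) * (1 + q x)"
          unfolding E_def by (simp only: mult.assoc)
      qed
    qed
  qed
qed

end
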